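(* Fix $\varepsilon>0$ and consider the class of stationary isotropic planar Boolean models $\Xi$ whose grains $K$ almost surely satisfy: for every $x\in\partial K$ the outward unit normal $n(x)$ is unique and $x-\varepsilon n(x)+B(\varepsilon)\subseteq K$. Then, with $c_m=c_m(w)$: (a) For $\hat V_1$ with weights $w=w^{(1)}$: $\lim_{a\to0}E\hat V_1(\Xi)$ exists for every such $\Xi$ iff $w_1=w_6=0$; in that case $\lim_{a\to0}E\hat V_1(\Xi)=\frac1\pi c_3\bar V_1(\Xi)$, so $\hat V_1$ is asymptotically unbiased for every such $\Xi$ iff $c_3=\pi$; if $w_1=w_6=0$ and $c_3=\pi$, then $E\hat V_1(\Xi)-\bar V_1(\Xi)=a\big(c_4\gamma+c_5(\frac\gamma\pi EV_1(K))^2\big)e^{-\gamma EV_2(K)}+O(a^2)$, so the bias is $O(a^2)$ for every such $\Xi$ iff additionally $w_2=w_5$ and $(-5+2\sqrt2)w_2+(4-4\sqrt2)w_3+(3-2\sqrt2)w_4+(-7+6\sqrt2)w_5=0$. (b) For $\hat V_0$ with weights $w=w^{(0)}$: $\lim_{a\to0}E\hat V_0(\Xi)$ exists for every such $\Xi$ iff $w_1=w_6=0$ and $(2-\sqrt2)w_2+(-2+2\sqrt2)w_3+(2-\sqrt2)w_5=0$; in that case $\lim_{a\to0}E\hat V_0(\Xi)=\big(c_4\gamma+c_5(\frac\gamma\pi EV_1(K))^2\big)e^{-\gamma EV_2(K)}$, so $\hat V_0$ is asymptotically unbiased for every such $\Xi$ iff additionally $2w_2-2w_5=1$ and $(-5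+2\sqrt2)w_2+(4-4\sqrt2)w_3+(3-2\sqrt2)w_4+(-7+6\sqrt2)w_5=-\frac\pi4$.
   Context: Let $C=[0,1]^2$ and $C_0=\{x_0,x_1,x_2,x_3\}$ with $x_0=(0,0)$, $x_1=(1,0)$, $x_2=(0,1)$, $x_3=(1,1)$. A configuration is a subset of $C_0$. The 16 configurations are grouped into six classes: $\eta_1=\{\emptyset\}$; $\eta_2$ = the four one-point subsets; $\eta_3$ = the four adjacent pairs $\{x_0,x_1\},\{x_0,x_2\},\{x_1,x_3\},\{x_2,x_3\}$; $\eta_4=\{\{x_0,x_3\},\{x_1,x_2\}\}$ (diagonal pairs); $\eta_5$ = the four three-point subsets; $\eta_6=\{C_0\}$. For $Y\subseteq\mathbb R^2$, $a>0$, $z\in\mathbb R^2$ and the rotation $R_v$ by angle $v$, the configuration of $Y$ at $z$ is $\{x\in C_0: z+aR_vx\in Y\}$. Boolean model: $\Xi=\bigcup_i(x_i+K_i)$ where $\{x_i\}$ is a stationary Poisson point process in $\mathbb R^2$ of intensity $\gamma>0$ and $K_1,K_2,\dots$ are i.i.d. random nonempty compact convex sets, independent of the point process, with rotation-invariant distribution and $EV_j(K)<\infty$ for $j=0,1,2$ ($K$ denotes a generic grain). Here $V_2$ is area, $V_1$ is half the boundary length and $V_0$ is the Euler characteristic. The specific intrinsic volumes are $\bar V_j(\Xi)=\lim_{s\to\infty}EV_j(\Xi\cap sW)/V_2(sW)$ for any compact convex $W$ with nonempty interior. For weights $w^{(i)}\in\mathbb R^6$ and lattice distance $a>0$ the estimator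 is $\hat V_i(\Xi)=a^{i-2}\sum_{j=1}^6 w^{(i)}_jN_j/N_0$, where, for an observation window $W$, $N_0$ is the number of $z\in a\mathbb Z^2$ with $z+aC\subseteq W$ and $N_j$ is the number of those $z$ whose configuration of $\Xi$ (with $v=0$) lies in $\eta_j$. By stationarity $E\hat V_i(\Xi)=a^{i-2}\sum_{j=1}^6 w^{(i)}_j P(\{x\in C_0: ax\in\Xi\}\in\eta_j)$. The estimator is asymptotically unbiased if $\lim_{a\to0}E\hat V_i(\Xi)=\bar V_i(\Xi)$. For $w=(w_1,\dots,w_6)\in\mathbb R^6$ define $c_3(w)=4\big(-w_1+(2-\sqrt2)w_2+(-2+2\sqrt2)w_3+(2-\sqrt2)w_5-w_6\big)$, $c_4(w)=-w_1+2w_2-2w_5+w_6$, $c_5(w)=4\big(2w_1+(-5+2\sqrt2)w_2+(4-4\sqrt2)w_3+(3-2\sqrt2)w_4+(-7+6\sqrt2)w_5+(3-2\sqrt2)w_6\big)$. $B(\varepsilon)$ is the closed disk of radius $\varepsilon$ centered at the origin. *)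

theory Defs
  imports "HOL-Probability.Probability" "HOL-Library.Landau_Symbols"
begin

type_synonym pt = "real \<times> real"

definition x0 :: pt where "x0 = (0, 0)"
definition x1 :: pt where "x1 = (1, 0)"
definition x2 :: pt where "x2 = (0, 1)"
definition x3 :: pt where "x3 = (1, 1)"
definition C0 :: "pt set" where "C0 = {x0, x1, x2, x3}"

definition eta :: "nat \<Rightarrow> pt set set" where
  "eta j =
    (if j = 1 then {{}}
     else if j = 2 then {{x0}, {x1}, {x2}, {x3}}
     else if j = 3 then {{x0, x1}, {x0, x2}, {x1, x3}, {x2, x3}}
     else if j = 4 then {{x0, x3}, {x1, x2}}
     else if j = 5 then {{x1, x2, x3}, {x0, x2, x3}, {x0, x1, x3}, {x0, x1, x2}}
     else if j = 6 then {C0}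
     else {})"

definition rot :: "real \<Rightarrow> pt \<Rightarrow> pt" where
  "rot v = (\<lambda>(x, y). (cos v * x - sin v * y, sin v * x + cos v * y))"

definition config :: "pt set \<Rightarrow> real \<Rightarrow> pt \<Rightarrow> real \<Rightarrow> pt set" where
  "config Y a z v = {x \<in> C0. z + a *\<^sub>R rot v x \<in> Y}"

definition KC :: "pt set set" where
  "KC = {K. K \<noteq> {} \<and> compact K \<and> convex K}"

definition mink :: "pt set \<Rightarrow> pt set \<Rightarrow> pt set" where
  "mink A B = {x + y | x y. x \<in> A \<and> y \<in> B}"

text \<open>Half the boundary length of a convex body, via the Steiner formula
  area(K + B(r)) = V2 K + 2 V1 K r + pi r^2.\<close>
definition V1c :: "pt set \<Rightarrow> real" where
  "V1c K = Lim (at_right 0)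
     (\<lambda>r. (measure lborel (mink K (cball 0 r)) - measure lborel K) / (2 * r))"

definition Vconv :: "nat \<Rightarrow> pt set \<Rightarrow> real" where
  "Vconv j K = (if j = 0 then (if K = {} then 0 else 1)
                else if j = 1 then V1c K
                else measure lborel K)"

definition incl_excl :: "(pt set \<Rightarrow> real) \<Rightarrow> pt set set \<Rightarrow> real" where
  "incl_excl f F = (\<Sum>I \<in> {I. I \<subseteq> F \<and> I \<noteq> {}}. (-1) ^ (card I + 1) * f (\<Inter> I))"

definition polyconvex_rep :: "pt set set \<Rightarrow> pt set \<Rightarrow> bool" where
  "polyconvex_rep F A \<longleftrightarrow> finite F \<and> (\<forall>K\<in>F. compact K \<and> convex K) \<and> \<Union> F = A"

text \<open>Additive extension of the intrinsic volumes to polyconvex sets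
  (finite unions of compact convex sets), via inclusion-exclusion.\<close>
definition V :: "nat \<Rightarrow> pt set \<Rightarrow> real" where
  "V j A = (THE c. \<forall>F. polyconvex_rep F A \<longrightarrow> incl_excl (Vconv j) F = c)"

text \<open>Measurable structure on the grains: sigma-algebra generated by the
  (Fell) miss-events, on the set of nonempty compact convex sets.\<close>
definition grain_space :: "pt set measure" where
  "grain_space = sigma KC {{K \<in> KC. K \<inter> C = {}} | C. compact C}"

definition smooth_eps :: "real \<Rightarrow> pt set \<Rightarrow> bool" where
  "smooth_eps \<epsilon> K \<longleftrightarrow>
     (\<forall>x \<in> frontier K. \<exists>u. norm u = 1 \<and> (\<forall>y\<in>K. inner (y - x) u \<le> 0) \<and>
        (\<forall>u'. norm u' = 1 \<and> (\<forall>y\<in>K. inner (y - x) u' \<le> 0) \<longrightarrow> u' = u) \<and>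
        cball (x - \<epsilon> *\<^sub>R u) \<epsilon> \<subseteq> K)"

definition grain_law :: "real \<Rightarrow> pt set measure \<Rightarrow> bool" where
  "grain_law \<epsilon> Q \<longleftrightarrow> prob_space Q \<and> sets Q = sets grain_space \<and>
     (AE K in Q. smooth_eps \<epsilon> K) \<and>
     (\<forall>v. distr Q Q (\<lambda>K. rot v ` K) = Q) \<and>
     (\<forall>j\<le>2. integrable Q (\<lambda>K. V j K))"

definition poisson_prob :: "real \<Rightarrow> nat \<Rightarrow> real" where
  "poisson_prob m n = exp (- m) * m ^ n / fact n"

text \<open>P is the law of a Poisson process on R^2 x KC with intensity measure
  gamma * (Lebesgue x Q), i.e. the marked (independently marked) stationary
  Poisson process {(x_i, K_i)} of intensity gamma with i.i.d. grains of law Q.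
  Realisations are sets of marked points.\<close>
definition bm_law :: "real \<Rightarrow> pt set measure \<Rightarrow> (pt \<times> pt set) set measure \<Rightarrow> bool" where
  "bm_law \<gamma> Q P \<longleftrightarrow> prob_space P \<and> space P = {\<phi>. \<phi> \<subseteq> UNIV \<times> KC} \<and>
     (\<forall>B \<in> sets (lborel \<Otimes>\<^sub>M Q). emeasure (lborel \<Otimes>\<^sub>M Q) B < \<infinity> \<longrightarrow>
        (\<forall>n. {\<phi> \<in> space P. finite (\<phi> \<inter> B) \<and> card (\<phi> \<inter> B) = n} \<in> sets P \<and>
             measure P {\<phi> \<in> space P. finite (\<phi> \<inter> B) \<and> card (\<phi> \<inter> B) = n}
               = poisson_prob (\<gamma> * measure (lborel \<Otimes>\<^sub>M Q) B) n)) \<and>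
     (\<forall>(k::nat) (B :: nat \<Rightarrow> (pt \<times> pt set) set).
        (\<forall>i<k. B i \<in> sets (lborel \<Otimes>\<^sub>M Q) \<and> emeasure (lborel \<Otimes>\<^sub>M Q) (B i) < \<infinity>) \<and>
        disjoint_family_on B {..<k} \<longrightarrow>
        prob_space.indep_vars P (\<lambda>_. count_space UNIV) (\<lambda>i \<phi>. card (\<phi> \<inter> B i)) {..<k})"

definition Xi :: "(pt \<times> pt set) set \<Rightarrow> pt set" where
  "Xi \<phi> = (\<Union>p \<in> \<phi>. (\<lambda>y. fst p + y) ` snd p)"

definition boolean_model :: "real \<Rightarrow> real \<Rightarrow> pt set measure \<Rightarrow> (pt \<times> pt set) set measure \<Rightarrow> bool" where
  "boolean_model \<epsilon> \<gamma> Q P \<longleftrightarrow> \<gamma> > 0 \<and> grain_law \<epsilon> Q \<and> bm_law \<gamma> Q P"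

definition EV :: "nat \<Rightarrow> pt set measure \<Rightarrow> real" where
  "EV j Q = (\<integral>K. V j K \<partial>Q)"

definition W0 :: "pt set" where "W0 = cbox (0, 0) (1, 1)"

definition barV :: "nat \<Rightarrow> (pt \<times> pt set) set measure \<Rightarrow> real" where
  "barV j P = Lim at_top (\<lambda>s::real.
      (\<integral>\<phi>. V j (Xi \<phi> \<inter> (\<lambda>x. s *\<^sub>R x) ` W0) \<partial>(completion P))
        / measure lborel ((\<lambda>x. s *\<^sub>R x) ` W0))"

definition EVhat :: "nat \<Rightarrow> (nat \<Rightarrow> real) \<Rightarrow> (pt \<times> pt set) set measure \<Rightarrow> real \<Rightarrow> real" where
  "EVhat i w P a = a powi (int i - 2) *
     (\<Sum>j = 1..6. w j * measure (completion P) {\<phi> \<in> space P. config (Xi \<phi>) a 0 0 \<in> eta j})"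

definition c3 :: "(nat \<Rightarrow> real) \<Rightarrow> real" where
  "c3 w = 4 * (- w 1 + (2 - sqrt 2) * w 2 + (-2 + 2 * sqrt 2) * w 3 + (2 - sqrt 2) * w 5 - w 6)"

definition c4 :: "(nat \<Rightarrow> real) \<Rightarrow> real" where
  "c4 w = - w 1 + 2 * w 2 - 2 * w 5 + w 6"

definition c5 :: "(nat \<Rightarrow> real) \<Rightarrow> real" where
  "c5 w = 4 * (2 * w 1 + (-5 + 2 * sqrt 2) * w 2 + (4 - 4 * sqrt 2) * w 3
              + (3 - 2 * sqrt 2) * w 4 + (-7 + 6 * sqrt 2) * w 5 + (3 - 2 * sqrt 2) * w 6)"

end

theory Submission
 imports Defs
begin

text \<open>
 By the Poisson property the probability that no point of \<open>a S\<close>, \<open>S \<subseteq> C0\<close>, is covered is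
 \<open>exp (- \<gamma> E A)\<close> with \<open>A\<close> the area of the union of the translates of the grain by \<open>a S\<close>. The inner balls
 make this union agree with the union of the segment hulls up to \<open>O(a ^ 3)\<close>, so that isotropy
 gives \<open>E A = EV 2 + c (2 EV 1 / pi) a + d a\<^sup>2 + O(a ^ 3)\<close> with constants depending on the shape of \<open>S\<close> only.
 Inclusion-exclusion over \<open>C0\<close> turns this into the expansion of the estimator up to second order.
 The specific intrinsic volumes come from expanding \<open>V j (\<Union> ...)\<close> by inclusion-exclusion over the
 grains hitting the window, integrated with the factorial moments of the Poisson process and the
 kinematic formulas. For the necessity of the conditions it suffices to vary the intensity of the
 model whose grains are discs of radius \<open>\<epsilon>\<close>; this requires a Poisson process, which is built from
 independent samples in the unit squares.
\<close>

section \<open>Areas, widths and Minkowski sums in the plane\<close>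

text \<open>The integral geometry rests on one uniqueness principle: a functional on convex bodies
  that is additive on convex unions, invariant under point reflections, zero on sums of two segments
  and continuous along increasing sequences vanishes. Point reflections suffice because a trapezoid
  and its mirror image tile a parallelogram. Adding a segment to a body raises its area by a width,
  and half the boundary length is a mean of widths; this is why widths carry all first-order terms.
  Inner balls yield a cubic error because two translates at distance t leave gaps only in slices
  within order t^2 of the extremes, each of length at most t. For sums over tuples of Poisson points
  the product formula fails on repeated points, and the law speaks of disjoint sets only; tuples are
  therefore first separated by strips of their abscissae, and ties are excluded afterwards by
  comparing two second moments. The intrinsic volume of the covered part of the window agrees with a
  measurable series only almost surely, so its mean is taken in the completion.\<close>

definition cross :: "pt => pt => real" where
 "cross u p = fst u * snd p - snd u * fst p"

abbreviation area :: "pt set => real" where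
 "area \<equiv> measure lborel"

text \<open>For a convex body this is \<open>norm u\<close> times the width orthogonal to
  \<open>u\<close>, that is, twice the mixed area of \<open>A\<close> with the segment from 0 to
  \<open>u\<close>.\<close>

definition wd :: "pt => pt set => real" where
 "wd u A = measure lborel (cross u ` A)"

lemma rot_0 [simp]: "rot 0 = id" by (auto simp: rot_def)

lemma rot_add: "rot v (rot w p) = rot (v + w) p" by (cases p) (simp add: rot_def cos_add sin_add algebra_simps)

lemma rot_inverse [simp]: "rot v (rot (- v) p) = p" "rot (- v) (rot v p) = p" by (simp_all add: rot_add)

lemma linear_rot: "linear (rot v)" by (rule linearI) (auto simp: rot_def algebra_simps split: prod.splits)

lemma bij_rot: "bij (rot v)" by (rule bijI'[where f = "rot v"]) (metis rot_inverse(2), metis rot_inverse(1))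

lemma continuous_on_rot [continuous_intros]: "continuous_on S f ==> continuous_on S (%x. rot v (f x))"
 by (intro continuous_on_compose2[OF linear_continuous_on[OF linear_conv_bounded_linear[THEN iffD1, OF linear_rot], of UNIV]]) auto

lemma measurable_rot [measurable]: "rot v \<in> borel_measurable borel" by (intro borel_measurable_continuous_onI continuous_intros)

lemma norm_rot [simp]: "norm (rot v p) = norm p"
proof -
 have "(cos v * x - sin v * y)\<^sup>2 + (sin v * x + cos v * y)\<^sup>2 = x\<^sup>2 + y\<^sup>2" for x y
 proof -
  have "(cos v * x - sin v * y)\<^sup>2 + (sin v * x + cos v * y)\<^sup>2 = ((sin v)\<^sup>2 + (cos v)\<^sup>2) * (x\<^sup>2 + y\<^sup>2)"
   by algebra
  then show ?thesis by simp
 qed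
 then show ?thesis by (cases p) (simp add: rot_def norm_Pair)
qed

lemma cross_rot [simp]: "cross (rot v u) (rot v p) = cross u p"
proof -
 have "(c * a - s * b) * (s * x + c * y) - (s * a + c * b) * (c * x - s * y) = (s * s + c * c) * (a * y - b * x)"
  for a b c s x y :: real by algebra
 from this[of "cos v" "fst u" "sin v" "snd u" "fst p" "snd p"] show ?thesis
  by (simp add: rot_def cross_def case_prod_unfold sin_cos_squared_add3 add.commute)
qed

lemma rot_pi: "rot pi p = - p" by (cases p) (simp add: rot_def)

text \<open>Lets statements about an arbitrary direction be proved for the horizontal one, where
  slices are available.\<close>

lemma polar: "\<exists>v. u = rot v (norm u, 0)"
proof (cases "u = 0")
 case True then show ?thesis by (auto simp: rot_def zero_prod_def)
next
 case False
 obtain a b where u: "u = (a, b)" by force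
 define n where "n = norm u"
 have n: "n > 0" using False by (simp add: n_def)
 have n2: "n\<^sup>2 = a\<^sup>2 + b\<^sup>2" by (simp add: n_def u norm_Pair)
 have "(a / n)\<^sup>2 + (b / n)\<^sup>2 = 1" unfolding power_divide add_divide_distrib[symmetric] n2[symmetric] using n by simp
 then obtain v where "a / n = cos v" "b / n = sin v" by (metis sincos_total_2pi)
 then have "cos v * n = a" "sin v * n = b" using n by (auto simp: field_simps)
 then have "rot v (n, 0) = u" by (simp add: u rot_def)
 then show ?thesis unfolding n_def by (intro exI) (rule sym)
qed

section \<open>Invariance of planar Lebesgue measure under shears and rotations\<close>

lemma emeasure_pt_slices:
 assumes "A \<in> sets (borel :: pt measure)"
 shows "emeasure lborel A = (\<integral>\<^sup>+y. emeasure lborel {x. (x, y) \<in> A} \<partial>lborel)"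
  and "(%y. emeasure lborel {x. (x, y) \<in> A}) \<in> borel_measurable borel"
  and "{x. (x, y) \<in> A} \<in> sets borel"
proof -
 have A: "A \<in> sets (lborel \<Otimes>\<^sub>M lborel)" using assms by (metis lborel_prod sets_lborel)
 have *: "(%x. (x, y)) -` A = {x. (x, y) \<in> A}" for y by auto
 show "emeasure lborel A = (\<integral>\<^sup>+y. emeasure lborel {x. (x, y) \<in> A} \<partial>lborel)"
  using lborel_pair.emeasure_pair_measure_alt2[OF A] by (simp add: lborel_prod *)
 show "(%y. emeasure lborel {x. (x, y) \<in> A}) \<in> borel_measurable borel"
  using lborel_pair.measurable_emeasure_Pair2[OF A] by (simp add: *)
 show "{x. (x, y) \<in> A} \<in> sets borel" using sets_Pair2[OF A, of y] by (simp add: *)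
qed

lemma emeasure_pt_slices':
 assumes "A \<in> sets (borel :: pt measure)"
 shows "emeasure lborel A = (\<integral>\<^sup>+x. emeasure lborel {y. (x, y) \<in> A} \<partial>lborel)"
proof -
 have A: "A \<in> sets (lborel \<Otimes>\<^sub>M lborel)" using assms by (metis lborel_prod sets_lborel)
 have *: "Pair x -` A = {y. (x, y) \<in> A}" for x by auto
 show "emeasure lborel A = (\<integral>\<^sup>+x. emeasure lborel {y. (x, y) \<in> A} \<partial>lborel)"
  using lborel.emeasure_pair_measure_alt[OF A] by (simp add: lborel_prod *)
qed

lemma lborel_shift: 
 fixes c :: "'a::euclidean_space"
 assumes "A \<in> sets borel"
 shows "emeasure lborel {x. x + c \<in> A} = emeasure lborel A"
proof -
 have "emeasure lborel A = emeasure (distr lborel borel ((+) c)) A" by (simp add: lborel_distr_plus)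
 also have "... = emeasure lborel {x. x + c \<in> A}" using assms by (subst emeasure_distr) (auto simp: vimage_def add.commute)
 finally show ?thesis ..
qed

lemma lborel_shear1: "distr lborel borel (%(x, y). (x + c * y, y)) = (lborel :: pt measure)"
proof (rule measure_eqI)
 fix A assume "A \<in> sets (distr lborel borel (%(x, y). (x + c * y, y)) :: pt measure)"
 then have A [measurable]: "A \<in> sets (borel :: pt measure)" by simp
 have m: "(%(x, y). (x + c * y, y)) \<in> borel_measurable (borel :: pt measure)"
  by (intro borel_measurable_continuous_onI) (auto simp: case_prod_unfold intro!: continuous_intros)
 have "emeasure (distr lborel borel (%(x, y). (x + c * y, y))) A
   = (\<integral>\<^sup>+y. emeasure lborel {x. (x, y) \<in> (%(x, y). (x + c * y, y)) -` A} \<partial>lborel)"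
  using m measurable_sets[OF m A] by (simp add: emeasure_distr emeasure_pt_slices)
 also have "... = (\<integral>\<^sup>+y. emeasure lborel {x. (x, y) \<in> A} \<partial>lborel)"
  using emeasure_pt_slices(3)[OF A] by (intro nn_integral_cong) (auto simp: lborel_shift[of "{x. (x, _) \<in> A}", simplified])
 finally show "emeasure (distr lborel borel (%(x, y). (x + c * y, y))) A = emeasure lborel A" by (simp add: emeasure_pt_slices)
qed simp

lemma lborel_swap: "distr lborel borel prod.swap = (lborel :: pt measure)"
proof (rule measure_eqI)
 fix A assume "A \<in> sets (distr lborel borel prod.swap :: pt measure)"
 then have A [measurable]: "A \<in> sets (borel :: pt measure)" by simp
 have m: "prod.swap \<in> borel_measurable (borel :: pt measure)"
  by (intro borel_measurable_continuous_onI) (auto simp: prod.swap_def[abs_def] intro!: continuous_intros)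
 have "emeasure (distr lborel borel prod.swap) A
   = (\<integral>\<^sup>+y. emeasure lborel {x. (x, y) \<in> prod.swap -` A} \<partial>lborel)"
  using m measurable_sets[OF m A] by (simp add: emeasure_distr emeasure_pt_slices)
 also have "... = emeasure lborel A" using emeasure_pt_slices'[OF A] by simp
 finally show "emeasure (distr lborel borel prod.swap) A = emeasure lborel A" .
qed simp

lemma lborel_distr_comp:
 assumes "distr lborel borel f = (lborel :: pt measure)" "distr lborel borel g = (lborel :: pt measure)"
  and "f \<in> borel_measurable borel" "g \<in> borel_measurable borel"
 shows "distr lborel borel (%x. f (g x)) = (lborel :: pt measure)"
proof -
 have "distr lborel borel (f \<circ> g) = distr (distr lborel borel g) borel f" using assms(3,4) by (intro distr_distr[symmetric]) auto
 then show ?thesis using assms(1,2) by (simp add: comp_def)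
qed

lemma lborel_shear2: "distr lborel borel (%(x, y). (x, y + c * x)) = (lborel :: pt measure)"
proof -
 have m: "prod.swap \<in> borel_measurable (borel :: pt measure)"
  by (intro borel_measurable_continuous_onI) (auto simp: prod.swap_def[abs_def] intro!: continuous_intros)
 have m': "(%(x, y). (x + c * y, y)) \<in> borel_measurable (borel :: pt measure)"
  by (intro borel_measurable_continuous_onI) (auto simp: case_prod_unfold intro!: continuous_intros)
 have "(%(x, y). (x, y + c * x)) = (%p. prod.swap ((%(x, y). (x + c * y, y)) (prod.swap p)))"
  by (auto simp: fun_eq_iff)
 then show ?thesis
  using lborel_distr_comp[OF lborel_swap lborel_distr_comp[OF lborel_shear1 lborel_swap m' m] m measurable_compose[OF m m', unfolded comp_def]]
  by simp
qed

text \<open>A rotation is the composition of a horizontal, a vertical and a horizontal shear, and a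
  shear only translates slices. The factor \<open>t\<close> is the tangent of the half angle, which
  exists unless the angle is a half turn.\<close>

lemma lborel_rot_aux:
 assumes "cos v ~= -1"
 shows "distr lborel borel (rot v) = (lborel :: pt measure)"
proof -
 define t where "t = sin v / (1 + cos v)"
 have c: "1 + cos v ~= 0" using assms by auto
 have sc: "(sin v)\<^sup>2 = (1 + cos v) * (1 - cos v)"  using sin_squared_eq[of v] by (simp add: power2_eq_square algebra_simps)
 have h1: "t * sin v = 1 - cos v" using c sc by (simp add: t_def power2_eq_square)
 have h2: "t * (1 + cos v) = sin v" using c by (simp add: t_def)
 have eq: "rot v = (%p. (%(x, y). (x + (- t) * y, y)) ((%(x, y). (x, y + sin v * x)) ((%(x, y). (x + (- t) * y, y)) p)))"
 proof
  fix p :: pt obtain x y where p: "p = (x, y)" by force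
  have s: "y + sin v * (x - t * y) = sin v * x + cos v * y"
  proof -
   have "y + sin v * (x - t * y) = sin v * x + (1 - t * sin v) * y" by (simp add: algebra_simps)
   then show ?thesis by (simp add: h1)
  qed
  have "x - t * y - t * (sin v * x + cos v * y) = x - (t * sin v) * x - (t * (1 + cos v)) * y" by (simp add: algebra_simps)
  also have "... = cos v * x - sin v * y" by (simp only: h1 h2) (simp add: algebra_simps)
  finally have "rot v p = (x - t * y - t * (sin v * x + cos v * y), sin v * x + cos v * y)" by (simp add: p rot_def)
  then show "rot v p = (%(x, y). (x + (- t) * y, y)) ((%(x, y). (x, y + sin v * x)) ((%(x, y). (x + (- t) * y, y)) p))"
   using s by (simp add: p)
 qed
 have m1: "(%(x, y). (x + (- t) * y, y)) \<in> borel_measurable (borel :: pt measure)"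
  by (intro borel_measurable_continuous_onI) (auto simp: case_prod_unfold intro!: continuous_intros)
 have m2: "(%(x, y). (x, y + sin v * x)) \<in> borel_measurable (borel :: pt measure)"
  by (intro borel_measurable_continuous_onI) (auto simp: case_prod_unfold intro!: continuous_intros)
 show ?thesis unfolding eq
  by (rule lborel_distr_comp[OF lborel_shear1 lborel_distr_comp[OF lborel_shear2 lborel_shear1 m2 m1] m1 measurable_compose[OF m1 m2]])
qed

lemma lborel_rot: "distr lborel borel (rot v) = (lborel :: pt measure)"
proof (cases "cos v = -1")
 case True
 then have "sin v = 0" using sin_cos_squared_add[of v] by simp
 \<comment> \<open>The half turn, excluded before, is two quarter turns.\<close>
 then have "rot v = rot (pi/2) \<circ> rot (pi/2)" using True by (auto simp: rot_def fun_eq_iff)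
 then show ?thesis using lborel_distr_comp[OF lborel_rot_aux lborel_rot_aux, of "pi/2" "pi/2"] by (simp add: comp_def)
qed (rule lborel_rot_aux)

lemma rot_image_eq: "rot v ` A = rot (- v) -` A" by (auto simp: image_iff) (metis rot_inverse(1))

lemma sets_rot [measurable (raw)]: "A \<in> sets borel ==> rot v ` A \<in> sets borel"
 unfolding rot_image_eq using measurable_sets[OF measurable_rot] by simp

lemma area_rot [simp]: "A \<in> sets borel ==> area (rot v ` A) = area A"
 by (subst (2) lborel_rot[of "- v", symmetric]) (simp add: measure_distr rot_image_eq)

lemma area_translation [simp]:
 assumes "A \<in> sets borel" shows "area ((%x. c + x) ` A) = area A"
proof -
 have "(%x. c + x) ` A = {x. x + (- c) \<in> A}" by (auto simp: image_iff) (metis add.commute diff_add_cancel)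
 then show ?thesis using lborel_shift[OF assms, of "- c"] by (simp add: measure_def)
qed

lemma area_uminus [simp]: "A \<in> sets borel ==> area (uminus ` A) = area A"
 using area_rot[of A pi] by (simp add: rot_pi[abs_def])

lemma compact_convex_real:
 fixes S :: "real set"
 assumes "compact S" "convex S" "S ~= {}"
 obtains a b where "a \<le> b" "S = {a..b}"
proof -
 from assms obtain a b where "S = {a..b}" by (metis connected_compact_interval_1 convex_connected box_real(2))
 with assms(3) that show thesis by auto
qed

section \<open>Convex bodies, Minkowski sums and widths\<close>

lemma KC_D: "K \<in> KC ==> compact K" "K \<in> KC ==> convex K" "K \<in> KC ==> K ~= {}"
 by (auto simp: KC_def)

lemma KC_I: "compact K ==> convex K ==> K ~= {} ==> K \<in> KC" by (auto simp: KC_def)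

lemma mink_compact [simp]: "compact A ==> compact B ==> compact (mink A B)"
 unfolding mink_def using compact_sums by blast

lemma mink_convex [simp]: "convex A ==> convex B ==> convex (mink A B)"
proof -
 assume "convex A" "convex B"
 moreover have "mink A B = (\<Union>x\<in>A. \<Union>y\<in>B. {x + y})" unfolding mink_def by blast
 ultimately show ?thesis by (metis convex_sums)
qed

lemma mink_KC [simp]: "A \<in> KC ==> B \<in> KC ==> mink A B \<in> KC"
 by (auto simp: KC_def mink_compact mink_convex) (auto simp: mink_def)

lemma mink_empty [simp]: "mink {} B = {}" "mink A {} = {}" by (auto simp: mink_def)

lemma mink_eq_empty [simp]: "mink A B = {} \<longleftrightarrow> A = {} \<or> B = {}" by (auto simp: mink_def)

lemma mink_iff: "z \<in> mink A B \<longleftrightarrow> (\<exists>x\<in>A. \<exists>y\<in>B. z = x + y)" unfolding mink_def by blast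

lemma mink_assoc: "mink (mink A B) C = mink A (mink B C)"
proof (intro equalityI subsetI)
 fix z assume "z \<in> mink (mink A B) C"
 then obtain a b c where "a \<in> A" "b \<in> B" "c \<in> C" "z = a + (b + c)" unfolding mink_def using add.assoc by blast
 then show "z \<in> mink A (mink B C)" unfolding mink_def by blast
next
 fix z assume "z \<in> mink A (mink B C)"
 then obtain a b c where "a \<in> A" "b \<in> B" "c \<in> C" "z = (a + b) + c" unfolding mink_def using add.assoc[symmetric] by blast
 then show "z \<in> mink (mink A B) C" unfolding mink_def by blast
qed

lemma mink_commute: "mink A B = mink B A"
proof -
 have "mink A B \<subseteq> mink B A" for A B
 proof
  fix z assume "z \<in> mink A B"
  then obtain x y where "x \<in> A" "y \<in> B" "z = y + x" unfolding mink_def using add.commute by blast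
  then show "z \<in> mink B A" unfolding mink_def by blast
 qed
 then show ?thesis by blast
qed

lemma mink_mono: "A \<subseteq> A' ==> B \<subseteq> B' ==> mink A B \<subseteq> mink A' B'"
 unfolding mink_def by blast

lemma mink_zero [simp]: "mink A {0} = A" unfolding set_eq_iff mink_iff by simp

lemma mink_linear_image:
 assumes "linear f" shows "f ` mink A B = mink (f ` A) (f ` B)"
proof (intro equalityI subsetI)
 fix z assume "z \<in> f ` mink A B"
 then obtain x y where "x \<in> A" "y \<in> B" "z = f (x + y)" unfolding mink_def by blast
 then show "z \<in> mink (f ` A) (f ` B)" unfolding mink_iff linear_add[OF assms] by blast
next
 fix z assume "z \<in> mink (f ` A) (f ` B)"
 then obtain x y where xy: "x \<in> A" "y \<in> B" "z = f x + f y" unfolding mink_iff by blast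
 then have "z = f (x + y)" "x + y \<in> mink A B" unfolding mink_iff linear_add[OF assms] by blast+
 then show "z \<in> f ` mink A B" by blast
qed

abbreviation seg :: "pt => pt set" where "seg u \<equiv> closed_segment 0 u"

lemma seg_KC [simp]: "closed_segment p q \<in> KC" by (auto simp: KC_def)

lemma compact_sets_borel [simp, measurable]: "compact A ==> A \<in> sets (borel :: 'a :: t2_space measure)"
 by (simp add: borel_compact)

lemma KC_sets [simp]: "A \<in> KC ==> A \<in> sets borel" using KC_D(1) by simp

lemma emeasure_compact: "compact A ==> emeasure lborel A = ennreal (measure lborel (A :: 'a :: euclidean_space set))"
 using emeasure_compact_finite[of A] by (intro emeasure_eq_ennreal_measure) auto

lemma compact_fmeasurable [simp]: "compact A ==> A \<in> fmeasurable (lborel :: 'a :: euclidean_space measure)"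
 using emeasure_compact_finite[of A] by (simp add: fmeasurable_def)

lemma area_mono: "A \<subseteq> B ==> A \<in> sets borel ==> compact B ==> measure lborel A \<le> measure lborel (B :: 'a :: euclidean_space set)"
 by (intro measure_mono_fmeasurable) auto

lemma continuous_cross [continuous_intros]:
 "continuous_on S f ==> continuous_on S g ==> continuous_on S (%x. cross (f x) (g x))"
 unfolding cross_def by (intro continuous_intros)

lemma linear_cross: "linear (cross u)" by (rule linearI) (auto simp: cross_def algebra_simps)

lemma cross_image:
 assumes "A \<in> KC" obtains a b where "a \<le> b" "cross u ` A = {a..b}"
proof (rule compact_convex_real)
 show "compact (cross u ` A)" using KC_D[OF assms] by (intro compact_continuous_image continuous_intros)
 show "convex (cross u ` A)" using KC_D[OF assms] by (intro convex_linear_image linear_cross)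
 show "cross u ` A ~= {}" using KC_D[OF assms] by auto
qed (use that in auto)

lemma KC_rot [simp]: "A \<in> KC ==> rot v ` A \<in> KC"
 by (auto simp: KC_def intro!: compact_continuous_image continuous_intros convex_linear_image linear_rot)

lemma wd_rot [simp]: "wd (rot v u) (rot v ` A) = wd u A" by (simp add: wd_def image_image)

lemma wd_scale:
 assumes "A \<in> KC" shows "wd (c *\<^sub>R u) A = \<bar>c\<bar> * wd u A"
proof -
 obtain a b where ab: "a \<le> b" "cross u ` A = {a..b}" using cross_image[OF assms] .
 have "cross (c *\<^sub>R u) ` A = (%x. c * x) ` (cross u ` A)" by (auto simp: cross_def image_image algebra_simps)
 also have "... = (if c \<ge> 0 then {c * a..c * b} else {c * b..c * a})" using ab by (simp add: image_mult_atLeastAtMost_if)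
 finally show ?thesis using ab by (auto simp: wd_def algebra_simps mult_left_mono mult_left_mono_neg)
qed

lemma wd_mink:
 assumes "A \<in> KC" "B \<in> KC" shows "wd u (mink A B) = wd u A + wd u B"
proof -
 obtain a b where ab: "a \<le> b" "cross u ` A = {a..b}" using cross_image[OF assms(1)] .
 obtain c d where cd: "c \<le> d" "cross u ` B = {c..d}" using cross_image[OF assms(2)] .
 have "cross u ` mink A B = {x + y | x y. x \<in> cross u ` A \<and> y \<in> cross u ` B}"
 proof (intro equalityI subsetI)
  fix z assume "z \<in> cross u ` mink A B"
  then obtain x y where "x \<in> A" "y \<in> B" "z = cross u x + cross u y"
   unfolding mink_def using linear_add[OF linear_cross, of u] by blast
  then show "z \<in> {x + y | x y. x \<in> cross u ` A \<and> y \<in> cross u ` B}" by blast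
 next
  fix z assume "z \<in> {x + y | x y. x \<in> cross u ` A \<and> y \<in> cross u ` B}"
  then obtain x y where xy: "x \<in> A" "y \<in> B" "z = cross u x + cross u y" by blast
  then have "z = cross u (x + y)" using linear_add[OF linear_cross, of u] by simp
  with xy show "z \<in> cross u ` mink A B" unfolding mink_def by blast
 qed
 also have "... = {a + c..b + d}" unfolding ab cd
 proof safe
  fix x assume "x \<in> {a + c..b + d}"
  then have "x = max a (x - d) + (x - max a (x - d))" "max a (x - d) \<in> {a..b}" "x - max a (x - d) \<in> {c..d}" using ab cd by auto
  then show "\<exists>xa y. x = xa + y \<and> xa \<in> {a..b} \<and> y \<in> {c..d}" by blast
 qed auto
 finally show ?thesis using ab cd by (simp add: wd_def)
qed

lemma wd_seg: "wd u (closed_segment p q) = \<bar>cross u (q - p)\<bar>"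
proof -
 have "cross u ` closed_segment p q = closed_segment (cross u p) (cross u q)"
  by (rule closed_segment_linear_image[OF linear_cross, symmetric])
 then show ?thesis by (auto simp: wd_def closed_segment_eq_real_ivl linear_diff[OF linear_cross])
qed

lemma wd_nonneg [simp]: "wd u A \<ge> 0" by (simp add: wd_def)

lemma seg_horizontal:
 assumes "t \<ge> 0" shows "seg (t, 0) = {(s, 0) | s. 0 \<le> s \<and> s \<le> t}"
proof -
 have "linear (%s::real. (s, 0::real))" by (rule linearI) auto
 from closed_segment_linear_image[OF this, of 0 t]
 have "seg (t, 0) = (%s. (s, 0)) ` closed_segment 0 t" by (simp add: zero_prod_def)
 then show ?thesis using assms by (auto simp: closed_segment_eq_real_ivl)
qed

lemma slice_interval:
 assumes "A \<in> KC" "y \<in> snd ` A"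
 obtains a b where "a \<le> b" "{x. (x, y) \<in> A} = {a..b}"
proof (rule compact_convex_real)
 have "{x. (x, y) \<in> A} = fst ` (A \<inter> {p. snd p = y})" by force
 moreover have "closed {p :: pt. snd p = y}" by (intro closed_Collect_eq continuous_intros)
 ultimately show "compact {x. (x, y) \<in> A}"
  using KC_D(1)[OF assms(1)] by (auto intro!: compact_continuous_image continuous_intros compact_Int_closed)
 show "convex {x. (x, y) \<in> A}"
 proof (rule convexI)
  fix s t u v :: real assume h: "s \<in> {x. (x, y) \<in> A}" "t \<in> {x. (x, y) \<in> A}" "0 \<le> u" "0 \<le> v" "u + v = 1"
  then have "u *\<^sub>R (s, y) + v *\<^sub>R (t, y) \<in> A" using KC_D(2)[OF assms(1)] unfolding convex_def by blast
  moreover have "u *\<^sub>R (s, y) + v *\<^sub>R (t, y) = (u *\<^sub>R s + v *\<^sub>R t, y)"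
   using h(5) by (simp add: distrib_right[symmetric])
  ultimately show "u *\<^sub>R s + v *\<^sub>R t \<in> {x. (x, y) \<in> A}" by simp
 qed
 show "{x. (x, y) \<in> A} ~= {}" using assms(2) by auto
qed (use that in auto)

text \<open>Every nonempty horizontal slice of \<open>A\<close> is an interval, which the segment
  lengthens by exactly \<open>t\<close>. Integration over the heights of \<open>A\<close> gives
  \<open>t\<close> times its vertical extent, which is the width.\<close>

lemma area_mink_seg_horizontal:
 assumes A: "A \<in> KC" and t: "t \<ge> 0"
 shows "area (mink A (seg (t, 0))) = area A + wd (t, 0) A"
proof -
 let ?M = "mink A (seg (t, 0))"
 have Ms: "?M \<in> sets borel" "A \<in> sets borel" using A by simp_all
 obtain c d where cd: "c \<le> d" "snd ` A = {c..d}" using cross_image[OF A, of "(1,0)"] by (auto simp: cross_def)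
 have slice: "{x. (x, y) \<in> ?M} = {x + s | x s. (x, y) \<in> A \<and> 0 \<le> s \<and> s \<le> t}" for y
 proof -
  have "(x, y) \<in> ?M \<longleftrightarrow> (\<exists>p\<in>A. \<exists>s. 0 \<le> s \<and> s \<le> t \<and> (x, y) = p + (s, 0))" for x
   unfolding mink_iff seg_horizontal[OF t] by blast
  then show ?thesis by (auto simp: Bex_def)
 qed
 have len: "emeasure lborel {x. (x, y) \<in> ?M} = emeasure lborel {x. (x, y) \<in> A} + ennreal t * indicator (snd ` A) y" for y
 proof (cases "y \<in> snd ` A")
  case True
  then obtain a b where ab: "a \<le> b" "{x. (x, y) \<in> A} = {a..b}" using slice_interval[OF A] by blast
  have "{x. (x, y) \<in> ?M} = {a..b + t}"
  proof -
   have "(x, y) \<in> A \<longleftrightarrow> a \<le> x \<and> x \<le> b" for x using ab(2) unfolding set_eq_iff by simp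
   then have "{x. (x, y) \<in> ?M} = {x + s | x s. a \<le> x \<and> x \<le> b \<and> 0 \<le> s \<and> s \<le> t}" unfolding slice by simp
   also have "... = {a..b + t}"
   proof safe
    fix x assume "x \<in> {a..b + t}"
    \<comment> \<open>Stay in the slice of \<open>A\<close> as far as possible and let the segment
      supply the rest.\<close>
    then have "x = min x b + (x - min x b)" "a \<le> min x b" "min x b \<le> b" "0 \<le> x - min x b" "x - min x b \<le> t"
     using ab t by auto
    then show "\<exists>xa s. x = xa + s \<and> a \<le> xa \<and> xa \<le> b \<and> 0 \<le> s \<and> s \<le> t" by blast
   qed auto
   finally show ?thesis .
  qed
  then show ?thesis using True ab t by (simp add: ennreal_plus[symmetric] del: ennreal_plus)
 next
  case False
  then have "(x, y) \<notin> A" for x by (metis image_eqI snd_conv)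
  then have "{x. (x, y) \<in> ?M} = {}" "{x. (x, y) \<in> A} = {}" unfolding slice by simp_all
  then show ?thesis using False by simp
 qed
 have "emeasure lborel ?M = emeasure lborel A + ennreal t * emeasure lborel (snd ` A)" using emeasure_pt_slices(2)[OF Ms(2)] cd
  by (simp add: emeasure_pt_slices(1)[OF Ms(1)] emeasure_pt_slices(1)[OF Ms(2)] len nn_integral_add nn_integral_cmult)
 moreover have "wd (t, 0) A = t * (d - c)"
 proof -
  have "cross (t, 0) ` A = (%x. t * x) ` (snd ` A)" by (simp add: cross_def image_image)
  also have "... = {t * c..t * d}" using cd t by (simp add: image_mult_atLeastAtMost_if)
  finally show ?thesis using cd t by (simp add: wd_def mult_left_mono right_diff_distrib)
 qed
 moreover have "emeasure lborel ?M = ennreal (area ?M)" "emeasure lborel A = ennreal (area A)"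
  using A KC_D(1) by (auto intro: emeasure_compact)
 moreover have "emeasure lborel (snd ` A) = ennreal (d - c)" using cd by simp
 ultimately have "ennreal (area ?M) = ennreal (area A + wd (t, 0) A)"
  using cd t by (simp add: ennreal_mult[symmetric] ennreal_plus[symmetric] del: ennreal_plus)
 then show ?thesis by (simp del: ennreal_plus)
qed

lemma area_mink_seg:
 assumes A: "A \<in> KC"
 shows "area (mink A (seg u)) = area A + wd u A"
proof -
 define w where "w = (norm u, 0 :: real)"
 from polar[of u] obtain v where "u = rot v (norm u, 0)" ..
 then have v: "rot v w = u" unfolding w_def by (rule sym)
 have s: "seg u = rot v ` seg w" using closed_segment_linear_image[OF linear_rot, of v 0 w] v linear_0[OF linear_rot, of v] by simp
 let ?A = "rot (- v) ` A"
 have A': "?A \<in> KC" using A by simp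
 have AA: "rot v ` ?A = A" by (simp add: image_image)
 have "area (mink A (seg u)) = area (rot v ` (mink ?A (seg w)))" unfolding s mink_linear_image[OF linear_rot] AA ..
 also have "... = area ?A + wd w ?A" using A' by (simp add: area_mink_seg_horizontal w_def del: image_image)
 also have "wd w ?A = wd u A" using wd_rot[of v w ?A] unfolding v AA by (rule sym)
 finally show ?thesis using area_rot[of A "- v"] A by (simp del: area_rot)
qed

section \<open>Valuations on convex bodies\<close>

text \<open>The point is that \<open>mink A K\<close> and \<open>mink B K\<close> meet only in
  \<open>mink (A \<inter> B) K\<close>. If a point equals \<open>a + k\<close> and
  \<open>b + l\<close>, the segment from \<open>a\<close> to \<open>b\<close> stays in the convex
  union and by connectedness meets \<open>A \<inter> B\<close>; the same convex combination of
  \<open>k\<close> and \<open>l\<close> completes the decomposition.\<close>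

lemma area_mink_valuation:
 assumes A: "A \<in> KC" and B: "B \<in> KC" and K: "K \<in> KC" and AB: "convex (A \<union> B)"
 shows "area (mink (A \<union> B) K) + area (mink (A \<inter> B) K) = area (mink A K) + area (mink B K)"
proof -
 have 1: "mink (A \<union> B) K = mink A K \<union> mink B K" unfolding mink_def by blast
 have "mink A K \<inter> mink B K \<subseteq> mink (A \<inter> B) K"
 proof
  fix p assume "p \<in> mink A K \<inter> mink B K"
  then obtain a k b l where h: "a \<in> A" "k \<in> K" "p = a + k" "b \<in> B" "l \<in> K" "p = b + l" unfolding mink_def by blast
  have "closed_segment a b \<subseteq> A \<union> B" using AB h by (intro closed_segment_subset) auto
  moreover have "connected (closed_segment a b)" by simp
  moreover have "closed A" "closed B" using KC_D(1) A B by (auto intro: compact_imp_closed)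
  moreover have "a \<in> A \<inter> closed_segment a b" "b \<in> B \<inter> closed_segment a b" using h by auto
  ultimately have "A \<inter> B \<inter> closed_segment a b ~= {}" unfolding connected_closed by blast
  then obtain c where "c \<in> A \<inter> B" "c \<in> closed_segment a b" by blast
  then obtain t where t: "0 \<le> t" "t \<le> 1" and c: "(1 - t) *\<^sub>R a + t *\<^sub>R b \<in> A \<inter> B"
   unfolding in_segment by blast
  have "p = ((1 - t) *\<^sub>R a + t *\<^sub>R b) + ((1 - t) *\<^sub>R k + t *\<^sub>R l)"
  proof -
   have "p = (1 - t) *\<^sub>R p + t *\<^sub>R p" by (simp add: algebra_simps)
   also have "... = (1 - t) *\<^sub>R (a + k) + t *\<^sub>R (b + l)" using h(3,6) by simp
   also have "... = ((1 - t) *\<^sub>R a + t *\<^sub>R b) + ((1 - t) *\<^sub>R k + t *\<^sub>R l)" by (simp add: algebra_simps)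
   finally show ?thesis .
  qed
  moreover have "(1 - t) *\<^sub>R k + t *\<^sub>R l \<in> K" using KC_D(2)[OF K] h t by (intro convexD) auto
  ultimately show "p \<in> mink (A \<inter> B) K" using c unfolding mink_def by blast
 qed
 moreover have "mink (A \<inter> B) K \<subseteq> mink A K \<inter> mink B K" unfolding mink_def by blast
 ultimately have 2: "mink (A \<inter> B) K = mink A K \<inter> mink B K" by blast
 have "area (mink A K \<union> mink B K) = area (mink A K) + area (mink B K) - area (mink A K \<inter> mink B K)"
  using A B K KC_D(1) by (intro measure_Un3) auto
 then show ?thesis by (simp add: 1 2)
qed

lemma area_valuation:
 assumes "A \<in> KC" "B \<in> KC" "convex (A \<union> B)"
 shows "area (A \<union> B) + area (A \<inter> B) = area A + area B"
proof -
 have "{0} \<in> KC" by (auto simp: KC_def)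
 then show ?thesis using area_mink_valuation[OF assms(1,2) _ assms(3), of "{0}"] by simp
qed

lemma KC_translation [simp]: "A \<in> KC ==> (%x. c + x) ` A \<in> KC"
 by (auto simp: KC_def intro!: compact_translation convex_translation)

lemma KC_uminus [simp]: "A \<in> KC ==> uminus ` A \<in> KC"
 by (auto simp: KC_def intro!: compact_negations convex_negations)

lemma reflect_eq: "(%x. c - x) ` A = (%x. c + x) ` uminus ` (A :: pt set)" by (simp add: image_image)

lemma KC_reflect [simp]: "A \<in> KC ==> (%x. c - x) ` A \<in> KC" unfolding reflect_eq by simp

lemma area_reflect [simp]: "A \<in> KC ==> area ((%x. c - x) ` A) = area A"
 unfolding reflect_eq using area_translation[of "uminus ` A" c] by simp

lemma mink_translation: "mink ((%x. c + x) ` A) B = (%x. c + x) ` mink A B"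
proof (intro equalityI subsetI)
 fix z assume "z \<in> mink ((%x. c + x) ` A) B"
 then obtain a b where "a \<in> A" "b \<in> B" "z = c + (a + b)" unfolding mink_def using add.assoc by blast
 then show "z \<in> (%x. c + x) ` mink A B" unfolding mink_def by blast
next
 fix z assume "z \<in> (%x. c + x) ` mink A B"
 then obtain a b where "a \<in> A" "b \<in> B" "z = (c + a) + b" unfolding mink_def using add.assoc[symmetric] by blast
 then show "z \<in> mink ((%x. c + x) ` A) B" unfolding mink_def by blast
qed

lemma mink_uminus: "mink (uminus ` A) (uminus ` B) = uminus ` mink A B"
 using mink_linear_image[OF linear_rot, of pi A B] by (simp add: rot_pi[abs_def])

lemma area_mink_reflect: 
 assumes "A \<in> KC" "K \<in> KC"
 shows "area (mink ((%x. c - x) ` A) K) = area (mink A (uminus ` K))"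
proof -
 have "mink ((%x. c - x) ` A) K = (%x. c + x) ` mink (uminus ` A) (uminus ` uminus ` K)"
  unfolding reflect_eq mink_translation by (simp add: image_image)
 also have "... = (%x. c + x) ` uminus ` mink A (uminus ` K)" unfolding mink_uminus ..
 finally show ?thesis using assms by simp
qed

text \<open>The union of the increasing sets is convex and \<open>M\<close> exceeds it only inside
  its frontier, which is a null set by convexity. This takes the place of continuity of the area in
  the Hausdorff metric.\<close>

lemma measure_incseq_convex:
 fixes P :: "nat => 'a::euclidean_space set"
 assumes P: "\<And>n. compact (P n)" "\<And>n. convex (P n)" "incseq P"
  and M: "compact M" "\<And>n. P n \<subseteq> M" "M \<subseteq> closure (\<Union>n. P n)"
 shows "(%n. measure lborel (P n)) \<longlonglongrightarrow> measure lborel M"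
proof -
 define C where "C = (\<Union>n. P n)"
 have C: "convex C" unfolding convex_def
 proof (intro ballI allI impI)
  fix x y u v assume "x \<in> C" "y \<in> C" and uv: "(0::real) \<le> u" "0 \<le> v" "u + v = 1"
  then obtain i j where "x \<in> P i" "y \<in> P j" by (auto simp: C_def)
  then have "x \<in> P (max i j)" "y \<in> P (max i j)" using monoD[OF P(3)] by (meson max.cobounded1 max.cobounded2 subsetD)+
  then have "u *\<^sub>R x + v *\<^sub>R y \<in> P (max i j)" using P(2) uv by (intro convexD) auto
  then show "u *\<^sub>R x + v *\<^sub>R y \<in> C" by (auto simp: C_def)
 qed
 have Cb: "C \<in> sets borel" using P by (auto simp: C_def intro!: sets.countable_UN)
 have CM: "C \<subseteq> M" using M by (auto simp: C_def)
 have "M - C \<subseteq> frontier C" using M(3) interior_subset[of C] by (auto simp: frontier_def C_def)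
 then have "negligible (M - C)" using negligible_convex_frontier[OF C] negligible_subset by blast
 then have "M - C \<in> null_sets lborel" using Cb M(1) by (simp add: negligible_iff_null_sets null_sets_completion_iff)
 then have "emeasure lborel (C \<union> (M - C)) = emeasure lborel C" using Cb by (intro emeasure_Un_null_set) auto
 then have eq: "emeasure lborel M = emeasure lborel C" using CM by (simp add: Un_absorb1)
 have "(%n. measure lborel (P n)) \<longlonglongrightarrow> measure lborel (\<Union>n. P n)"
  using P eq emeasure_compact_finite[OF M(1)] by (intro Lim_measure_incseq) (auto simp: C_def)
 then show ?thesis using eq by (simp add: measure_def C_def)
qed

lemma area_mink_incseq:
 assumes P: "\<And>n. P n \<in> KC" "incseq P" and M: "M \<in> KC" "\<And>n. P n \<subseteq> M" "M \<subseteq> closure (\<Union>n. P n)" and K: "K \<in> KC"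
 shows "(%n. area (mink (P n) K)) \<longlonglongrightarrow> area (mink M K)"
proof (rule measure_incseq_convex)
 show "incseq (%n. mink (P n) K)" using P(2) by (auto simp: incseq_def mink_mono)
 show "mink M K \<subseteq> closure (\<Union>n. mink (P n) K)"
 proof
  fix z assume "z \<in> mink M K"
  then obtain x k where z: "x \<in> M" "k \<in> K" "z = x + k" unfolding mink_def by blast
  show "z \<in> closure (\<Union>n. mink (P n) K)" unfolding closure_approachable
  proof (intro allI impI)
   fix e :: real assume "e > 0"
   then obtain y where y: "y \<in> (\<Union>n. P n)" "dist y x < e" using M(3) z(1) closure_approachable[of x "\<Union>n. P n"] by blast
   then have "y + k \<in> (\<Union>n. mink (P n) K)" using z(2) unfolding mink_def by blast
   moreover have "dist (y + k) z < e" using y z by simp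
   ultimately show "\<exists>y\<in>\<Union>n. mink (P n) K. dist y z < e" by blast
  qed
 qed
 show "mink (P n) K \<subseteq> mink M K" for n using mink_mono[OF M(2) order_refl] .
qed (use P M K KC_D in \<open>auto\<close>)

section \<open>Uniqueness of functionals that vanish on parallelograms\<close>

lemma segv: "h \<ge> 0 ==> seg (0, h) = {(0, s) | s. 0 \<le> s \<and> s \<le> h}"
proof -
 assume "h \<ge> 0"
 have "linear (%s::real. (0::real, s))" by (rule linearI) auto
 from closed_segment_linear_image[OF this, of 0 h]
 have "seg (0, h) = (%s. (0, s)) ` closed_segment 0 h" by (simp add: zero_prod_def)
 then show ?thesis using \<open>h \<ge> 0\<close> by (auto simp: closed_segment_eq_real_ivl)
qed

text \<open>Meant for the difference of the two sides of an integral-geometric formula. Such a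
  functional is shown to vanish on trapezoids, then on polygons cut into vertical strips, then on
  all bodies by inner approximation. \<open>par\<close> includes degenerate parallelograms, hence
  segments and points.\<close>

locale zero_valuation =
 fixes G :: "pt set => real"
 assumes val: "\<And>A B. A \<in> KC ==> B \<in> KC ==> convex (A \<union> B) ==> A \<inter> B ~= {} ==> G (A \<union> B) + G (A \<inter> B) = G A + G B"
  and refl: "\<And>A c. A \<in> KC ==> G ((%x. c - x) ` A) = G A"
  and par: "\<And>u w. G (mink (seg u) (seg w)) = 0"
  and cont: "\<And>P M. (\<And>n. P n \<in> KC) ==> incseq P ==> M \<in> KC ==> (\<And>n. P n \<subseteq> M)
    ==> M \<subseteq> closure (\<Union>n. P n) ==> (%n. G (P n)) \<longlonglongrightarrow> G M"
begin

text \<open>Two point reflections compose to a translation.\<close>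

lemma transl: "A \<in> KC ==> G ((%x. c + x) ` A) = G A"
 using refl[of A 0] refl[of "(%x. 0 - x) ` A" c] KC_reflect[of A 0] by (simp add: image_image)

text \<open>The trapezoid with vertical sides over \<open>s\<close> and \<open>t\<close>:
  \<open>a\<close> and \<open>b\<close> are the lower ends on the left and on the right,
  \<open>c\<close> and \<open>d\<close> the upper ends. The case \<open>s = t\<close> is allowed and
  gives a set on a vertical line.\<close>

definition Z :: "real => real => real => real => real => real => pt set" where
 "Z s t a b c d = {((1 - l) * s + l * t, y) | l y. 0 \<le> l \<and> l \<le> 1 \<and> (1 - l) * a + l * b \<le> y \<and> y \<le> (1 - l) * c + l * d}"

lemma Z_par:
 assumes "h \<ge> 0" shows "Z s t a b (a + h) (b + h) = (%x. (s, a) + x) ` mink (seg (t - s, b - a)) (seg (0, h))"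
proof (intro equalityI subsetI)
 fix z assume "z \<in> Z s t a b (a + h) (b + h)"
 then obtain l y where h: "0 \<le> l" "l \<le> 1" "(1 - l) * a + l * b \<le> y" "y \<le> (1 - l) * (a + h) + l * (b + h)"
  "z = ((1 - l) * s + l * t, y)" unfolding Z_def by blast
 define e where "e = y - ((1 - l) * a + l * b)"
 have "e \<le> h" "0 \<le> e" using h by (simp_all add: e_def algebra_simps)
 then have "(0, e) \<in> seg (0, h)" using assms by (simp add: segv)
 moreover have "l *\<^sub>R (t - s, b - a) \<in> seg (t - s, b - a)" using h unfolding in_segment by auto
 ultimately have "l *\<^sub>R (t - s, b - a) + (0, e) \<in> mink (seg (t - s, b - a)) (seg (0, h))" unfolding mink_def by blast
 moreover have "z = (s, a) + (l *\<^sub>R (t - s, b - a) + (0, e))" using h by (simp add: e_def algebra_simps)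
 ultimately show "z \<in> (%x. (s, a) + x) ` mink (seg (t - s, b - a)) (seg (0, h))" by blast
next
 fix z assume "z \<in> (%x. (s, a) + x) ` mink (seg (t - s, b - a)) (seg (0, h))"
 then obtain x w where xw: "x \<in> seg (t - s, b - a)" "w \<in> seg (0, h)" "z = (s, a) + (x + w)" unfolding mink_def by blast
 then obtain l e where "x = l *\<^sub>R (t - s, b - a)" "0 \<le> l" "l \<le> 1" "w = (0, e)" "0 \<le> e" "e \<le> h"
  using assms by (auto simp: segv in_segment)
 then show "z \<in> Z s t a b (a + h) (b + h)" unfolding Z_def using xw(3)
  by (intro CollectI exI[of _ l] exI[of _ "snd z"]) (auto simp: algebra_simps)
qed

lemma G_Z_par: "h \<ge> 0 ==> G (Z s t a b (a + h) (b + h)) = 0" by (simp add: Z_par transl par)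

lemma Z_par_KC: "h \<ge> 0 ==> Z s t a b (a + h) (b + h) \<in> KC"
 unfolding Z_par by (intro KC_translation mink_KC seg_KC)

text \<open>The trapezoid and its reflection in the midpoint of its upper edge form a parallelogram
  and overlap in that edge, itself a degenerate parallelogram. Both copies have the same value, so
  twice this value is zero.\<close>

lemma G_Z:
 assumes T: "Z s t p r q w \<in> KC" and st: "s < t" and pq: "p \<le> q" "r \<le> w"
 shows "G (Z s t p r q w) = 0"
proof -
 let ?T = "Z s t p r q w" and ?R = "Z s t q w (q + w - r) (q + w - p)"
 \<comment> \<open>The sum of the lengths of the two vertical sides, which is the vertical side of
   the parallelogram.\<close>
 define H where "H = q + w - p - r"
 have H: "H \<ge> 0" using pq by (simp add: H_def)
 have R: "?R = (%x. (s + t, q + w) - x) ` ?T"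
 proof (intro equalityI subsetI)
  fix z assume "z \<in> ?R"
  then obtain l y where h: "0 \<le> l" "l \<le> 1" "(1 - l) * q + l * w \<le> y" "y \<le> (1 - l) * (q + w - r) + l * (q + w - p)"
   "z = ((1 - l) * s + l * t, y)" unfolding Z_def by blast
  have "((1 - (1 - l)) * s + (1 - l) * t, q + w - y) \<in> ?T"
   unfolding Z_def using h by (intro CollectI exI[of _ "1 - l"] exI[of _ "q + w - y"]) (auto simp: algebra_simps)
  moreover have "z = (s + t, q + w) - ((1 - (1 - l)) * s + (1 - l) * t, q + w - y)" using h by (simp add: algebra_simps)
  ultimately show "z \<in> (%x. (s + t, q + w) - x) ` ?T" by blast
 next
  fix z assume "z \<in> (%x. (s + t, q + w) - x) ` ?T"
  then obtain l y where h: "0 \<le> l" "l \<le> 1" "(1 - l) * p + l * r \<le> y" "y \<le> (1 - l) * q + l * w"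
   "z = (s + t, q + w) - ((1 - l) * s + l * t, y)" unfolding Z_def by blast
  have "((1 - (1 - l)) * s + (1 - l) * t, q + w - y) \<in> ?R"
   unfolding Z_def using h by (intro CollectI exI[of _ "1 - l"] exI[of _ "q + w - y"]) (auto simp: algebra_simps)
  moreover have "z = ((1 - (1 - l)) * s + (1 - l) * t, q + w - y)" using h by (simp add: algebra_simps)
  ultimately show "z \<in> ?R" by simp
 qed
 have lin: "(1 - l) * p + l * r \<le> (1 - l) * q + l * w" "(1 - l) * q + l * w \<le> (1 - l) * (q + w - r) + l * (q + w - p)"
  if "0 \<le> l" "l \<le> 1" for l
 proof -
  show "(1 - l) * p + l * r \<le> (1 - l) * q + l * w" using that pq by (intro add_mono mult_left_mono) auto
  have "(1 - l) * r + l * p \<le> (1 - l) * w + l * q" using that pq by (intro add_mono mult_left_mono) auto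
  then show "(1 - l) * q + l * w \<le> (1 - l) * (q + w - r) + l * (q + w - p)" by (simp add: algebra_simps)
 qed
 have U: "?T \<union> ?R = Z s t p r (p + H) (r + H)"
 proof (intro equalityI subsetI)
  fix z assume "z \<in> ?T \<union> ?R"
  then show "z \<in> Z s t p r (p + H) (r + H)"
  proof
   assume "z \<in> ?T"
   then obtain l y where h: "0 \<le> l" "l \<le> 1" "(1 - l) * p + l * r \<le> y" "y \<le> (1 - l) * q + l * w"
    "z = ((1 - l) * s + l * t, y)" unfolding Z_def by blast
   then show ?thesis unfolding Z_def using lin[of l] by (intro CollectI exI[of _ l] exI[of _ y]) (auto simp: H_def algebra_simps)
  next
   assume "z \<in> ?R"
   then obtain l y where h: "0 \<le> l" "l \<le> 1" "(1 - l) * q + l * w \<le> y" "y \<le> (1 - l) * (q + w - r) + l * (q + w - p)"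
    "z = ((1 - l) * s + l * t, y)" unfolding Z_def by blast
   then show ?thesis unfolding Z_def using lin[of l] by (intro CollectI exI[of _ l] exI[of _ y]) (auto simp: H_def algebra_simps)
  qed
 next
  fix z assume "z \<in> Z s t p r (p + H) (r + H)"
  then obtain l y where h: "0 \<le> l" "l \<le> 1" "(1 - l) * p + l * r \<le> y" "y \<le> (1 - l) * (p + H) + l * (r + H)"
    "z = ((1 - l) * s + l * t, y)" unfolding Z_def by blast
  have "(1 - l) * (p + H) + l * (r + H) = (1 - l) * (q + w - r) + l * (q + w - p)" by (simp add: H_def algebra_simps)
  then show "z \<in> ?T \<union> ?R" using h unfolding Z_def by (cases "y \<le> (1 - l) * q + l * w") fastforce+
 qed
 have I: "?T \<inter> ?R = Z s t q w (q + 0) (w + 0)"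
 proof (intro equalityI subsetI)
  fix z assume "z \<in> ?T \<inter> ?R"
  then obtain l y l' y' where h: "0 \<le> l" "l \<le> 1" "y \<le> (1 - l) * q + l * w" "z = ((1 - l) * s + l * t, y)"
   and h': "0 \<le> l'" "l' \<le> 1" "(1 - l') * q + l' * w \<le> y'" "z = ((1 - l') * s + l' * t, y')" unfolding Z_def by blast
  have "l * (t - s) = l' * (t - s)" using h(4) h'(4) by (simp add: algebra_simps)
  then have "l = l'" "y = y'" using st h(4) h'(4) by auto
  then show "z \<in> Z s t q w (q + 0) (w + 0)" unfolding Z_def using h h' by auto
 next
  fix z assume "z \<in> Z s t q w (q + 0) (w + 0)"
  then obtain l where h: "0 \<le> l" "l \<le> 1" "z = ((1 - l) * s + l * t, (1 - l) * q + l * w)" unfolding Z_def by force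
  then show "z \<in> ?T \<inter> ?R" unfolding Z_def using lin[of l] by blast
 qed
 have "G (?T \<union> ?R) + G (?T \<inter> ?R) = G ?T + G ?R"
 proof (rule val)
  show "?R \<in> KC" unfolding R using T by simp
  show "convex (?T \<union> ?R)" unfolding U using Z_par_KC[OF H] KC_D(2) by blast
  show "?T \<inter> ?R ~= {}" unfolding I using Z_par_KC[of 0] KC_D(3) by blast
 qed (rule T)
 moreover have "G ?R = G ?T" unfolding R by (rule refl[OF T])
 ultimately show ?thesis unfolding U I using G_Z_par[OF H] G_Z_par[of 0] by simp
qed

lemma chord:
 assumes "C \<in> KC" "\<And>z. z \<in> C ==> fst z = s"
 obtains p q where "p \<le> q" "C = {s} \<times> {p..q}"
proof -
 obtain p q where pq: "p \<le> q" "cross (1, 0) ` C = {p..q}" using cross_image[OF assms(1)] .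
 have "cross (1, 0) z = snd z" for z by (simp add: cross_def)
 then have "snd ` C = {p..q}" using pq(2) by simp
 have "C = {s} \<times> {p..q}"
 proof (intro equalityI subsetI)
  fix z assume "z \<in> C"
  then have "fst z = s" "snd z \<in> {p..q}" using assms(2) \<open>snd ` C = {p..q}\<close> by blast+
  then show "z \<in> {s} \<times> {p..q}" by (cases z) auto
 next
  fix z assume "z \<in> {s} \<times> {p..q}"
  then obtain z' where "z' \<in> C" "snd z' = snd z" "fst z = s" using \<open>snd ` C = {p..q}\<close> by (metis imageE mem_Sigma_iff prod.collapse singletonD)
  then show "z \<in> C" using assms(2)[of z'] by (metis prod.collapse)
 qed
 then show thesis using pq that by blast
qed

lemma G_vertical:
 assumes "C \<in> KC" "\<And>z. z \<in> C ==> fst z = s" shows "G C = 0"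
proof -
 obtain p q where pq: "p \<le> q" "C = {s} \<times> {p..q}" using chord assms by blast
 \<comment> \<open>A vertical chord is a trapezoid whose two sides coincide.\<close>
 have "C = Z s s p p (p + (q - p)) (p + (q - p))"
 proof -
  have "(1 - l) * a + l * a = a" for l a :: real by (simp add: left_diff_distrib)
  then show ?thesis unfolding pq(2) Z_def by (auto intro: exI[of _ 0])
 qed
 then show ?thesis using G_Z_par[of "q - p" s s p p] pq(1) by simp
qed


lemma convex_combo_hull_Un:
 fixes U W :: "'a::euclidean_space set"
 assumes "z \<in> convex hull (U \<union> W)" "U ~= {}" "W ~= {}"
 obtains a b l where "a \<in> convex hull U" "b \<in> convex hull W" "0 \<le> l" "l \<le> 1" "z = (1 - l) *\<^sub>R a + l *\<^sub>R b"
proof -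
 have "convex hull (U \<union> W) = convex hull (convex hull U \<union> convex hull W)" by (rule hull_Un) (blast intro: convex_Inter)
 also have "... = {u *\<^sub>R s + v *\<^sub>R t | u v s t. u \<ge> 0 \<and> v \<ge> 0 \<and> u + v = 1 \<and> s \<in> convex hull U \<and> t \<in> convex hull W}"
  using assms(2,3) by (intro convex_hull_union_two) auto
 finally obtain u v s t where h: "u \<ge> 0" "v \<ge> 0" "u + v = 1" "s \<in> convex hull U" "t \<in> convex hull W" "z = u *\<^sub>R s + v *\<^sub>R t"
  using assms(1) by blast
 then have "u = 1 - v" by simp
 then show thesis using that[of s t v] h by simp
qed

context
 fixes M :: "pt set" and \<alpha> \<beta> :: real
 assumes M: "M \<in> KC" and ab: "\<alpha> < \<beta>" and fM: "fst ` M = {\<alpha>..\<beta>}"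
begin

text \<open>Equidistant abscissae \<open>\<tau>\<close>, the vertical chords \<open>cd\<close> of
  \<open>M\<close> over them, and the inscribed polygon \<open>poly\<close> spanned by these chords;
  the outer chords lie over the two ends of the projection of \<open>M\<close>.\<close>

definition \<tau> :: "nat => nat => real" where "\<tau> N i = \<alpha> + (\<beta> - \<alpha>) * real i / real N"
definition cd :: "nat => nat => pt set" where "cd N i = M \<inter> {z. fst z = \<tau> N i}"
definition poly :: "nat => pt set" where "poly N = convex hull (\<Union>i\<le>N. cd N i)"

lemma tau_mono: "N > 0 ==> i \<le> j ==> \<tau> N i \<le> \<tau> N j"
 using ab by (simp add: \<tau>_def divide_right_mono mult_left_mono)

lemma tau_strict: "N > 0 ==> i < j ==> \<tau> N i < \<tau> N j"
 using ab by (simp add: \<tau>_def divide_strict_right_mono mult_strict_left_mono)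

lemma tau_range: "N > 0 ==> i \<le> N ==> \<alpha> \<le> \<tau> N i \<and> \<tau> N i \<le> \<beta>"
 using tau_mono[of N 0 i] tau_mono[of N i N] by (simp add: \<tau>_def)

lemma convex_halfplanes [simp]: "convex {z :: pt. fst z \<le> c}" "convex {z :: pt. c \<le> fst z}" "convex {z :: pt. fst z = c}"
 "closed {z :: pt. fst z \<le> c}" "closed {z :: pt. c \<le> fst z}" "closed {z :: pt. fst z = c}"
proof -
 have f: "fst z = inner (1, 0) z" for z :: pt by (simp add: inner_prod_def)
 show "convex {z :: pt. fst z \<le> c}" "convex {z :: pt. c \<le> fst z}" "convex {z :: pt. fst z = c}"
  unfolding f by (rule convex_halfspace_le convex_halfspace_ge convex_hyperplane)+
 show "closed {z :: pt. fst z \<le> c}" "closed {z :: pt. c \<le> fst z}" "closed {z :: pt. fst z = c}"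
  by (intro closed_Collect_le closed_Collect_eq continuous_intros)+
qed

lemma cd_KC: "N > 0 ==> i \<le> N ==> cd N i \<in> KC"
proof (rule KC_I)
 assume "N > 0" "i \<le> N"
 then have "\<tau> N i \<in> fst ` M" using tau_range fM by simp
 then show "cd N i ~= {}" by (auto simp: cd_def image_iff)
qed (use KC_D(1,2)[OF M] in \<open>auto simp: cd_def intro!: compact_Int_closed convex_Int\<close>)

lemma poly_KC: "N > 0 ==> poly N \<in> KC"
proof (rule KC_I)
 assume "N > 0"
 then show "compact (poly N)" unfolding poly_def using cd_KC KC_D(1) by (intro compact_convex_hull compact_UN) auto
 have "cd N 0 ~= {}" using cd_KC[OF \<open>N > 0\<close>, of 0] KC_D(3) by auto
 then show "poly N ~= {}" unfolding poly_def by (auto intro: hull_inc)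
qed (simp add: poly_def)

lemma cd_poly: "i \<le> N ==> cd N i \<subseteq> poly N" unfolding poly_def by (blast intro: hull_inc)

lemma poly_M: "poly N \<subseteq> M" unfolding poly_def using KC_D(2)[OF M] by (intro hull_minimal) (auto simp: cd_def)

lemma poly_cd: "i \<le> N ==> poly N \<inter> {z. fst z = \<tau> N i} = cd N i"
 using cd_poly[of i N] poly_M[of N] by (auto simp: cd_def)

text \<open>A point of the polygon is a combination of a point \<open>a\<close> spanned by the
  chords up to \<open>j\<close> and a point \<open>b\<close> spanned by the later ones. The segment
  from \<open>a\<close> to \<open>b\<close> crosses both chords that bound the strip, so a point of
  it inside the strip lies between two points of these chords, hence in their trapezoid.\<close>

lemma strip_subset:
 assumes N: "N > 0" and j: "j < N"
  and c: "cd N j = {\<tau> N j} \<times> {p..q}" and d: "cd N (Suc j) = {\<tau> N (Suc j)} \<times> {r..w}"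
  and z: "z \<in> poly N" "\<tau> N j \<le> fst z" "fst z \<le> \<tau> N (Suc j)"
 shows "z \<in> Z (\<tau> N j) (\<tau> N (Suc j)) p r q w"
proof -
 define s t where "s = \<tau> N j" and "t = \<tau> N (Suc j)"
 have st: "s < t" using N by (simp add: s_def t_def tau_strict)
 define U where "U = (\<Union>i\<le>j. cd N i)"
 define W where "W = (\<Union>i\<in>{Suc j..N}. cd N i)"
 have UW: "(\<Union>i\<le>N. cd N i) = U \<union> W"
 proof -
  have "{..N} = {..j} \<union> {Suc j..N}" using j by auto
  then show ?thesis by (simp add: U_def W_def UN_Un)
 qed
 have "U ~= {}" "W ~= {}"
 proof -
  have "cd N j ~= {}" "cd N (Suc j) ~= {}" using cd_KC[OF N] j KC_D(3) by auto
  moreover have "cd N j \<subseteq> U" "cd N (Suc j) \<subseteq> W" unfolding U_def W_def using j by (intro UN_upper; simp)+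
  ultimately show "U ~= {}" "W ~= {}" by blast+
 qed
 then obtain a b l where abl: "a \<in> convex hull U" "b \<in> convex hull W" "0 \<le> l" "l \<le> 1" "z = (1 - l) *\<^sub>R a + l *\<^sub>R b"
  using convex_combo_hull_Un z(1) unfolding poly_def UW by metis
 have "convex hull U \<subseteq> {z. fst z \<le> s}" using tau_mono[OF N] by (intro hull_minimal) (auto simp: U_def cd_def s_def)
 then have as: "fst a \<le> s" using abl(1) by blast
 have "convex hull W \<subseteq> {z. t \<le> fst z}" using tau_mono[OF N] by (intro hull_minimal) (auto simp: W_def cd_def t_def)
 then have bt: "t \<le> fst b" using abl(2) by blast
 have aP: "a \<in> poly N" and bP: "b \<in> poly N"
  using abl(1,2) hull_mono[of U "U \<union> W"] hull_mono[of W "U \<union> W"] unfolding poly_def UW by auto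
 \<comment> \<open>The line through \<open>a\<close> and \<open>b\<close>, with slope
   \<open>m\<close>, written as a function \<open>Y\<close> of the abscissa.\<close>
 define m where "m = (snd b - snd a) / (fst b - fst a)"
 define Y where "Y x = snd a + m * (x - fst a)" for x
 have D: "fst b - fst a > 0" using as bt st by simp
 have Yp: "(x, Y x) \<in> poly N" if "fst a \<le> x" "x \<le> fst b" for x
 proof -
  define k where "k = (x - fst a) / (fst b - fst a)"
  have k: "0 \<le> k" "k \<le> 1" using that D by (auto simp: k_def)
  have "(x, Y x) = (1 - k) *\<^sub>R a + k *\<^sub>R b"
  proof (rule prod_eqI)
   have "k * (fst b - fst a) = x - fst a" using D by (simp add: k_def)
   then show "fst (x, Y x) = fst ((1 - k) *\<^sub>R a + k *\<^sub>R b)" by (simp add: algebra_simps)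
   have "k * (snd b - snd a) = m * (x - fst a)" by (simp add: k_def m_def)
   then show "snd (x, Y x) = snd ((1 - k) *\<^sub>R a + k *\<^sub>R b)" by (simp add: Y_def algebra_simps)
  qed
  then show ?thesis using convexD[OF KC_D(2)[OF poly_KC[OF N]] aP bP, of "1 - k" k] k by simp
 qed
 have zY: "snd z = Y (fst z)"
 proof -
  have "m * (fst b - fst a) = snd b - snd a" using D by (simp add: m_def)
  moreover have "fst z - fst a = l * (fst b - fst a)" "snd z - snd a = l * (snd b - snd a)" by (simp_all add: abl(5) algebra_simps)
  ultimately show ?thesis by (simp add: Y_def mult.left_commute)
 qed
 have "(s, Y s) \<in> cd N j" "(t, Y t) \<in> cd N (Suc j)" using Yp[of s] Yp[of t] as bt st j poly_M by (auto simp: cd_def s_def t_def)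
 then have pq: "p \<le> Y s" "Y s \<le> q" "r \<le> Y t" "Y t \<le> w" by (auto simp: c d)
 define k where "k = (fst z - s) / (t - s)"
 have k: "0 \<le> k" "k \<le> 1" using z st by (auto simp: k_def s_def t_def)
 have kz: "fst z = (1 - k) * s + k * t"
 proof -
  have "k * (t - s) = fst z - s" using st by (simp add: k_def)
  then show ?thesis by (simp add: algebra_simps)
 qed
 have "Y (fst z) = (1 - k) * Y s + k * Y t" by (simp add: kz Y_def algebra_simps)
 moreover have "(1 - k) * p + k * r \<le> (1 - k) * Y s + k * Y t" "(1 - k) * Y s + k * Y t \<le> (1 - k) * q + k * w"
  using k pq by (intro add_mono mult_left_mono; simp)+
 ultimately have "(1 - k) * p + k * r \<le> snd z" "snd z \<le> (1 - k) * q + k * w" using zY by auto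
 then show ?thesis unfolding Z_def s_def[symmetric] t_def[symmetric] using k kz
  by (intro CollectI exI[of _ k] exI[of _ "snd z"]) (auto simp: prod_eq_iff)
qed

lemma G_strip:
 assumes N: "N > 0" and j: "j < N"
 shows "poly N \<inter> {z. \<tau> N j \<le> fst z \<and> fst z \<le> \<tau> N (Suc j)} \<in> KC" (is "?E \<in> KC")
  and "G (poly N \<inter> {z. \<tau> N j \<le> fst z \<and> fst z \<le> \<tau> N (Suc j)}) = 0"
proof -
 define s t where "s = \<tau> N j" and "t = \<tau> N (Suc j)"
 have st: "s < t" using N by (simp add: s_def t_def tau_strict)
 obtain p q where c: "p \<le> q" "cd N j = {s} \<times> {p..q}" using chord[OF cd_KC[OF N, of j], of s] j by (auto simp: cd_def s_def)
 obtain r w where d: "r \<le> w" "cd N (Suc j) = {t} \<times> {r..w}"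
  using chord[OF cd_KC[OF N, of "Suc j"], of t] j by (auto simp: cd_def t_def)
 have E: "?E = poly N \<inter> ({z. s \<le> fst z} \<inter> {z. fst z \<le> t})" by (auto simp: s_def t_def)
 have ne: "cd N j \<subseteq> ?E" using cd_poly[of j N] j st by (auto simp: cd_def s_def t_def)
 show K: "?E \<in> KC"
 proof (rule KC_I)
  show "?E ~= {}" using ne KC_D(3)[OF cd_KC[OF N, of j]] j by auto
 qed (use KC_D[OF poly_KC[OF N]] in \<open>auto simp: E intro!: compact_Int_closed convex_Int closed_Int\<close>)
 have "?E = Z s t p r q w"
 proof (intro equalityI subsetI)
  fix z assume "z \<in> ?E" then show "z \<in> Z s t p r q w"
   using strip_subset[OF N j c(2)[unfolded s_def] d(2)[unfolded t_def], of z] by (auto simp: s_def t_def)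
 next
  fix z assume "z \<in> Z s t p r q w"
  then obtain l y where h: "0 \<le> l" "l \<le> 1" "(1 - l) * p + l * r \<le> y" "y \<le> (1 - l) * q + l * w"
    "z = ((1 - l) * s + l * t, y)" unfolding Z_def by blast
  \<comment> \<open>The vertical fibre of the trapezoid over this abscissa. A point at relative
    height \<open>k\<close> in it lies between the points at the same relative height on the two
    sides.\<close>
  define lo hi where "lo = (1 - l) * p + l * r" and "hi = (1 - l) * q + l * w"
  obtain k where k: "0 \<le> k" "k \<le> 1" "y = (1 - k) * lo + k * hi"
  proof -
   have "y \<in> closed_segment lo hi" using h by (auto simp: lo_def hi_def closed_segment_eq_real_ivl)
   then show thesis using that by (auto simp: in_segment)
  qed
  have m: "(1 - k) * x + k * x' \<in> {x..x'}" if "x \<le> x'" for x x' :: real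
  proof -
   have "0 \<le> k * (x' - x)" "0 \<le> (1 - k) * (x' - x)" using k that by auto
   then show ?thesis by (auto simp: algebra_simps)
  qed
  have "(s, (1 - k) * p + k * q) \<in> poly N" "(t, (1 - k) * r + k * w) \<in> poly N"
   using cd_poly[of j N] cd_poly[of "Suc j" N] j c d m[of p q] m[of r w] by auto
  then have "(1 - l) *\<^sub>R (s, (1 - k) * p + k * q) + l *\<^sub>R (t, (1 - k) * r + k * w) \<in> poly N"
   using h by (intro convexD[OF KC_D(2)[OF poly_KC[OF N]]]) auto
  moreover have "(1 - l) *\<^sub>R (s, (1 - k) * p + k * q) + l *\<^sub>R (t, (1 - k) * r + k * w) = z"
   unfolding h(5) k(3) lo_def hi_def by (simp add: algebra_simps)
  moreover have "s \<le> fst z" "fst z \<le> t"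
  proof -
   have "0 \<le> l * (t - s)" "0 \<le> (1 - l) * (t - s)" using h st by auto
   then show "s \<le> fst z" "fst z \<le> t" unfolding h(5) by (auto simp: algebra_simps)
  qed
  ultimately show "z \<in> ?E" by (simp add: s_def t_def)
 qed
 then show "G ?E = 0" using G_Z[of s t p r q w] K st c(1) d(1) by simp
qed

lemma G_cd: "N > 0 ==> i \<le> N ==> G (cd N i) = 0"
 by (rule G_vertical[OF cd_KC, of _ _ "\<tau> N i"]) (auto simp: cd_def)

text \<open>The polygon is assembled strip by strip; the part already covered meets the next strip
  in a chord, where \<open>G\<close> is zero.\<close>

lemma G_poly: assumes N: "N > 0" shows "G (poly N) = 0"
proof -
 have P: "poly N \<in> KC" using N by (rule poly_KC)
 have "j \<le> N ==> poly N \<inter> {z. fst z \<le> \<tau> N j} \<in> KC \<and> G (poly N \<inter> {z. fst z \<le> \<tau> N j}) = 0" for j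
 proof (induction j)
  case 0
  have "poly N \<inter> {z. fst z \<le> \<tau> N 0} = cd N 0"
  proof -
   have "\<alpha> \<le> fst z" if "z \<in> poly N" for z using that poly_M fM by (metis atLeastAtMost_iff image_eqI subsetD)
   then have "poly N \<inter> {z. fst z \<le> \<tau> N 0} = poly N \<inter> {z. fst z = \<tau> N 0}" by (force simp: \<tau>_def)
   then show ?thesis using poly_cd[of 0 N] by simp
  qed
  then show ?case using cd_KC[OF N, of 0] G_cd[OF N, of 0] by simp
 next
  case (Suc j)
  let ?A = "poly N \<inter> {z. fst z \<le> \<tau> N j}" and ?B = "poly N \<inter> {z. \<tau> N j \<le> fst z \<and> fst z \<le> \<tau> N (Suc j)}"
  have st: "\<tau> N j < \<tau> N (Suc j)" using N by (simp add: tau_strict)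
  have U: "?A \<union> ?B = poly N \<inter> {z. fst z \<le> \<tau> N (Suc j)}" using st by force
  have I: "?A \<inter> ?B = cd N j" using st poly_cd[of j N] Suc.prems by force
  have A: "?A \<in> KC" "G ?A = 0" using Suc by auto
  have B: "?B \<in> KC" "G ?B = 0" using G_strip[OF N, of j] Suc.prems by auto
  have C: "cd N j \<in> KC" "G (cd N j) = 0" using cd_KC[OF N, of j] G_cd[OF N, of j] Suc.prems by auto
  have cv: "convex (poly N \<inter> {z. fst z \<le> \<tau> N (Suc j)})" using KC_D(2)[OF P] by (intro convex_Int) auto
  have "G (?A \<union> ?B) + G (?A \<inter> ?B) = G ?A + G ?B" using A B C cv KC_D(3) by (intro val) (auto simp: U I)
  then have "G (poly N \<inter> {z. fst z \<le> \<tau> N (Suc j)}) = 0" using A B C by (simp add: U I)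
  moreover have "poly N \<inter> {z. fst z \<le> \<tau> N (Suc j)} \<in> KC"
  proof (rule KC_I)
   show "compact (poly N \<inter> {z. fst z \<le> \<tau> N (Suc j)})" using KC_D(1)[OF P] by (intro compact_Int_closed) auto
   show "poly N \<inter> {z. fst z \<le> \<tau> N (Suc j)} ~= {}" using KC_D(3)[OF A(1)] unfolding U[symmetric] by blast
  qed (rule cv)
  ultimately show ?case by simp
 qed
 from this[of N] have "G (poly N \<inter> {z. fst z \<le> \<tau> N N}) = 0" by simp
 moreover have "poly N \<inter> {z. fst z \<le> \<tau> N N} = poly N"
 proof -
  have "fst z \<le> \<beta>" if "z \<in> poly N" for z using that poly_M fM by (metis atLeastAtMost_iff image_eqI subsetD)
  then show ?thesis using N by (auto simp: \<tau>_def)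
 qed
 ultimately show ?thesis by simp
qed

text \<open>A point off the right end is moved towards a point \<open>b\<close> over the right end
  until its abscissa is the next dyadic node. It then lies on a chord, and a fine subdivision makes
  the shift small.\<close>

lemma poly_dense: "M \<subseteq> closure (\<Union>n. poly (2 ^ n))"
proof
 fix z assume z: "z \<in> M"
 have zr: "\<alpha> \<le> fst z" "fst z \<le> \<beta>" using z fM by (metis atLeastAtMost_iff image_eqI)+
 show "z \<in> closure (\<Union>n. poly (2 ^ n))"
 proof (cases "fst z = \<beta>")
  case True
  then have "z \<in> cd (2 ^ 0) 1" using z by (simp add: cd_def \<tau>_def)
  then have "z \<in> poly (2 ^ 0)" using cd_poly[of 1 "2 ^ 0"] by auto
  then have "z \<in> (\<Union>n. poly (2 ^ n))" by (rule UN_I[OF UNIV_I])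
  then show ?thesis by (rule subsetD[OF closure_subset])
 next
  case False
  then have zb: "fst z < \<beta>" using zr by simp
  obtain b where b: "b \<in> M" "fst b = \<beta>" using fM ab by (metis atLeastAtMost_iff imageE less_imp_le order_refl)
  show ?thesis unfolding closure_approachable
  proof (intro allI impI)
   fix e :: real assume e: "e > 0"
   \<comment> \<open>The allowed horizontal shift: moving by less than \<open>\<eta>\<close> in
     abscissa moves the point by less than \<open>e\<close> along the line to \<open>b\<close>. The
     \<open>+ 1\<close> makes the final estimate strict.\<close>
   define \<eta> where "\<eta> = e * (\<beta> - fst z) / (norm (b - z) + 1)"
   have \<eta>: "\<eta> > 0" using e zb by (simp add: \<eta>_def add_nonneg_pos)
   obtain n where n: "(\<beta> - \<alpha>) / \<eta> < 2 ^ n" using real_arch_pow[of 2 "(\<beta> - \<alpha>) / \<eta>"] by auto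
   define r where "r = (fst z - \<alpha>) / (\<beta> - \<alpha>) * 2 ^ n"
   define i where "i = nat \<lceil>r\<rceil>"
   have r: "0 \<le> r" "r \<le> 2 ^ n" using zr ab by (auto simp: r_def divide_le_eq mult_le_cancel_right1)
   have i: "r \<le> real i" "real i < r + 1" using r(1) by (auto simp: i_def) linarith
   have "\<lceil>r\<rceil> \<le> 2 ^ n" using r(2) by (simp add: ceiling_le_iff)
   then have iN: "i \<le> 2 ^ n" by (simp add: i_def nat_le_iff)
   define x where "x = \<tau> (2 ^ n) i"
   have rz: "\<alpha> + (\<beta> - \<alpha>) * r / 2 ^ n = fst z" using ab by (simp add: r_def)
   have "fst z \<le> x" using i(1) ab unfolding x_def \<tau>_def rz[symmetric] by (simp add: divide_right_mono mult_left_mono)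
   moreover have "x \<le> \<beta>" using tau_range[of "2 ^ n" i] iN by (simp add: x_def)
   moreover have "x - fst z \<le> (\<beta> - \<alpha>) / 2 ^ n"
   proof -
    have "x - fst z = (\<beta> - \<alpha>) * (real i - r) / 2 ^ n" unfolding x_def \<tau>_def rz[symmetric]
     by (simp add: right_diff_distrib diff_divide_distrib)
    also have "... \<le> (\<beta> - \<alpha>) * 1 / 2 ^ n" using i(2) ab by (intro divide_right_mono mult_left_mono) auto
    finally show ?thesis by simp
   qed
   moreover have "(\<beta> - \<alpha>) / 2 ^ n < \<eta>" using n \<eta> by (simp add: field_simps)
   ultimately have x: "fst z \<le> x" "x \<le> \<beta>" "x - fst z < \<eta>" by auto
   define l where "l = (x - fst z) / (\<beta> - fst z)"
   have l: "0 \<le> l" "l \<le> 1" using x zb by (auto simp: l_def)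
   define z' where "z' = (1 - l) *\<^sub>R z + l *\<^sub>R b"
   have "z' \<in> M" unfolding z'_def using KC_D(2)[OF M] z b l by (intro convexD) auto
   moreover have "fst z' = x"
   proof -
    have "l * (\<beta> - fst z) = x - fst z" using zb by (simp add: l_def)
    then show ?thesis by (simp add: z'_def b algebra_simps)
   qed
   ultimately have "z' \<in> cd (2 ^ n) i" by (simp add: cd_def x_def)
   then have "z' \<in> poly (2 ^ n)" using cd_poly[OF iN] by blast
   moreover have "dist z' z < e"
   proof -
    have "z' - z = l *\<^sub>R (b - z)" by (simp add: z'_def algebra_simps)
    then have "dist z' z = l * norm (b - z)" using l by (simp add: dist_norm)
    also have "... \<le> \<eta> / (\<beta> - fst z) * norm (b - z)"
     using x(3) zb unfolding l_def by (intro mult_right_mono divide_right_mono) auto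
    also have "... = e * (norm (b - z) / (norm (b - z) + 1))" using zb by (simp add: \<eta>_def)
    also have "... < e * 1" using e by (intro mult_strict_left_mono) (auto simp: divide_less_eq add_nonneg_pos)
    finally show ?thesis by simp
   qed
   ultimately show "\<exists>y\<in>\<Union>n. poly (2 ^ n). dist y z < e" by (intro bexI[of _ z'] UN_I[OF UNIV_I])
  qed
 qed
qed

text \<open>The numbers of strips are powers of two, so that node \<open>i\<close> of one level is
  node \<open>2 * i\<close> of the next.\<close>

lemma poly_incseq: "incseq (%n. poly (2 ^ n))"
proof (rule incseq_SucI)
 fix n
 have t: "\<tau> (2 ^ n) i = \<tau> (2 ^ Suc n) (2 * i)" for i by (simp add: \<tau>_def)
 have "(\<Union>i\<le>2 ^ n. cd (2 ^ n) i) \<subseteq> (\<Union>i\<le>2 ^ Suc n. cd (2 ^ Suc n) i)"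
 proof
  fix z assume "z \<in> (\<Union>i\<le>2 ^ n. cd (2 ^ n) i)"
  then obtain i where "i \<le> 2 ^ n" "z \<in> cd (2 ^ n) i" by blast
  then have "2 * i \<le> 2 ^ Suc n" "z \<in> cd (2 ^ Suc n) (2 * i)" using t by (auto simp: cd_def)
  then show "z \<in> (\<Union>i\<le>2 ^ Suc n. cd (2 ^ Suc n) i)" by blast
 qed
 then show "poly (2 ^ n) \<le> poly (2 ^ Suc n)" unfolding poly_def by (rule hull_mono)
qed

lemma G_zero_nondeg: "G M = 0"
proof -
 have "(%n. G (poly (2 ^ n))) \<longlonglongrightarrow> G M" by (intro cont poly_KC poly_incseq M poly_M poly_dense) simp
 moreover have "G (poly (2 ^ n)) = 0" for n by (rule G_poly) simp
 ultimately show ?thesis by (simp add: LIMSEQ_const_iff)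
qed

end

theorem G_zero: assumes M: "M \<in> KC" shows "G M = 0"
proof -
 obtain \<alpha> \<beta> where ab: "\<alpha> \<le> \<beta>" "fst ` M = {\<alpha>..\<beta>}"
 proof -
  have "fst ` M = (%x. - x) ` (cross (0, 1) ` M)" by (simp add: cross_def image_image)
  moreover obtain a b where "a \<le> b" "cross (0, 1) ` M = {a..b}" using cross_image[OF M] .
  ultimately have "fst ` M = {- b..- a}" "- b \<le> - a" by simp_all
  then show thesis using that by blast
 qed
 show ?thesis
 proof (cases "\<alpha> = \<beta>")
  case True
  then have "fst z = \<alpha>" if "z \<in> M" for z using ab that by (metis atLeastAtMost_iff image_eqI order_antisym)
  then show ?thesis using G_vertical[OF M] by blast
 next
  case False then show ?thesis using G_zero_nondeg[OF M, of \<alpha> \<beta>] ab by simp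
 qed
qed

end

section \<open>Measurability of random compact sets\<close>

declare split_paired_All [simp del] split_paired_Ex [simp del]

text \<open>Random compact sets, tested on closed balls only. The class is closed under
  intersections, translations and reflections, which lets every later set be expressed through
  hitting events.\<close>

definition rset :: "'a measure => ('a => pt set) => bool" where
 "rset N A \<longleftrightarrow> (\<forall>w\<in>space N. compact (A w)) \<and> (\<forall>q r. {w \<in> space N. A w \<inter> cball q r ~= {}} \<in> sets N)"

lemma rset_compact: "rset N A ==> w \<in> space N ==> compact (A w)" by (simp add: rset_def)

lemma rset_hit: "rset N A ==> {w \<in> space N. A w \<inter> cball q r ~= {}} \<in> sets N"
 unfolding rset_def by blast

lemma rset_const: "compact A ==> rset N (%_. A)"
 unfolding rset_def by (cases "\<exists>q r. A \<inter> cball q r ~= {}") auto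

lemma rset_compose:
 assumes f: "f \<in> measurable N' N" and A: "rset N A" shows "rset N' (%w. A (f w))" unfolding rset_def
proof (intro conjI allI ballI)
 fix q :: pt and r
 have "{w \<in> space N'. A (f w) \<inter> cball q r ~= {}} = f -` {w \<in> space N. A w \<inter> cball q r ~= {}} \<inter> space N'"
  using measurable_space[OF f] by auto
 also have "... \<in> sets N'" using measurable_sets[OF f rset_hit[OF A]] .
 finally show "{w \<in> space N'. A (f w) \<inter> cball q r ~= {}} \<in> sets N'" .
qed (use rset_compact[OF A] measurable_space[OF f] in auto)

text \<open>By compactness, three sets have a common point as soon as at every scale some point of a
  dense set is close to all of them, since the nearby points have a common limit. With a countable
  \<open>D\<close>, as in the use below, the right side is a countable combination of hitting events
  of balls; the third set is the test ball.\<close>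

lemma triple_intersection:
 fixes A B C D :: "pt set"
 assumes A: "compact A" and B: "compact B" and C: "compact C"
  and D: "\<And>X. open X ==> X ~= {} ==> \<exists>d\<in>D. d \<in> X"
 shows "A \<inter> B \<inter> C ~= {} \<longleftrightarrow>
  (\<forall>n. \<exists>q\<in>D. A \<inter> cball q (1 / real (Suc n)) ~= {} \<and> B \<inter> cball q (1 / real (Suc n)) ~= {} \<and> C \<inter> cball q (1 / real (Suc n)) ~= {})"
proof
 assume "A \<inter> B \<inter> C ~= {}"
 then obtain p where p: "p \<in> A" "p \<in> B" "p \<in> C" by auto
 show "\<forall>n. \<exists>q\<in>D. A \<inter> cball q (1 / real (Suc n)) ~= {} \<and> B \<inter> cball q (1 / real (Suc n)) ~= {} \<and> C \<inter> cball q (1 / real (Suc n)) ~= {}"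
 proof
  fix n
  obtain q where "q \<in> D" "q \<in> ball p (1 / real (Suc n))" using D[of "ball p (1 / real (Suc n))"] by auto
  then have "q \<in> D" "p \<in> cball q (1 / real (Suc n))" by (auto simp: dist_commute)
  with p show "\<exists>q\<in>D. A \<inter> cball q (1 / real (Suc n)) ~= {} \<and> B \<inter> cball q (1 / real (Suc n)) ~= {} \<and> C \<inter> cball q (1 / real (Suc n)) ~= {}"
   by blast
 qed
next
 assume h: "\<forall>n. \<exists>q\<in>D. A \<inter> cball q (1 / real (Suc n)) ~= {} \<and> B \<inter> cball q (1 / real (Suc n)) ~= {} \<and> C \<inter> cball q (1 / real (Suc n)) ~= {}"
 have "\<forall>n. \<exists>q a b c. a \<in> A \<and> b \<in> B \<and> c \<in> C \<and> dist q a \<le> 1 / real (Suc n) \<and> dist q b \<le> 1 / real (Suc n) \<and> dist q c \<le> 1 / real (Suc n)"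
 proof
  fix n
  from h obtain q where "A \<inter> cball q (1 / real (Suc n)) ~= {}" "B \<inter> cball q (1 / real (Suc n)) ~= {}" "C \<inter> cball q (1 / real (Suc n)) ~= {}" by blast
  then obtain a b c where "a \<in> A \<inter> cball q (1 / real (Suc n))" "b \<in> B \<inter> cball q (1 / real (Suc n))" "c \<in> C \<inter> cball q (1 / real (Suc n))" by (metis ex_in_conv)
  then show "\<exists>q a b c. a \<in> A \<and> b \<in> B \<and> c \<in> C \<and> dist q a \<le> 1 / real (Suc n) \<and> dist q b \<le> 1 / real (Suc n) \<and> dist q c \<le> 1 / real (Suc n)"
   unfolding Int_iff mem_cball by blast
 qed
 then obtain q a b c where s: "\<And>n. a n \<in> A" "\<And>n. b n \<in> B" "\<And>n. c n \<in> C"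
  "\<And>n. dist (q n) (a n) \<le> 1 / real (Suc n)" "\<And>n. dist (q n) (b n) \<le> 1 / real (Suc n)" "\<And>n. dist (q n) (c n) \<le> 1 / real (Suc n)"
  by metis
 obtain l r where l: "l \<in> A" "strict_mono r" "(a \<circ> r) \<longlonglongrightarrow> l" using A s(1) unfolding compact_def by metis
 have z: "(%n. 1 / real (Suc n) + 1 / real (Suc n)) \<longlonglongrightarrow> 0 + 0"
  by (intro tendsto_add; rule LIMSEQ_inverse_real_of_nat[unfolded inverse_eq_divide])
 have lim: "(%n. x (r n)) \<longlonglongrightarrow> l" if "\<And>n. dist (q n) (x n) \<le> 1 / real (Suc n)" for x
 proof -
  have "(%n. dist (x n) (a n)) \<longlonglongrightarrow> 0"
  proof (rule tendsto_sandwich[OF _ _ tendsto_const z[simplified]])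
   have "dist (x n) (a n) \<le> 1 / real (Suc n) + 1 / real (Suc n)" for n
    using dist_triangle[of "x n" "a n" "q n"] that[of n] s(4)[of n] by (simp add: dist_commute)
   then show "\<forall>\<^sub>F n in sequentially. dist (x n) (a n) \<le> 2 / (1 + real n)" by (simp add: add_divide_distrib[symmetric])
  qed simp
  then have "(%n. dist (x (r n)) (a (r n))) \<longlonglongrightarrow> 0"
   by (rule LIMSEQ_subseq_LIMSEQ[OF _ l(2), unfolded comp_def])
  then have "(%n. x (r n) - a (r n)) \<longlonglongrightarrow> 0" by (subst tendsto_norm_zero_iff[symmetric]) (simp add: dist_norm)
  with l(3) show ?thesis unfolding comp_def by (rule Lim_transform)
 qed
 have "l \<in> B" using closed_sequentially[OF compact_imp_closed[OF B], of "%n. b (r n)"] s(2) lim[OF s(5)] by blast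
 moreover have "l \<in> C" using closed_sequentially[OF compact_imp_closed[OF C], of "%n. c (r n)"] s(3) lim[OF s(6)] by blast
 ultimately show "A \<inter> B \<inter> C ~= {}" using l(1) by blast
qed

lemma rset_Int:
 assumes A: "rset N A" and B: "rset N B" shows "rset N (%w. A w \<inter> B w)" unfolding rset_def
proof (intro conjI allI ballI)
 fix q :: pt and r
 obtain D :: "pt set" where D: "countable D" "\<And>X. open X ==> X ~= {} ==> \<exists>d\<in>D. d \<in> X"
  using countable_dense_setE by blast
 let ?P = "%n d. cball q r \<inter> cball d (1 / real (Suc n)) ~= {}"
 have "{w \<in> space N. A w \<inter> B w \<inter> cball q r ~= {}} = 
  {w \<in> space N. \<forall>n. \<exists>d\<in>D. A w \<inter> cball d (1 / real (Suc n)) ~= {} \<and> B w \<inter> cball d (1 / real (Suc n)) ~= {} \<and> cball q r \<inter> cball d (1 / real (Suc n)) ~= {}}"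
  by (intro Collect_cong conj_cong refl triple_intersection rset_compact[OF A] rset_compact[OF B] compact_cball D(2))
 also have "... = {w \<in> space N. \<forall>n. \<exists>d\<in>D. w \<in> {w \<in> space N. A w \<inter> cball d (1 / real (Suc n)) ~= {}} \<inter> {w \<in> space N. B w \<inter> cball d (1 / real (Suc n)) ~= {}} \<inter> {w \<in> space N. ?P n d}}"
  by auto
 also have "... \<in> sets N"
 proof -
  have "{w \<in> space N. A w \<inter> cball d (1 / real (Suc n)) ~= {}} \<inter> {w \<in> space N. B w \<inter> cball d (1 / real (Suc n)) ~= {}} \<inter> {w \<in> space N. ?P n d} \<in> sets N" for n d
  proof -
   have "{w \<in> space N. ?P n d} \<in> sets N" by (cases "?P n d") auto
   then show ?thesis by (intro sets.Int rset_hit[OF A] rset_hit[OF B])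
  qed
  from this[measurable] show ?thesis using D(1) by measurable
 qed
 finally show "{w \<in> space N. A w \<inter> B w \<inter> cball q r ~= {}} \<in> sets N" .
qed (use rset_compact[OF A] rset_compact[OF B] in auto)

lemma rset_nonempty:
 assumes A: "rset N A" shows "{w \<in> space N. A w ~= {}} \<in> sets N"
proof -
 have "{w \<in> space N. A w ~= {}} = (\<Union>n::nat. {w \<in> space N. A w \<inter> cball 0 (real n) ~= {}})"
 proof (intro equalityI subsetI)
  fix w assume w: "w \<in> {w \<in> space N. A w ~= {}}"
  then obtain a where a: "a \<in> A w" by auto
  obtain n where "norm a \<le> real n" using real_arch_simple by blast
  then have "a \<in> A w \<inter> cball 0 (real n)" using a by simp
  then show "w \<in> (\<Union>n::nat. {w \<in> space N. A w \<inter> cball 0 (real n) ~= {}})" using w by blast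
 qed auto
 also have "... \<in> sets N" by (intro sets.countable_UN image_subsetI rset_hit[OF A])
 finally show ?thesis .
qed

lemma cball_Int_cball_iff:
 fixes x y :: pt
 assumes "r \<ge> 0" "s \<ge> 0"
 shows "cball x r \<inter> cball y s ~= {} \<longleftrightarrow> dist x y \<le> r + s"
proof
 assume "cball x r \<inter> cball y s ~= {}"
 then obtain z where "dist x z \<le> r" "dist y z \<le> s" by (auto simp del: split_paired_Ex)
 then show "dist x y \<le> r + s" using dist_triangle[of x y z] by (simp add: dist_commute)
next
 assume h: "dist x y \<le> r + s"
 show "cball x r \<inter> cball y s ~= {}"
 proof (cases "r + s = 0")
  case True
  then have "x \<in> cball x r \<inter> cball y s" using h assms by (auto simp: add_nonneg_eq_0_iff)
  then show ?thesis by blast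
 next
  case False
  then have p: "r + s > 0" using assms by simp
  define z where "z = x + (r / (r + s)) *\<^sub>R (y - x)"
  have "dist x z = r / (r + s) * dist x y" using assms by (simp add: z_def dist_norm norm_minus_commute)
  also have "... \<le> r / (r + s) * (r + s)" using h assms by (intro mult_left_mono) auto
  finally have 1: "dist x z \<le> r" using p by simp
  have "y - z = (s / (r + s)) *\<^sub>R (y - x)"
  proof -
   have "s / (r + s) = 1 - r / (r + s)" using p by (simp add: field_simps)
   moreover have "y - z = (y - x) - (r / (r + s)) *\<^sub>R (y - x)" by (simp add: z_def)
   ultimately show ?thesis by (simp add: scaleR_left_diff_distrib)
  qed
  then have "dist y z = s / (r + s) * dist x y" using assms by (simp add: dist_norm norm_minus_commute)
  also have "... \<le> s / (r + s) * (r + s)" using h assms by (intro mult_left_mono) auto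
  finally have 2: "dist y z \<le> s" using p by simp
  show ?thesis using 1 2 by (metis IntI empty_iff mem_cball)
 qed
qed

lemma rset_cball:
 assumes [measurable]: "f \<in> borel_measurable N" and r: "r \<ge> 0" shows "rset N (%w. cball (f w) r)" unfolding rset_def
proof (intro conjI allI ballI)
 fix q s
 show "{w \<in> space N. cball (f w) r \<inter> cball q s ~= {}} \<in> sets N"
 proof (cases "s \<ge> 0")
  case True
  then have "{w \<in> space N. cball (f w) r \<inter> cball q s ~= {}} = {w \<in> space N. dist (f w) q \<le> r + s}"
   using r by (simp add: cball_Int_cball_iff)
  also have "... \<in> sets N" by measurable
  finally show ?thesis .
 qed simp
qed simp

lemma rset_singleton: "f \<in> borel_measurable N ==> rset N (%w. {f w})" using rset_cball[of f N 0] by simp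

lemma rset_translation:
 assumes A: "rset N A" and f: "f \<in> borel_measurable N" shows "rset N (%w. (%y. f w + y) ` A w)" unfolding rset_def
proof (intro conjI allI ballI)
 fix q :: pt and r
 show "{w \<in> space N. (%y. f w + y) ` A w \<inter> cball q r ~= {}} \<in> sets N"
 proof (cases "r \<ge> 0")
  case True
  have "(%y. f w + y) ` A w \<inter> cball q r ~= {} \<longleftrightarrow> A w \<inter> cball (q - f w) r ~= {}" for w
  proof -
   have "f w + y \<in> cball q r \<longleftrightarrow> y \<in> cball (q - f w) r" for y by (simp add: dist_norm algebra_simps)
   then show ?thesis by blast
  qed
  then have "{w \<in> space N. (%y. f w + y) ` A w \<inter> cball q r ~= {}} = {w \<in> space N. A w \<inter> cball (q - f w) r ~= {}}" by simp
  also have "... \<in> sets N" using f True by (intro rset_nonempty rset_Int A rset_cball) (auto intro: borel_measurable_diff)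
  finally show ?thesis .
 qed simp
qed (use rset_compact[OF A] compact_translation in auto)

lemma rset_uminus:
 assumes A: "rset N A" shows "rset N (%w. uminus ` A w)" unfolding rset_def
proof (intro conjI allI ballI)
 fix q :: pt and r
 have "uminus ` A w \<inter> cball q r ~= {} \<longleftrightarrow> A w \<inter> cball (- q) r ~= {}" for w
 proof -
  have "- y \<in> cball q r \<longleftrightarrow> y \<in> cball (- q) r" for y by (metis dist_minus mem_cball minus_minus)
  then show ?thesis by blast
 qed
 then show "{w \<in> space N. uminus ` A w \<inter> cball q r ~= {}} \<in> sets N" using rset_hit[OF A] by simp
qed (use rset_compact[OF A] compact_negations in auto)

text \<open>Rational parameters suffice if the radius is relaxed by \<open>1 / real (Suc n)\<close>;
  since the segment is compact, the relaxation disappears in the limit.\<close>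

lemma rset_seg:
 assumes f [measurable]: "f \<in> borel_measurable N" shows "rset N (%w. seg (f w))" unfolding rset_def
proof (intro conjI allI ballI)
 fix q :: pt and r
 have eq: "seg u \<inter> cball q r ~= {} \<longleftrightarrow> (\<forall>n. \<exists>t\<in>\<rat> \<inter> {0..1}. dist q (t *\<^sub>R u) \<le> r + 1 / real (Suc n))" for u
 proof
  assume "seg u \<inter> cball q r ~= {}"
  then obtain t where t: "0 \<le> t" "t \<le> 1" "dist q (t *\<^sub>R u) \<le> r" by (auto simp: in_segment)
  show "\<forall>n. \<exists>t\<in>\<rat> \<inter> {0..1}. dist q (t *\<^sub>R u) \<le> r + 1 / real (Suc n)"
  proof
   fix n
   define e where "e = 1 / real (Suc n) / (norm u + 1)"
   have e: "e > 0" by (simp add: e_def add_nonneg_pos)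
   obtain t' where t': "t' \<in> \<rat> \<inter> {0..1}" "\<bar>t' - t\<bar> \<le> e"
   proof (cases "t = 0 \<or> t = 1")
    case True then show thesis using that[of t] e t by auto
   next
    case False
    then obtain s where "s \<in> \<rat>" "max 0 (t - e) < s" "s < t" using Rats_dense_in_real[of "max 0 (t - e)" t] t e by auto
    then show thesis using that[of s] t by auto
   qed
   have "dist q (t' *\<^sub>R u) \<le> dist q (t *\<^sub>R u) + dist (t *\<^sub>R u) (t' *\<^sub>R u)" by (rule dist_triangle)
   also have "dist (t *\<^sub>R u) (t' *\<^sub>R u) = \<bar>t' - t\<bar> * norm u"
    by (simp add: dist_norm scaleR_left_diff_distrib[symmetric] abs_minus_commute)
   also have "... \<le> e * (norm u + 1)" using t'(2) by (intro mult_mono) auto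
   also have "e * (norm u + 1) = 1 / real (Suc n)" using add_nonneg_pos[OF norm_ge_zero[of u] zero_less_one] by (simp add: e_def)
   finally show "\<exists>t\<in>\<rat> \<inter> {0..1}. dist q (t *\<^sub>R u) \<le> r + 1 / real (Suc n)" using t t'(1) by force
  qed
 next
  assume h: "\<forall>n. \<exists>t\<in>\<rat> \<inter> {0..1}. dist q (t *\<^sub>R u) \<le> r + 1 / real (Suc n)"
  have "infdist q (seg u) \<le> r"
  proof (rule field_le_epsilon)
   fix e :: real assume "e > 0"
   then obtain n where "1 / real (Suc n) < e" using reals_Archimedean by (auto simp: inverse_eq_divide)
   moreover from h obtain t where "0 \<le> t" "t \<le> 1" "dist q (t *\<^sub>R u) \<le> r + 1 / real (Suc n)" by force
   moreover have "t *\<^sub>R u \<in> seg u" using calculation by (auto simp: in_segment)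
   ultimately show "infdist q (seg u) \<le> r + e" using infdist_le[of "t *\<^sub>R u" "seg u" q] by linarith
  qed
  moreover obtain y where "y \<in> seg u" "infdist q (seg u) = dist q y" using infdist_attains_inf[of "seg u" q] by auto
  ultimately show "seg u \<inter> cball q r ~= {}" by (metis IntI empty_iff mem_cball)
 qed
 have "countable (\<rat> \<inter> {0..1 :: real})" using countable_rat by blast
 then show "{w \<in> space N. seg (f w) \<inter> cball q r ~= {}} \<in> sets N" unfolding eq by measurable
qed simp

text \<open>Membership is hitting by a random singleton. Joint measurability in the parameter and
  the point is what Fubini requires.\<close>

lemma rset_member:
 assumes A: "rset N A" shows "{p \<in> space (N \<Otimes>\<^sub>M borel). snd p \<in> A (fst p)} \<in> sets (N \<Otimes>\<^sub>M borel)"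
proof -
 have "rset (N \<Otimes>\<^sub>M borel) (%p. A (fst p) \<inter> {snd p})"
  by (intro rset_Int rset_compose[OF measurable_fst A] rset_singleton) simp
 from rset_nonempty[OF this] show ?thesis by simp
qed

lemma measurable_area_sections:
 assumes S: "{p \<in> space (N \<Otimes>\<^sub>M borel). P (fst p) (snd p)} \<in> sets (N \<Otimes>\<^sub>M (borel :: pt measure))"
 shows "(%w. emeasure lborel {y. P w y}) \<in> borel_measurable N"
proof -
 have "{p \<in> space (N \<Otimes>\<^sub>M borel). P (fst p) (snd p)} \<in> sets (N \<Otimes>\<^sub>M lborel)"
  using S by (simp cong: sets_pair_measure_cong)
 from lborel.measurable_emeasure_Pair[OF this]
 have "(%w. emeasure lborel (Pair w -` {p \<in> space (N \<Otimes>\<^sub>M borel). P (fst p) (snd p)})) \<in> borel_measurable N" .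
 moreover have "Pair w -` {p \<in> space (N \<Otimes>\<^sub>M borel). P (fst p) (snd p)} = {y. P w y}" if "w \<in> space N" for w
  using that by (auto simp: space_pair_measure)
 ultimately show ?thesis by (simp cong: measurable_cong)
qed

lemma rset_emeasure: "rset N A ==> (%w. emeasure lborel (A w)) \<in> borel_measurable N"
 using measurable_area_sections[of N "%w y. y \<in> A w"] rset_member[of N A] by simp

lemma rset_area: "rset N A ==> (%w. area (A w)) \<in> borel_measurable N"
 unfolding measure_def using rset_emeasure by measurable

text \<open>Turns membership in a Minkowski sum into a hitting event of an intersection, so that
  areas of random sums are measurable without treating the sum as a random compact set.\<close>

lemma mink_member: "y \<in> mink A B \<longleftrightarrow> A \<inter> (%x. y + x) ` uminus ` B ~= {}"
proof
 assume "y \<in> mink A B"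
 then obtain a b where "a \<in> A" "b \<in> B" "y = a + b" unfolding mink_def by blast
 then have "a \<in> A" "a = y + (- b)" by simp_all
 then show "A \<inter> (%x. y + x) ` uminus ` B ~= {}" using \<open>b \<in> B\<close> by blast
next
 assume "A \<inter> (%x. y + x) ` uminus ` B ~= {}"
 then obtain b where "b \<in> B" "y + (- b) \<in> A" by blast
 then have "y = (y + (- b)) + b" by simp
 then show "y \<in> mink A B" unfolding mink_def using \<open>b \<in> B\<close> \<open>y + (- b) \<in> A\<close> by blast
qed

lemma rset_mink_member:
 assumes A: "rset N A" and B: "rset N B"
 shows "{p \<in> space (N \<Otimes>\<^sub>M borel). snd p \<in> mink (A (fst p)) (B (fst p))} \<in> sets (N \<Otimes>\<^sub>M borel)"
 unfolding mink_member
 by (intro rset_nonempty rset_Int rset_translation rset_uminus rset_compose[OF measurable_fst A] rset_compose[OF measurable_fst B]) simp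

lemma rset_mink_emeasure:
 assumes A: "rset N A" and B: "rset N B" shows "(%w. emeasure lborel (mink (A w) (B w))) \<in> borel_measurable N"
 using measurable_area_sections[OF rset_mink_member[OF A B]] by simp

lemma rset_mink_area:
 assumes A: "rset N A" and B: "rset N B" shows "(%w. area (mink (A w) (B w))) \<in> borel_measurable N"
 unfolding measure_def using rset_mink_emeasure[OF A B] by measurable

lemma space_grain_space [simp]: "space grain_space = KC" unfolding grain_space_def by (intro space_measure_of) auto

lemma rset_grain: "rset grain_space (%K. K)" unfolding rset_def
proof (intro conjI allI ballI)
 fix q :: pt and r
 have "{K \<in> KC. K \<inter> cball q r = {}} \<in> sets grain_space"
  unfolding grain_space_def by (subst sets_measure_of) (auto intro!: sigma_sets.Basic exI[of _ "cball q r"])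
 from sets.compl_sets[OF this]
 show "{w \<in> space grain_space. w \<inter> cball q r ~= {}} \<in> sets grain_space"
  by (simp add: set_diff_eq conj_commute) (metis (mono_tags, lifting) Collect_cong)
qed (simp add: KC_D)

section \<open>The Steiner formula\<close>

lemma wd_eq: "A \<in> KC ==> wd z A = area (mink A (seg z)) - area A" by (simp add: area_mink_seg)

lemma wd_measurable: "A \<in> KC ==> (%z. wd z A) \<in> borel_measurable borel"
 unfolding wd_eq by (intro borel_measurable_diff rset_mink_area rset_const rset_seg) (auto dest: KC_D)

lemma cball_KC [simp]: "r \<ge> 0 ==> cball c r \<in> KC" by (auto simp: KC_def)

lemma seg_subset_cball: "z \<in> cball 0 r ==> seg z \<subseteq> cball 0 r"
 by (rule closed_segment_subset) (auto intro: order_trans[OF norm_ge_zero])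

lemma wd_le:
 assumes A: "A \<in> KC" "B \<in> KC" "A \<subseteq> B" and z: "z \<in> cball 0 1"
 shows "wd z A \<le> area (mink B (cball 0 1))"
proof -
 have "wd z A \<le> area (mink A (seg z))" using A by (simp add: wd_eq)
 also have "... \<le> area (mink B (cball 0 1))"
  using A KC_D(1) seg_subset_cball[OF z] by (intro area_mono mink_mono) (auto intro!: compact_sets_borel mink_compact)
 finally show ?thesis .
qed

text \<open>An unnormalised mean width. Averaging over the unit disc instead of over directions
  keeps the integral with respect to \<open>lborel\<close>; \<open>kap\<close> is its value on a
  unit segment.\<close>

definition Lw :: "pt set => real" where
 "Lw A = (LINT z|lborel. indicator (cball 0 1) z * wd z A)"

definition kap :: real where
 "kap = (LINT z|lborel. indicator (cball (0::pt) 1) z * \<bar>snd z\<bar>)"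

lemma integrable_cball: "integrable lborel (%z :: pt. indicator (cball 0 1) z *\<^sub>R (c :: real))"
 by (intro integrable_scaleR_left integrable_real_indicator) (use emeasure_compact_finite[of "cball 0 1 :: pt set"] in auto)

lemma Lw_integrable: "A \<in> KC ==> integrable lborel (%z. indicator (cball 0 1) z * wd z A)"
proof -
 assume A: "A \<in> KC"
 have "integrable lborel (%z :: pt. indicator (cball 0 1) z *\<^sub>R area (mink A (cball 0 1)))" by (rule integrable_cball)
 then show ?thesis by (rule Bochner_Integration.integrable_bound)
    (use A wd_le[OF A A order_refl] wd_measurable[OF A] in \<open>auto simp: indicator_def intro!: borel_measurable_times\<close>)
qed

lemma Lw_cong: "(\<And>z. wd z A = wd z B) ==> Lw A = Lw B" unfolding Lw_def by simp

lemma wd_minus: "A \<in> KC ==> wd (- z) A = wd z A" using wd_scale[of A "-1" z] by simp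

lemma uminus_seg: "uminus ` seg z = seg (- z)"
 using closed_segment_linear_image[of "uminus :: pt => pt" 0 z] by (simp add: linear_iff)

lemma wd_reflect: "A \<in> KC ==> wd z ((%x. c - x) ` A) = wd z A"
 using wd_minus[of A z] by (simp add: wd_eq area_mink_reflect uminus_seg)

lemma valuation_KC:
 assumes "A \<in> KC" "B \<in> KC" "convex (A \<union> B)" "A \<inter> B ~= {}"
 shows "A \<union> B \<in> KC" "A \<inter> B \<in> KC" using assms by (auto simp: KC_def intro: compact_Un compact_Int convex_Int)

lemma wd_valuation:
 assumes "A \<in> KC" "B \<in> KC" "convex (A \<union> B)" "A \<inter> B ~= {}"
 shows "wd z (A \<union> B) + wd z (A \<inter> B) = wd z A + wd z B"
 using area_mink_valuation[OF assms(1,2) _ assms(3), of "seg z"] area_valuation[OF assms(1-3)] valuation_KC[OF assms] assms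
 by (simp add: wd_eq)

lemma Lw_valuation:
 assumes "A \<in> KC" "B \<in> KC" "convex (A \<union> B)" "A \<inter> B ~= {}"
 shows "Lw (A \<union> B) + Lw (A \<inter> B) = Lw A + Lw B" unfolding Lw_def
 by (simp add: Bochner_Integration.integral_add[symmetric] Lw_integrable valuation_KC[OF assms] assms 
   distrib_left[symmetric] wd_valuation[OF assms])

lemma area_seg [simp]: "area (seg u) = 0"
proof -
 have "{0} \<in> KC" by (auto simp: KC_def)
 from area_mink_seg[OF this, of u] show ?thesis by (simp add: wd_def cross_def mink_commute[of "{0}"])
qed

lemma kap_rot: "(LINT z|lborel. indicator (cball 0 1) z * \<bar>cross z u\<bar>) = norm u * kap"
proof -
 define n where "n = norm u"
 obtain v where v: "rot v (n, 0) = u" using polar[of u] unfolding n_def by (auto dest: sym)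
 have cm: "(%z. cross z w) \<in> borel_measurable borel" for w by (intro borel_measurable_continuous_onI continuous_intros)
 have "(LINT z|lborel. indicator (cball 0 1) z * \<bar>cross z u\<bar>) = (LINT z|distr lborel borel (rot v). indicator (cball 0 1) z * \<bar>cross z u\<bar>)"
  by (simp add: lborel_rot)
 also have "... = (LINT z|lborel. indicator (cball 0 1) (rot v z) * \<bar>cross (rot v z) u\<bar>)"
  using cm by (intro integral_distr) (auto intro!: borel_measurable_times)
 also have "... = (LINT z|lborel. n * (indicator (cball (0::pt) 1) z * \<bar>snd z\<bar>))"
 proof -
  have "indicator (cball 0 1) (rot v z) * \<bar>cross (rot v z) u\<bar> = (n * (indicator (cball 0 1) z * \<bar>snd z\<bar>) :: real)" for z :: pt
  proof -
   have "cross (rot v z) u = cross z (n, 0)" unfolding v[symmetric] by (rule cross_rot)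
   then have "\<bar>cross (rot v z) u\<bar> = n * \<bar>snd z\<bar>" by (simp add: cross_def abs_mult n_def)
   then show ?thesis by (simp add: indicator_def)
  qed
  then show ?thesis by (simp only:)
 qed
 finally show ?thesis by (simp add: kap_def n_def)
qed

lemma Lw_seg: "Lw (seg u) = norm u * kap" unfolding Lw_def wd_seg by (simp add: kap_rot)

text \<open>The rectangle \<open>?Q\<close> lies in the unit disc, has area 1/4 and stays at height
  at least 1/4, which bounds the integral below by 1/16.\<close>

lemma kap_pos: "kap > 0"
proof -
 let ?Q = "cbox (-(1/2), 1/4) (1/2, 1/2) :: pt set"
 have Q: "measure lborel ?Q = 1 / 4"
 proof -
  have "?Q = {-(1/2)..1/2} \<times> {1/4..1/2}" by (auto simp: cbox_Pair_eq)
  then have "emeasure (lborel \<Otimes>\<^sub>M lborel) ?Q = ennreal 1 * ennreal (1/4)"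
   using lborel.emeasure_pair_measure_Times[of "{-(1/2)..1/2::real}" lborel "{1/4..1/2::real}"] by simp
  then have e: "emeasure lborel ?Q = ennreal (1/4)" by (simp only: lborel_prod) simp
  show ?thesis unfolding measure_def e by simp
 qed
 have sub: "p \<in> cball 0 1" "1/4 \<le> \<bar>snd p\<bar>" if "p \<in> ?Q" for p
 proof -
  have p: "fst p \<in> {-(1/2)..1/2}" "snd p \<in> {1/4..1/2}" using that by (auto simp: cbox_Pair_eq)
  then have "(fst p)\<^sup>2 \<le> (1/2)\<^sup>2" "(snd p)\<^sup>2 \<le> (1/2)\<^sup>2" by (auto intro!: abs_le_square_iff[THEN iffD1])
  then have "(norm p)\<^sup>2 \<le> 1\<^sup>2" by (simp add: norm_prod_def power2_eq_square)
  then have "norm p \<le> 1" by (rule power2_le_imp_le) simp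
  then show "p \<in> cball 0 1" by simp
  show "1/4 \<le> \<bar>snd p\<bar>" using p by auto
 qed
 have "1/16 = (LINT z|lborel. indicator ?Q z * (1/4 :: real))" by (simp add: Q)
 also have "... \<le> kap" unfolding kap_def
 proof (rule integral_mono)
  show "integrable lborel (%z. indicator ?Q z * (1/4 :: real))"
   using emeasure_compact_finite[OF compact_cbox, of "(-(1/2), 1/4)" "(1/2, 1/2) :: pt"]
   by (intro integrable_mult_left integrable_real_indicator) (auto simp: top.not_eq_extremum[symmetric])
  have "integrable lborel (%z. indicator (cball 0 1) z * wd z (seg (1, 0)))" by (rule Lw_integrable) simp
  then show "integrable lborel (%z :: pt. indicator (cball 0 1) z * \<bar>snd z\<bar>)" by (simp add: wd_seg cross_def)
  show "indicator ?Q z * (1/4 :: real) \<le> indicator (cball 0 1) z * \<bar>snd z\<bar>" for z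
   using sub[of z] by (auto simp: indicator_def)
 qed
 finally show ?thesis by simp
qed

lemma Lw_mink: "A \<in> KC ==> B \<in> KC ==> Lw (mink A B) = Lw A + Lw B" unfolding Lw_def
 by (simp add: Bochner_Integration.integral_add[symmetric] Lw_integrable distrib_left[symmetric] wd_mink)

lemma rot_cball [simp]: "rot v ` cball 0 r = cball 0 r" unfolding rot_image_eq vimage_def by (simp add: cball_def)

lemma wd_cball: "r \<ge> 0 ==> wd u (cball 0 r) = 2 * r * norm u"
proof -
 assume r: "r \<ge> 0"
 define n where "n = norm u"
 obtain v where v: "rot v (n, 0) = u" using polar[of u] unfolding n_def by (auto dest: sym)
 have s: "cross (1, 0) ` cball 0 r = {-r..r}"
 proof (intro equalityI subsetI)
  fix y assume "y \<in> cross (1, 0) ` cball 0 r"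
  then obtain p :: pt where "norm p \<le> r" "y = snd p" by (auto simp: cross_def simp del: split_paired_Ex)
  moreover have "\<bar>snd p\<bar> \<le> norm p" using norm_snd_le[of "snd p" "fst p"] by simp
  ultimately show "y \<in> {-r..r}" by auto
 next
  fix y assume "y \<in> {-r..r}"
  then have "norm (0 :: real, y) \<le> r" by (auto simp: norm_Pair)
  then have "y = cross (1, 0) (0, y)" "(0 :: real, y) \<in> cball 0 r" by (simp_all only: mem_cball_0 cross_def) simp
  then show "y \<in> cross (1, 0) ` cball 0 r" by blast
 qed
 have "wd u (cball 0 r) = wd (rot v (n, 0)) (rot v ` cball 0 r)" by (simp add: v del: wd_rot)
 also have "... = wd (n *\<^sub>R (1, 0)) (cball 0 r)" by (subst wd_rot) simp
 also have "... = 2 * r * n" using r by (subst wd_scale) (auto simp: wd_def s n_def)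
 finally show ?thesis by (simp add: n_def)
qed

lemma area_cball [simp]: "r \<ge> 0 ==> area (cball c r) = pi * r\<^sup>2"
 by (simp add: content_cball unit_ball_vol_2 power2_eq_square)

lemma Lw_incseq:
 assumes P: "\<And>n. P n \<in> KC" "incseq P" and M: "M \<in> KC" "\<And>n. P n \<subseteq> M" "M \<subseteq> closure (\<Union>n. P n)"
 shows "(%n. Lw (P n)) \<longlonglongrightarrow> Lw M"
proof -
 have a0: "(%n. area (P n)) \<longlonglongrightarrow> area M" using P M KC_D by (intro measure_incseq_convex) auto
 have w: "(%n. wd z (P n)) \<longlonglongrightarrow> wd z M" for z
  unfolding wd_eq[OF P(1)] wd_eq[OF M(1)] by (intro tendsto_diff area_mink_incseq P M seg_KC a0)
 show ?thesis unfolding Lw_def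
 proof (rule integral_dominated_convergence)
  show "integrable lborel (%z :: pt. indicator (cball 0 1) z *\<^sub>R area (mink M (cball 0 1)))" by (rule integrable_cball)
  show "AE z in lborel. (%n. indicator (cball 0 1) z * wd z (P n)) \<longlonglongrightarrow> indicator (cball 0 1) z * wd z M"
   by (intro AE_I2 tendsto_mult tendsto_const w)
  show "AE z in lborel. norm (indicator (cball 0 1) z * wd z (P n)) \<le> indicator (cball 0 1) z *\<^sub>R area (mink M (cball 0 1))" for n
   using wd_le[OF P(1) M(1) M(2)] by (intro AE_I2) (auto simp: indicator_def)
 qed (use wd_measurable P M in \<open>auto intro!: borel_measurable_times\<close>)
qed

lemma area_par: "area (mink (seg u) (seg w)) = \<bar>cross w u\<bar>" by (simp add: area_mink_seg wd_seg)

text \<open>The difference of the two sides is a \<open>zero_valuation\<close>. On a parallelogram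
  the disc is enlarged by the two segments one after the other, which only involves widths of the
  disc. The linear coefficient thereby identifies half the boundary length with the normalised mean
  width.\<close>

theorem steiner:
 assumes M: "M \<in> KC" and r: "r \<ge> 0"
 shows "area (mink M (cball 0 r)) = area M + 2 * r * (Lw M / kap) + pi * r\<^sup>2"
proof -
 define G where "G M = area (mink M (cball 0 r)) - area M - 2 * r * (Lw M / kap) - pi * r\<^sup>2" for M
 have Br: "cball 0 r \<in> KC" using r by simp
 have ub: "uminus ` cball 0 r = cball (0 :: pt) r" using rot_cball[of pi r] by (simp add: rot_pi[abs_def] del: rot_cball)
 interpret zero_valuation G
 proof
  fix A B assume h: "A \<in> KC" "B \<in> KC" "convex (A \<union> B)" "A \<inter> B ~= {}"
  have "2 * r * (Lw (A \<union> B) / kap) + 2 * r * (Lw (A \<inter> B) / kap) = 2 * r * (Lw A / kap) + 2 * r * (Lw B / kap)"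
   using Lw_valuation[OF h] by (simp add: add_divide_distrib[symmetric] distrib_left[symmetric])
  then show "G (A \<union> B) + G (A \<inter> B) = G A + G B"
   unfolding G_def using area_mink_valuation[OF h(1,2) Br h(3)] area_valuation[OF h(1-3)] by linarith
 next
  fix A c assume "A \<in> KC"
  then show "G ((%x. c - x) ` A) = G A"
   unfolding G_def using Lw_cong[OF wd_reflect, of A c] by (simp add: area_mink_reflect Br ub)
 next
  fix u w
  have "mink (mink (seg u) (seg w)) (cball 0 r) = mink (mink (cball 0 r) (seg u)) (seg w)"
   by (simp only: mink_assoc mink_commute[of "cball 0 r"])
  then have "area (mink (mink (seg u) (seg w)) (cball 0 r)) = pi * r\<^sup>2 + 2 * r * norm u + 2 * r * norm w + \<bar>cross w u\<bar>"
   using Br r by (simp add: area_mink_seg wd_mink wd_cball wd_seg)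
  then show "G (mink (seg u) (seg w)) = 0" using kap_pos by (simp add: G_def area_par Lw_mink Lw_seg field_simps)
 next
  fix P M assume h: "\<And>n. P n \<in> KC" "incseq P" "M \<in> KC" "\<And>n. P n \<subseteq> M" "M \<subseteq> closure (\<Union>n. P n)"
  have "(%n. area (P n)) \<longlonglongrightarrow> area M" using h KC_D by (intro measure_incseq_convex) auto
  then show "(%n. G (P n)) \<longlonglongrightarrow> G M"
   unfolding G_def using kap_pos by (intro tendsto_intros area_mink_incseq Lw_incseq h Br) auto
 qed
 show ?thesis using G_zero[OF M] by (simp add: G_def)
qed

theorem V1c_eq: assumes M: "M \<in> KC" shows "V1c M = Lw M / kap"
proof -
 have "((%r. Lw M / kap + pi * r / 2) \<longlongrightarrow> Lw M / kap + pi * 0 / 2) (at_right 0)"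
  by (intro tendsto_intros) simp
 then have t: "((%r. Lw M / kap + pi * r / 2) \<longlongrightarrow> Lw M / kap) (at_right 0)" by simp
 have "\<forall>\<^sub>F r in at_right 0. Lw M / kap + pi * r / 2 = (area (mink M (cball 0 r)) - area M) / (2 * r)"
  using eventually_at_right_less[of "0::real"] by eventually_elim (simp add: steiner[OF M] field_simps power2_eq_square)
 with t have "((%r. (area (mink M (cball 0 r)) - area M) / (2 * r)) \<longlongrightarrow> Lw M / kap) (at_right 0)"
  by (rule Lim_transform_eventually)
 then show ?thesis unfolding V1c_def by (intro tendsto_Lim) auto
qed

text \<open>The Steiner polynomial is exact, so radius 1 replaces the limit in the
  definition.\<close>

lemma V1c_steiner: "M \<in> KC ==> V1c M = (area (mink M (cball 0 1)) - area M - pi) / 2"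
 using steiner[of M 1] V1c_eq[of M] by simp

lemma V1c_nonneg: "M \<in> KC ==> V1c M \<ge> 0"
 unfolding V1c_eq Lw_def using kap_pos by (intro divide_nonneg_pos Bochner_Integration.integral_nonneg) auto

lemma V1c_empty [simp]: "V1c {} = 0"
proof -
 have "((%r. (area (mink {} (cball 0 r)) - area {}) / (2 * r)) \<longlongrightarrow> 0) (at_right 0)" by simp
 then show ?thesis unfolding V1c_def by (intro tendsto_Lim) auto
qed

lemma V1c_cball: "r \<ge> 0 ==> V1c (cball 0 r) = pi * r" using kap_pos
proof -
 assume r: "r \<ge> 0"
 have "mink (cball 0 r) (cball 0 1) = (cball 0 (r + 1) :: pt set)"
 proof (intro equalityI subsetI)
  fix z :: pt assume "z \<in> mink (cball 0 r) (cball 0 1)"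
  then obtain x y where "norm x \<le> r" "norm y \<le> 1" "z = x + y" unfolding mink_def by auto
  then show "z \<in> cball 0 (r + 1)" using norm_triangle_ineq[of x y] by simp
 next
  fix z :: pt assume z: "z \<in> cball 0 (r + 1)"
  have "(r / (r + 1)) *\<^sub>R z \<in> cball 0 r" "(1 / (r + 1)) *\<^sub>R z \<in> cball 0 1"
  proof -
   have "r * norm z \<le> r * (r + 1)" using z r by (intro mult_left_mono) auto
   then show "(r / (r + 1)) *\<^sub>R z \<in> cball 0 r" using r by (simp add: pos_divide_le_eq)
   show "(1 / (r + 1)) *\<^sub>R z \<in> cball 0 1" using z r by (simp add: pos_divide_le_eq)
  qed
  moreover have "z = (r / (r + 1)) *\<^sub>R z + (1 / (r + 1)) *\<^sub>R z"
  proof -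
   have "r / (r + 1) + 1 / (r + 1) = 1" using r by (simp add: add_divide_distrib[symmetric])
   then show ?thesis by (simp add: scaleR_left_distrib[symmetric])
  qed
  ultimately show "z \<in> mink (cball 0 r) (cball 0 1)" unfolding mink_def by blast
 qed
 then show ?thesis using r by (simp add: V1c_steiner power2_eq_square algebra_simps)
qed

section \<open>Intrinsic volumes of polyconvex sets\<close>

text \<open>Passing from \<open>t\<close> to a point just to its right loses exactly the intervals
  with right end \<open>t\<close>, so the coefficients of these intervals sum to zero for every
  \<open>t\<close>. Each nonempty interval has one right end; summing over all right ends gives the
  claim.\<close>

lemma euler_additive_real:
 fixes S :: "'i => real set"
 assumes I: "finite I" and S: "\<And>i. i \<in> I ==> compact (S i)" "\<And>i. i \<in> I ==> convex (S i)"
  and z: "\<And>x. (\<Sum>i\<in>I. \<alpha> i * indicator (S i) x) = (0::real)"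
 shows "(\<Sum>i\<in>I. \<alpha> i * of_bool (S i ~= {})) = 0"
proof -
 define J where "J = {i\<in>I. S i ~= {}}"
 have J: "finite J" using I by (simp add: J_def)
 have "\<exists>l r. l \<le> r \<and> S i = {l..r}" if "i \<in> J" for i
  using compact_convex_real[of "S i"] S that by (auto simp: J_def)
 then obtain l r where lr: "\<And>i. i \<in> J ==> l i \<le> r i" "\<And>i. i \<in> J ==> S i = {l i..r i}" by metis
 have zJ: "(\<Sum>i\<in>J. \<alpha> i * indicator (S i) x) = 0" for x
  unfolding z[of x, symmetric] using I by (intro sum.mono_neutral_left) (auto simp: J_def)
 have fib: "(\<Sum>i\<in>{i\<in>J. r i = t}. \<alpha> i) = 0" for t
 proof -
  define E where "E = {e \<in> l ` J \<union> r ` J. e > t}"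
  have E: "finite E" using J by (simp add: E_def)
  \<comment> \<open>The next endpoint after \<open>t\<close>, or \<open>t + 1\<close> if that comes
    first; no interval starts or ends strictly between \<open>t\<close> and
    \<open>m\<close>.\<close>
  define m where "m = Min (insert (t + 1) E)"
  have m: "t < m" unfolding m_def using E by (subst Min_gr_iff) (auto simp: E_def)
  have mle: "m \<le> e" if "e \<in> E" for e unfolding m_def using E that by (intro Min_le) auto
  define s where "s = (t + m) / 2"
  have s: "t < s" "s < m" using m by (auto simp: s_def)
  have pt: "\<alpha> i * indicator (S i) t - \<alpha> i * indicator (S i) s = (if r i = t then \<alpha> i else 0)" if i: "i \<in> J" for i
  proof -
   have "l i \<le> t \<or> m \<le> l i" "r i \<le> t \<or> m \<le> r i"
   proof -
    have "t < l i ==> m \<le> l i" "t < r i ==> m \<le> r i" using mle[of "l i"] mle[of "r i"] i by (auto simp: E_def)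
    then show "l i \<le> t \<or> m \<le> l i" "r i \<le> t \<or> m \<le> r i" by linarith+
   qed
   then show ?thesis using lr[OF i] s by (auto simp: indicator_def)
  qed
  have "0 = (\<Sum>i\<in>J. \<alpha> i * indicator (S i) t - \<alpha> i * indicator (S i) s)" by (simp add: sum_subtractf zJ)
  also have "... = (\<Sum>i\<in>J. if r i = t then \<alpha> i else 0)" using pt by (intro sum.cong) auto
  also have "... = (\<Sum>i\<in>{i\<in>J. r i = t}. \<alpha> i)" using J by (simp add: sum.inter_filter)
  finally show ?thesis by simp
 qed
 have "(\<Sum>i\<in>I. \<alpha> i * of_bool (S i ~= {})) = (\<Sum>i\<in>J. \<alpha> i)"
  using I by (intro sum.mono_neutral_cong_right) (auto simp: J_def)
 also have "... = (\<Sum>t\<in>r ` J. \<Sum>i\<in>{i\<in>J. r i = t}. \<alpha> i)" using J by (intro sum.group[symmetric]) auto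
 also have "... = 0" by (simp add: fib)
 finally show ?thesis .
qed

lemma slice_compact_convex:
 assumes "compact A" "convex A"
 shows "compact {x. (x, y) \<in> A}" "convex {x. (x, y) \<in> (A :: pt set)}"
proof -
 have "compact {x. (x, y) \<in> A} \<and> convex {x. (x, y) \<in> A}"
 proof (cases "y \<in> snd ` A")
  case True
  then have "A \<in> KC" using assms by (auto simp: KC_def)
  from slice_interval[OF this True] obtain a b where "{x. (x, y) \<in> A} = {a..b}" by blast
  then show ?thesis by simp
 next
  case False
  then have "{x. (x, y) \<in> A} = {}" by (metis (mono_tags, lifting) Collect_empty_eq image_eqI snd_conv)
  then show ?thesis by simp
 qed
 then show "compact {x. (x, y) \<in> A}" "convex {x. (x, y) \<in> A}" by auto
qed

text \<open>Hadwiger's induction on the dimension: the one-dimensional case on each horizontal line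
  yields a relation between the indicators of the projections to the vertical axis, to which the
  one-dimensional case applies once more.\<close>

lemma euler_additive:
 fixes S :: "'i => pt set"
 assumes I: "finite I" and S: "\<And>i. i \<in> I ==> compact (S i)" "\<And>i. i \<in> I ==> convex (S i)"
  and z: "\<And>x. (\<Sum>i\<in>I. \<alpha> i * indicator (S i) x) = (0::real)"
 shows "(\<Sum>i\<in>I. \<alpha> i * of_bool (S i ~= {})) = 0"
proof -
 have "(\<Sum>i\<in>I. \<alpha> i * of_bool (snd ` S i ~= {})) = 0"
 proof (rule euler_additive_real[OF I])
  fix i assume "i \<in> I"
  then show "compact (snd ` S i)" "convex (snd ` S i)"
   using S by (auto intro!: compact_continuous_image continuous_intros convex_linear_image linear_snd)
 next
  fix y
  have "(\<Sum>i\<in>I. \<alpha> i * of_bool ({x. (x, y) \<in> S i} ~= {})) = 0"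
  proof (rule euler_additive_real[OF I])
   fix x
   have "indicator {x. (x, y) \<in> S i} x = (indicator (S i) (x, y) :: real)" for i by (simp add: indicator_def)
   then show "(\<Sum>i\<in>I. \<alpha> i * indicator {x. (x, y) \<in> S i} x) = 0" using z[of "(x, y)"] by simp
  qed (use S slice_compact_convex in blast)+
  moreover have "of_bool ({x. (x, y) \<in> S i} ~= {}) = (indicator (snd ` S i) y :: real)" for i
   by (force simp: indicator_def of_bool_def image_iff)
  ultimately show "(\<Sum>i\<in>I. \<alpha> i * indicator (snd ` S i) y) = 0" by simp
 qed
 then show ?thesis by simp
qed

lemma area_additive:
 fixes S :: "'i => pt set"
 assumes I: "finite I" and S: "\<And>i. i \<in> I ==> compact (S i)"
  and z: "\<And>x. (\<Sum>i\<in>I. \<alpha> i * indicator (S i) x) = (0::real)"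
 shows "(\<Sum>i\<in>I. \<alpha> i * area (S i)) = 0"
proof -
 have int: "integrable lborel (indicator (S i) :: pt => real)" if "i \<in> I" for i
  using S[OF that] emeasure_compact_finite[OF S[OF that]] by (intro integrable_real_indicator) auto
 have "0 = (LINT x|lborel. (\<Sum>i\<in>I. \<alpha> i * indicator (S i) x))" by (simp add: z)
 also have "... = (\<Sum>i\<in>I. \<alpha> i * area (S i))" using int by (subst Bochner_Integration.integral_sum) auto
 finally show ?thesis by simp
qed

lemma cball_member: "y \<in> mink K (cball 0 r) \<longleftrightarrow> K \<inter> cball y r ~= {}"
proof -
 have "(%x. y + x) ` uminus ` cball 0 r = cball y r"
 proof (intro equalityI subsetI)
  fix z assume "z \<in> cball y r"
  then have "z = y + - (y - z)" "y - z \<in> cball 0 r" by (auto simp: dist_norm norm_minus_commute simp del: split_paired_All)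
  then show "z \<in> (%x. y + x) ` uminus ` cball 0 r" by blast
 next
  fix z assume "z \<in> (%x. y + x) ` uminus ` cball 0 r"
  then obtain x where "norm x \<le> r" "z = y - x" by (auto simp del: split_paired_All split_paired_Ex)
  then show "z \<in> cball y r" by (simp add: dist_norm norm_minus_commute)
 qed
 then show ?thesis by (simp add: mink_member)
qed

lemma V1c_decomp: "compact K ==> convex K ==> V1c K = (area (mink K (cball 0 1)) - area K - pi * of_bool (K ~= {})) / 2"
 by (cases "K = {}") (auto simp: V1c_steiner KC_def)

text \<open>By Steiner with radius 1 the functional combines the area of the parallel body, the area
  and the Euler characteristic. The parallel body contains \<open>y\<close> iff the set meets the
  ball around \<open>y\<close>, so the relation between its indicators is the Euler relation for the
  sets cut with that ball.\<close>

lemma V1c_additive: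
 fixes S :: "'i => pt set"
 assumes I: "finite I" and S: "\<And>i. i \<in> I ==> compact (S i)" "\<And>i. i \<in> I ==> convex (S i)"
  and z: "\<And>x. (\<Sum>i\<in>I. \<alpha> i * indicator (S i) x) = (0::real)"
 shows "(\<Sum>i\<in>I. \<alpha> i * V1c (S i)) = 0"
proof -
 have 1: "(\<Sum>i\<in>I. \<alpha> i * area (mink (S i) (cball 0 1))) = 0"
 proof (rule area_additive[OF I])
  fix y
  have "(\<Sum>i\<in>I. \<alpha> i * of_bool (S i \<inter> cball y 1 ~= {})) = 0"
  proof (rule euler_additive[OF I])
   fix x
   show "(\<Sum>i\<in>I. \<alpha> i * indicator (S i \<inter> cball y 1) x) = 0"
    using z[of x] by (cases "x \<in> cball y 1") (simp_all add: indicator_inter_arith)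
  qed (use S in \<open>auto intro: compact_Int convex_Int\<close>)
  then show "(\<Sum>i\<in>I. \<alpha> i * indicator (mink (S i) (cball 0 1)) y) = 0" by (simp add: indicator_def cball_member)
 qed (use S in simp)
 have "(\<Sum>i\<in>I. \<alpha> i * V1c (S i)) = (\<Sum>i\<in>I. (\<alpha> i * area (mink (S i) (cball 0 1)) - \<alpha> i * area (S i) - pi * (\<alpha> i * of_bool (S i ~= {}))) / 2)"
  using S by (intro sum.cong refl) (simp add: V1c_decomp algebra_simps)
 also have "... = 0" using 1 area_additive[OF I S(1) z] euler_additive[OF I S z]
  by (simp add: sum_divide_distrib[symmetric] sum_subtractf sum_distrib_left[symmetric])
 finally show ?thesis .
qed

lemma Vconv_additive:
 fixes S :: "'i => pt set"
 assumes "finite I" "\<And>i. i \<in> I ==> compact (S i)" "\<And>i. i \<in> I ==> convex (S i)"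
  and "\<And>x. (\<Sum>i\<in>I. \<alpha> i * indicator (S i) x) = (0::real)"
 shows "(\<Sum>i\<in>I. \<alpha> i * Vconv j (S i)) = 0"
proof -
 have "Vconv 0 K = of_bool (K ~= {})" for K by (simp add: Vconv_def)
 then show ?thesis using euler_additive[OF assms] V1c_additive[OF assms] area_additive[OF assms(1,2,4)]
  by (cases "j = 0"; cases "j = 1") (simp_all add: Vconv_def)
qed

text \<open>Expansion of the product of the factors \<open>1 - indicator (T i) x\<close>. The family
  is indexed, so that equal members may occur.\<close>

lemma indicator_UN_incl_excl:
 assumes "finite I"
 shows "indicator (\<Union>i\<in>I. T i) x = (\<Sum>J\<in>Pow I - {{}}. (-1) ^ (card J + 1) * indicator (\<Inter>i\<in>J. T i) x :: real)"
proof -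
 have "1 - indicator (\<Union>i\<in>I. T i) x = (\<Prod>i\<in>I. 1 + - indicator (T i) x :: real)"
 proof (cases "x \<in> (\<Union>i\<in>I. T i)")
  case True
  then obtain i where "i \<in> I" "x \<in> T i" by blast
  then have "(\<Prod>i\<in>I. 1 + - indicator (T i) x :: real) = 0" using assms by (intro prod_zero bexI[of _ i]) (auto simp: indicator_def)
  then show ?thesis using True by simp
 qed (auto intro!: prod.neutral[symmetric] simp: indicator_def)
 also have "... = (\<Prod>i\<in>I. - indicator (T i) x + 1)" by (simp add: add.commute)
 also have "... = (\<Sum>J\<in>Pow I. (\<Prod>i\<in>J. - indicator (T i) x) * (\<Prod>i\<in>I - J. 1))"
  using assms by (rule prod_add)
 also have "... = (\<Sum>J\<in>Pow I. (-1) ^ card J * indicator (\<Inter>i\<in>J. T i) x)"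
 proof (intro sum.cong refl)
  fix J assume "J \<in> Pow I"
  then have J: "finite J" using assms finite_subset by auto
  have "(\<Prod>i\<in>J. indicator (T i) x :: real) = indicator (\<Inter>i\<in>J. T i) x"
   using J by (induction J) (auto simp: indicator_def)
  then show "(\<Prod>i\<in>J. - indicator (T i) x) * (\<Prod>i\<in>I - J. 1) = (-1) ^ card J * (indicator (\<Inter>i\<in>J. T i) x :: real)"
   by (simp add: prod_uminus)
 qed
 also have "... = 1 + (\<Sum>J\<in>Pow I - {{}}. (-1) ^ card J * indicator (\<Inter>i\<in>J. T i) x)"
  using assms by (subst sum.remove[of _ "{}"]) auto
 finally have "indicator (\<Union>i\<in>I. T i) x = - (\<Sum>J\<in>Pow I - {{}}. (-1) ^ card J * indicator (\<Inter>i\<in>J. T i) x :: real)"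
  by simp
 then show ?thesis by (simp add: sum_negf[symmetric])
qed

lemma compact_convex_INT:
 fixes T :: "'i => pt set"
 assumes "J ~= {}" "\<And>i. i \<in> J ==> compact (T i)" "\<And>i. i \<in> J ==> convex (T i)"
 shows "compact (\<Inter>i\<in>J. T i)" "convex (\<Inter>i\<in>J. T i)"
proof -
 obtain k where k: "k \<in> J" using assms(1) by blast
 have "compact (T k \<inter> (\<Inter>i\<in>J. T i))"
  using assms k by (intro compact_Int_closed closed_INT) (auto intro: compact_imp_closed)
 moreover have "T k \<inter> (\<Inter>i\<in>J. T i) = (\<Inter>i\<in>J. T i)" using k by blast
 ultimately show "compact (\<Inter>i\<in>J. T i)" by simp
 show "convex (\<Inter>i\<in>J. T i)" using assms(3) by (rule convex_INT)
qed

text \<open>Shows at the same time that the description in \<open>V\<close> is well defined. Two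
  representations of one union give inclusion-exclusion sums of indicators with the same value, and
  \<open>Vconv j\<close> respects linear relations between indicators of convex bodies.\<close>

lemma V_UN:
 fixes T :: "'i => pt set"
 assumes I: "finite I" and T: "\<And>i. i \<in> I ==> compact (T i)" "\<And>i. i \<in> I ==> convex (T i)"
 shows "V j (\<Union>i\<in>I. T i) = (\<Sum>J\<in>Pow I - {{}}. (-1) ^ (card J + 1) * Vconv j (\<Inter>i\<in>J. T i))"
proof -
 let ?A = "\<Union>i\<in>I. T i" and ?c = "\<Sum>J\<in>Pow I - {{}}. (-1) ^ (card J + 1) * Vconv j (\<Inter>i\<in>J. T i)"
 have uniq: "incl_excl (Vconv j) F = ?c" if F: "polyconvex_rep F ?A" for F
 proof -
  have Ff: "finite F" "\<And>K. K \<in> F ==> compact K" "\<And>K. K \<in> F ==> convex K" "\<Union> F = ?A"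
   using F by (auto simp: polyconvex_rep_def)
  \<comment> \<open>Both expansions are put into one family over a disjoint sum, the second with the
    opposite sign, so that their difference is a single linear relation.\<close>
  define IS where "IS = (Pow I - {{}}) <+> (Pow F - {{}})"
  define S where "S = case_sum (%J. \<Inter>i\<in>J. T i) (%J. \<Inter>K\<in>J. K)"
  define \<alpha> where "\<alpha> = case_sum (%J :: 'i set. (-1) ^ (card J + 1) :: real) (%J :: pt set set. - ((-1) ^ (card J + 1))) "
  have fin: "finite (Pow I - {{}})" "finite (Pow F - {{}})" using I Ff by auto
  have split: "(\<Sum>s\<in>IS. \<alpha> s * h (S s)) = (\<Sum>J\<in>Pow I - {{}}. (-1) ^ (card J + 1) * h (\<Inter>i\<in>J. T i))
   - (\<Sum>J\<in>Pow F - {{}}. (-1) ^ (card J + 1) * h (\<Inter>K\<in>J. K))" for h :: "pt set => real"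
   unfolding IS_def unfolding sum.Plus[OF fin] by (simp add: \<alpha>_def S_def sum_negf)
  have "(\<Sum>s\<in>IS. \<alpha> s * Vconv j (S s)) = 0"
  proof (rule Vconv_additive)
   show "finite IS" using fin by (simp add: IS_def)
   fix s assume "s \<in> IS"
   have cI: "compact (\<Inter>i\<in>J. T i) \<and> convex (\<Inter>i\<in>J. T i)" if "J \<in> Pow I - {{}}" for J
    using compact_convex_INT[of J T] T that by blast
   have cF: "compact (\<Inter>K\<in>J. K) \<and> convex (\<Inter>K\<in>J. K)" if "J \<in> Pow F - {{}}" for J
    using compact_convex_INT[of J "%K. K"] Ff(2,3) that by blast
   have "compact (S s) \<and> convex (S s)" using \<open>s \<in> IS\<close> unfolding IS_def
   proof (elim PlusE)
    fix J assume "J \<in> Pow I - {{}}" "s = Inl J" then show ?thesis using cI[of J] by (simp add: S_def)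
   next
    fix J assume "J \<in> Pow F - {{}}" "s = Inr J" then show ?thesis using cF[of J] unfolding S_def by simp
   qed
   then show "compact (S s)" "convex (S s)" by auto
  next
   fix x
   have "(\<Sum>s\<in>IS. \<alpha> s * indicator (S s) x) = indicator ?A x - (indicator (\<Union>K\<in>F. K) x :: real)"
    unfolding split[of "%A. indicator A x"] indicator_UN_incl_excl[OF I] indicator_UN_incl_excl[OF Ff(1)] by (rule refl)
   then show "(\<Sum>s\<in>IS. \<alpha> s * indicator (S s) x) = 0" using Ff(4) by simp
  qed
  then have "?c - (\<Sum>J\<in>Pow F - {{}}. (-1) ^ (card J + 1) * Vconv j (\<Inter>K\<in>J. K)) = 0" unfolding split .
  moreover have "Pow F - {{}} = {J. J \<subseteq> F \<and> J ~= {}}" by auto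
  ultimately show ?thesis by (simp add: incl_excl_def)
 qed
 have rep: "polyconvex_rep (T ` I) ?A" using I T by (auto simp: polyconvex_rep_def)
 show ?thesis unfolding V_def
 proof (rule the_equality)
  fix c assume "\<forall>F. polyconvex_rep F ?A --> incl_excl (Vconv j) F = c"
  then show "c = ?c" using rep uniq[OF rep] by simp
 qed (use uniq in blast)
qed

lemma V_convex: "compact K ==> convex K ==> V j K = Vconv j K"
proof -
 assume "compact K" "convex K"
 moreover have "Pow {()} - {{}} = {{()}}" by auto
 ultimately show ?thesis using V_UN[of "{()}" "%_. K" j] by simp
qed

section \<open>Kinematic formulas\<close>

lemma rset_V1c:
 assumes A: "rset N A" and c: "\<And>w. w \<in> space N ==> convex (A w)"
 shows "(%w. V1c (A w)) \<in> borel_measurable N"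
proof -
 have [measurable]: "{w \<in> space N. A w ~= {}} \<in> sets N" by (rule rset_nonempty[OF A])
 have *: "(%w. (area (mink (A w) (cball 0 1)) - area (A w) - pi * of_bool (A w ~= {})) / 2) \<in> borel_measurable N"
  using rset_mink_area[OF A rset_const[OF compact_cball]] rset_area[OF A]
  by (intro borel_measurable_divide borel_measurable_diff borel_measurable_times borel_measurable_const) 
    (simp_all add: of_bool_def)
 have eq: "V1c (A w) = (area (mink (A w) (cball 0 1)) - area (A w) - pi * of_bool (A w ~= {})) / 2" if "w \<in> space N" for w
  using V1c_decomp rset_compact[OF A that] c[OF that] by blast
 show ?thesis by (rule measurable_cong[THEN iffD2, OF eq *])
qed

lemma emeasure_area: "compact A ==> ennreal (area A) = emeasure lborel A" by (rule emeasure_compact[symmetric])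

lemma wd_eq': "compact A ==> convex A ==> wd z A = area (mink A (seg z)) - area A"
proof (cases "A = {}")
 case False
 assume "compact A" "convex A"
 with False have "A \<in> KC" by (simp add: KC_def)
 then show ?thesis by (rule wd_eq)
qed (simp add: wd_def)

lemma V1c_eq': "compact A ==> convex A ==> V1c A = Lw A / kap"
proof (cases "A = {}")
 case False
 assume "compact A" "convex A"
 with False have "A \<in> KC" by (simp add: KC_def)
 then show ?thesis by (rule V1c_eq)
qed (simp add: Lw_def wd_def)

lemma rset_wd:
 assumes A: "rset N A" and c: "\<And>w. w \<in> space N ==> convex (A w)" and f: "f \<in> borel_measurable N"
 shows "(%w. wd (f w) (A w)) \<in> borel_measurable N"
proof -
 have "(%w. area (mink (A w) (seg (f w))) - area (A w)) \<in> borel_measurable N"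
  by (intro borel_measurable_diff rset_mink_area rset_area rset_seg A f)
 then show ?thesis using wd_eq' rset_compact[OF A] c by (simp cong: measurable_cong)
qed

lemma mink_uminus_member: "x \<in> mink M (uminus ` K) \<longleftrightarrow> M \<inter> (%y. x + y) ` K ~= {}"
 by (simp add: mink_member image_image)

lemma nn_area: "compact (mink M (uminus ` K)) ==>
 (\<integral>\<^sup>+x. of_bool (M \<inter> (%y. x + y) ` K ~= {}) \<partial>lborel) = emeasure lborel (mink M (uminus ` K))"
proof -
 assume c: "compact (mink M (uminus ` K))"
 have "of_bool (M \<inter> (%y. x + y) ` K ~= {}) = (indicator (mink M (uminus ` K)) x :: ennreal)" for x
  by (simp add: indicator_def mink_uminus_member)
 then show ?thesis using c by simp
qed

lemma translate_KC: "K \<in> KC ==> compact ((%y. x + y) ` K)" "K \<in> KC ==> convex ((%y. x + y) ` K)"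
 using KC_translation KC_D by blast+

lemma rset_tr: "K \<in> KC ==> rset borel (%x. (%y. x + y) ` K)"
 by (intro rset_translation rset_const KC_D) simp_all

lemma compact_Int_tr: "M \<in> KC ==> K \<in> KC ==> compact (M \<inter> (%y. x + y) ` K)"
 by (intro compact_Int KC_D translate_KC)

lemma convex_Int_tr: "M \<in> KC ==> K \<in> KC ==> convex (M \<inter> (%y. x + y) ` K)"
 by (intro convex_Int KC_D translate_KC)

lemma rset_Int_tr: "M \<in> KC ==> K \<in> KC ==> rset borel (%x. M \<inter> (%y. x + y) ` K)"
 by (intro rset_Int rset_const rset_tr KC_D)

lemma space_borel_pair [simp]: "space (borel \<Otimes>\<^sub>M borel) = UNIV" by (simp add: space_pair_measure)

lemma nn_swap:
 fixes f :: "'a::euclidean_space => 'b::euclidean_space => ennreal"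
 assumes "(%p. f (fst p) (snd p)) \<in> borel_measurable (borel \<Otimes>\<^sub>M borel)"
 shows "(\<integral>\<^sup>+x. \<integral>\<^sup>+y. f x y \<partial>lborel \<partial>lborel) = (\<integral>\<^sup>+y. \<integral>\<^sup>+x. f x y \<partial>lborel \<partial>lborel)"
proof -
 have "case_prod f \<in> borel_measurable (lborel \<Otimes>\<^sub>M lborel)"
  using assms by (simp add: case_prod_unfold cong: measurable_cong_sets sets_pair_measure_cong)
 from lborel_pair.Fubini[OF this] show ?thesis by simp
qed

lemma kin_area:
 assumes M: "M \<in> KC" and K: "K \<in> KC"
 shows "(\<integral>\<^sup>+x. emeasure lborel (M \<inter> (%y. x + y) ` K) \<partial>lborel) = emeasure lborel M * emeasure lborel K"
proof -
 have Mb [measurable]: "M \<in> sets borel" using M by simp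
 have mem: "{p \<in> space (borel \<Otimes>\<^sub>M borel). snd p \<in> (%y. fst p + y) ` K} \<in> sets (borel \<Otimes>\<^sub>M borel)"
  by (rule rset_member[OF rset_tr[OF K]])
 have "(\<integral>\<^sup>+x. emeasure lborel (M \<inter> (%y. x + y) ` K) \<partial>lborel) = (\<integral>\<^sup>+x. \<integral>\<^sup>+y. indicator M y * indicator {p. snd p \<in> (%y. fst p + y) ` K} (x, y) \<partial>lborel \<partial>lborel)"
 proof (intro nn_integral_cong)
  fix x
  have "emeasure lborel (M \<inter> (%y. x + y) ` K) = (\<integral>\<^sup>+y. indicator (M \<inter> (%y. x + y) ` K) y \<partial>lborel)"
   using compact_Int_tr[OF M K] by simp
  also have "... = (\<integral>\<^sup>+y. indicator M y * indicator {p. snd p \<in> (%y. fst p + y) ` K} (x, y) \<partial>lborel)"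
   by (intro nn_integral_cong) (simp add: indicator_def)
  finally show "emeasure lborel (M \<inter> (%y. x + y) ` K) = (\<integral>\<^sup>+y. indicator M y * indicator {p. snd p \<in> (%y. fst p + y) ` K} (x, y) \<partial>lborel)" .
 qed
 also have "... = (\<integral>\<^sup>+y. \<integral>\<^sup>+x. indicator M y * indicator {p. snd p \<in> (%y. fst p + y) ` K} (x, y) \<partial>lborel \<partial>lborel)"
  using mem by (intro nn_swap) (auto intro!: borel_measurable_times_ennreal borel_measurable_indicator)
 also have "... = (\<integral>\<^sup>+y. indicator M y * emeasure lborel K \<partial>lborel)"
 proof (intro nn_integral_cong)
  fix y
  have R: "(%k. y - k) ` K \<in> KC" using K by simp
  have "(\<integral>\<^sup>+x. indicator M y * indicator {p. snd p \<in> (%y. fst p + y) ` K} (x, y) \<partial>lborel) = (\<integral>\<^sup>+x. indicator M y * indicator ((%k. y - k) ` K) x \<partial>lborel)"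
  proof (intro nn_integral_cong)
   fix x
   have "y \<in> (%y. x + y) ` K \<longleftrightarrow> x \<in> (%k. y - k) ` K"
   proof
    assume "y \<in> (%y. x + y) ` K" then obtain k where "k \<in> K" "y = x + k" by blast
    then have "x = y - k" by simp
    with \<open>k \<in> K\<close> show "x \<in> (%k. y - k) ` K" by blast
   next
    assume "x \<in> (%k. y - k) ` K" then obtain k where "k \<in> K" "x = y - k" by blast
    then have "y = x + k" by simp
    with \<open>k \<in> K\<close> show "y \<in> (%y. x + y) ` K" by blast
   qed
   then show "indicator M y * indicator {p. snd p \<in> (%y. fst p + y) ` K} (x, y) = (indicator M y * indicator ((%k. y - k) ` K) x :: ennreal)"
    by (simp add: indicator_def)
  qed
  also have "... = indicator M y * emeasure lborel ((%k. y - k) ` K)" using R by (subst nn_integral_cmult_indicator) auto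
  also have "emeasure lborel ((%k. y - k) ` K) = emeasure lborel K"
   using emeasure_area[OF KC_D(1)[OF R]] emeasure_area[OF KC_D(1)[OF K]] K by simp
  finally show "(\<integral>\<^sup>+x. indicator M y * indicator {p. snd p \<in> (%y. fst p + y) ` K} (x, y) \<partial>lborel) = indicator M y * emeasure lborel K" .
 qed
 also have "... = emeasure lborel M * emeasure lborel K" by (simp add: nn_integral_multc)
 finally show ?thesis .
qed

text \<open>\<open>M\<close> cut with the segment running back from \<open>y\<close> along
  \<open>z\<close> is again a segment, and its share of \<open>z\<close> is the length of the
  parameter set. Adding the reflected \<open>K\<close> then adds that share of \<open>wd z K\<close>
  to the area of \<open>K\<close>; the \<open>of_bool\<close> factor covers an empty cut.\<close>

lemma seg_piece:
 assumes M: "M \<in> KC" and K: "K \<in> KC"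
 shows "emeasure lborel (mink (M \<inter> (%x. y + x) ` uminus ` seg z) (uminus ` K)) =
  of_bool (y \<in> mink M (seg z)) * emeasure lborel K + emeasure lborel {t \<in> {0..1}. y - t *\<^sub>R z \<in> M} * ennreal (wd z K)"
proof -
 let ?N = "M \<inter> (%x. y + x) ` uminus ` seg z" and ?S = "{t \<in> {0..1}. y - t *\<^sub>R z \<in> M}"
 have N: "?N = (%t. y - t *\<^sub>R z) ` ?S"
 proof (intro equalityI subsetI)
  fix p assume "p \<in> ?N"
  then obtain s where s: "s \<in> seg z" "p = y + - s" "p \<in> M" by blast
  then obtain t where "0 \<le> t" "t \<le> 1" "s = t *\<^sub>R z" unfolding in_segment by auto
  then have "0 \<le> t" "t \<le> 1" "p = y - t *\<^sub>R z" "p \<in> M" using s by auto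
  then show "p \<in> (%t. y - t *\<^sub>R z) ` ?S" by auto
 next
  fix p assume "p \<in> (%t. y - t *\<^sub>R z) ` ?S"
  then obtain t where t: "0 \<le> t" "t \<le> 1" "p = y + - (t *\<^sub>R z)" "p \<in> M" by auto
  moreover have "t *\<^sub>R z \<in> seg z" using t by (auto simp: in_segment)
  ultimately show "p \<in> ?N" by blast
 qed
 have ne: "y \<in> mink M (seg z) \<longleftrightarrow> ?S ~= {}" unfolding mink_member N by simp
 show ?thesis
 proof (cases "?S = {}")
  case True
  show ?thesis unfolding N ne unfolding True by simp
 next
  case False
  have cl: "closed ((%t. y - t *\<^sub>R z) -` M)"
   using KC_D(1)[OF M] by (intro closed_vimage compact_imp_closed continuous_intros)
  have "compact ({0..1} \<inter> ((%t. y - t *\<^sub>R z) -` M))" using cl by (intro compact_Int_closed) auto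
  moreover have S: "?S = {0..1} \<inter> ((%t. y - t *\<^sub>R z) -` M)" by auto
  moreover have "convex ?S"
  proof (rule convexI)
   fix s t u v :: real assume h: "s \<in> ?S" "t \<in> ?S" "0 \<le> u" "0 \<le> v" "u + v = 1"
   then have "u *\<^sub>R (y - s *\<^sub>R z) + v *\<^sub>R (y - t *\<^sub>R z) \<in> M" using KC_D(2)[OF M] by (intro convexD) auto
   moreover have "u *\<^sub>R (y - s *\<^sub>R z) + v *\<^sub>R (y - t *\<^sub>R z) = y - (u *\<^sub>R s + v *\<^sub>R t) *\<^sub>R z"
   proof -
    have "u *\<^sub>R (y - s *\<^sub>R z) + v *\<^sub>R (y - t *\<^sub>R z) = (u + v) *\<^sub>R y - (u *\<^sub>R s + v *\<^sub>R t) *\<^sub>R z"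
     by (simp add: scaleR_left_distrib scaleR_right_diff_distrib)
    then show ?thesis using h(5) by simp
   qed
   moreover have "u *\<^sub>R s + v *\<^sub>R t \<in> {0..1}" using h by (intro convexD[OF convex_real_interval(5)]) auto
   ultimately show "u *\<^sub>R s + v *\<^sub>R t \<in> ?S" by simp
  qed
  ultimately have cc: "compact ?S" "convex ?S" by (simp_all only:)
  from compact_convex_real[OF cc False] obtain a b where ab: "a \<le> b" "?S = {a..b}" .
  \<comment> \<open>Larger parameters lie further back along \<open>z\<close>, so the base point of
    the segment belongs to the parameter \<open>b\<close>.\<close>
  have "?N = (%x. (y - b *\<^sub>R z) + x) ` seg ((b - a) *\<^sub>R z)" unfolding N ab(2)
  proof (intro equalityI subsetI)
   fix p assume "p \<in> (%t. y - t *\<^sub>R z) ` {a..b}"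
   then obtain t where t: "a \<le> t" "t \<le> b" "p = y - t *\<^sub>R z" by auto
   have "(b - t) *\<^sub>R z \<in> seg ((b - a) *\<^sub>R z)"
   proof (cases "a = b")
    case False
    then have "(b - t) *\<^sub>R z = ((b - t) / (b - a)) *\<^sub>R ((b - a) *\<^sub>R z)" by simp
    moreover have "0 \<le> (b - t) / (b - a)" "(b - t) / (b - a) \<le> 1" using t ab False by (auto simp: divide_simps)
    ultimately show ?thesis unfolding in_segment by (metis add_0 scaleR_zero_right)
   qed (use t in auto)
   moreover have "p = (y - b *\<^sub>R z) + (b - t) *\<^sub>R z" by (simp add: t scaleR_left_diff_distrib)
   ultimately show "p \<in> (%x. (y - b *\<^sub>R z) + x) ` seg ((b - a) *\<^sub>R z)" by blast
  next
   fix p assume "p \<in> (%x. (y - b *\<^sub>R z) + x) ` seg ((b - a) *\<^sub>R z)"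
   then obtain u where u: "0 \<le> u" "u \<le> 1" "p = (y - b *\<^sub>R z) + u *\<^sub>R ((b - a) *\<^sub>R z)" by (auto simp: in_segment)
   have "0 \<le> u * (b - a)" "0 \<le> (1 - u) * (b - a)" using u ab by auto
   then have "b - u * (b - a) \<in> {a..b}" by (auto simp: algebra_simps)
   moreover have "p = y - (b - u * (b - a)) *\<^sub>R z" using u(3) scaleR_left_diff_distrib[of b "u * (b - a)" z] by simp
   ultimately show "p \<in> (%t. y - t *\<^sub>R z) ` {a..b}" by blast
  qed
  then have "area (mink ?N (uminus ` K)) = area (mink (uminus ` K) (seg ((b - a) *\<^sub>R z)))"
   using K by (simp add: mink_translation mink_commute[of "seg _"])
  also have "... = area K + (b - a) * wd z K"
  proof -
   have "uminus ` K = (%x. 0 - x) ` K" by simp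
   then have "wd z (uminus ` K) = wd z K" using wd_reflect[OF K, of z 0] by simp
   then show ?thesis using K ab by (simp add: area_mink_seg wd_scale)
  qed
  finally have a: "area (mink ?N (uminus ` K)) = area K + (b - a) * wd z K" .
  have "compact (mink ?N (uminus ` K))"
   using KC_D(1)[OF M] KC_D(1)[OF K] by (intro mink_compact compact_Int compact_translation compact_negations) auto
  then have "emeasure lborel (mink ?N (uminus ` K)) = ennreal (area K + (b - a) * wd z K)" using a emeasure_compact by metis
  also have "... = emeasure lborel K + ennreal (b - a) * ennreal (wd z K)"
   using ab emeasure_compact[OF KC_D(1)[OF K]] by (simp add: ennreal_mult)
  finally show ?thesis using ab False ne by simp
 qed
qed

text \<open>A width is the gain in area from adding a segment, so the area of the cut plus the
  segment is integrated over all positions. By Fubini, for fixed \<open>y\<close> the admissible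
  positions form the set measured in \<open>seg_piece\<close>; the contribution of the cut itself is
  removed with \<open>kin_area\<close>.\<close>

lemma kin_wd:
 assumes M: "M \<in> KC" and K: "K \<in> KC"
 shows "(\<integral>\<^sup>+x. ennreal (wd z (M \<inter> (%y. x + y) ` K)) \<partial>lborel) = ennreal (wd z M * area K + area M * wd z K)"
proof -
 let ?A = "%x. M \<inter> (%y. x + y) ` K" and ?N = "%y. M \<inter> (%x. y + x) ` uminus ` seg z"
 have A: "rset borel ?A" by (rule rset_Int_tr[OF M K])
 have Ac: "compact (?A x)" "convex (?A x)" for x using compact_Int_tr[OF M K] convex_Int_tr[OF M K] by auto
 have mM: "compact (mink M (seg z))" using M KC_D by (intro mink_compact) auto
 have jm: "{p \<in> space (borel \<Otimes>\<^sub>M borel). snd p \<in> mink (?A (fst p)) (seg z)} \<in> sets (borel \<Otimes>\<^sub>M borel)"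
  by (rule rset_mink_member[OF A rset_const]) simp
 have "(\<integral>\<^sup>+x. emeasure lborel (mink (?A x) (seg z)) \<partial>lborel) = (\<integral>\<^sup>+x. \<integral>\<^sup>+y. indicator {p. snd p \<in> mink (?A (fst p)) (seg z)} (x, y) \<partial>lborel \<partial>lborel)"
 proof (intro nn_integral_cong)
  fix x
  have "compact (mink (?A x) (seg z))" using Ac by (intro mink_compact) auto
  then have "emeasure lborel (mink (?A x) (seg z)) = (\<integral>\<^sup>+y. indicator (mink (?A x) (seg z)) y \<partial>lborel)" by simp
  also have "... = (\<integral>\<^sup>+y. indicator {p. snd p \<in> mink (?A (fst p)) (seg z)} (x, y) \<partial>lborel)"
   by (intro nn_integral_cong) (simp add: indicator_def)
  finally show "emeasure lborel (mink (?A x) (seg z)) = (\<integral>\<^sup>+y. indicator {p. snd p \<in> mink (?A (fst p)) (seg z)} (x, y) \<partial>lborel)" .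
 qed
 also have "... = (\<integral>\<^sup>+y. \<integral>\<^sup>+x. indicator {p. snd p \<in> mink (?A (fst p)) (seg z)} (x, y) \<partial>lborel \<partial>lborel)"
  using jm by (intro nn_swap) (auto intro!: borel_measurable_indicator)
 also have "... = (\<integral>\<^sup>+y. emeasure lborel (mink (?N y) (uminus ` K)) \<partial>lborel)"
 proof (intro nn_integral_cong)
  fix y
  have "compact (mink (?N y) (uminus ` K))"
   using KC_D(1)[OF M] KC_D(1)[OF K] by (intro mink_compact compact_Int compact_translation compact_negations) auto
  from nn_area[OF this] have "emeasure lborel (mink (?N y) (uminus ` K)) = (\<integral>\<^sup>+x. of_bool (?N y \<inter> (%y. x + y) ` K ~= {}) \<partial>lborel)" by simp
  also have "... = (\<integral>\<^sup>+x. indicator {p. snd p \<in> mink (?A (fst p)) (seg z)} (x, y) \<partial>lborel)"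
  proof (intro nn_integral_cong)
   fix x
   have "?N y \<inter> (%y. x + y) ` K = ?A x \<inter> (%x. y + x) ` uminus ` seg z" by blast
   then show "of_bool (?N y \<inter> (%y. x + y) ` K ~= {}) = (indicator {p. snd p \<in> mink (?A (fst p)) (seg z)} (x, y) :: ennreal)"
    by (simp add: indicator_def mink_member)
  qed
  finally show "(\<integral>\<^sup>+x. indicator {p. snd p \<in> mink (?A (fst p)) (seg z)} (x, y) \<partial>lborel) = emeasure lborel (mink (?N y) (uminus ` K))" ..
 qed
 also have "... = (\<integral>\<^sup>+y. indicator (mink M (seg z)) y * emeasure lborel K + emeasure lborel {t \<in> {0..1}. y - t *\<^sub>R z \<in> M} * ennreal (wd z K) \<partial>lborel)"
  by (simp add: seg_piece[OF M K] indicator_def of_bool_def)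
 also have "... = emeasure lborel (mink M (seg z)) * emeasure lborel K + emeasure lborel M * ennreal (wd z K)"
 proof -
  have Mb [measurable]: "M \<in> sets borel" using M by simp
  have jm2: "(%p. indicator {0..1} (snd p) * indicator M (fst p - snd p *\<^sub>R z) :: ennreal) \<in> borel_measurable (borel \<Otimes>\<^sub>M borel)"
  proof -
   have "(%p :: pt \<times> real. fst p - snd p *\<^sub>R z) \<in> borel_measurable (borel \<Otimes>\<^sub>M borel)"
    by (intro borel_measurable_diff borel_measurable_scaleR measurable_fst measurable_snd borel_measurable_const)
   then show ?thesis by measurable
  qed
  have l: "emeasure lborel {t \<in> {0..1}. y - t *\<^sub>R z \<in> M} = (\<integral>\<^sup>+t. indicator {0..1} t * indicator M (y - t *\<^sub>R z) \<partial>lborel)" for y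
  proof -
   have "closed ((%t. y - t *\<^sub>R z) -` M)" using KC_D(1)[OF M] by (intro closed_vimage compact_imp_closed continuous_intros)
   then have "{t \<in> {0..1}. y - t *\<^sub>R z \<in> M} \<in> sets borel"
    using sets.Int[of "{0..1}" borel "(%t. y - t *\<^sub>R z) -` M"] by (simp add: Int_def)
   then have "emeasure lborel {t \<in> {0..1}. y - t *\<^sub>R z \<in> M} = (\<integral>\<^sup>+t. indicator {t \<in> {0..1}. y - t *\<^sub>R z \<in> M} t \<partial>lborel)" by simp
   also have "... = (\<integral>\<^sup>+t. indicator {0..1} t * indicator M (y - t *\<^sub>R z) \<partial>lborel)"
    by (intro nn_integral_cong) (simp add: indicator_def)
   finally show ?thesis .
  qed
  have lm: "(%y. emeasure lborel {t \<in> {0..1}. y - t *\<^sub>R z \<in> M}) \<in> borel_measurable borel"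
  proof -
   have "case_prod (%y t. indicator {0..1} t * indicator M (y - t *\<^sub>R z) :: ennreal) \<in> borel_measurable (borel \<Otimes>\<^sub>M lborel)"
    using jm2 by (simp add: case_prod_unfold cong: measurable_cong_sets sets_pair_measure_cong)
   from lborel.borel_measurable_nn_integral[OF this] show ?thesis unfolding l .
  qed
  have "(\<integral>\<^sup>+y. emeasure lborel {t \<in> {0..1}. y - t *\<^sub>R z \<in> M} \<partial>lborel) = (\<integral>\<^sup>+t. \<integral>\<^sup>+y. indicator {0..1} t * indicator M (y - t *\<^sub>R z) \<partial>lborel \<partial>lborel)"
   unfolding l by (rule nn_swap[OF jm2])
  also have "... = (\<integral>\<^sup>+t. indicator {0..1} t * emeasure lborel M \<partial>(lborel :: real measure))"
  proof (intro nn_integral_cong)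
   fix t :: real
   have "{y. y + - (t *\<^sub>R z) \<in> M} = (%y. y + - (t *\<^sub>R z)) -` M \<inter> space borel" by auto
   also have "... \<in> sets borel" by (rule measurable_sets[OF _ Mb]) simp
   finally have s: "{y. y + - (t *\<^sub>R z) \<in> M} \<in> sets borel" .
   have "(\<integral>\<^sup>+y. indicator {0..1} t * indicator M (y - t *\<^sub>R z) \<partial>lborel) = (\<integral>\<^sup>+y. indicator {0..1} t * indicator {y. y + - (t *\<^sub>R z) \<in> M} y \<partial>lborel)"
    by (intro nn_integral_cong) (simp add: indicator_def)
   also have "... = indicator {0..1} t * emeasure lborel {y. y + - (t *\<^sub>R z) \<in> M}"
    using s by (subst nn_integral_cmult_indicator) auto
   finally show "(\<integral>\<^sup>+y. indicator {0..1} t * indicator M (y - t *\<^sub>R z) \<partial>lborel) = indicator {0..1} t * emeasure lborel M"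
    using lborel_shift[OF Mb, of "- (t *\<^sub>R z)"] by simp
  qed
  also have "... = emeasure lborel M" by (simp add: nn_integral_multc)
  finally have "(\<integral>\<^sup>+y. emeasure lborel {t \<in> {0..1}. y - t *\<^sub>R z \<in> M} \<partial>lborel) = emeasure lborel M" .
  then show ?thesis using lm mM by (simp add: nn_integral_add nn_integral_multc)
 qed
 finally have 1: "(\<integral>\<^sup>+x. emeasure lborel (mink (?A x) (seg z)) \<partial>lborel) = emeasure lborel (mink M (seg z)) * emeasure lborel K + emeasure lborel M * ennreal (wd z K)" .
 have "emeasure lborel (mink (?A x) (seg z)) = emeasure lborel (?A x) + ennreal (wd z (?A x))" for x
 proof -
  have "area (mink (?A x) (seg z)) = area (?A x) + wd z (?A x)" using wd_eq'[OF Ac] by simp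
  then show ?thesis using Ac(1) emeasure_compact[OF mink_compact[OF Ac(1)], of "seg z"] emeasure_compact[OF Ac(1)] by simp
 qed
 then have "(\<integral>\<^sup>+x. emeasure lborel (mink (?A x) (seg z)) \<partial>lborel) = (\<integral>\<^sup>+x. emeasure lborel (?A x) \<partial>lborel) + (\<integral>\<^sup>+x. ennreal (wd z (?A x)) \<partial>lborel)"
  using rset_emeasure[OF A] rset_wd[OF A Ac(2), of "%_. z"] by (simp add: nn_integral_add)
 then have "ennreal (area M * area K) + (\<integral>\<^sup>+x. ennreal (wd z (?A x)) \<partial>lborel) = ennreal ((area M + wd z M) * area K + area M * wd z K)"
  unfolding 1 kin_area[OF M K] using emeasure_compact[OF mM] emeasure_compact[OF KC_D(1)[OF M]] emeasure_compact[OF KC_D(1)[OF K]] M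
  by (simp add: area_mink_seg ennreal_mult)
 also have "... = ennreal (area M * area K) + ennreal (wd z M * area K + area M * wd z K)"
  by (subst ennreal_plus[symmetric]) (simp_all add: algebra_simps)
 finally show ?thesis by (simp only: ennreal_add_left_cancel) simp
qed

lemma Lw_nn: "compact A ==> convex A ==> ennreal (Lw A) = (\<integral>\<^sup>+z. indicator (cball 0 1) z * ennreal (wd z A) \<partial>lborel)"
proof (cases "A = {}")
 case True then show ?thesis by (simp add: Lw_def wd_def)
next
 case False
 assume "compact A" "convex A"
 with False have A: "A \<in> KC" by (simp add: KC_def)
 show ?thesis unfolding Lw_def by (subst nn_integral_eq_integral[OF Lw_integrable[OF A], symmetric])
    (auto intro!: nn_integral_cong simp: indicator_def)
qed

text \<open>The formula for widths is linear in the widths of \<open>M\<close> and of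
  \<open>K\<close>, so it can be integrated over \<open>z\<close> in the disc term by term.\<close>

theorem kin_V1c:
 assumes M: "M \<in> KC" and K: "K \<in> KC"
 shows "(\<integral>\<^sup>+x. ennreal (V1c (M \<inter> (%y. x + y) ` K)) \<partial>lborel) = ennreal (V1c M * area K + area M * V1c K)"
proof -
 let ?A = "%x. M \<inter> (%y. x + y) ` K"
 have A: "rset borel ?A" by (rule rset_Int_tr[OF M K])
 have Ac: "compact (?A x)" "convex (?A x)" for x using compact_Int_tr[OF M K] convex_Int_tr[OF M K] by auto
 have wm: "(%p. wd (snd p) (?A (fst p))) \<in> borel_measurable (borel \<Otimes>\<^sub>M borel)"
  by (intro rset_wd rset_compose[OF measurable_fst A]) (auto simp: Ac)
 have "(\<integral>\<^sup>+x. ennreal (Lw (?A x)) \<partial>lborel) = (\<integral>\<^sup>+x. \<integral>\<^sup>+z. indicator (cball 0 1) z * ennreal (wd z (?A x)) \<partial>lborel \<partial>lborel)"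
  by (simp add: Lw_nn Ac)
 also have "... = (\<integral>\<^sup>+z. \<integral>\<^sup>+x. indicator (cball 0 1) z * ennreal (wd z (?A x)) \<partial>lborel \<partial>lborel)"
  by (intro nn_swap borel_measurable_times_ennreal measurable_compose[OF wm measurable_ennreal]
    measurable_compose[OF measurable_snd borel_measurable_indicator]) simp
 also have "... = (\<integral>\<^sup>+z. indicator (cball 0 1) z * ennreal (wd z M * area K + area M * wd z K) \<partial>lborel)"
 proof (intro nn_integral_cong)
  fix z
  have "(%x. ennreal (wd z (?A x))) \<in> borel_measurable borel" using rset_wd[OF A Ac(2), of "%_. z"] by simp
  then show "(\<integral>\<^sup>+x. indicator (cball 0 1) z * ennreal (wd z (?A x)) \<partial>lborel) = indicator (cball 0 1) z * ennreal (wd z M * area K + area M * wd z K)"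
   by (simp add: nn_integral_cmult kin_wd[OF M K])
 qed
 also have "... = (\<integral>\<^sup>+z. ennreal (indicator (cball 0 1) z * wd z M * area K + area M * (indicator (cball 0 1) z * wd z K)) \<partial>lborel)"
  by (intro nn_integral_cong) (simp add: indicator_def)
 also have "... = ennreal (Lw M * area K + area M * Lw K)" using Lw_integrable[OF M] Lw_integrable[OF K]
  by (subst nn_integral_eq_integral) (auto simp: Lw_def)
 finally have L: "(\<integral>\<^sup>+x. ennreal (Lw (?A x)) \<partial>lborel) = ennreal (Lw M * area K + area M * Lw K)" .
 have Lm: "(%x. ennreal (Lw (?A x))) \<in> borel_measurable borel"
 proof -
  have "(%x. kap * V1c (?A x)) \<in> borel_measurable borel" using rset_V1c[OF A Ac(2)] by simp
  then show ?thesis using kap_pos by (simp add: V1c_eq' Ac)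
 qed
 have "(\<integral>\<^sup>+x. ennreal (V1c (?A x)) \<partial>lborel) = (\<integral>\<^sup>+x. ennreal (1 / kap) * ennreal (Lw (?A x)) \<partial>lborel)"
  using kap_pos by (intro nn_integral_cong) (simp add: V1c_eq' Ac ennreal_mult'[symmetric])
 also have "... = ennreal (1 / kap) * ennreal (Lw M * area K + area M * Lw K)" using Lm by (simp add: nn_integral_cmult L)
 also have "... = ennreal (V1c M * area K + area M * V1c K)"
  using kap_pos by (simp add: ennreal_mult'[symmetric] V1c_eq M K add_divide_distrib)
 finally show ?thesis .
qed

section \<open>The generic grain\<close>

lemma sets_grain_basic: "compact C ==> {K \<in> KC. K \<inter> C = {}} \<in> sets grain_space"
 unfolding grain_space_def by (subst sets_measure_of) (auto intro!: sigma_sets.Basic)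

lemma measurable_rot_grain: "(%K. rot v ` K) \<in> measurable grain_space grain_space"
proof -
 have "(%K. rot v ` K) \<in> measurable grain_space (sigma KC {{K \<in> KC. K \<inter> C = {}} | C. compact C})"
 proof (rule measurable_measure_of)
  show "(%K. rot v ` K) \<in> space grain_space \<rightarrow> KC" by simp
  fix y assume "y \<in> {{K \<in> KC. K \<inter> C = {}} | C. compact C}"
  then obtain C where C: "compact C" "y = {K \<in> KC. K \<inter> C = {}}" by blast
  have "rot v ` K \<inter> C = {} \<longleftrightarrow> K \<inter> rot (- v) ` C = {}" for K
  proof -
   have "rot v ` K \<inter> C = {} \<longleftrightarrow> (\<forall>x\<in>K. rot v x \<notin> C)" by blast
   also have "... \<longleftrightarrow> (\<forall>x\<in>K. x \<notin> rot (- v) ` C)" by (simp add: rot_image_eq)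
   finally show ?thesis by blast
  qed
  then have "(%K. rot v ` K) -` y \<inter> space grain_space = {K \<in> KC. K \<inter> rot (- v) ` C = {}}"
   unfolding C(2) using KC_rot by auto
  also have "... \<in> sets grain_space" using C(1) by (intro sets_grain_basic compact_continuous_image continuous_intros)
  finally show "(%K. rot v ` K) -` y \<inter> space grain_space \<in> sets grain_space" .
 qed auto
 then show ?thesis by (simp add: grain_space_def)
qed

definition tg :: "pt \<times> pt set => pt set" where "tg p = (%y. fst p + y) ` snd p"

lemma Xi_tg: "Xi \<phi> = (\<Union>p\<in>\<phi>. tg p)" by (simp add: Xi_def tg_def)

locale grains =
 fixes \<epsilon> :: real and Q :: "pt set measure"
 assumes eps: "\<epsilon> > 0" and law: "grain_law \<epsilon> Q"
begin

lemma sets_Q [simp, measurable_cong]: "sets Q = sets grain_space" using law by (simp add: grain_law_def)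

lemma space_Q [simp]: "space Q = KC" using sets_eq_imp_space_eq[OF sets_Q] by simp

sublocale prob_space Q using law by (simp add: grain_law_def)

lemma prob_KC [simp]: "prob KC = 1" using prob_space by simp

lemma rset_Q: "rset Q (%K. K)" using rset_compose[OF measurable_ident_sets[OF sets_Q] rset_grain] by simp

definition vv :: real where "vv = EV 2 Q"
definition mm :: real where "mm = EV 1 Q"
text \<open>By isotropy the direction is immaterial: this is the mean width of the grain, identified
  with \<open>2 * mm / pi\<close> in \<open>bb_eq\<close>.\<close>

definition bb :: real where "bb = (\<integral>K. wd (1, 0) K \<partial>Q)"

lemma V_integrable: "j \<le> 2 ==> integrable Q (%K. V j K)" using law by (simp add: grain_law_def)

lemma V_Q: "K \<in> space Q ==> V j K = Vconv j K" using V_convex KC_D by simp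

lemma area_integrable: "integrable Q area" and vv_eq: "vv = (\<integral>K. area K \<partial>Q)"
proof -
 have "V 2 K = area K" if "K \<in> space Q" for K using V_Q[OF that] by (simp add: Vconv_def)
 note * = this
 have "integrable Q (%K. V 2 K) \<longleftrightarrow> integrable Q (%K. area K)"
  by (rule Bochner_Integration.integrable_cong[OF refl *])
 then show "integrable Q area" using V_integrable[of 2] by simp
 show "vv = (\<integral>K. area K \<partial>Q)" unfolding vv_def EV_def by (rule Bochner_Integration.integral_cong[OF refl *])
qed

lemma V1c_integrable: "integrable Q V1c" and mm_eq: "mm = (\<integral>K. V1c K \<partial>Q)"
proof -
 have "V 1 K = V1c K" if "K \<in> space Q" for K using V_Q[OF that] by (simp add: Vconv_def)
 note * = this
 have "integrable Q (%K. V 1 K) \<longleftrightarrow> integrable Q (%K. V1c K)"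
  by (rule Bochner_Integration.integrable_cong[OF refl *])
 then show "integrable Q V1c" using V_integrable[of 1] by simp
 show "mm = (\<integral>K. V1c K \<partial>Q)" unfolding mm_def EV_def by (rule Bochner_Integration.integral_cong[OF refl *])
qed

lemma vv_nonneg: "vv \<ge> 0" unfolding vv_eq by (intro Bochner_Integration.integral_nonneg) simp
lemma mm_nonneg: "mm \<ge> 0" unfolding mm_eq by (intro Bochner_Integration.integral_nonneg) (simp add: V1c_nonneg)

lemma rot_measurable: "(%K. rot v ` K) \<in> measurable Q Q" using measurable_rot_grain by (simp cong: measurable_cong_sets)

lemma rot_invariant:
 fixes f :: "pt set => real"
 assumes "f \<in> borel_measurable Q"
 shows "(\<integral>K. f (rot v ` K) \<partial>Q) = (\<integral>K. f K \<partial>Q)"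
proof -
 have "distr Q Q (%K. rot v ` K) = Q" using law by (simp add: grain_law_def)
 then have "(\<integral>K. f K \<partial>Q) = (\<integral>K. f K \<partial>distr Q Q (%K. rot v ` K))" by simp
 also have "... = (\<integral>K. f (rot v ` K) \<partial>Q)" by (rule integral_distr[OF rot_measurable assms])
 finally show ?thesis ..
qed

lemma wd_Q_measurable: "(%K. wd u K) \<in> borel_measurable Q" by (intro rset_wd rset_Q) (auto simp: KC_D)

text \<open>A unit segment from the origin fits into the unit disc, so the Steiner formula bounds
  the width; integrability of widths follows from that of \<open>V1c\<close>.\<close>

lemma wd_bound:
 assumes "K \<in> KC" shows "wd u K \<le> norm u * (2 * V1c K + pi)"
proof (cases "u = 0")
 case True then show ?thesis using wd_scale[OF assms, of 0 0] by simp
next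
 case False
 define e where "e = u /\<^sub>R norm u"
 have e: "norm e = 1" "u = norm u *\<^sub>R e" using False by (auto simp: e_def)
 have "area K + wd e K = area (mink K (seg e))" using assms by (simp add: area_mink_seg)
 also have "... \<le> area (mink K (cball 0 1))"
  using e(1) assms KC_D by (intro area_mono mink_mono seg_subset_cball compact_sets_borel mink_compact) auto
 also have "... = area K + 2 * V1c K + pi" using V1c_steiner[OF assms] by simp
 finally have "wd e K \<le> 2 * V1c K + pi" by simp
 moreover have "wd u K = norm u * wd e K" using wd_scale[OF assms, of "norm u" e] e(2) by simp
 ultimately show ?thesis by (simp add: mult_left_mono)
qed

lemma wd_integrable: "integrable Q (%K. wd u K)"
proof (rule Bochner_Integration.integrable_bound)
 show "integrable Q (%K. norm u * (2 * V1c K + pi))" using V1c_integrable by simp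
 show "AE K in Q. norm (wd u K) \<le> norm (norm u * (2 * V1c K + pi))"
 proof (rule AE_I2)
  fix K assume "K \<in> space Q"
  then have "K \<in> KC" by simp
  then show "norm (wd u K) \<le> norm (norm u * (2 * V1c K + pi))" using wd_bound[of K u] V1c_nonneg[of K] by simp
 qed
qed (rule wd_Q_measurable)

lemma E_wd: "(\<integral>K. wd u K \<partial>Q) = norm u * bb"
proof -
 define n where "n = norm u"
 obtain v where v: "rot v (n, 0) = u" using polar[of u] unfolding n_def by (auto dest: sym)
 have "(\<integral>K. wd u K \<partial>Q) = (\<integral>K. wd u (rot v ` K) \<partial>Q)" by (rule rot_invariant[OF wd_Q_measurable, symmetric])
 also have "... = (\<integral>K. n * wd (1, 0) K \<partial>Q)"
 proof (rule Bochner_Integration.integral_cong[OF refl])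
  fix K assume "K \<in> space Q"
  then have K: "K \<in> KC" by simp
  have "wd u (rot v ` K) = wd (n, 0) K" unfolding v[symmetric] by (rule wd_rot)
  also have "... = n * wd (1, 0) K" using wd_scale[OF K, of n "(1, 0)"] by (simp add: n_def)
  finally show "wd u (rot v ` K) = n * wd (1, 0) K" .
 qed
 finally show ?thesis by (simp add: bb_def n_def)
qed

lemma bb_nonneg: "bb \<ge> 0" unfolding bb_def by (intro Bochner_Integration.integral_nonneg) simp

lemma wd_uminus: "K \<in> KC ==> wd z (uminus ` K) = wd z K" using wd_reflect[of K z 0] by simp

lemma V1c_uminus: "K \<in> KC ==> V1c (uminus ` K) = V1c K"
 using Lw_cong[of "uminus ` K" K] by (simp add: V1c_eq wd_uminus)

text \<open>The mean measure of the positions at which a random grain meets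
  \<open>M\<close>.\<close>

definition UU :: "pt set => real" where "UU M = (\<integral>K. area (mink M (uminus ` K)) \<partial>Q)"

lemma mink_Q_measurable: "M \<in> KC ==> (%K. area (mink M (uminus ` K))) \<in> borel_measurable Q"
 by (intro rset_mink_area rset_const rset_uminus rset_Q KC_D)

lemma mink_cball_area: "K \<in> KC ==> r \<ge> 0 ==> area (mink (cball 0 r) (uminus ` K)) = area K + 2 * r * V1c K + pi * r\<^sup>2"
 using steiner[of "uminus ` K" r] by (simp add: mink_commute[of "cball 0 r"] V1c_eq[symmetric] V1c_uminus)

lemma mink_Q_integrable: assumes M: "M \<in> KC" shows "integrable Q (%K. area (mink M (uminus ` K)))"
proof -
 obtain r where r: "M \<subseteq> cball 0 r" "r \<ge> 0"
 proof -
  have "bounded M" using KC_D(1)[OF M] by (rule compact_imp_bounded)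
  then obtain r where "\<forall>x\<in>M. norm x \<le> r" by (auto simp: bounded_iff)
  then have "M \<subseteq> cball 0 (max r 0)" by auto
  then show thesis using that by force
 qed
 show ?thesis
 proof (rule Bochner_Integration.integrable_bound)
  show "integrable Q (%K. area K + 2 * r * V1c K + pi * r\<^sup>2)" using V1c_integrable area_integrable by simp
  show "AE K in Q. norm (area (mink M (uminus ` K))) \<le> norm (area K + 2 * r * V1c K + pi * r\<^sup>2)"
  proof (rule AE_I2)
   fix K assume "K \<in> space Q"
   then have K: "K \<in> KC" by simp
   have "area (mink M (uminus ` K)) \<le> area (mink (cball 0 r) (uminus ` K))"
    using r M K KC_D(1) by (intro area_mono mink_mono compact_sets_borel mink_compact compact_negations) auto
   then show "norm (area (mink M (uminus ` K))) \<le> norm (area K + 2 * r * V1c K + pi * r\<^sup>2)"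
    using mink_cball_area[OF K r(2)] by simp
  qed
 qed (rule mink_Q_measurable[OF M])
qed

text \<open>The mean over the isotropic grain is taken before the uniqueness principle is applied.
  The resulting functional of \<open>M\<close> is already invariant under reflections, and on
  parallelograms it involves the grain only through \<open>bb\<close> and \<open>vv\<close>.\<close>

theorem UU_eq: assumes M: "M \<in> KC" shows "UU M = area M + bb * V1c M + vv"
proof -
 define G where "G M = UU M - area M - bb * (Lw M / kap) - vv" for M
 interpret zero_valuation G
 proof
  fix A B assume h: "A \<in> KC" "B \<in> KC" "convex (A \<union> B)" "A \<inter> B ~= {}"
  note h' = valuation_KC[OF h]
  have "UU (A \<union> B) + UU (A \<inter> B) = (\<integral>K. area (mink (A \<union> B) (uminus ` K)) + area (mink (A \<inter> B) (uminus ` K)) \<partial>Q)"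
   unfolding UU_def by (rule Bochner_Integration.integral_add[symmetric]; rule mink_Q_integrable; rule h')
  also have "... = (\<integral>K. area (mink A (uminus ` K)) + area (mink B (uminus ` K)) \<partial>Q)"
   using area_mink_valuation[OF h(1,2) _ h(3)] by (intro Bochner_Integration.integral_cong refl) simp
  also have "... = UU A + UU B" unfolding UU_def by (rule Bochner_Integration.integral_add; rule mink_Q_integrable; rule h)
  finally have "UU (A \<union> B) + UU (A \<inter> B) = UU A + UU B" .
  moreover have "bb * (Lw (A \<union> B) / kap) + bb * (Lw (A \<inter> B) / kap) = bb * (Lw A / kap) + bb * (Lw B / kap)"
   using Lw_valuation[OF h] by (simp add: add_divide_distrib[symmetric] distrib_left[symmetric])
  ultimately show "G (A \<union> B) + G (A \<inter> B) = G A + G B" unfolding G_def using area_valuation[OF h(1-3)] by linarith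
 next
  fix A c assume A: "A \<in> KC"
  \<comment> \<open>Reflecting \<open>A\<close> amounts to rotating the grain by \<open>pi\<close>,
    which leaves its law unchanged.\<close>
  have "UU ((%x. c - x) ` A) = (\<integral>K. area (mink A (uminus ` rot pi ` K)) \<partial>Q)"
   unfolding UU_def using A by (intro Bochner_Integration.integral_cong refl) (simp add: area_mink_reflect rot_pi[abs_def])
  also have "... = UU A" unfolding UU_def by (rule rot_invariant[OF mink_Q_measurable[OF A]])
  finally show "G ((%x. c - x) ` A) = G A" unfolding G_def using Lw_cong[OF wd_reflect, of A c] A by simp
 next
  fix u w
  have "UU (mink (seg u) (seg w)) = (\<integral>K. area K + wd u K + wd w K + \<bar>cross w u\<bar> \<partial>Q)" unfolding UU_def
  proof (rule Bochner_Integration.integral_cong[OF refl])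
   fix K assume "K \<in> space Q"
   then have K: "K \<in> KC" by simp
   have "mink (mink (seg u) (seg w)) (uminus ` K) = mink (mink (uminus ` K) (seg u)) (seg w)"
    by (simp only: mink_assoc mink_commute[of "uminus ` K"])
   then show "area (mink (mink (seg u) (seg w)) (uminus ` K)) = area K + wd u K + wd w K + \<bar>cross w u\<bar>"
    using K by (simp add: area_mink_seg wd_mink wd_seg wd_uminus)
  qed
  also have "... = vv + norm u * bb + norm w * bb + \<bar>cross w u\<bar>"
   using area_integrable wd_integrable[of u] wd_integrable[of w] by (simp add: E_wd vv_eq)
  finally show "G (mink (seg u) (seg w)) = 0" using kap_pos by (simp add: G_def area_par Lw_mink Lw_seg field_simps)
 next
  fix P M assume h: "\<And>n. P n \<in> KC" "incseq P" "M \<in> KC" "\<And>n. P n \<subseteq> M" "M \<subseteq> closure (\<Union>n. P n)"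
  have "(%n. area (P n)) \<longlonglongrightarrow> area M" using h KC_D by (intro measure_incseq_convex) auto
  moreover have "(%n. UU (P n)) \<longlonglongrightarrow> UU M" unfolding UU_def
  proof (rule integral_dominated_convergence)
   show "integrable Q (%K. area (mink M (uminus ` K)))" by (rule mink_Q_integrable[OF h(3)])
   show "AE K in Q. (%n. area (mink (P n) (uminus ` K))) \<longlonglongrightarrow> area (mink M (uminus ` K))"
    by (rule AE_I2) (intro area_mink_incseq h KC_uminus, simp)
   show "AE K in Q. norm (area (mink (P n) (uminus ` K))) \<le> area (mink M (uminus ` K))" for n
   proof (rule AE_I2)
    fix K assume "K \<in> space Q"
    then have "K \<in> KC" by simp
    then have "area (mink (P n) (uminus ` K)) \<le> area (mink M (uminus ` K))"
     using h KC_D(1) by (intro area_mono mink_mono compact_sets_borel mink_compact compact_negations) auto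
    then show "norm (area (mink (P n) (uminus ` K))) \<le> area (mink M (uminus ` K))" by simp
   qed
  qed (rule mink_Q_measurable; rule h)+
  ultimately show "(%n. G (P n)) \<longlonglongrightarrow> G M"
   unfolding G_def using kap_pos by (intro tendsto_intros Lw_incseq h) auto
 qed
 show ?thesis using G_zero[OF M] by (simp add: G_def V1c_eq[OF M])
qed

text \<open>The hitting functional of the unit disc is evaluated twice: by \<open>UU_eq\<close>, and
  by the Steiner formula applied to the grain.\<close>

lemma bb_eq: "bb = 2 * mm / pi"
proof -
 have "UU (cball 0 1) = (\<integral>K. area K + 2 * V1c K + pi \<partial>Q)"
  unfolding UU_def using mink_cball_area[of _ 1] by (intro Bochner_Integration.integral_cong refl) simp
 also have "... = vv + 2 * mm + pi" using area_integrable V1c_integrable by (simp add: vv_eq mm_eq)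
 finally have "pi + bb * pi + vv = vv + 2 * mm + pi" using UU_eq[of "cball 0 1"] V1c_cball[of 1] by simp
 then show ?thesis by (simp add: field_simps)
qed

section \<open>Kinematic integrals over position and grain\<close>

abbreviation mu :: "(pt \<times> pt set) measure" where "mu \<equiv> lborel \<Otimes>\<^sub>M Q"

lemma rset_tg: "rset mu tg" unfolding tg_def by (intro rset_translation rset_compose[OF measurable_snd rset_Q]) simp

lemma space_mu: "space mu = UNIV \<times> KC" by (simp add: space_pair_measure)

lemma tg_cc: "p \<in> space mu ==> compact (tg p) \<and> convex (tg p)"
 unfolding tg_def space_mu using translate_KC by auto

lemma nn_mu:
 assumes "f \<in> borel_measurable mu"
 shows "(\<integral>\<^sup>+p. f p \<partial>mu) = (\<integral>\<^sup>+K. \<integral>\<^sup>+x. f (x, K) \<partial>lborel \<partial>Q)"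
proof -
 interpret pair_sigma_finite lborel Q ..
 show ?thesis using nn_integral_snd[OF assms] by simp
qed

lemma rset_M_tg: "M \<in> KC ==> rset mu (%p. M \<inter> tg p)" by (intro rset_Int rset_const rset_tg KC_D)

text \<open>\<open>T0\<close>, \<open>T2\<close> and \<open>T1\<close> describe how cutting with a
  random grain acts on Euler characteristic, area and boundary length. Their right sides again
  involve only these three quantities, which allows iteration over several grains.\<close>

lemma T0: assumes M: "M \<in> KC"
 shows "(\<integral>\<^sup>+p. ennreal (of_bool (M \<inter> tg p ~= {})) \<partial>mu) = ennreal (area M + bb * V1c M + vv)"
proof -
 have [measurable]: "{p \<in> space mu. M \<inter> tg p ~= {}} \<in> sets mu" by (rule rset_nonempty[OF rset_M_tg[OF M]])
 have "(\<integral>\<^sup>+p. ennreal (of_bool (M \<inter> tg p ~= {})) \<partial>mu) = (\<integral>\<^sup>+K. \<integral>\<^sup>+x. ennreal (of_bool (M \<inter> tg (x, K) ~= {})) \<partial>lborel \<partial>Q)"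
  by (rule nn_mu) (simp add: of_bool_def)
 also have "... = (\<integral>\<^sup>+K. ennreal (area (mink M (uminus ` K))) \<partial>Q)"
 proof (rule nn_integral_cong)
  fix K assume "K \<in> space Q"
  then have c: "compact (mink M (uminus ` K))" using M KC_D(1) by (intro mink_compact compact_negations) auto
  show "(\<integral>\<^sup>+x. ennreal (of_bool (M \<inter> tg (x, K) ~= {})) \<partial>lborel) = ennreal (area (mink M (uminus ` K)))"
   using nn_area[OF c] by (simp add: tg_def emeasure_area[OF c] of_bool_def if_distrib[of ennreal] cong: if_cong)
 qed
 also have "... = ennreal (UU M)" unfolding UU_def by (rule nn_integral_eq_integral[OF mink_Q_integrable[OF M]]) simp
 finally show ?thesis by (simp add: UU_eq[OF M])
qed

lemma T2: assumes M: "M \<in> KC"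
 shows "(\<integral>\<^sup>+p. ennreal (area (M \<inter> tg p)) \<partial>mu) = ennreal (vv * area M)"
proof -
 have "(\<integral>\<^sup>+p. ennreal (area (M \<inter> tg p)) \<partial>mu) = (\<integral>\<^sup>+K. \<integral>\<^sup>+x. ennreal (area (M \<inter> tg (x, K))) \<partial>lborel \<partial>Q)"
  by (rule nn_mu) (intro measurable_compose[OF rset_area[OF rset_M_tg[OF M]] measurable_ennreal])
 also have "... = (\<integral>\<^sup>+K. ennreal (area M * area K) \<partial>Q)"
 proof (rule nn_integral_cong)
  fix K assume "K \<in> space Q"
  then have K: "K \<in> KC" by simp
  show "(\<integral>\<^sup>+x. ennreal (area (M \<inter> tg (x, K))) \<partial>lborel) = ennreal (area M * area K)"
   using kin_area[OF M K] by (simp add: tg_def emeasure_area[OF compact_Int_tr[OF M K]] emeasure_compact[OF KC_D(1)[OF M]] emeasure_compact[OF KC_D(1)[OF K]] ennreal_mult)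
 qed
 also have "... = ennreal (\<integral>K. area M * area K \<partial>Q)" using area_integrable by (intro nn_integral_eq_integral) auto
 finally show ?thesis by (simp add: vv_eq mult.commute)
qed

lemma T1: assumes M: "M \<in> KC"
 shows "(\<integral>\<^sup>+p. ennreal (V1c (M \<inter> tg p)) \<partial>mu) = ennreal (vv * V1c M + mm * area M)"
proof -
 have "(\<integral>\<^sup>+p. ennreal (V1c (M \<inter> tg p)) \<partial>mu) = (\<integral>\<^sup>+K. \<integral>\<^sup>+x. ennreal (V1c (M \<inter> tg (x, K))) \<partial>lborel \<partial>Q)"
  using tg_cc KC_D(2)[OF M] by (intro nn_mu measurable_compose[OF rset_V1c[OF rset_M_tg[OF M]] measurable_ennreal]) (auto intro: convex_Int)
 also have "... = (\<integral>\<^sup>+K. ennreal (V1c M * area K + area M * V1c K) \<partial>Q)"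
  using kin_V1c[OF M] by (intro nn_integral_cong) (simp add: tg_def)
 also have "... = ennreal (\<integral>K. V1c M * area K + area M * V1c K \<partial>Q)"
  using area_integrable V1c_integrable V1c_nonneg M by (intro nn_integral_eq_integral) auto
 also have "(\<integral>K. V1c M * area K + area M * V1c K \<partial>Q) = vv * V1c M + mm * area M"
  using area_integrable V1c_integrable by (simp add: vv_eq mm_eq mult.commute)
 finally show ?thesis .
qed

end

section \<open>Factorial moments of the Poisson process\<close>

definition inj_tuples :: "nat => 'a set => (nat => 'a) set" where
 "inj_tuples k A = {t \<in> PiE {..<k} (%_. A). inj_on t {..<k}}"

lemma finite_inj_tuples: "finite A ==> finite (inj_tuples k A)"
 unfolding inj_tuples_def by (rule finite_subset[of _ "PiE {..<k} (%_. A)"]) (auto intro: finite_PiE)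

lemma card_inj_tuples: "finite A ==> card (inj_tuples k A) = (\<Prod>i<k. card A - i)"
proof (induction k)
 case 0
 then show ?case by (simp add: inj_tuples_def)
next
 case (Suc k)
 let ?S = "Sigma (inj_tuples k A) (%t. A - t ` {..<k})"
 have img: "inj_tuples (Suc k) A = (%(t, a). t(k := a)) ` ?S"
 proof (intro equalityI subsetI)
  fix t assume t: "t \<in> inj_tuples (Suc k) A"
  then have tP: "\<And>i. i < Suc k ==> t i \<in> A" "t \<in> extensional {..<Suc k}" and tj: "inj_on t {..<Suc k}"
   by (auto simp: inj_tuples_def PiE_def)
  define t' where "t' = restrict t {..<k}"
  have "t = t'(k := t k)" using tP(2) by (auto simp: t'_def extensional_def fun_eq_iff less_Suc_eq)
  moreover have "t' \<in> inj_tuples k A" using tP tj by (auto simp: t'_def inj_tuples_def inj_on_def)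
  moreover have "t k \<in> A - t' ` {..<k}" using tP(1)[of k] tj by (auto simp: t'_def lessThan_Suc)
  ultimately show "t \<in> (%(t, a). t(k := a)) ` ?S" by (metis (no_types, lifting) SigmaI case_prod_conv image_eqI)
 next
  fix t assume "t \<in> (%(t, a). t(k := a)) ` ?S"
  then obtain t' a where h: "t' \<in> inj_tuples k A" "a \<in> A" "a \<notin> t' ` {..<k}" "t = t'(k := a)" by auto
  then show "t \<in> inj_tuples (Suc k) A" by (auto simp: inj_tuples_def PiE_def extensional_def inj_on_def Pi_def less_Suc_eq) 
 qed
 have inj: "inj_on (%(t, a). t(k := a)) ?S"
 proof (rule inj_onI, clarify)
  fix t a t' a'
  assume h: "t \<in> inj_tuples k A" "t' \<in> inj_tuples k A" "t(k := a) = t'(k := a')"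
  have "t i = t' i" for i
  proof (cases "i = k")
   case True
   then show ?thesis using h(1,2) by (auto simp: inj_tuples_def PiE_def extensional_def)
  next
   case False then show ?thesis using h(3) by (metis fun_upd_other)
  qed
  then show "t = t' \<and> a = a'" using h(3) by (metis ext fun_upd_same)
 qed
 have "card (inj_tuples (Suc k) A) = card ?S" unfolding img by (rule card_image[OF inj])
 also have "... = (\<Sum>t\<in>inj_tuples k A. card (A - t ` {..<k}))" using Suc.prems by (intro card_SigmaI finite_inj_tuples) auto
 also have "... = (\<Sum>t\<in>inj_tuples k A. card A - k)"
 proof (rule sum.cong[OF refl])
  fix t assume "t \<in> inj_tuples k A"
  then have "t ` {..<k} \<subseteq> A" "inj_on t {..<k}" by (auto simp: inj_tuples_def)
  then show "card (A - t ` {..<k}) = card A - k" using Suc.prems by (simp add: card_Diff_subset card_image)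
 qed
 finally show ?case using Suc by (simp add: mult.commute)
qed

lemma inj_tuples_image:
 assumes "t \<in> inj_tuples k A" shows "t ` {..<k} \<subseteq> A" "card (t ` {..<k}) = k" "inj_on t {..<k}"
 using assms by (auto simp: inj_tuples_def card_image)

lemma sum_inj_tuples:
 fixes g :: "'a set => 'b::semiring_1"
 assumes A: "finite A"
 shows "(\<Sum>t\<in>inj_tuples k A. g (t ` {..<k})) = of_nat (fact k) * (\<Sum>I\<in>{I. I \<subseteq> A \<and> card I = k}. g I)"
proof -
 have fin: "finite {I. I \<subseteq> A \<and> card I = k}" using A by (auto intro: finite_subset[of _ "Pow A"])
 have "(\<Sum>t\<in>inj_tuples k A. g (t ` {..<k})) = (\<Sum>I\<in>{I. I \<subseteq> A \<and> card I = k}. \<Sum>t\<in>{t \<in> inj_tuples k A. t ` {..<k} = I}. g (t ` {..<k}))"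
  by (rule sum.group[symmetric, OF finite_inj_tuples[OF A] fin]) (use inj_tuples_image in blast)
 also have "... = (\<Sum>I\<in>{I. I \<subseteq> A \<and> card I = k}. of_nat (fact k) * g I)"
 proof (rule sum.cong[OF refl])
  fix I assume "I \<in> {I. I \<subseteq> A \<and> card I = k}"
  then have I: "I \<subseteq> A" "card I = k" "finite I" using A finite_subset by auto
  have "{t \<in> inj_tuples k A. t ` {..<k} = I} = inj_tuples k I"
  proof (intro equalityI subsetI)
   fix t assume "t \<in> inj_tuples k I"
   then have t: "t \<in> PiE {..<k} (%_. I)" "inj_on t {..<k}" by (auto simp: inj_tuples_def)
   then have "t ` {..<k} \<subseteq> I" "card (t ` {..<k}) = k" by (auto simp: card_image)
   then have "t ` {..<k} = I" using I by (intro card_subset_eq) auto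
   moreover have "t \<in> PiE {..<k} (%_. A)" using t(1) I(1) by (auto simp: PiE_def Pi_def)
   ultimately show "t \<in> {t \<in> inj_tuples k A. t ` {..<k} = I}" using t by (simp add: inj_tuples_def)
  qed (auto simp: inj_tuples_def PiE_def Pi_def)
  then have "card {t \<in> inj_tuples k A. t ` {..<k} = I} = (\<Prod>i<k. k - i)" using card_inj_tuples[OF I(3), of k] I(2) by simp
  also have "... = fact k" by (simp add: fact_prod_rev lessThan_atLeast0)
  finally have c: "card {t \<in> inj_tuples k A. t ` {..<k} = I} = fact k" .
  have "(\<Sum>t\<in>{t \<in> inj_tuples k A. t ` {..<k} = I}. g (t ` {..<k})) = (\<Sum>t\<in>{t \<in> inj_tuples k A. t ` {..<k} = I}. g I)"
   by (rule sum.cong) auto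
  also have "... = of_nat (fact k) * g I" by (simp only: sum_constant c)
  finally show "(\<Sum>t\<in>{t \<in> inj_tuples k A. t ` {..<k} = I}. g (t ` {..<k})) = of_nat (fact k) * g I" .
 qed
 finally show ?thesis by (simp only: sum_distrib_left)
qed

lemma poisson_sums: "(%n. poisson_prob l n) sums 1"
proof -
 have "(%n. exp (- l) * (l ^ n /\<^sub>R fact n)) sums (exp (- l) * exp l)" by (intro sums_mult exp_converges)
 then show ?thesis by (simp add: poisson_prob_def exp_minus divide_inverse mult_ac)
qed

text \<open>The assumed events include finiteness, whereas \<open>card\<close> of an infinite set is
  0. Positive values force finiteness, and the event of value 0 is the complement of all the
  others.\<close>

lemma card_Int_measurable:
 assumes E: "\<And>n. {\<phi> \<in> space P. finite (\<phi> \<inter> B) \<and> card (\<phi> \<inter> B) = n} \<in> sets P"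
 shows "(%\<phi>. card (\<phi> \<inter> B)) \<in> measurable P (count_space UNIV)"
proof -
 have pos: "{\<phi> \<in> space P. card (\<phi> \<inter> B) = Suc n} \<in> sets P" for n
 proof -
  have "finite X" if "card X = Suc n" for X :: "'a set" using that card_ge_0_finite[of X] by simp
  then have "{\<phi> \<in> space P. card (\<phi> \<inter> B) = Suc n} = {\<phi> \<in> space P. finite (\<phi> \<inter> B) \<and> card (\<phi> \<inter> B) = Suc n}" by blast
  then show ?thesis using E by simp
 qed
 have "(%\<phi>. card (\<phi> \<inter> B)) -` {n} \<inter> space P \<in> sets P" for n
 proof -
  have eq: "(%\<phi>. card (\<phi> \<inter> B)) -` {n} \<inter> space P = {\<phi> \<in> space P. card (\<phi> \<inter> B) = n}" by auto
  show ?thesis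
  proof (cases n)
   case 0
   have "{\<phi> \<in> space P. card (\<phi> \<inter> B) = 0} = space P - (\<Union>n. {\<phi> \<in> space P. card (\<phi> \<inter> B) = Suc n})"
    by (auto simp: gr0_conv_Suc[symmetric])
   also have "... \<in> sets P" using pos by (intro sets.Diff sets.countable_UN) auto
   finally show ?thesis unfolding eq using 0 by simp
  next
   case (Suc m) then show ?thesis unfolding eq using pos[of m] by simp
  qed
 qed
 then show ?thesis by (simp add: measurable_count_space_eq2_countable)
qed

locale bmodel = grains +
 fixes \<gamma> :: real and P :: "(pt \<times> pt set) set measure"
 assumes gam: "\<gamma> > 0" and bm: "bm_law \<gamma> Q P"
begin

sublocale P: prob_space P using bm by (simp add: bm_law_def)

lemma space_P: "space P = {\<phi>. \<phi> \<subseteq> UNIV \<times> KC}" using bm by (simp add: bm_law_def)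

lemma count_event:
 assumes "B \<in> sets mu" "emeasure mu B < \<infinity>"
 shows "{\<phi> \<in> space P. finite (\<phi> \<inter> B) \<and> card (\<phi> \<inter> B) = n} \<in> sets P"
  and "measure P {\<phi> \<in> space P. finite (\<phi> \<inter> B) \<and> card (\<phi> \<inter> B) = n} = poisson_prob (\<gamma> * measure mu B) n"
 using bm assms unfolding bm_law_def by blast+

lemma count_indep:
 assumes "\<And>i. i < k ==> A i \<in> sets mu" "\<And>i. i < k ==> emeasure mu (A i) < \<infinity>" "disjoint_family_on A {..<k}"
 shows "P.indep_vars (%_. count_space UNIV) (%i \<phi>. card (\<phi> \<inter> A i)) {..<(k::nat)}"
proof -
 have "\<forall>(k::nat) (B :: nat => (pt \<times> pt set) set).
    (\<forall>i<k. B i \<in> sets mu \<and> emeasure mu (B i) < \<infinity>) \<and> disjoint_family_on B {..<k} -->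
    prob_space.indep_vars P (%_. count_space UNIV) (%i \<phi>. card (\<phi> \<inter> B i)) {..<k}"
  using bm unfolding bm_law_def by (elim conjE)
 then show ?thesis using assms by blast
qed

context
 fixes B assumes B: "B \<in> sets mu" and Bfin: "emeasure mu B < \<infinity>"
begin

definition Fin where "Fin = {\<phi> \<in> space P. finite (\<phi> \<inter> B)}"

lemma Fin_sets [measurable]: "Fin \<in> sets P"
proof -
 have "Fin = (\<Union>n. {\<phi> \<in> space P. finite (\<phi> \<inter> B) \<and> card (\<phi> \<inter> B) = n})" by (auto simp: Fin_def)
 also have "... \<in> sets P" using count_event(1)[OF B Bfin] by (intro sets.countable_UN) auto
 finally show ?thesis .
qed

lemma sub_fin: "A \<in> sets mu ==> A \<subseteq> B ==> emeasure mu A < \<infinity>"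
 using emeasure_mono[of A B mu] B Bfin by (simp add: le_less_trans)

lemma prob_Fin: "measure P Fin = 1"
proof -
 let ?E = "%n. {\<phi> \<in> space P. finite (\<phi> \<inter> B) \<and> card (\<phi> \<inter> B) = n}"
 have "(%n. measure P (?E n)) sums measure P (\<Union>n. ?E n)"
  using count_event(1)[OF B Bfin] by (intro P.finite_measure_UNION) (auto simp: disjoint_family_on_def)
 moreover have "(\<Union>n. ?E n) = Fin" by (auto simp: Fin_def)
 ultimately have "(%n. poisson_prob (\<gamma> * measure mu B) n) sums measure P Fin" using count_event(2)[OF B Bfin] by simp
 then show ?thesis using poisson_sums sums_unique2 by blast
qed

lemma AE_Fin: "AE \<phi> in P. \<phi> \<in> Fin" using P.AE_in_set_eq_1[OF Fin_sets] prob_Fin by simp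

lemma count_measurable:
 assumes A: "A \<in> sets mu" "A \<subseteq> B"
 shows "(%\<phi>. card (\<phi> \<inter> A)) \<in> measurable P (count_space UNIV)"
 by (rule card_Int_measurable[OF count_event(1)[OF A(1) sub_fin[OF A]]])

lemma E_count:
 assumes A: "A \<in> sets mu" "A \<subseteq> B"
 shows "(\<integral>\<^sup>+\<phi>. of_nat (card (\<phi> \<inter> A)) \<partial>P) = ennreal \<gamma> * emeasure mu A"
proof -
 define l where "l = \<gamma> * measure mu A"
 have l: "l \<ge> 0" using gam by (simp add: l_def)
 have Am: "emeasure mu A = ennreal (measure mu A)" using sub_fin[OF A] by (intro emeasure_eq_ennreal_measure) auto
 let ?E = "%n. {\<phi> \<in> space P. finite (\<phi> \<inter> A) \<and> card (\<phi> \<inter> A) = n}"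
 have Em [measurable]: "?E n \<in> sets P" for n by (rule count_event(1)[OF A(1) sub_fin[OF A]])
 have "(\<integral>\<^sup>+\<phi>. of_nat (card (\<phi> \<inter> A)) \<partial>P) = (\<integral>\<^sup>+\<phi>. (\<Sum>n. of_nat n * indicator (?E n) \<phi>) \<partial>P)"
 proof (rule nn_integral_cong)
  fix \<phi> assume \<phi>: "\<phi> \<in> space P"
  show "of_nat (card (\<phi> \<inter> A)) = (\<Sum>n. of_nat n * (indicator (?E n) \<phi> :: ennreal))"
  proof (subst suminf_finite[of "{card (\<phi> \<inter> A)}"])
   show "of_nat (card (\<phi> \<inter> A)) = (\<Sum>n\<in>{card (\<phi> \<inter> A)}. of_nat n * (indicator (?E n) \<phi> :: ennreal))"
    using \<phi> by (cases "finite (\<phi> \<inter> A)") auto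
  qed auto
 qed
 also have "... = (\<Sum>n. of_nat n * emeasure P (?E n))" by (simp add: nn_integral_suminf nn_integral_cmult)
 also have "... = (\<Sum>n. ennreal (real n * poisson_prob l n))"
 proof (rule arg_cong[where f = suminf], rule ext)
  fix n
  have "emeasure P (?E n) = ennreal (poisson_prob l n)" unfolding P.emeasure_eq_measure count_event(2)[OF A(1) sub_fin[OF A]] l_def ..
  then show "of_nat n * emeasure P (?E n) = ennreal (real n * poisson_prob l n)"
   by (simp only: ennreal_of_nat_eq_real_of_nat) (simp add: ennreal_mult')
 qed
 also have "... = ennreal l"
 proof -
  have "(%n. real (Suc n) * poisson_prob l (Suc n)) sums (l * 1)"
  proof -
   have "real (Suc n) * poisson_prob l (Suc n) = l * poisson_prob l n" for n by (simp add: poisson_prob_def divide_simps del: of_nat_Suc)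
   then show ?thesis using sums_mult[OF poisson_sums[of l], of l] by simp
  qed
  then have "(%n. real n * poisson_prob l n) sums l" by (subst (asm) sums_Suc_iff) simp
  then show ?thesis using l by (intro suminf_ennreal_eq) (auto simp: poisson_prob_def)
 qed
 finally show ?thesis using gam by (simp add: Am l_def ennreal_mult)
qed

section \<open>Sums over tuples of Poisson points in a set of finite intensity\<close>

definition nu where "nu = density mu (%p. ennreal \<gamma> * indicator B p)"

lemma sets_nu [simp, measurable_cong]: "sets nu = sets mu" by (simp add: nu_def)

lemma space_nu [simp]: "space nu = space mu" by (simp add: nu_def)

lemma emeasure_nu: "A \<in> sets mu ==> emeasure nu A = ennreal \<gamma> * emeasure mu (A \<inter> B)"
 unfolding nu_def using B
 by (subst emeasure_density) (auto simp: nn_integral_cmult mult.assoc indicator_inter_arith[symmetric] Int_commute)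

lemma finite_nu: "finite_measure nu"
proof
 have "emeasure nu (space nu) = ennreal \<gamma> * emeasure mu (space mu \<inter> B)" using emeasure_nu[OF sets.top] by simp
 also have "space mu \<inter> B = B" using sets.sets_into_space[OF B] by blast
 finally show "emeasure nu (space nu) ~= \<infinity>" using Bfin by (simp add: ennreal_mult_eq_top_iff)
qed

interpretation nu: finite_measure nu by (rule finite_nu)
interpretation NU: product_sigma_finite "%_ :: nat. nu" ..

abbreviation NN :: "nat => (nat => pt \<times> pt set) measure" where "NN k \<equiv> PiM {..<k} (%_. nu)"

text \<open>The sum of \<open>F\<close> over all tuples of points in \<open>B\<close>, repetitions
  included; the value is 0 where infinitely many points lie in \<open>B\<close>, so that only finite
  sums occur.\<close>

definition Sg :: "nat => ((nat => pt \<times> pt set) => ennreal) => (pt \<times> pt set) set => ennreal" where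
 "Sg k F \<phi> = indicator Fin \<phi> * (\<integral>\<^sup>+t. F t \<partial>count_space (PiE {..<k} (%_. \<phi> \<inter> B)))"

text \<open>The multivariate Campbell formula for \<open>F\<close>. It fails for functions that see
  tuples with repeated points, so it is proved for functions supported on ever larger sets of
  separated tuples.\<close>

definition good :: "nat => ((nat => pt \<times> pt set) => ennreal) => bool" where
 "good k F \<longleftrightarrow> Sg k F \<in> borel_measurable P \<and> (\<integral>\<^sup>+\<phi>. Sg k F \<phi> \<partial>P) = (\<integral>\<^sup>+t. F t \<partial>NN k)"

lemma good_cong:
 assumes "\<And>t. t \<in> space (NN k) ==> F t = G t" "good k G" shows "good k F"
proof -
 have sub: "PiE {..<k} (%_. \<phi> \<inter> B) \<subseteq> space (NN k)" for \<phi>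
  using sets.sets_into_space[OF B] by (auto simp: space_PiM PiE_def Pi_def)
 have "Sg k F \<phi> = Sg k G \<phi>" for \<phi>
  unfolding Sg_def using sub[of \<phi>] assms(1) by (intro arg_cong2[where f = "(*)"] refl nn_integral_cong) auto
 then have "Sg k F = Sg k G" by (rule ext)
 moreover have "(\<integral>\<^sup>+t. F t \<partial>NN k) = (\<integral>\<^sup>+t. G t \<partial>NN k)" using assms(1) by (rule nn_integral_cong)
 ultimately show ?thesis using assms(2) by (simp add: good_def)
qed

lemma good_cmult:
 assumes "good k F" "F \<in> borel_measurable (NN k)" shows "good k (%t. c * F t)"
proof -
 have "Sg k (%t. c * F t) = (%\<phi>. c * Sg k F \<phi>)" by (auto simp: Sg_def nn_integral_cmult mult.left_commute)
 moreover have m: "Sg k F \<in> borel_measurable P" using assms by (simp add: good_def)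
 moreover from m have "(%\<phi>. c * Sg k F \<phi>) \<in> borel_measurable P" by measurable
 ultimately show ?thesis using assms by (simp add: good_def nn_integral_cmult)
qed

lemma good_add:
 assumes "good k F" "F \<in> borel_measurable (NN k)" "good k G" "G \<in> borel_measurable (NN k)"
 shows "good k (%t. F t + G t)"
proof -
 have "Sg k (%t. F t + G t) = (%\<phi>. Sg k F \<phi> + Sg k G \<phi>)"
  by (auto simp: Sg_def nn_integral_add distrib_left)
 moreover have m: "Sg k F \<in> borel_measurable P" "Sg k G \<in> borel_measurable P" using assms by (simp_all add: good_def)
 moreover from m have "(%\<phi>. Sg k F \<phi> + Sg k G \<phi>) \<in> borel_measurable P" by measurable
 ultimately show ?thesis using assms by (simp add: good_def nn_integral_add)
qed

lemma good_sum:
 assumes "finite J" "\<And>j. j \<in> J ==> good k (F j)" "\<And>j. j \<in> J ==> F j \<in> borel_measurable (NN k)"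
 shows "good k (%t. \<Sum>j\<in>J. F j t)" using assms
proof (induction J)
 case empty
 have "Sg k (%t. 0) = (%\<phi>. 0)" by (auto simp: Sg_def)
 then show ?case by (simp add: good_def)
next
 case (insert j J)
 then have "good k (%t. F j t + (\<Sum>j\<in>J. F j t))" by (intro good_add) (auto intro!: borel_measurable_sum)
 then show ?case using insert by simp
qed

lemma good_SUP:
 assumes "\<And>i :: nat. good k (U i)" "\<And>i. U i \<in> borel_measurable (NN k)" "incseq U"
 shows "good k (SUP i. U i)"
proof -
 have inc: "incseq (%i. Sg k (U i))"
  using assms(3) by (auto simp: Sg_def incseq_def le_fun_def intro!: mult_left_mono nn_integral_mono)
 have S: "Sg k (SUP i. U i) = (SUP i. Sg k (U i))"
 proof
  fix \<phi>
  have "(\<integral>\<^sup>+t. (SUP i. U i) t \<partial>count_space (PiE {..<k} (%_. \<phi> \<inter> B))) = (\<integral>\<^sup>+t. (SUP i. U i t) \<partial>count_space (PiE {..<k} (%_. \<phi> \<inter> B)))"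
   by (simp add: image_comp)
  also have "... = (SUP i. \<integral>\<^sup>+t. U i t \<partial>count_space (PiE {..<k} (%_. \<phi> \<inter> B)))"
   using assms(3) by (intro nn_integral_monotone_convergence_SUP) auto
  finally show "Sg k (SUP i. U i) \<phi> = (SUP i. Sg k (U i)) \<phi>" by (simp add: Sg_def SUP_mult_left_ennreal image_comp)
 qed
 have "(\<integral>\<^sup>+\<phi>. (SUP i. Sg k (U i)) \<phi> \<partial>P) = (\<integral>\<^sup>+\<phi>. (SUP i. Sg k (U i) \<phi>) \<partial>P)" by (simp add: image_comp)
 also have "... = (SUP i. \<integral>\<^sup>+\<phi>. Sg k (U i) \<phi> \<partial>P)"
  using assms(1) inc by (intro nn_integral_monotone_convergence_SUP) (auto simp: good_def)
 also have "... = (SUP i. \<integral>\<^sup>+t. U i t \<partial>NN k)" using assms(1) by (simp add: good_def)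
 also have "... = (\<integral>\<^sup>+t. (SUP i. U i t) \<partial>NN k)"
  using assms(2,3) by (intro nn_integral_monotone_convergence_SUP[symmetric]) auto
 also have "... = (\<integral>\<^sup>+t. (SUP i. U i) t \<partial>NN k)" by (simp add: image_comp)
 finally have "(\<integral>\<^sup>+\<phi>. (SUP i. Sg k (U i)) \<phi> \<partial>P) = (\<integral>\<^sup>+t. (SUP i. U i) t \<partial>NN k)" .
 moreover have "(SUP i. Sg k (U i)) \<in> borel_measurable P"
 proof -
  have m: "Sg k (U i) \<in> borel_measurable P" for i using assms(1) by (simp add: good_def)
  have "(SUP i. Sg k (U i)) = (%\<phi>. SUP i. Sg k (U i) \<phi>)" by (simp add: fun_eq_iff image_comp)
  also have "... \<in> borel_measurable P" using m by measurable
  finally show ?thesis .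
 qed
 ultimately show ?thesis unfolding good_def S by blast
qed

text \<open>On a product of disjoint sets the sum over tuples is the product of the counts, and
  these are independent with means given by \<open>nu\<close>.\<close>

lemma good_rect:
 assumes A: "\<And>i. i < k ==> A i \<in> sets mu" "\<And>i. i < k ==> A i \<subseteq> B" and d: "disjoint_family_on A {..<k}"
 shows "good k (indicator (PiE {..<k} A))"
proof -
 have m: "(%\<phi>. of_nat (card (\<phi> \<inter> A i)) :: ennreal) \<in> borel_measurable P" if "i < k" for i
  using measurable_compose[OF count_measurable[OF A[OF that]], of "of_nat :: nat => ennreal" borel] by simp
 have S: "Sg k (indicator (PiE {..<k} A)) \<phi> = indicator Fin \<phi> * (\<Prod>i<k. of_nat (card (\<phi> \<inter> A i)))" for \<phi>
 proof (cases "\<phi> \<in> Fin")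
  case True
  let ?X = "PiE {..<k} (%_. \<phi> \<inter> B)"
  have X: "finite ?X" using True by (auto simp: Fin_def intro: finite_PiE)
  have i: "?X \<inter> PiE {..<k} A = PiE {..<k} (%i. \<phi> \<inter> A i)" using A(2) by (auto simp: PiE_def Pi_def)
  have "(\<integral>\<^sup>+t. indicator (PiE {..<k} A) t \<partial>count_space ?X) = (\<integral>\<^sup>+t. indicator (?X \<inter> PiE {..<k} A) t \<partial>count_space ?X)"
   by (intro nn_integral_cong) (auto simp: indicator_def)
  also have "... = emeasure (count_space ?X) (?X \<inter> PiE {..<k} A)" by simp
  also have "... = of_nat (card (?X \<inter> PiE {..<k} A))" using X by (simp add: emeasure_count_space)
  also have "... = (\<Prod>i<k. of_nat (card (\<phi> \<inter> A i)))" unfolding i by (simp add: card_PiE)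
  finally show ?thesis by (simp add: Sg_def)
 qed (simp add: Sg_def)
 have "(\<integral>\<^sup>+\<phi>. Sg k (indicator (PiE {..<k} A)) \<phi> \<partial>P) = (\<integral>\<^sup>+\<phi>. (\<Prod>i<k. of_nat (card (\<phi> \<inter> A i))) \<partial>P)"
  unfolding S using AE_Fin by (intro nn_integral_cong_AE) auto
 also have "... = (\<Prod>i<k. \<integral>\<^sup>+\<phi>. of_nat (card (\<phi> \<inter> A i)) \<partial>P)"
 proof (rule P.indep_vars_nn_integral)
  have "P.indep_vars (%_. count_space UNIV) (%i \<phi>. card (\<phi> \<inter> A i)) {..<k}"
   using A d sub_fin by (intro count_indep) auto
  then show "P.indep_vars (%_. borel) (%i \<phi>. of_nat (card (\<phi> \<inter> A i)) :: ennreal) {..<k}"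
   by (rule P.indep_vars_compose2) simp
 qed auto
 also have "... = (\<Prod>i<k. emeasure nu (A i))"
 proof (rule prod.cong[OF refl])
  fix i assume "i \<in> {..<k}"
  then have "A i \<inter> B = A i" "A i \<in> sets mu" "A i \<subseteq> B" using A by auto
  then show "(\<integral>\<^sup>+\<phi>. of_nat (card (\<phi> \<inter> A i)) \<partial>P) = emeasure nu (A i)" by (simp add: E_count emeasure_nu)
 qed
 also have "... = emeasure (NN k) (PiE {..<k} A)" using A by (intro NU.emeasure_PiM[symmetric]) auto
 finally have "(\<integral>\<^sup>+\<phi>. Sg k (indicator (PiE {..<k} A)) \<phi> \<partial>P) = (\<integral>\<^sup>+t. indicator (PiE {..<k} A) t \<partial>NN k)"
  using A by (subst nn_integral_indicator) (auto intro!: sets_PiM_I_finite)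
 moreover have "Sg k (indicator (PiE {..<k} A)) \<in> borel_measurable P"
  unfolding S[abs_def] using m by (intro borel_measurable_times_ennreal borel_measurable_prod_ennreal) auto
 ultimately show ?thesis by (simp add: good_def)
qed

text \<open>A Dynkin argument inside a fixed product of disjoint sets, because independence is given
  for disjoint sets only. A measurable rectangle cut with this product again has disjoint
  factors.\<close>

lemma good_set:
 assumes C: "\<And>i. i < k ==> C i \<in> sets mu" "\<And>i. i < k ==> C i \<subseteq> B" and d: "disjoint_family_on C {..<k}"
  and D: "D \<in> sets (NN k)"
 shows "good k (indicator (D \<inter> PiE {..<k} C))"
proof -
 have Cs: "PiE {..<k} C \<in> sets (NN k)" using C by (intro sets_PiM_I_finite) auto
 have gC: "good k (indicator (PiE {..<k} C))" by (rule good_rect[OF C d])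
 have finC: "emeasure (NN k) (PiE {..<k} C) < \<infinity>"
  using C by (subst NU.emeasure_PiM) (auto simp: top.not_eq_extremum[symmetric] ennreal_prod_eq_top nu.emeasure_finite)
 have "D \<in> sigma_sets (\<Pi>\<^sub>E i\<in>{..<k}. space nu) (prod_algebra {..<k} (%_. nu))" using D by (simp add: sets_PiM)
 with Int_stable_prod_algebra prod_algebra_sets_into_space show ?thesis
 proof (induction D rule: sigma_sets_induct_disjoint)
  case (basic A)
  then obtain X where X: "A = PiE {..<k} X" "X \<in> {..<k} \<rightarrow> sets nu" by (auto simp: prod_algebra_eq_finite)
  have "disjoint_family_on (%i. X i \<inter> C i) {..<k}" using d unfolding disjoint_family_on_def by blast
  then have "good k (indicator (PiE {..<k} (%i. X i \<inter> C i)))" using X C by (intro good_rect) auto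
  moreover have "PiE {..<k} (%i. X i \<inter> C i) = A \<inter> PiE {..<k} C" unfolding X(1) by (auto simp: PiE_def Pi_def)
  ultimately show ?case by simp
 next
  case empty
  have "Sg k (%_. 0) = (%\<phi>. 0)" by (auto simp: Sg_def)
  then show ?case by (simp add: good_def)
 next
  case (compl A)
  have As: "A \<in> sets (NN k)" using compl(1) by (simp add: sets_PiM)
  let ?I = "indicator (A \<inter> PiE {..<k} C) :: _ => ennreal" and ?J = "indicator (((\<Pi>\<^sub>E i\<in>{..<k}. space nu) - A) \<inter> PiE {..<k} C) :: _ => ennreal"
  have sp: "PiE {..<k} C \<subseteq> (\<Pi>\<^sub>E i\<in>{..<k}. space nu)" using sets.sets_into_space[OF Cs] by (simp add: space_PiM)
  have sum: "indicator (PiE {..<k} C) t = ?I t + ?J t" for t using sp by (auto simp: indicator_def)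
  have SC: "Sg k (indicator (PiE {..<k} C)) \<phi> = Sg k ?I \<phi> + Sg k ?J \<phi>" for \<phi>
   by (simp add: Sg_def sum nn_integral_add distrib_left)
  \<comment> \<open>Finiteness permits the sum for the complement to be obtained by subtraction in
    the extended reals.\<close>
  have SIf: "Sg k ?I \<phi> < \<infinity>" for \<phi>
  proof (cases "\<phi> \<in> Fin")
   case True
   then have "finite (PiE {..<k} (%_. \<phi> \<inter> B))" by (auto simp: Fin_def intro: finite_PiE)
   have "Sg k ?I \<phi> = (\<integral>\<^sup>+t. ?I t \<partial>count_space (PiE {..<k} (%_. \<phi> \<inter> B)))"
    using True by (simp add: Sg_def)
   also have "... \<le> (\<integral>\<^sup>+t. 1 \<partial>count_space (PiE {..<k} (%_. \<phi> \<inter> B)))"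
    by (intro nn_integral_mono) (auto simp: indicator_def)
   also have "... < \<infinity>" using \<open>finite (PiE {..<k} (%_. \<phi> \<inter> B))\<close> by (simp add: emeasure_count_space of_nat_less_top)
   finally show ?thesis .
  qed (simp add: Sg_def)
  have SJ: "Sg k ?J = (%\<phi>. Sg k (indicator (PiE {..<k} C)) \<phi> - Sg k ?I \<phi>)"
   using SIf by (auto simp: SC ennreal_add_diff_cancel_left less_top[symmetric])
  have mI: "Sg k ?I \<in> borel_measurable P" and mC: "Sg k (indicator (PiE {..<k} C)) \<in> borel_measurable P"
   using compl(2) gC by (auto simp: good_def)
  have mJ: "Sg k ?J \<in> borel_measurable P" unfolding SJ using mI mC by measurable
  have "(\<integral>\<^sup>+\<phi>. Sg k ?I \<phi> \<partial>P) + (\<integral>\<^sup>+\<phi>. Sg k ?J \<phi> \<partial>P) = (\<integral>\<^sup>+\<phi>. Sg k (indicator (PiE {..<k} C)) \<phi> \<partial>P)"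
   unfolding SC by (rule nn_integral_add[symmetric, OF mI mJ])
  also have "... = (\<integral>\<^sup>+t. indicator (PiE {..<k} C) t \<partial>NN k)" using gC by (simp add: good_def)
  also have "... = (\<integral>\<^sup>+t. ?I t \<partial>NN k) + (\<integral>\<^sup>+t. ?J t \<partial>NN k)"
  proof -
   have "((\<Pi>\<^sub>E i\<in>{..<k}. space nu) - A) \<in> sets (NN k)" using sets.compl_sets[OF As] by (simp add: space_PiM)
   then show ?thesis unfolding sum using As Cs by (intro nn_integral_add) auto
  qed
  also have "(\<integral>\<^sup>+t. ?I t \<partial>NN k) = (\<integral>\<^sup>+\<phi>. Sg k ?I \<phi> \<partial>P)" using compl(2) by (simp add: good_def)
  finally have "(\<integral>\<^sup>+\<phi>. Sg k ?I \<phi> \<partial>P) + (\<integral>\<^sup>+\<phi>. Sg k ?J \<phi> \<partial>P) = (\<integral>\<^sup>+\<phi>. Sg k ?I \<phi> \<partial>P) + (\<integral>\<^sup>+t. ?J t \<partial>NN k)" .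
  moreover have "(\<integral>\<^sup>+\<phi>. Sg k ?I \<phi> \<partial>P) ~= top"
  proof -
   have "(\<integral>\<^sup>+\<phi>. Sg k ?I \<phi> \<partial>P) = (\<integral>\<^sup>+t. ?I t \<partial>NN k)" using compl(2) by (simp add: good_def)
   also have "... \<le> (\<integral>\<^sup>+t. indicator (PiE {..<k} C) t \<partial>NN k)" by (intro nn_integral_mono) (auto simp: indicator_def)
   also have "... = emeasure (NN k) (PiE {..<k} C)" using Cs by simp
   finally show ?thesis using finC by (auto simp: top_unique)
  qed
  ultimately have "(\<integral>\<^sup>+\<phi>. Sg k ?J \<phi> \<partial>P) = (\<integral>\<^sup>+t. ?J t \<partial>NN k)" by (simp add: ennreal_add_left_cancel)
  then show ?case using mJ by (simp add: good_def)
 next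
  case (union A)
  have As: "A i \<in> sets (NN k)" for i using union(2) by (auto simp: sets_PiM)
  have suminf: "indicator ((\<Union>i. A i) \<inter> PiE {..<k} C) t = (\<Sum>i. indicator (A i \<inter> PiE {..<k} C) t :: ennreal)" for t
  proof -
   have "disjoint_family (%i. A i \<inter> PiE {..<k} C)" using union(1) by (auto simp: disjoint_family_on_def)
   from suminf_indicator[OF this, of t] show ?thesis by (simp add: Int_commute Int_UN_distrib2)
  qed
  have S: "Sg k (indicator ((\<Union>i. A i) \<inter> PiE {..<k} C)) \<phi> = (\<Sum>i. Sg k (indicator (A i \<inter> PiE {..<k} C)) \<phi>)" for \<phi>
   by (simp add: Sg_def suminf nn_integral_suminf)
  have m: "Sg k (indicator (A i \<inter> PiE {..<k} C)) \<in> borel_measurable P" for i using union(3) by (simp add: good_def)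
  have "(\<integral>\<^sup>+\<phi>. Sg k (indicator ((\<Union>i. A i) \<inter> PiE {..<k} C)) \<phi> \<partial>P) = (\<Sum>i. \<integral>\<^sup>+\<phi>. Sg k (indicator (A i \<inter> PiE {..<k} C)) \<phi> \<partial>P)"
   unfolding S by (rule nn_integral_suminf[OF m])
  also have "... = (\<Sum>i. \<integral>\<^sup>+t. indicator (A i \<inter> PiE {..<k} C) t \<partial>NN k)" using union(3) by (simp add: good_def)
  also have "... = (\<integral>\<^sup>+t. indicator ((\<Union>i. A i) \<inter> PiE {..<k} C) t \<partial>NN k)"
   unfolding suminf using As Cs by (intro nn_integral_suminf[symmetric]) auto
  finally have "(\<integral>\<^sup>+\<phi>. Sg k (indicator ((\<Union>i. A i) \<inter> PiE {..<k} C)) \<phi> \<partial>P) = (\<integral>\<^sup>+t. indicator ((\<Union>i. A i) \<inter> PiE {..<k} C) t \<partial>NN k)" .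
  moreover have "Sg k (indicator ((\<Union>i. A i) \<inter> PiE {..<k} C)) \<in> borel_measurable P"
   unfolding S[abs_def] using m by measurable
  ultimately show ?case by (simp add: good_def)
 qed
qed

lemma good_cells:
 assumes C: "\<And>i. i < k ==> C i \<in> sets mu" "\<And>i. i < k ==> C i \<subseteq> B" and d: "disjoint_family_on C {..<k}"
  and F: "F \<in> borel_measurable (NN k)"
 shows "good k (%t. F t * indicator (PiE {..<k} C) t)"
proof -
 have Cs [measurable]: "PiE {..<k} C \<in> sets (NN k)" using C by (intro sets_PiM_I_finite) auto
 show ?thesis using F
 proof (induction F rule: borel_measurable_induct)
  case (cong f g) then show ?case by (intro good_cong[OF _ cong(4)]) simp
 next
  case (set A)
  then show ?case using good_set[OF C d set] by (simp add: indicator_inter_arith[symmetric])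
 next
  case (mult u c)
  then have "good k (%t. c * (u t * indicator (PiE {..<k} C) t))" by (intro good_cmult) auto
  then show ?case by (simp add: mult.assoc)
 next
  case (add u v)
  then have "good k (%t. v t * indicator (PiE {..<k} C) t + u t * indicator (PiE {..<k} C) t)" by (intro good_add) auto
  then show ?case by (simp add: distrib_right)
 next
  case (seq U)
  have "good k (SUP i. (%t. U i t * indicator (PiE {..<k} C) t))"
   using seq by (intro good_SUP) (auto simp: incseq_def le_fun_def intro!: mult_right_mono)
  moreover have "(SUP i. (%t. U i t * indicator (PiE {..<k} C) t)) = (%t. (SUP i. U i) t * indicator (PiE {..<k} C) t)"
   by (auto simp: fun_eq_iff image_comp SUP_mult_right_ennreal)
  ultimately show ?case by simp
 qed
qed


section \<open>Separation of points by their abscissae\<close>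

definition xc :: "pt \<times> pt set => real" where "xc p = fst (fst p)"

text \<open>Dyadic strips of the abscissa compressed by \<open>arctan\<close>: at each level
  finitely many strips cover the whole plane, so finite sums over cells suffice.\<close>

definition strip :: "nat => pt \<times> pt set => int" where "strip m p = \<lfloor>2 ^ m * arctan (xc p)\<rfloor>"

lemma xc_measurable [measurable]: "xc \<in> borel_measurable mu"
proof -
 have "fst \<in> borel_measurable (borel :: pt measure)" by (intro borel_measurable_continuous_onI continuous_intros)
 then show ?thesis unfolding xc_def by measurable
qed

lemma strip_measurable [measurable]: "strip m \<in> measurable mu (count_space UNIV)"
proof -
 have "arctan \<in> borel_measurable borel" by (intro borel_measurable_continuous_onI continuous_intros)
 then show ?thesis unfolding strip_def[abs_def] by measurable
qed

text \<open>Assignments of pairwise distinct strips to the \<open>k\<close> places. The range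
  \<open>2 ^ (m + 1)\<close> stems from the bound 2 for the modulus of
  \<open>arctan\<close>.\<close>

definition cells :: "nat => nat => (nat => int) set" where
 "cells k m = {J \<in> PiE {..<k} (%_. {- (2 ^ (m + 1)) .. 2 ^ (m + 1)}). inj_on J {..<k}}"

lemma finite_cells: "finite (cells k m)"
 unfolding cells_def by (rule finite_subset[of _ "PiE {..<k} (%_. {- (2 ^ (m + 1)) .. 2 ^ (m + 1)})"]) (auto intro: finite_PiE)

definition cell :: "nat => (nat => int) => nat => (pt \<times> pt set) set" where
 "cell m J i = {p \<in> B. strip m p = J i}"

definition Sep :: "nat => nat => (nat => pt \<times> pt set) set" where
 "Sep k m = {t \<in> PiE {..<k} (%_. B). inj_on (%i. strip m (t i)) {..<k}}"

lemma cell_sets: "cell m J i \<in> sets mu"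
proof -
 have "cell m J i = B \<inter> (strip m -` {J i} \<inter> space mu)" using sets.sets_into_space[OF B] by (auto simp: cell_def)
 also have "... \<in> sets mu" using B by (intro sets.Int measurable_sets[OF strip_measurable]) auto
 finally show ?thesis .
qed

lemma strip_range: "strip m p \<in> {- (2 ^ (m + 1)) .. 2 ^ (m + 1)}"
proof -
 have "\<bar>arctan (xc p)\<bar> \<le> 2" using arctan_bounded[of "xc p"] pi_less_4 by (auto simp: abs_le_iff)
 then have "- 2 \<le> arctan (xc p)" "arctan (xc p) \<le> 2" by auto
 then have "2 ^ m * (- 2) \<le> 2 ^ m * arctan (xc p)" "2 ^ m * arctan (xc p) \<le> 2 ^ m * 2" by (intro mult_left_mono; simp)+
 define N :: int where "N = 2 ^ (m + 1)"
 have "real_of_int N = 2 ^ m * 2" by (simp add: N_def)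
 then have "real_of_int (- N) \<le> 2 ^ m * arctan (xc p)" "2 ^ m * arctan (xc p) \<le> real_of_int N" 
  using \<open>2 ^ m * (- 2) \<le> _\<close> \<open>_ \<le> 2 ^ m * 2\<close> by simp_all
 then have "- N \<le> strip m p" "strip m p \<le> N" unfolding strip_def by linarith+
 then show ?thesis by (simp add: N_def)
qed

text \<open>A separated tuple lies in exactly one product of cells, the one that records its
  strips.\<close>

lemma Sep_cells: "indicator (Sep k m) t = (\<Sum>J\<in>cells k m. indicator (PiE {..<k} (cell m J)) t :: ennreal)"
proof (cases "t \<in> Sep k m")
 case True
 define J where "J = (\<lambda>i\<in>{..<k}. strip m (t i))"
 have J: "J \<in> cells k m" using True strip_range by (auto simp: cells_def J_def Sep_def inj_on_def)
 have tJ: "t \<in> PiE {..<k} (cell m J')  \<longleftrightarrow> J' = J" if "J' \<in> cells k m" for J'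
 proof
  assume "t \<in> PiE {..<k} (cell m J')"
  then have "\<And>i. i < k ==> strip m (t i) = J' i" by (auto simp: PiE_def Pi_def cell_def)
  then show "J' = J" using that by (auto simp: J_def cells_def PiE_def extensional_def fun_eq_iff)
 next
  assume "J' = J"
  then show "t \<in> PiE {..<k} (cell m J')" using True by (auto simp: J_def Sep_def cell_def PiE_def Pi_def)
 qed
 have "(\<Sum>J'\<in>cells k m. indicator (PiE {..<k} (cell m J')) t :: ennreal) = (\<Sum>J'\<in>cells k m. if J' = J then 1 else 0)"
  using tJ by (intro sum.cong refl) (simp add: indicator_def)
 also have "... = 1" using J finite_cells by simp
 finally show ?thesis using True by simp
next
 case False
 have "t \<notin> PiE {..<k} (cell m J)" if "J \<in> cells k m" for J
 proof
  assume h: "t \<in> PiE {..<k} (cell m J)"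
  then have s: "\<And>i. i < k ==> strip m (t i) = J i" by (auto simp: PiE_def Pi_def cell_def)
  have "inj_on (%i. strip m (t i)) {..<k}" using that s by (auto simp: cells_def inj_on_def)
  moreover have "t \<in> PiE {..<k} (%_. B)" using h by (auto simp: PiE_def Pi_def cell_def)
  ultimately show False using False by (simp add: Sep_def)
 qed
 then show ?thesis using False by simp
qed

lemma Sep_sets: "Sep k m \<in> sets (NN k)"
proof -
 have "Sep k m = (\<Union>J\<in>cells k m. PiE {..<k} (cell m J))"
 proof (rule set_eqI)
  fix t
  have "(t \<in> Sep k m) = (indicator (Sep k m) t ~= (0 :: ennreal))" by (auto simp: indicator_def)
  also have "... = (t \<in> (\<Union>J\<in>cells k m. PiE {..<k} (cell m J)))"
   unfolding Sep_cells using finite_cells by (auto simp: sum_eq_0_iff indicator_def split: if_splits)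
  finally show "(t \<in> Sep k m) = (t \<in> (\<Union>J\<in>cells k m. PiE {..<k} (cell m J)))" .
 qed
 also have "... \<in> sets (NN k)" using finite_cells cell_sets by (intro sets.finite_UN sets_PiM_I_finite) auto
 finally show ?thesis .
qed

lemma good_Sep:
 assumes F: "F \<in> borel_measurable (NN k)"
 shows "good k (%t. F t * indicator (Sep k m) t)"
proof -
 have "good k (%t. \<Sum>J\<in>cells k m. F t * indicator (PiE {..<k} (cell m J)) t)"
 proof (rule good_sum[OF finite_cells])
  fix J assume J: "J \<in> cells k m"
  have "disjoint_family_on (cell m J) {..<k}" using J by (auto simp: disjoint_family_on_def cell_def cells_def inj_on_def)
  then show "good k (%t. F t * indicator (PiE {..<k} (cell m J)) t)"
   using cell_sets by (intro good_cells F) (auto simp: cell_def)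
  have "PiE {..<k} (cell m J) \<in> sets (NN k)" using cell_sets by (intro sets_PiM_I_finite) auto
  then show "(%t. F t * indicator (PiE {..<k} (cell m J)) t) \<in> borel_measurable (NN k)"
   using F by (intro borel_measurable_times_ennreal borel_measurable_indicator) auto
 qed
 then show ?thesis by (simp add: Sep_cells sum_distrib_left)
qed

text \<open>The limit of \<open>Sep k m\<close> for growing \<open>m\<close>. Different abscissae
  are more than distinct points, but they are reached by countably many strips, and under the
  product measure they hold almost everywhere.\<close>

definition SepI :: "nat => (nat => pt \<times> pt set) set" where
 "SepI k = {t \<in> PiE {..<k} (%_. B). inj_on (%i. xc (t i)) {..<k}}"

lemma strip_Suc: "strip (Suc m) p = strip (Suc m) q ==> strip m p = strip m q"
proof -
 have "strip m p = strip (Suc m) p div 2" for p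
 proof -
  have "strip (Suc m) p = \<lfloor>2 * (2 ^ m * arctan (xc p))\<rfloor>" by (simp add: strip_def mult.assoc)
  moreover have "\<lfloor>2 * x\<rfloor> div 2 = \<lfloor>x\<rfloor>" for x :: real using floor_divide_real_eq_div[of 2 "2 * x"] by simp
  ultimately show ?thesis by (simp add: strip_def)
 qed
 note * = this
 show "strip (Suc m) p = strip (Suc m) q ==> strip m p = strip m q" unfolding *[of p] *[of q] by simp
qed

lemma Sep_incseq: "incseq (Sep k)" by (rule incseq_SucI) (auto simp: Sep_def inj_on_def dest: strip_Suc)

lemma strip_separates:
 assumes "xc p ~= xc q" shows "\<exists>m. strip m p ~= strip m q"
proof -
 have "\<bar>arctan (xc p) - arctan (xc q)\<bar> > 0" using assms by (simp add: arctan_eq_iff)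
 then obtain m where m: "1 / \<bar>arctan (xc p) - arctan (xc q)\<bar> < 2 ^ m" using real_arch_pow[of 2] by auto
 then have "1 < 2 ^ m * \<bar>arctan (xc p) - arctan (xc q)\<bar>" using \<open>_ > 0\<close> by (simp add: field_simps)
 also have "... = \<bar>2 ^ m * arctan (xc p) - 2 ^ m * arctan (xc q)\<bar>" by (simp add: right_diff_distrib[symmetric] abs_mult)
 finally have "strip m p ~= strip m q" unfolding strip_def by linarith
 then show ?thesis by blast
qed

text \<open>Refining the strips keeps separated points separated, and each of the finitely many
  pairs is separated from some level on.\<close>

lemma SepI_UN: "SepI k = (\<Union>m. Sep k m)"
proof (intro equalityI subsetI)
 fix t assume t: "t \<in> SepI k"
 have "m \<le> n ==> strip n p = strip n q --> strip m p = strip m q" for m n p q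
  by (induction n rule: dec_induct) (auto dest: strip_Suc)
 then have mono: "strip m p ~= strip m q ==> m \<le> n ==> strip n p ~= strip n q" for m n p q by blast
 have "\<exists>M. \<forall>i<k. \<forall>j<k. i ~= j --> strip M (t i) ~= strip M (t j)"
 proof -
  have "\<exists>m. i ~= j --> i < k --> j < k --> strip m (t i) ~= strip m (t j)" for i j
   using strip_separates[of "t i" "t j"] t by (auto simp: SepI_def inj_on_def)
  then obtain m where m: "\<And>i j. i ~= j ==> i < k ==> j < k ==> strip (m i j) (t i) ~= strip (m i j) (t j)" by metis
  define M where "M = Max (insert 0 ((%(i, j). m i j) ` ({..<k} \<times> {..<k})))"
  have "m i j \<le> M" if "i < k" "j < k" for i j unfolding M_def using that by (intro Max_ge) auto
  then show ?thesis using m mono by blast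
 qed
 then obtain M where "\<forall>i<k. \<forall>j<k. i ~= j --> strip M (t i) ~= strip M (t j)" by blast
 then have "t \<in> Sep k M" using t by (auto simp: SepI_def Sep_def inj_on_def)
 then show "t \<in> (\<Union>m. Sep k m)" by blast
qed (auto simp: Sep_def SepI_def inj_on_def strip_def)

lemma good_SepI:
 assumes F: "F \<in> borel_measurable (NN k)"
 shows "good k (%t. F t * indicator (SepI k) t)"
proof -
 have "good k (SUP m. (%t. F t * indicator (Sep k m) t))"
 proof (rule good_SUP[OF good_Sep[OF F]])
  show "(%t. F t * indicator (Sep k m) t) \<in> borel_measurable (NN k)" for m
   using F Sep_sets by (intro borel_measurable_times_ennreal borel_measurable_indicator) auto
  show "incseq (%m t. F t * indicator (Sep k m) t)"
   using Sep_incseq[of k] by (auto simp: incseq_def le_fun_def indicator_def intro!: mult_left_mono)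
 qed
 moreover have "(SUP m. (%t. F t * indicator (Sep k m) t)) = (%t. F t * indicator (SepI k) t)"
 proof
  fix t
  have "(SUP m. indicator (Sep k m) t :: ennreal) = indicator (SepI k) t"
  proof (cases "t \<in> SepI k")
   case True
   then obtain m where "t \<in> Sep k m" by (auto simp: SepI_UN)
   then have "(1 :: ennreal) \<le> (SUP m. indicator (Sep k m) t)" by (intro SUP_upper2[of m]) auto
   moreover have "(SUP m. indicator (Sep k m) t) \<le> (1 :: ennreal)" by (intro SUP_least) (simp add: indicator_def)
   ultimately have "(SUP m. indicator (Sep k m) t) = (1 :: ennreal)" by (intro antisym)
   then show ?thesis using True by simp
  qed (auto simp: SepI_UN)
  then show "(SUP m. (%t. F t * indicator (Sep k m) t)) t = F t * indicator (SepI k) t"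
   by (simp add: image_comp SUP_mult_left_ennreal[symmetric])
 qed
 ultimately show ?thesis by simp
qed

lemma nu_null_x: "emeasure nu {p \<in> space mu. xc p = c} = 0"
proof -
 have s0: "{p \<in> space mu. xc p = c} \<in> sets mu" by measurable
 have l: "emeasure lborel {x :: pt. fst x = c} = 0"
 proof -
  have s: "{x :: pt. fst x = c} \<in> sets borel" by (intro borel_closed closed_Collect_eq continuous_intros)
  have "{x. (x, y) \<in> {x :: pt. fst x = c}} = {c}" for y by auto
  then show ?thesis using emeasure_pt_slices(1)[OF s] by simp
 qed
 have "{p \<in> space mu. xc p = c} = {x. fst x = c} \<times> space Q" by (auto simp: space_pair_measure xc_def)
 moreover have "{x :: pt. fst x = c} \<in> sets lborel" by (simp, intro borel_closed closed_Collect_eq continuous_intros)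
 ultimately have "emeasure mu {p \<in> space mu. xc p = c} = 0"
  using emeasure_pair_measure_Times[OF _ sets.top, of "{x :: pt. fst x = c}" lborel] l by simp
 then have "emeasure mu ({p \<in> space mu. xc p = c} \<inter> B) = 0" by (rule emeasure_eq_0[OF s0 _ Int_lower1])
 then show ?thesis using emeasure_nu[OF s0] by simp
qed

text \<open>\<open>nu\<close> has no mass outside \<open>B\<close>, so all coordinates lie in
  \<open>B\<close>. Two coordinates share an abscissa only on a null set: with the others fixed, one
  coordinate would have to lie on a vertical line.\<close>

lemma AE_SepI: "AE t in NN k. t \<in> SepI k"
proof -
 have comp: "(%t. t i) \<in> measurable (NN k) mu" if "i < k" for i
  using measurable_component_singleton[of i "{..<k}" "%_. nu"] that by (simp cong: measurable_cong_sets)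
 have 1: "AE t in NN k. t i \<in> B" if i: "i < k" for i
 proof (rule AE_I[where N = "PiE {..<k} (%j. if j = i then space mu - B else space mu)"])
  show "{t \<in> space (NN k). t i \<notin> B} \<subseteq> PiE {..<k} (%j. if j = i then space mu - B else space mu)"
   by (auto simp: space_PiM PiE_def Pi_def)
  have "(space mu - B) \<inter> B = {}" by blast
  then have "emeasure nu (space mu - B) = 0" using emeasure_nu[OF sets.compl_sets[OF B]] by simp
  then show "emeasure (NN k) (PiE {..<k} (%j. if j = i then space mu - B else space mu)) = 0"
   using B i sets.compl_sets[OF B] sets.top[of mu] by (subst NU.emeasure_PiM) auto
  show "PiE {..<k} (%j. if j = i then space mu - B else space mu) \<in> sets (NN k)"
   using B sets.compl_sets[OF B] sets.top[of mu] by (intro sets_PiM_I_finite) auto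
 qed
 have 2: "AE t in NN k. xc (t i) ~= xc (t j)" if i: "i < k" "j < k" "i ~= j" for i j
 proof -
  let ?T = "{t \<in> space (NN k). xc (t i) = xc (t j)}"
  have xm: "(%t. xc (t i)) \<in> borel_measurable (NN k)" if "i < k" for i
   using measurable_compose[OF comp[OF that] xc_measurable] .
  have T: "?T \<in> sets (NN k)" using xm[OF i(1)] xm[OF i(2)] by measurable
  define I' where "I' = {..<k} - {i}"
  have I': "finite I'" "i \<notin> I'" "insert i I' = {..<k}" "j \<in> I'" using i by (auto simp: I'_def)
  have "emeasure (NN k) ?T = (\<integral>\<^sup>+t. indicator ?T t \<partial>PiM (insert i I') (%_. nu))" using T by (simp add: I')
  also have "... = (\<integral>\<^sup>+t. (\<integral>\<^sup>+p. indicator ?T (t(i := p)) \<partial>nu) \<partial>PiM I' (%_. nu))"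
   using T by (intro NU.product_nn_integral_insert I'(1,2)) (simp add: I')
  also have "... = (\<integral>\<^sup>+t. 0 \<partial>PiM I' (%_. nu))"
  proof (rule nn_integral_cong)
   fix t assume t: "t \<in> space (PiM I' (%_. nu))"
   have s: "{p \<in> space mu. xc p = xc (t j)} \<in> sets nu" by measurable
   have "(\<integral>\<^sup>+p. indicator ?T (t(i := p)) \<partial>nu) \<le> (\<integral>\<^sup>+p. indicator {p \<in> space mu. xc p = xc (t j)} p \<partial>nu)"
    using i by (intro nn_integral_mono) (auto simp: indicator_def)
   also have "... = 0" unfolding nn_integral_indicator[OF s] by (rule nu_null_x)
   finally show "(\<integral>\<^sup>+p. indicator ?T (t(i := p)) \<partial>nu) = 0" by simp
  qed
  finally have "emeasure (NN k) ?T = 0" by simp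
  then show ?thesis using T by (intro AE_I[where N = ?T]) auto
 qed
 have "AE t in NN k. (\<forall>i\<in>{..<k}. t i \<in> B) \<and> (\<forall>i\<in>{..<k}. \<forall>j\<in>{..<k} - {i}. xc (t i) ~= xc (t j))"
  using 1 2 by (intro AE_conjI AE_finite_allI) auto
 from this AE_space[of "NN k"] show ?thesis by eventually_elim (auto simp: SepI_def space_PiM PiE_def Pi_def inj_on_def)
qed

end
end

section \<open>Specific intrinsic volumes\<close>

context bmodel
begin

lemma E_count_fun:
 assumes A: "A \<in> sets mu" "emeasure mu A < \<infinity>"
 shows "(\<integral>\<^sup>+\<phi>. indicator {\<phi> \<in> space P. finite (\<phi> \<inter> A)} \<phi> * g (card (\<phi> \<inter> A)) \<partial>P) = (\<Sum>n. g n * ennreal (poisson_prob (\<gamma> * measure mu A) n))"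
proof -
 let ?E = "%n. {\<phi> \<in> space P. finite (\<phi> \<inter> A) \<and> card (\<phi> \<inter> A) = n}"
 have Em [measurable]: "?E n \<in> sets P" for n by (rule count_event(1)[OF A])
 have "(\<integral>\<^sup>+\<phi>. indicator {\<phi> \<in> space P. finite (\<phi> \<inter> A)} \<phi> * g (card (\<phi> \<inter> A)) \<partial>P) = (\<integral>\<^sup>+\<phi>. (\<Sum>n. g n * indicator (?E n) \<phi>) \<partial>P)"
 proof (rule nn_integral_cong)
  fix \<phi> assume \<phi>: "\<phi> \<in> space P"
  show "indicator {\<phi> \<in> space P. finite (\<phi> \<inter> A)} \<phi> * g (card (\<phi> \<inter> A)) = (\<Sum>n. g n * indicator (?E n) \<phi>)"
  proof (subst suminf_finite[of "{card (\<phi> \<inter> A)}"])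
   show "indicator {\<phi> \<in> space P. finite (\<phi> \<inter> A)} \<phi> * g (card (\<phi> \<inter> A)) = (\<Sum>n\<in>{card (\<phi> \<inter> A)}. g n * indicator (?E n) \<phi>)"
    using \<phi> by (cases "finite (\<phi> \<inter> A)") auto
  qed auto
 qed
 also have "... = (\<Sum>n. g n * emeasure P (?E n))" by (simp add: nn_integral_suminf nn_integral_cmult)
 also have "... = (\<Sum>n. g n * ennreal (poisson_prob (\<gamma> * measure mu A) n))"
  by (simp only: P.emeasure_eq_measure count_event(2)[OF A])
 finally show ?thesis .
qed

lemma poisson_factorial2:
 assumes "l \<ge> 0"
 shows "(\<Sum>n. of_nat (n * (n - 1)) * ennreal (poisson_prob l n)) = ennreal (l * l)"
proof -
 have "(%n. real (Suc (Suc n) * Suc n) * poisson_prob l (Suc (Suc n))) sums (l * l * 1)"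
 proof -
  have "real (Suc (Suc n) * Suc n) * poisson_prob l (Suc (Suc n)) = l * l * poisson_prob l n" for n
  proof -
   have "fact (Suc (Suc n)) = real (Suc (Suc n) * Suc n) * fact n" by (simp add: algebra_simps)
   then show ?thesis unfolding poisson_prob_def by (simp add: divide_simps del: of_nat_Suc fact_Suc)
  qed
  then show ?thesis using sums_mult[OF poisson_sums[of l], of "l * l"] by simp
 qed
 \<comment> \<open>Two index shifts; the terms for 0 and 1 vanish.\<close>
 then have "(%n. real (n * (n - 1)) * poisson_prob l n) sums (l * l)"
  using sums_Suc_iff[of "%n. real (Suc n * (Suc n - 1)) * poisson_prob l (Suc n)" "l * l"]
   sums_Suc_iff[of "%n. real (n * (n - 1)) * poisson_prob l n" "l * l"] by simp
 then have "(\<Sum>n. ennreal (real (n * (n - 1)) * poisson_prob l n)) = ennreal (l * l)"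
  using assms by (intro suminf_ennreal_eq) (auto simp: poisson_prob_def)
 moreover have "ennreal (real (n * (n - 1)) * poisson_prob l n) = of_nat (n * (n - 1)) * ennreal (poisson_prob l n)" for n
  by (simp only: ennreal_of_nat_eq_real_of_nat) (simp add: ennreal_mult')
 ultimately show ?thesis by simp
qed

context
 fixes B assumes B: "B \<in> sets mu" and Bfin: "emeasure mu B < \<infinity>"
begin

interpretation nu: finite_measure "nu B" by (rule finite_nu[OF B Bfin])
interpretation NU: product_sigma_finite "%_ :: nat. nu B" ..

text \<open>Without ties among the abscissae, a tuple is separated iff its entries are distinct,
  which turns the sum with repetitions into a sum over injective tuples.\<close>

lemma Sg_Sep_eq:
 assumes "\<phi> \<in> Fin B" and nt: "inj_on xc (\<phi> \<inter> B)"
 shows "Sg B k (%t. F t * indicator (SepI B k) t) \<phi> = (\<Sum>t\<in>inj_tuples k (\<phi> \<inter> B). F t)"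
proof -
 let ?X = "PiE {..<k} (%_. \<phi> \<inter> B)"
 have fin: "finite (\<phi> \<inter> B)" using assms(1) by (simp add: Fin_def[OF B Bfin])
 then have X: "finite ?X" by (auto intro: finite_PiE)
 have "Sg B k (%t. F t * indicator (SepI B k) t) \<phi> = (\<Sum>t\<in>?X. F t * indicator (SepI B k) t)"
  using assms(1) X by (simp add: Sg_def[OF B Bfin] nn_integral_count_space_finite)
 also have "... = (\<Sum>t\<in>inj_tuples k (\<phi> \<inter> B). F t)"
 proof (rule sum.mono_neutral_cong_right[OF X])
  show "inj_tuples k (\<phi> \<inter> B) \<subseteq> ?X" by (auto simp: inj_tuples_def)
  have iff: "t \<in> SepI B k \<longleftrightarrow> t \<in> inj_tuples k (\<phi> \<inter> B)" if "t \<in> ?X" for t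
  proof -
   have im: "t ` {..<k} \<subseteq> \<phi> \<inter> B" and tB: "t \<in> PiE {..<k} (%_. B)" using that by (auto simp: PiE_def Pi_def)
   have "inj_on (xc \<circ> t) {..<k} \<longleftrightarrow> inj_on t {..<k}"
    using inj_on_subset[OF nt im] by (auto intro: comp_inj_on dest: inj_on_imageI2)
   then show ?thesis using that tB by (simp add: SepI_def[OF B Bfin] inj_tuples_def comp_def)
  qed
  show "\<forall>t\<in>?X - inj_tuples k (\<phi> \<inter> B). F t * indicator (SepI B k) t = 0" using iff by auto
  show "F t * indicator (SepI B k) t = F t" if "t \<in> inj_tuples k (\<phi> \<inter> B)" for t
   using iff[of t] that by (auto simp: inj_tuples_def)
 qed
 finally show ?thesis .
qed

lemma NN_total: "emeasure (PiM {..<k} (%_. nu B)) (space (PiM {..<k} (%_. nu B))) = (ennreal \<gamma> * emeasure mu B) ^ k"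
proof -
 have "emeasure (nu B) (space mu) = ennreal \<gamma> * emeasure mu B"
  using emeasure_nu[OF B Bfin sets.top] sets.sets_into_space[OF B] by (simp add: Int_absorb1)
 then show ?thesis
  unfolding space_PiM space_nu[OF B Bfin] by (subst NU.emeasure_PiM) (use sets.top[of mu] in \<open>auto simp: sets_nu[OF B Bfin]\<close>)
qed

text \<open>There are at most as many ordered pairs with different abscissae as ordered pairs of
  distinct points. The former have mean \<open>l * l\<close> by the Campbell formula, the latter by
  the second factorial moment of the Poisson law. Equal finite means force equality almost surely,
  which rules out ties.\<close>

lemma AE_no_ties: "AE \<phi> in P. inj_on xc (\<phi> \<inter> B)"
proof -
 let ?a = "%\<phi>. Sg B 2 (%t. 1 * indicator (SepI B 2) t) \<phi>"
 let ?b = "%\<phi>. indicator (Fin B) \<phi> * of_nat (card (\<phi> \<inter> B) * (card (\<phi> \<inter> B) - 1)) :: ennreal"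
 define l where "l = \<gamma> * measure mu B"
 have l: "l \<ge> 0" using gam by (simp add: l_def)
 have le: "ennreal \<gamma> * emeasure mu B = ennreal l" using Bfin gam by (simp add: l_def ennreal_mult emeasure_eq_ennreal_measure)
 have g: "good B 2 (%t. 1 * indicator (SepI B 2) t)" by (rule good_SepI[OF B Bfin]) simp
 have Ea: "(\<integral>\<^sup>+\<phi>. ?a \<phi> \<partial>P) = ennreal (l * l)"
 proof -
  have "(\<integral>\<^sup>+\<phi>. ?a \<phi> \<partial>P) = (\<integral>\<^sup>+t. 1 * indicator (SepI B 2) t \<partial>PiM {..<2::nat} (%_. nu B))"
   using g by (simp add: good_def[OF B Bfin])
  also have "... = (\<integral>\<^sup>+t. 1 \<partial>PiM {..<2::nat} (%_. nu B))"
   using AE_SepI[OF B Bfin, of 2] by (intro nn_integral_cong_AE) auto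
  also have "... = ennreal l ^ 2" using NN_total[of 2] le by simp
  finally show ?thesis using l by (simp add: power2_eq_square ennreal_mult)
 qed
 have Eb: "(\<integral>\<^sup>+\<phi>. ?b \<phi> \<partial>P) = ennreal (l * l)"
  unfolding Fin_def[OF B Bfin] using E_count_fun[OF B Bfin, of "%n. of_nat (n * (n - 1))"] poisson_factorial2[OF l] l_def by simp
 have Fs: "Fin B \<in> sets P" by (rule Fin_sets[OF B Bfin])
 have mb: "?b \<in> borel_measurable P"
 proof -
  have "(%\<phi>. of_nat (card (\<phi> \<inter> B) * (card (\<phi> \<inter> B) - 1)) :: ennreal) \<in> borel_measurable P"
   using measurable_compose[OF count_measurable[OF B Bfin B order_refl], of "%n. of_nat (n * (n - 1)) :: ennreal" borel] by simp
  then show ?thesis using Fs by (intro borel_measurable_times_ennreal borel_measurable_indicator)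
 qed
 have ma: "?a \<in> borel_measurable P" using g by (simp add: good_def[OF B Bfin])
 have cnt: "?a \<phi> = of_nat (card {t \<in> inj_tuples 2 (\<phi> \<inter> B). t \<in> SepI B 2})" if "\<phi> \<in> Fin B" for \<phi>
 proof -
  let ?X = "PiE {..<2::nat} (%_. \<phi> \<inter> B)"
  have "finite (\<phi> \<inter> B)" using that by (simp add: Fin_def[OF B Bfin])
  then have X: "finite ?X" by (auto intro: finite_PiE)
  have "?a \<phi> = (\<Sum>t\<in>?X. indicator (SepI B 2) t)"
   using that X by (simp add: Sg_def[OF B Bfin] nn_integral_count_space_finite)
  also have "... = of_nat (card (?X \<inter> SepI B 2))" using X by (simp add: indicator_def sum_of_bool_eq)
  also have "?X \<inter> SepI B 2 = {t \<in> inj_tuples 2 (\<phi> \<inter> B). t \<in> SepI B 2}"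
   by (auto simp: inj_tuples_def SepI_def[OF B Bfin] inj_on_def)
  finally show ?thesis .
 qed
 have cb: "?b \<phi> = of_nat (card (inj_tuples 2 (\<phi> \<inter> B)))" if "\<phi> \<in> Fin B" for \<phi>
  using that card_inj_tuples[of "\<phi> \<inter> B" 2] by (simp add: Fin_def[OF B Bfin] numeral_2_eq_2)
 have ab: "?a \<phi> \<le> ?b \<phi>" for \<phi>
 proof (cases "\<phi> \<in> Fin B")
  case True
  then have "finite (inj_tuples 2 (\<phi> \<inter> B))" by (intro finite_inj_tuples) (simp add: Fin_def[OF B Bfin])
  then show ?thesis unfolding cnt[OF True] cb[OF True] by (intro of_nat_mono card_mono) auto
 qed (simp add: Sg_def[OF B Bfin])
 have "(\<integral>\<^sup>+\<phi>. ?b \<phi> - ?a \<phi> \<partial>P) = (\<integral>\<^sup>+\<phi>. ?b \<phi> \<partial>P) - (\<integral>\<^sup>+\<phi>. ?a \<phi> \<partial>P)"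
  using ma mb ab Ea by (intro nn_integral_diff) auto
 also have "... = 0" unfolding Ea Eb by simp
 finally have "AE \<phi> in P. ?b \<phi> - ?a \<phi> = 0" using ma mb by (subst (asm) nn_integral_0_iff_AE) auto
 with AE_Fin[OF B Bfin] show ?thesis
 proof eventually_elim
  case (elim \<phi>)
  then have fin: "finite (inj_tuples 2 (\<phi> \<inter> B))" by (intro finite_inj_tuples) (simp add: Fin_def[OF B Bfin])
  have "?b \<phi> \<le> ?a \<phi>" using elim(2) by (simp add: diff_eq_0_iff_ennreal)
  then have "card (inj_tuples 2 (\<phi> \<inter> B)) \<le> card {t \<in> inj_tuples 2 (\<phi> \<inter> B). t \<in> SepI B 2}"
   unfolding cnt[OF elim(1)] cb[OF elim(1)] by simp
  then have all: "{t \<in> inj_tuples 2 (\<phi> \<inter> B). t \<in> SepI B 2} = inj_tuples 2 (\<phi> \<inter> B)"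
   using fin by (intro card_seteq) auto
  show "inj_on xc (\<phi> \<inter> B)"
  proof (rule inj_onI, rule ccontr)
   fix p q assume pq: "p \<in> \<phi> \<inter> B" "q \<in> \<phi> \<inter> B" "xc p = xc q" "p ~= q"
   define t where "t = (\<lambda>i\<in>{..<2::nat}. if i = 0 then p else q)"
   have "t \<in> inj_tuples 2 (\<phi> \<inter> B)" using pq by (auto simp: inj_tuples_def t_def inj_on_def less_2_cases_iff)
   then have "inj_on (%i. xc (t i)) {..<2}" using all by (auto simp: SepI_def[OF B Bfin])
   then have "xc (t 0) ~= xc (t 1)" unfolding inj_on_def by fastforce
   then show False using pq by (simp add: t_def)
  qed
 qed
qed

end

lemma Vconv_nonneg: "compact A ==> convex A ==> Vconv j A \<ge> 0"
 using V1c_nonneg[of A] by (cases "A = {}") (auto simp: Vconv_def KC_def)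

lemma Vconv_empty [simp]: "Vconv j {} = 0" by (simp add: Vconv_def)

text \<open>The kinematic operator: the right sides of \<open>T0\<close>, \<open>T1\<close> and
  \<open>T2\<close> in terms of \<open>Vconv\<close>, so that an empty \<open>M\<close> is covered
  as well.\<close>

definition Tc :: "nat => pt set => real" where
 "Tc j M = (if j = 0 then Vconv 2 M + bb * Vconv 1 M + vv * Vconv 0 M
  else if j = 1 then vv * Vconv 1 M + mm * Vconv 2 M else vv * Vconv 2 M)"

context
 fixes W assumes W: "W \<in> KC"
begin

definition hitW where "hitW = {p \<in> space mu. W \<inter> tg p ~= {}}"

lemma hitW_sets: "hitW \<in> sets mu" unfolding hitW_def by (rule rset_nonempty[OF rset_M_tg[OF W]])

lemma hitW_finite: "emeasure mu hitW < \<infinity>"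
proof -
 have "emeasure mu hitW = (\<integral>\<^sup>+p. indicator hitW p \<partial>mu)" using hitW_sets by simp
 also have "... = (\<integral>\<^sup>+p. ennreal (of_bool (W \<inter> tg p ~= {})) \<partial>mu)"
  by (intro nn_integral_cong) (auto simp: hitW_def indicator_def)
 also have "... < \<infinity>" unfolding T0[OF W] by simp
 finally show ?thesis .
qed

interpretation nu: finite_measure "nu hitW" by (rule finite_nu[OF hitW_sets hitW_finite])
interpretation NU: product_sigma_finite "%_ :: nat. nu hitW" ..

abbreviation NW where "NW k \<equiv> PiM {..<k::nat} (%_. nu hitW)"

definition WT :: "nat => (nat => pt \<times> pt set) => pt set" where
 "WT k t = W \<inter> (\<Inter>i\<in>{..<k}. tg (t i))"

lemma rset_WT: "rset (NW k) (WT k)"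
proof -
 have comp: "(%t. t i) \<in> measurable (NW k) mu" if "i < k" for i
 proof -
  have "(%t. t i) \<in> measurable (NW k) (nu hitW)" using that by (intro measurable_component_singleton) simp
  then show ?thesis using measurable_cong_sets[OF refl sets_nu[OF hitW_sets hitW_finite]] by blast
 qed
 have "j \<le> k ==> rset (NW k) (%t. W \<inter> (\<Inter>i\<in>{..<j}. tg (t i)))" for j
 proof (induction j)
  case 0 show ?case using rset_const[OF KC_D(1)[OF W]] by simp
 next
  case (Suc j)
  then have "rset (NW k) (%t. W \<inter> (\<Inter>i\<in>{..<j}. tg (t i)))" "rset (NW k) (%t. tg (t j))"
   using rset_compose[OF comp rset_tg] by auto
  then have "rset (NW k) (%t. (W \<inter> (\<Inter>i\<in>{..<j}. tg (t i))) \<inter> tg (t j))" by (rule rset_Int)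
  moreover have "(W \<inter> (\<Inter>i\<in>{..<j}. tg (t i))) \<inter> tg (t j) = W \<inter> (\<Inter>i\<in>{..<Suc j}. tg (t i))" for t
   by (auto simp: less_Suc_eq)
  ultimately show ?case by simp
 qed
 then show ?thesis unfolding WT_def[abs_def] by simp
qed

lemma space_NW: "t \<in> space (NW k) ==> i < k ==> t i \<in> space mu"
 by (auto simp: space_PiM space_nu[OF hitW_sets hitW_finite] PiE_def Pi_def)

lemma WT_cc: "t \<in> space (NW k) ==> compact (WT k t)" "t \<in> space (NW k) ==> convex (WT k t)"
proof -
 assume t: "t \<in> space (NW k)"
 show "compact (WT k t)" by (rule rset_compact[OF rset_WT t])
 show "convex (WT k t)" unfolding WT_def using tg_cc space_NW[OF t] KC_D(2)[OF W] by (intro convex_Int convex_INT) auto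
qed

text \<open>By the Campbell formula this is the mean of the sum, over ordered
  \<open>k\<close>-tuples of distinct points, of \<open>Vconv j\<close> of the window cut with their
  grains. Inclusion-exclusion over subsets divides it by \<open>fact k\<close>.\<close>

definition Rk :: "nat => nat => ennreal" where
 "Rk j k = (\<integral>\<^sup>+t. ennreal (Vconv j (WT k t)) \<partial>NW k)"

lemma Vconv_WT_measurable: "(%t. Vconv j (WT k t)) \<in> borel_measurable (NW k)"
proof -
 have [measurable]: "{t \<in> space (NW k). WT k t ~= {}} \<in> sets (NW k)" by (rule rset_nonempty[OF rset_WT])
 have "(%t. of_bool (WT k t ~= {}) :: real) \<in> borel_measurable (NW k)" by (simp add: of_bool_def)
 moreover have "Vconv 0 A = of_bool (A ~= {})" for A by (simp add: Vconv_def)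
 ultimately show ?thesis using rset_V1c[OF rset_WT WT_cc(2)] rset_area[OF rset_WT]
  by (cases "j = 0"; cases "j = 1") (simp_all add: Vconv_def)
qed

lemma T_all:
 assumes "compact M" "convex M" "j \<le> 2"
 shows "(\<integral>\<^sup>+p. ennreal (Vconv j (M \<inter> tg p)) \<partial>mu) = ennreal (Tc j M)"
proof (cases "M = {}")
 case True then show ?thesis by (simp add: Tc_def)
next
 case False
 then have M: "M \<in> KC" using assms by (simp add: KC_def)
 have V0: "Vconv 0 A = of_bool (A ~= {})" for A by (simp add: Vconv_def)
 consider "j = 0" | "j = 1" | "j = 2" using assms(3) by linarith
 then show ?thesis
 proof cases
  case 1 then show ?thesis using T0[OF M] False by (simp add: V0 Tc_def) (simp add: Vconv_def)
 next
  case 2 then show ?thesis using T1[OF M] by (simp add: Tc_def Vconv_def)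
 next
  case 3 then show ?thesis using T2[OF M] by (simp add: Tc_def Vconv_def)
 qed
qed

text \<open>The last grain is integrated out with the kinematic formula. Extending that integral
  from the grains hitting \<open>W\<close> to all grains changes nothing, as the others give an
  empty intersection.\<close>

lemma Rk_Suc:
 assumes j: "j \<le> 2"
 shows "Rk j (Suc k) = (\<integral>\<^sup>+t. ennreal (\<gamma> * Tc j (WT k t)) \<partial>NW k)"
proof -
 let ?H = "hitW"
 have ins: "{..<Suc k} = insert k {..<k}" by auto
 have "Rk j (Suc k) = (\<integral>\<^sup>+t. ennreal (Vconv j (WT (Suc k) t)) \<partial>PiM (insert k {..<k}) (%_. nu hitW))"
  unfolding Rk_def ins ..
 also have "... = (\<integral>\<^sup>+t. \<integral>\<^sup>+p. ennreal (Vconv j (WT (Suc k) (t(k := p)))) \<partial>nu hitW \<partial>NW k)"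
  using measurable_compose[OF Vconv_WT_measurable[of j "Suc k"] measurable_ennreal]
  by (intro NU.product_nn_integral_insert) (auto simp: ins)
 also have "... = (\<integral>\<^sup>+t. ennreal (\<gamma> * Tc j (WT k t)) \<partial>NW k)"
 proof (rule nn_integral_cong)
  fix t assume t: "t \<in> space (NW k)"
  have eq: "WT (Suc k) (t(k := p)) = WT k t \<inter> tg p" for p
  proof -
   have "(\<Inter>i\<in>{..<k}. tg ((t(k := p)) i)) = (\<Inter>i\<in>{..<k}. tg (t i))" by (rule INF_cong) auto
   then show ?thesis by (auto simp: WT_def lessThan_Suc)
  qed
  have rs: "rset mu (%p. WT k t \<inter> tg p)" by (intro rset_Int rset_const WT_cc[OF t] rset_tg)
  have cc: "compact (WT k t \<inter> tg p)" "convex (WT k t \<inter> tg p)" if "p \<in> space mu" for p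
   using tg_cc[OF that] WT_cc[OF t] by (auto intro: compact_Int convex_Int)
  have meas: "(%p. ennreal (Vconv j (WT k t \<inter> tg p))) \<in> borel_measurable mu"
  proof -
   have [measurable]: "{p \<in> space mu. WT k t \<inter> tg p ~= {}} \<in> sets mu" by (rule rset_nonempty[OF rs])
   have "(%p. of_bool (WT k t \<inter> tg p ~= {}) :: real) \<in> borel_measurable mu" by (simp add: of_bool_def)
   moreover have "Vconv 0 A = of_bool (A ~= {})" for A by (simp add: Vconv_def)
   ultimately have "(%p. Vconv j (WT k t \<inter> tg p)) \<in> borel_measurable mu" using rset_V1c[OF rs cc(2)] rset_area[OF rs]
    by (cases "j = 0"; cases "j = 1") (simp_all add: Vconv_def)
   then show ?thesis by measurable
  qed
  have "(\<integral>\<^sup>+p. ennreal (Vconv j (WT (Suc k) (t(k := p)))) \<partial>nu hitW) = (\<integral>\<^sup>+p. (ennreal \<gamma> * indicator hitW p) * ennreal (Vconv j (WT k t \<inter> tg p)) \<partial>mu)"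
   unfolding eq nu_def[OF hitW_sets hitW_finite] using hitW_sets meas
   by (subst nn_integral_density) (auto intro!: borel_measurable_times_ennreal)
  also have "... = (\<integral>\<^sup>+p. ennreal \<gamma> * ennreal (Vconv j (WT k t \<inter> tg p)) \<partial>mu)"
  proof (rule nn_integral_cong)
   fix p assume p: "p \<in> space mu"
   show "(ennreal \<gamma> * indicator hitW p) * ennreal (Vconv j (WT k t \<inter> tg p)) = ennreal \<gamma> * ennreal (Vconv j (WT k t \<inter> tg p))"
   proof (cases "p \<in> hitW")
    case False
    then have "WT k t \<inter> tg p = {}" using p by (auto simp: hitW_def WT_def)
    then show ?thesis by simp
   qed simp
  qed
  also have "... = ennreal \<gamma> * ennreal (Tc j (WT k t))" using meas T_all[OF WT_cc[OF t] j] by (simp add: nn_integral_cmult)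
  also have "... = ennreal (\<gamma> * Tc j (WT k t))" using gam by (simp add: ennreal_mult')
  finally show "(\<integral>\<^sup>+p. ennreal (Vconv j (WT (Suc k) (t(k := p)))) \<partial>nu hitW) = ennreal (\<gamma> * Tc j (WT k t))" .
 qed
 finally show ?thesis .
qed

lemma Rk_0: "Rk j 0 = ennreal (Vconv j W)"
proof -
 have "Rk j 0 = (\<integral>\<^sup>+t. ennreal (Vconv j W) \<partial>NW 0)" by (simp add: Rk_def WT_def)
 also have "... = ennreal (Vconv j W) * emeasure (NW 0) (space (NW 0))" by (rule nn_integral_const)
 also have "emeasure (NW 0) (space (NW 0)) = 1" using NN_total[OF hitW_sets hitW_finite, of 0] by simp
 finally show ?thesis by simp
qed

lemma nn_lin:
 assumes "a \<ge> 0" "b \<ge> 0" "c \<ge> 0"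
 shows "(\<integral>\<^sup>+t. ennreal (a * Vconv 2 (WT k t) + b * Vconv 1 (WT k t) + c * Vconv 0 (WT k t)) \<partial>NW k)
  = ennreal a * Rk 2 k + ennreal b * Rk 1 k + ennreal c * Rk 0 k"
proof -
 have m: "(%t. ennreal (Vconv j (WT k t))) \<in> borel_measurable (NW k)" for j
  using measurable_compose[OF Vconv_WT_measurable[of j k] measurable_ennreal] .
 have "(\<integral>\<^sup>+t. ennreal (a * Vconv 2 (WT k t) + b * Vconv 1 (WT k t) + c * Vconv 0 (WT k t)) \<partial>NW k)
  = (\<integral>\<^sup>+t. ennreal a * ennreal (Vconv 2 (WT k t)) + ennreal b * ennreal (Vconv 1 (WT k t)) + ennreal c * ennreal (Vconv 0 (WT k t)) \<partial>NW k)"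
  using assms Vconv_nonneg[OF WT_cc] by (intro nn_integral_cong) (simp add: ennreal_mult')
 also have "... = ennreal a * Rk 2 k + ennreal b * Rk 1 k + ennreal c * Rk 0 k"
  unfolding Rk_def using m by (simp add: nn_integral_add nn_integral_cmult)
 finally show ?thesis .
qed

end

text \<open>The mean number of grains covering a fixed point; the prime distinguishes it from the
  lattice point \<open>x0\<close>.\<close>

definition x0' :: real where "x0' = \<gamma> * vv"

text \<open>Coefficients of the exponential series shifted by \<open>s\<close>. They are adapted to
  the triangular recursion behind \<open>Rk_Suc\<close>: a step multiplies by \<open>x0'\<close> and
  feeds index \<open>s - 1\<close> into index \<open>s\<close>.\<close>

definition ek :: "nat => nat => real" where
 "ek s k = (if k < s then 0 else x0' ^ (k - s) / fact (k - s))"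

lemma ek_rec0: "real (Suc k) * ek 0 (Suc k) = x0' * ek 0 k" by (simp add: ek_def divide_simps del: of_nat_Suc)

lemma ek_rec1: "real (Suc k) * ek 1 (Suc k) = x0' * ek 1 k + ek 0 k"
proof (cases k)
 case (Suc n)
 have "ek 1 (Suc k) = ek 0 k" "ek 1 k = ek 0 n" by (auto simp: ek_def Suc)
 moreover have "real k * ek 0 k = x0' * ek 0 n" using ek_rec0[of n] Suc by simp
 ultimately show ?thesis by (simp add: algebra_simps)
qed (simp add: ek_def)

lemma ek_rec2: "real (Suc k) * ek 2 (Suc k) = x0' * ek 2 k + 2 * ek 1 k"
proof (cases k)
 case (Suc n)
 have "ek 2 (Suc k) = ek 1 k" "ek 2 k = ek 1 n" "ek 1 k = ek 0 n" by (auto simp: ek_def Suc numeral_2_eq_2)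
 moreover have "real (Suc n) * ek 1 (Suc n) = x0' * ek 1 n + ek 0 n" by (rule ek_rec1)
 ultimately show ?thesis by (simp add: Suc algebra_simps)
qed (simp add: ek_def)

lemma x0'_nonneg: "x0' \<ge> 0" using gam vv_nonneg by (simp add: x0'_def)

lemma ek_nonneg: "ek s k \<ge> 0" using x0'_nonneg by (simp add: ek_def)

lemma ek_sums: "(%k. ek s k) sums exp x0'" and ek_alt: "(%k. (-1) ^ k * ek s k) sums ((-1) ^ s * exp (- x0'))"
proof -
 have a: "(%k. ek s (k + s)) sums exp x0'" using exp_converges[of x0'] by (simp add: ek_def divide_inverse mult.commute)
 have z: "(\<Sum>i<s. ek s i) = 0" by (simp add: ek_def)
 show "(%k. ek s k) sums exp x0'" using a z by (simp add: sums_iff_shift)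
 have "(%k. (-1) ^ s * ((- x0') ^ k /\<^sub>R fact k)) sums ((-1) ^ s * exp (- x0'))" by (intro sums_mult exp_converges)
 moreover have "(-1) ^ s * ((- x0') ^ k /\<^sub>R fact k) = (-1) ^ (k + s) * ek s (k + s)" for k
  by (simp add: ek_def divide_inverse power_add power_minus[of x0'] mult_ac)
 ultimately have b: "(%k. (-1) ^ (k + s) * ek s (k + s)) sums ((-1) ^ s * exp (- x0'))" by simp
 have z': "(\<Sum>i<s. (-1) ^ i * ek s i) = 0" by (simp add: ek_def)
 show "(%k. (-1) ^ k * ek s k) sums ((-1) ^ s * exp (- x0'))" 
  using b z' sums_iff_shift[of "%k. (-1) ^ k * ek s k" s "(-1) ^ s * exp (- x0')"] by simp
qed

text \<open>The recursion is triangular: area reproduces itself, boundary length is fed by area, and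
  the Euler characteristic by both. The three claims are therefore proved in one induction, and
  \<open>ek_rec0\<close> to \<open>ek_rec2\<close> solve them.\<close>

lemma R_closed:
 assumes W: "W \<in> KC"
 shows "Rk W 2 k = ennreal (fact k * (area W * ek 0 k))"
  and "Rk W 1 k = ennreal (fact k * (V1c W * ek 0 k + \<gamma> * mm * area W * ek 1 k))"
  and "Rk W 0 k = ennreal (fact k * (ek 0 k + \<gamma> * (area W + bb * V1c W) * ek 1 k + \<gamma>\<^sup>2 * bb * mm * area W / 2 * ek 2 k))"
proof (induction k)
 case 0
 {
  case 1 show ?case using Rk_0[OF W, of 2] by (simp add: ek_def Vconv_def)
 next
  case 2 show ?case using Rk_0[OF W, of 1] by (simp add: ek_def Vconv_def)
 next
  case 3 show ?case using Rk_0[OF W, of 0] KC_D(3)[OF W] by (simp add: ek_def Vconv_def)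
 }
next
 case (Suc k)
 note nn = gam vv_nonneg mm_nonneg bb_nonneg V1c_nonneg[OF W] ek_nonneg
 define A where "A = area W"
 have A: "A \<ge> 0" by (simp add: A_def)
 define a2 where "a2 = fact k * (A * ek 0 k)"
 define a1 where "a1 = fact k * (V1c W * ek 0 k + \<gamma> * mm * A * ek 1 k)"
 define a0 where "a0 = fact k * (ek 0 k + \<gamma> * (A + bb * V1c W) * ek 1 k + \<gamma>\<^sup>2 * bb * mm * A / 2 * ek 2 k)"
 have pos: "a2 \<ge> 0" "a1 \<ge> 0" "a0 \<ge> 0" using nn A by (simp_all add: a2_def a1_def a0_def)
 have IH: "Rk W 2 k = ennreal a2" "Rk W 1 k = ennreal a1" "Rk W 0 k = ennreal a0"
  using Suc by (simp_all add: a2_def a1_def a0_def A_def)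
 have f: "fact (Suc k) * z = fact k * (real (Suc k) * z)" for z :: real by (simp add: mult.assoc mult.commute mult.left_commute)
 {
  case 1
  have "Rk W 2 (Suc k) = (\<integral>\<^sup>+t. ennreal (\<gamma> * vv * Vconv 2 (WT W k t) + 0 * Vconv 1 (WT W k t) + 0 * Vconv 0 (WT W k t)) \<partial>NW W k)"
   using Rk_Suc[OF W, of 2 k] by (simp add: Tc_def mult.assoc)
  also have "... = ennreal (\<gamma> * vv * a2)"
   using nn pos by (subst nn_lin[OF W]) (simp_all add: IH IH(2)[unfolded One_nat_def] ennreal_mult)
  also have "\<gamma> * vv * a2 = fact (Suc k) * (area W * ek 0 (Suc k))"
  proof -
   have "fact (Suc k) * (area W * ek 0 (Suc k)) = fact k * (A * (real (Suc k) * ek 0 (Suc k)))"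
    unfolding f A_def by (simp only: mult.left_commute)
   then show ?thesis unfolding ek_rec0 a2_def x0'_def by (simp add: mult_ac)
  qed
  finally show ?case .
 next
  case 2
  have "Rk W 1 (Suc k) = (\<integral>\<^sup>+t. ennreal (\<gamma> * mm * Vconv 2 (WT W k t) + \<gamma> * vv * Vconv 1 (WT W k t) + 0 * Vconv 0 (WT W k t)) \<partial>NW W k)"
   using Rk_Suc[OF W, of 1 k] by (simp add: Tc_def algebra_simps)
  also have "... = ennreal (\<gamma> * mm * a2 + \<gamma> * vv * a1)"
   using nn pos by (subst nn_lin[OF W]) (simp_all add: IH IH(2)[unfolded One_nat_def] ennreal_mult)
  also have "\<gamma> * mm * a2 + \<gamma> * vv * a1 = fact (Suc k) * (V1c W * ek 0 (Suc k) + \<gamma> * mm * area W * ek 1 (Suc k))"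
  proof -
   have "fact (Suc k) * (V1c W * ek 0 (Suc k) + \<gamma> * mm * area W * ek 1 (Suc k))
    = fact k * (V1c W * (real (Suc k) * ek 0 (Suc k)) + \<gamma> * mm * A * (real (Suc k) * ek 1 (Suc k)))"
    unfolding f A_def by (simp only: distrib_left mult_ac)
   then show ?thesis unfolding ek_rec0 ek_rec1 a2_def a1_def x0'_def by (simp add: algebra_simps)
  qed
  finally show ?case .
 next
  case 3
  have "Rk W 0 (Suc k) = (\<integral>\<^sup>+t. ennreal (\<gamma> * Vconv 2 (WT W k t) + \<gamma> * bb * Vconv 1 (WT W k t) + \<gamma> * vv * Vconv 0 (WT W k t)) \<partial>NW W k)"
   using Rk_Suc[OF W, of 0 k] by (simp add: Tc_def algebra_simps)
  also have "... = ennreal (\<gamma> * a2 + \<gamma> * bb * a1 + \<gamma> * vv * a0)"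
   using nn pos by (subst nn_lin[OF W]) (simp_all add: IH IH(2)[unfolded One_nat_def] ennreal_mult)
  also have "\<gamma> * a2 + \<gamma> * bb * a1 + \<gamma> * vv * a0 = fact (Suc k) * (ek 0 (Suc k) + \<gamma> * (area W + bb * V1c W) * ek 1 (Suc k) + \<gamma>\<^sup>2 * bb * mm * area W / 2 * ek 2 (Suc k))"
  proof -
   have "fact (Suc k) * (ek 0 (Suc k) + \<gamma> * (area W + bb * V1c W) * ek 1 (Suc k) + \<gamma>\<^sup>2 * bb * mm * area W / 2 * ek 2 (Suc k))
    = fact k * (real (Suc k) * ek 0 (Suc k) + \<gamma> * (A + bb * V1c W) * (real (Suc k) * ek 1 (Suc k)) + \<gamma>\<^sup>2 * bb * mm * A / 2 * (real (Suc k) * ek 2 (Suc k)))"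
    unfolding f A_def by (simp only: distrib_left mult_ac)
   then show ?thesis unfolding ek_rec0 ek_rec1 ek_rec2 a2_def a1_def a0_def x0'_def by (simp add: algebra_simps power2_eq_square)
  qed
  finally show ?case .
 }
qed

end

text \<open>Needed because the intrinsic volume of the covered part of the window is known to equal
  a measurable function only outside a null set; the completion absorbs that null set.\<close>

lemma measurable_completion_AE:
 fixes f g :: "'a => real"
 assumes f: "f \<in> borel_measurable (completion M)" and eq: "AE x in completion M. f x = g x"
 shows "g \<in> borel_measurable (completion M)"
proof (rule measurableI)
 fix A :: "real set" assume A: "A \<in> sets borel"
 show "g -` A \<inter> space (completion M) \<in> sets (completion M)"
 proof (rule completion.in_sets_AE)
  show "f -` A \<inter> space (completion M) \<in> sets (completion M)" by (rule measurable_sets[OF f A])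
  show "AE x in completion M. x \<in> f -` A \<inter> space (completion M) \<longleftrightarrow> x \<in> g -` A \<inter> space (completion M)"
   using eq by eventually_elim simp
 qed simp
qed simp

context bmodel
begin

context
 fixes W and j :: nat
 assumes W: "W \<in> KC" and j: "j \<le> 2"
  and summ: "summable (%k. enn2real (Rk W j k) / fact k)" and Rfin: "\<And>k. Rk W j k < \<infinity>"
begin

abbreviation BB where "BB \<equiv> hitW W"

lemmas BBs = hitW_sets[OF W] and BBf = hitW_finite[OF W]

definition gI :: "(pt \<times> pt set) set => real" where
 "gI I = Vconv j (W \<inter> (\<Inter>p\<in>I. tg p))"

definition hh :: "nat => (pt \<times> pt set) set => ennreal" where
 "hh k \<phi> = Sg BB k (%t. ennreal (Vconv j (WT W k t)) * indicator (SepI BB k) t) \<phi>"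

text \<open>On finite configurations without ties this is the sum of \<open>gI\<close> over the
  \<open>k\<close>-element subsets of the grains hitting the window, each subset being counted in
  \<open>fact k\<close> orders by \<open>hh\<close>.\<close>

definition h :: "nat => (pt \<times> pt set) set => real" where
 "h k \<phi> = enn2real (hh k \<phi>) / fact k"

lemma good_hh: "good BB k (%t. ennreal (Vconv j (WT W k t)) * indicator (SepI BB k) t)"
 by (rule good_SepI[OF BBs BBf measurable_compose[OF Vconv_WT_measurable[OF W] measurable_ennreal]])

lemma hh_measurable: "hh k \<in> borel_measurable P" using good_hh[of k] unfolding good_def[OF BBs BBf] hh_def[abs_def] by blast

lemma hh_integral: "(\<integral>\<^sup>+\<phi>. hh k \<phi> \<partial>P) = Rk W j k"
proof -
 have "(\<integral>\<^sup>+\<phi>. hh k \<phi> \<partial>P) = (\<integral>\<^sup>+t. ennreal (Vconv j (WT W k t)) * indicator (SepI BB k) t \<partial>PiM {..<k} (%_. nu BB))"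
  using good_hh[of k] unfolding good_def[OF BBs BBf] hh_def by blast
 also have "... = Rk W j k" unfolding Rk_def[OF W] using AE_SepI[OF BBs BBf, of k] by (intro nn_integral_cong_AE) auto
 finally show ?thesis .
qed

lemma h_measurable: "h k \<in> borel_measurable P" unfolding h_def[abs_def] using hh_measurable[of k] by measurable

lemma h_nonneg: "h k \<phi> \<ge> 0" by (simp add: h_def)

lemma h_integrable: "integrable P (h k)" and h_integral: "(\<integral>\<phi>. h k \<phi> \<partial>P) = enn2real (Rk W j k) / fact k"
proof -
 have fin: "AE \<phi> in P. hh k \<phi> ~= \<infinity>"
  using hh_measurable Rfin[of k] by (intro nn_integral_PInf_AE) (auto simp: hh_integral)
 have "(\<integral>\<^sup>+\<phi>. ennreal (h k \<phi>) \<partial>P) = (\<integral>\<^sup>+\<phi>. hh k \<phi> * ennreal (1 / fact k) \<partial>P)"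
 proof (rule nn_integral_cong_AE)
  show "AE \<phi> in P. ennreal (h k \<phi>) = hh k \<phi> * ennreal (1 / fact k)" using fin
  proof eventually_elim
   case (elim \<phi>)
   then have "hh k \<phi> = ennreal (enn2real (hh k \<phi>))" by (simp add: less_top)
   moreover have "ennreal (h k \<phi>) = ennreal (enn2real (hh k \<phi>)) * ennreal (1 / fact k)"
    unfolding h_def by (simp add: ennreal_mult[symmetric])
   ultimately show ?case by simp
  qed
 qed
 also have "... = Rk W j k * ennreal (1 / fact k)" using hh_measurable by (simp add: nn_integral_multc hh_integral)
 also have "... = ennreal (enn2real (Rk W j k) / fact k)"
 proof -
  have "Rk W j k = ennreal (enn2real (Rk W j k))" using Rfin[of k] by simp
  moreover have "ennreal (enn2real (Rk W j k)) * ennreal (1 / fact k) = ennreal (enn2real (Rk W j k) / fact k)"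
   by (simp add: ennreal_mult[symmetric])
  ultimately show ?thesis by simp
 qed
 finally have nn: "(\<integral>\<^sup>+\<phi>. ennreal (h k \<phi>) \<partial>P) = ennreal (enn2real (Rk W j k) / fact k)" .
 show "integrable P (h k)" by (rule integrableI_nn_integral_finite[OF h_measurable _ nn]) (simp add: h_nonneg)
 show "(\<integral>\<phi>. h k \<phi> \<partial>P) = enn2real (Rk W j k) / fact k"
  using nn by (intro integral_eq_nn_integral[THEN trans] h_measurable) (auto simp: h_nonneg)
qed

lemma h_nice:
 assumes sp: "\<phi> \<in> space P" and F: "\<phi> \<in> Fin BB" and nt: "inj_on xc (\<phi> \<inter> BB)"
 shows "h k \<phi> = (\<Sum>I\<in>{I. I \<subseteq> \<phi> \<inter> BB \<and> card I = k}. gI I)"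
proof -
 have fin: "finite (\<phi> \<inter> BB)" using F by (simp add: Fin_def[OF BBs BBf])
 have gnn: "gI I \<ge> 0" if "I \<subseteq> \<phi> \<inter> BB" for I
 proof -
  have t: "compact (tg p)" "convex (tg p)" if "p \<in> I" for p
   using tg_cc[of p] that \<open>I \<subseteq> _\<close> sets.sets_into_space[OF BBs] by blast+
  have "compact (W \<inter> (\<Inter>p\<in>I. tg p))"
   by (intro compact_Int_closed[OF KC_D(1)[OF W]] closed_INT ballI compact_imp_closed t)
  moreover have "convex (W \<inter> (\<Inter>p\<in>I. tg p))" by (intro convex_Int KC_D(2)[OF W] convex_INT t)
  ultimately have "compact (W \<inter> (\<Inter>p\<in>I. tg p))" "convex (W \<inter> (\<Inter>p\<in>I. tg p))" by simp_all
  then show ?thesis unfolding gI_def by (rule Vconv_nonneg)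
 qed
 define s where "s = (\<Sum>I\<in>{I. I \<subseteq> \<phi> \<inter> BB \<and> card I = k}. gI I)"
 have s: "s \<ge> 0" unfolding s_def by (rule sum_nonneg) (use gnn in blast)
 have "hh k \<phi> = (\<Sum>t\<in>inj_tuples k (\<phi> \<inter> BB). ennreal (Vconv j (WT W k t)))"
  unfolding hh_def by (rule Sg_Sep_eq[OF BBs BBf F nt])
 also have "... = (\<Sum>t\<in>inj_tuples k (\<phi> \<inter> BB). ennreal (gI (t ` {..<k})))" by (simp add: gI_def WT_def[OF W])
 also have "... = of_nat (fact k) * (\<Sum>I\<in>{I. I \<subseteq> \<phi> \<inter> BB \<and> card I = k}. ennreal (gI I))"
  by (rule sum_inj_tuples[OF fin])
 also have "(\<Sum>I\<in>{I. I \<subseteq> \<phi> \<inter> BB \<and> card I = k}. ennreal (gI I)) = ennreal (\<Sum>I\<in>{I. I \<subseteq> \<phi> \<inter> BB \<and> card I = k}. gI I)"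
  using gnn by (intro sum_ennreal) auto
 also have "of_nat (fact k) * ennreal (\<Sum>I\<in>{I. I \<subseteq> \<phi> \<inter> BB \<and> card I = k}. gI I) = ennreal (fact k * (\<Sum>I\<in>{I. I \<subseteq> \<phi> \<inter> BB \<and> card I = k}. gI I))"
 proof -
  have "0 \<le> (\<Sum>I\<in>{I. I \<subseteq> \<phi> \<inter> BB \<and> card I = k}. gI I)" by (rule sum_nonneg) (use gnn in blast)
  then show ?thesis by (simp only: ennreal_of_nat_eq_real_of_nat of_nat_fact) (rule ennreal_mult'[symmetric], simp)
 qed
 finally have "hh k \<phi> = ennreal (fact k * s)" unfolding s_def .
 then show ?thesis unfolding s_def[symmetric] using s by (simp add: h_def)
qed

text \<open>Inclusion-exclusion over the grains hitting the window, grouped by the number of grains.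
  The union omits the empty subset, which would contribute \<open>Vconv j W\<close>; this is why the
  full alternating sum is subtracted from it.\<close>

lemma V_nice:
 assumes sp: "\<phi> \<in> space P" and F: "\<phi> \<in> Fin BB" and nt: "inj_on xc (\<phi> \<inter> BB)"
 shows "V j (Xi \<phi> \<inter> W) = Vconv j W - (\<Sum>k. (-1) ^ k * h k \<phi>)" and "summable (%k. \<bar>(-1) ^ k * h k \<phi>\<bar>)"
proof -
 let ?A = "\<phi> \<inter> BB"
 have fin: "finite ?A" using F by (simp add: Fin_def[OF BBs BBf])
 have cc: "compact (W \<inter> tg p)" "convex (W \<inter> tg p)" if "p \<in> ?A" for p
 proof -
  have "p \<in> space mu" using that sets.sets_into_space[OF BBs] by blast
  from tg_cc[OF this] show "compact (W \<inter> tg p)" "convex (W \<inter> tg p)" by (auto intro: compact_Int convex_Int KC_D(1,2)[OF W])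
 qed
 have "\<phi> \<subseteq> space mu" using sp by (simp add: space_P space_mu)
 then have U: "Xi \<phi> \<inter> W = (\<Union>p\<in>?A. W \<inter> tg p)" by (auto simp: Xi_tg hitW_def[OF W])
 have h0: "h k \<phi> = 0" if "k \<notin> {..card ?A}" for k
 proof -
  have e: "{I. I \<subseteq> ?A \<and> card I = k} = {}" using that card_mono[OF fin] by fastforce
  show ?thesis unfolding h_nice[OF assms] e by simp
 qed
 show "summable (%k. \<bar>(-1) ^ k * h k \<phi>\<bar>)" using h0 by (intro summable_finite[of "{..card ?A}"]) auto
 have "V j (Xi \<phi> \<inter> W) = (\<Sum>J\<in>Pow ?A - {{}}. (-1) ^ (card J + 1) * Vconv j (\<Inter>p\<in>J. W \<inter> tg p))"
  unfolding U by (rule V_UN[OF fin cc])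
 also have "... = (\<Sum>J\<in>Pow ?A - {{}}. - ((-1) ^ card J * gI J))"
 proof (rule sum.cong[OF refl])
  fix J assume "J \<in> Pow ?A - {{}}"
  then have "(\<Inter>p\<in>J. W \<inter> tg p) = W \<inter> (\<Inter>p\<in>J. tg p)" by auto
  then show "(-1) ^ (card J + 1) * Vconv j (\<Inter>p\<in>J. W \<inter> tg p) = - ((-1) ^ card J * gI J)" by (simp add: gI_def)
 qed
 also have "... = gI {} - (\<Sum>J\<in>Pow ?A. (-1) ^ card J * gI J)"
 proof -
  have "(\<Sum>J\<in>Pow ?A. (-1) ^ card J * gI J) = (-1) ^ card ({} :: (pt \<times> pt set) set) * gI {} + (\<Sum>J\<in>Pow ?A - {{}}. (-1) ^ card J * gI J)"
   by (rule sum.remove) (simp_all only: finite_Pow_iff fin, simp)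
  then show ?thesis unfolding sum_negf by simp
 qed
 also have "(\<Sum>J\<in>Pow ?A. (-1) ^ card J * gI J) = (\<Sum>k\<le>card ?A. \<Sum>J\<in>{J \<in> Pow ?A. card J = k}. (-1) ^ card J * gI J)"
 proof (rule sum.group[symmetric])
  show "finite (Pow ?A)" by (simp only: finite_Pow_iff fin)
  show "card ` Pow ?A \<subseteq> {..card ?A}" using card_mono[OF fin] by blast
 qed simp
 also have "... = (\<Sum>k\<le>card ?A. (-1) ^ k * h k \<phi>)"
 proof (rule sum.cong[OF refl])
  fix k
  have e: "{J \<in> Pow ?A. card J = k} = {I. I \<subseteq> ?A \<and> card I = k}" by auto
  show "(\<Sum>J\<in>{J \<in> Pow ?A. card J = k}. (-1) ^ card J * gI J) = (-1) ^ k * h k \<phi>"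
   unfolding h_nice[OF assms] e by (simp add: sum_distrib_left)
 qed
 also have "... = (\<Sum>k. (-1) ^ k * h k \<phi>)" using h0 by (intro suminf_finite[symmetric]) auto
 finally show "V j (Xi \<phi> \<inter> W) = Vconv j W - (\<Sum>k. (-1) ^ k * h k \<phi>)" by (simp add: gI_def)
qed

text \<open>Expectation and alternating series may be exchanged because the means of the absolute
  values, \<open>Rk\<close> divided by \<open>fact k\<close>, are summable.\<close>

lemma EV_series:
 "(\<integral>\<phi>. V j (Xi \<phi> \<inter> W) \<partial>completion P) = Vconv j W - (\<Sum>k. (-1) ^ k * (enn2real (Rk W j k) / fact k))"
proof -
 define Y where "Y \<phi> = Vconv j W - (\<Sum>k. (-1) ^ k * h k \<phi>)" for \<phi>
 have nice: "AE \<phi> in P. \<phi> \<in> space P \<and> \<phi> \<in> Fin BB \<and> inj_on xc (\<phi> \<inter> BB)"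
  using AE_space AE_Fin[OF BBs BBf] AE_no_ties[OF BBs BBf] by eventually_elim auto
 have eq: "AE \<phi> in P. V j (Xi \<phi> \<inter> W) = Y \<phi>" using nice by eventually_elim (simp add: V_nice Y_def)
 have mh: "(%\<phi>. (-1) ^ k * h k \<phi>) \<in> borel_measurable P" for k using h_measurable[of k] by measurable
 have Ym: "Y \<in> borel_measurable P" unfolding Y_def[abs_def] using mh by (intro borel_measurable_diff borel_measurable_const borel_measurable_suminf)
 have int: "integrable P (%\<phi>. (-1) ^ k * h k \<phi>)" for k using h_integrable[of k] by simp
 have n: "(\<integral>\<phi>. norm ((-1) ^ k * h k \<phi>) \<partial>P) = enn2real (Rk W j k) / fact k" for k
  using h_nonneg[of k] h_integral[of k] by (simp add: abs_mult power_abs)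
 have s1: "AE \<phi> in P. summable (%k. norm ((-1) ^ k * h k \<phi>))" using nice by eventually_elim (simp add: V_nice(2)[simplified])
 have s2: "summable (%k. \<integral>\<phi>. norm ((-1) ^ k * h k \<phi>) \<partial>P)" unfolding n by (rule summ)
 have "(\<integral>\<phi>. V j (Xi \<phi> \<inter> W) \<partial>completion P) = (\<integral>\<phi>. Y \<phi> \<partial>completion P)"
 proof (rule integral_cong_AE)
  show m: "Y \<in> borel_measurable (completion P)" using Ym by (rule measurable_completion)
  have eqc: "AE \<phi> in completion P. V j (Xi \<phi> \<inter> W) = Y \<phi>" using eq by (rule AE_completion)
  then show "AE \<phi> in completion P. V j (Xi \<phi> \<inter> W) = Y \<phi>" .
  from eqc have "AE \<phi> in completion P. Y \<phi> = V j (Xi \<phi> \<inter> W)" by eventually_elim simp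
  from measurable_completion_AE[OF m this]
  show "(%\<phi>. V j (Xi \<phi> \<inter> W)) \<in> borel_measurable (completion P)" .
 qed
 also have "... = (\<integral>\<phi>. Y \<phi> \<partial>P)" using Ym by (rule integral_completion)
 also have "... = Vconv j W - (\<integral>\<phi>. (\<Sum>k. (-1) ^ k * h k \<phi>) \<partial>P)"
  unfolding Y_def using integrable_suminf[OF int s1 s2] by (subst Bochner_Integration.integral_diff) (auto simp: P.prob_space)
 also have "(\<integral>\<phi>. (\<Sum>k. (-1) ^ k * h k \<phi>) \<partial>P) = (\<Sum>k. \<integral>\<phi>. (-1) ^ k * h k \<phi> \<partial>P)"
  by (rule integral_suminf[OF int s1 s2])
 also have "... = (\<Sum>k. (-1) ^ k * (enn2real (Rk W j k) / fact k))" by (simp add: h_integral)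
 finally show ?thesis .
qed

end

definition ex0 :: real where "ex0 = exp (- \<gamma> * vv)"

text \<open>The alternating sum of \<open>ek s\<close> is \<open>exp (- x0')\<close> with the sign
  \<open>(-1) ^ s\<close>; this produces the common factor \<open>ex0\<close> and the sign of the
  second term.\<close>

lemma EV1_W:
 assumes W: "W \<in> KC"
 shows "(\<integral>\<phi>. V 1 (Xi \<phi> \<inter> W) \<partial>completion P) = V1c W - ex0 * (V1c W - \<gamma> * mm * area W)"
proof -
 let ?q = "%k. V1c W * ek 0 k + \<gamma> * mm * area W * ek 1 k"
 have q: "enn2real (Rk W 1 k) / fact k = ?q k" for k unfolding R_closed(2)[OF W] using gam mm_nonneg V1c_nonneg[OF W] ek_nonneg by simp
 have sq: "?q sums (V1c W * exp x0' + \<gamma> * mm * area W * exp x0')" by (intro sums_add sums_mult ek_sums)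
 have "(%k. V1c W * ((-1) ^ k * ek 0 k) + \<gamma> * mm * area W * ((-1) ^ k * ek 1 k)) sums (V1c W * ((-1) ^ 0 * exp (- x0')) + \<gamma> * mm * area W * ((-1) ^ 1 * exp (- x0')))"
  by (intro sums_add sums_mult ek_alt)
 then have sa: "(%k. (-1) ^ k * ?q k) sums (ex0 * (V1c W - \<gamma> * mm * area W))"
  by (simp add: ex0_def x0'_def algebra_simps)
 have "(\<integral>\<phi>. V 1 (Xi \<phi> \<inter> W) \<partial>completion P) = Vconv 1 W - (\<Sum>k. (-1) ^ k * (enn2real (Rk W 1 k) / fact k))"
 proof (rule EV_series[OF W])
  show "summable (%k. enn2real (Rk W 1 k) / fact k)" unfolding q using sq by (rule sums_summable)
  show "Rk W 1 k < \<infinity>" for k unfolding R_closed(2)[OF W] by simp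
 qed simp
 then show ?thesis unfolding q using sums_unique[OF sa] by (simp add: Vconv_def)
qed

lemma EV0_W:
 assumes W: "W \<in> KC"
 shows "(\<integral>\<phi>. V 0 (Xi \<phi> \<inter> W) \<partial>completion P) = 1 - ex0 * (1 - \<gamma> * (area W + bb * V1c W) + \<gamma>\<^sup>2 * bb * mm * area W / 2)"
proof -
 let ?c1 = "\<gamma> * (area W + bb * V1c W)" and ?c2 = "\<gamma>\<^sup>2 * bb * mm * area W / 2"
 let ?q = "%k. ek 0 k + ?c1 * ek 1 k + ?c2 * ek 2 k"
 have q: "enn2real (Rk W 0 k) / fact k = ?q k" for k
  unfolding R_closed(3)[OF W] using gam mm_nonneg bb_nonneg V1c_nonneg[OF W] ek_nonneg by simp
 have sq: "?q sums (exp x0' + ?c1 * exp x0' + ?c2 * exp x0')" by (intro sums_add sums_mult ek_sums)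
 have "(%k. (-1) ^ k * ek 0 k + ?c1 * ((-1) ^ k * ek 1 k) + ?c2 * ((-1) ^ k * ek 2 k)) sums ((-1) ^ 0 * exp (- x0') + ?c1 * ((-1) ^ 1 * exp (- x0')) + ?c2 * ((-1) ^ 2 * exp (- x0')))"
  by (intro sums_add sums_mult ek_alt)
 moreover have "(-1) ^ k * ek 0 k + ?c1 * ((-1) ^ k * ek 1 k) + ?c2 * ((-1) ^ k * ek 2 k) = (-1) ^ k * ?q k" for k
  by (simp only: distrib_left mult.left_commute)
 moreover have "(-1) ^ 0 * exp (- x0') + ?c1 * ((-1) ^ 1 * exp (- x0')) + ?c2 * ((-1) ^ 2 * exp (- x0')) = ex0 * (1 - ?c1 + ?c2)"
  by (simp add: ex0_def x0'_def algebra_simps)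
 ultimately have sa: "(%k. (-1) ^ k * ?q k) sums (ex0 * (1 - ?c1 + ?c2))" by simp
 have "(\<integral>\<phi>. V 0 (Xi \<phi> \<inter> W) \<partial>completion P) = Vconv 0 W - (\<Sum>k. (-1) ^ k * (enn2real (Rk W 0 k) / fact k))"
 proof (rule EV_series[OF W])
  show "summable (%k. enn2real (Rk W 0 k) / fact k)" unfolding q using sq by (rule sums_summable)
  show "Rk W 0 k < \<infinity>" for k unfolding R_closed(3)[OF W] by simp
 qed simp
 then show ?thesis unfolding q using sums_unique[OF sa] KC_D(3)[OF W] by (simp add: Vconv_def)
qed

end

lemma scaled_W0: "s > 0 ==> (%x. s *\<^sub>R x) ` W0 = mink (seg (s, 0)) (seg (0, s))"
proof (intro equalityI subsetI)
 fix z assume s: "s > 0" and "z \<in> (%x. s *\<^sub>R x) ` W0"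
 then obtain x y where "0 \<le> x" "x \<le> 1" "0 \<le> y" "y \<le> 1" "z = (s * x, 0) + (0, s * y)" by (auto simp: W0_def cbox_Pair_eq)
 moreover have "(s * x, 0) \<in> seg (s, 0)" "(0, s * y) \<in> seg (0, s)"
  using calculation s by (simp_all add: seg_horizontal segv mult_left_le)
 ultimately show "z \<in> mink (seg (s, 0)) (seg (0, s))" unfolding mink_def by blast
next
 fix z assume s: "s > 0" and "z \<in> mink (seg (s, 0)) (seg (0, s))"
 then obtain x y where h: "0 \<le> x" "x \<le> s" "0 \<le> y" "y \<le> s" "z = (x, y)" by (auto simp: mink_def seg_horizontal segv)
 then have "z = s *\<^sub>R (x / s, y / s)" "(x / s, y / s) \<in> W0" using s by (auto simp: W0_def cbox_Pair_eq)
 then show "z \<in> (%x. s *\<^sub>R x) ` W0" by blast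
qed

lemma scaled_W0_KC: "s > 0 ==> (%x. s *\<^sub>R x) ` W0 \<in> KC" by (simp add: scaled_W0)

lemma scaled_W0_area: "s > 0 ==> area ((%x. s *\<^sub>R x) ` W0) = s\<^sup>2"
 by (simp add: scaled_W0 area_par cross_def power2_eq_square)

lemma scaled_W0_V1c: "s > 0 ==> V1c ((%x. s *\<^sub>R x) ` W0) = 2 * s"
 using kap_pos by (simp add: scaled_W0 V1c_eq Lw_mink Lw_seg norm_Pair add_divide_distrib)

context bmodel
begin

theorem barV_1: "barV 1 P = \<gamma> * mm * ex0"
proof -
 \<comment> \<open>The boundary of the window contributes order \<open>s\<close>, which is
   negligible after division by its area.\<close>
 have "((%s. (1 - ex0) * 2 / s + ex0 * \<gamma> * mm) \<longlongrightarrow> 0 + ex0 * \<gamma> * mm) at_top"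
  by (intro tendsto_add tendsto_const real_tendsto_divide_at_top[OF tendsto_const] filterlim_ident)
 moreover have "\<forall>\<^sub>F s in at_top. (1 - ex0) * 2 / s + ex0 * \<gamma> * mm =
  (\<integral>\<phi>. V 1 (Xi \<phi> \<inter> (%x. s *\<^sub>R x) ` W0) \<partial>completion P) / area ((%x. s *\<^sub>R x) ` W0)"
  using eventually_gt_at_top[of 0]
 proof eventually_elim
  case (elim s)
  show ?case unfolding EV1_W[OF scaled_W0_KC[OF elim]] scaled_W0_V1c[OF elim] scaled_W0_area[OF elim]
   using elim by (simp add: field_simps power2_eq_square)
 qed
 ultimately have "((%s. (\<integral>\<phi>. V 1 (Xi \<phi> \<inter> (%x. s *\<^sub>R x) ` W0) \<partial>completion P) / area ((%x. s *\<^sub>R x) ` W0)) \<longlongrightarrow> 0 + ex0 * \<gamma> * mm) at_top"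
  by (rule Lim_transform_eventually)
 then have "barV 1 P = 0 + ex0 * \<gamma> * mm" unfolding barV_def by (intro tendsto_Lim) auto
 then show ?thesis by simp
qed

text \<open>The quadratic term arises as \<open>\<gamma>\<^sup>2 * bb * mm / 2\<close>; inserting
  \<open>bb_eq\<close> gives the form with \<open>pi\<close>.\<close>

theorem barV_0: "barV 0 P = (\<gamma> - pi * (\<gamma> / pi * mm)\<^sup>2) * ex0"
proof -
 let ?L = "ex0 * (\<gamma> - \<gamma>\<^sup>2 * bb * mm / 2)"
 have "((%s. (1 - ex0) / s\<^sup>2 + ex0 * \<gamma> * bb * 2 / s + ?L) \<longlongrightarrow> 0 + 0 + ?L) at_top"
  by (intro tendsto_add tendsto_const real_tendsto_divide_at_top[OF tendsto_const] filterlim_ident filterlim_pow_at_top) auto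
 moreover have "\<forall>\<^sub>F s in at_top. (1 - ex0) / s\<^sup>2 + ex0 * \<gamma> * bb * 2 / s + ?L =
  (\<integral>\<phi>. V 0 (Xi \<phi> \<inter> (%x. s *\<^sub>R x) ` W0) \<partial>completion P) / area ((%x. s *\<^sub>R x) ` W0)"
  using eventually_gt_at_top[of 0]
 proof eventually_elim
  case (elim s)
  show ?case unfolding EV0_W[OF scaled_W0_KC[OF elim]] scaled_W0_V1c[OF elim] scaled_W0_area[OF elim]
   using elim by (simp add: field_simps power2_eq_square)
 qed
 ultimately have "((%s. (\<integral>\<phi>. V 0 (Xi \<phi> \<inter> (%x. s *\<^sub>R x) ` W0) \<partial>completion P) / area ((%x. s *\<^sub>R x) ` W0)) \<longlongrightarrow> 0 + 0 + ?L) at_top"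
  by (rule Lim_transform_eventually)
 then have "barV 0 P = 0 + 0 + ?L" unfolding barV_def by (intro tendsto_Lim) auto
 moreover have "?L = (\<gamma> - pi * (\<gamma> / pi * mm)\<^sup>2) * ex0" unfolding bb_eq by (simp add: field_simps power2_eq_square)
 ultimately show ?thesis by simp
qed

end

section \<open>Unions of translates of a smooth body\<close>

lemma inner_rot [simp]: "inner (rot v x) (rot v y) = inner x (y :: pt)"
proof -
 have "(c * a - s * b) * (c * x - s * y) + (s * a + c * b) * (s * x + c * y) = (s * s + c * c) * (a * x + b * y)"
  for a b c s x y :: real by algebra
 from this[of "cos v" "fst x" "sin v" "snd x" "fst y" "snd y"] show ?thesis
  by (simp add: rot_def inner_prod_def case_prod_unfold sin_cos_squared_add3 add.commute)
qed

text \<open>Smoothness seen from support points: in every direction some support point carries an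
  inner ball. In this form the property passes directly to rotated bodies and to sums with
  segments.\<close>

definition inner_ball :: "real => pt set => bool" where
 "inner_ball e K \<longleftrightarrow> (\<forall>n. norm n = 1 --> (\<exists>x\<in>K. (\<forall>y\<in>K. inner y n \<le> inner x n) \<and> cball (x - e *\<^sub>R n) e \<subseteq> K))"

lemma support_point:
 fixes K :: "pt set"
 assumes "compact K" "K ~= {}" obtains x where "x \<in> K" "\<And>y. y \<in> K ==> inner y n \<le> inner x n"
proof -
 have "continuous_on K (%x. inner x n)" by (intro continuous_intros)
 from continuous_attains_sup[OF assms this] show thesis using that by blast
qed

text \<open>A support point lies on the frontier, and uniqueness of the normal there identifies the
  chosen direction with the one that carries the ball.\<close>

lemma smooth_inner_ball:
 assumes K: "K \<in> KC" and s: "smooth_eps e K" shows "inner_ball e K" unfolding inner_ball_def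
proof (intro allI impI)
 fix n :: pt assume n: "norm n = 1"
 obtain x where x: "x \<in> K" "\<And>y. y \<in> K ==> inner y n \<le> inner x n"
  using support_point[OF KC_D(1)[OF K] KC_D(3)[OF K]] by blast
 have "x \<notin> interior K"
 proof
  assume "x \<in> interior K"
  then obtain d where d: "d > 0" "cball x d \<subseteq> K" by (auto simp: mem_interior_cball)
  have "x + d *\<^sub>R n \<in> cball x d" using d n by (simp add: dist_norm)
  then have "inner (x + d *\<^sub>R n) n \<le> inner x n" using d x by blast
  then have "d * (norm n)\<^sup>2 \<le> 0" by (simp add: inner_add_left power2_norm_eq_inner)
  then show False using n d by simp
 qed
 then have "x \<in> frontier K" using x(1) closure_subset[of K] by (auto simp: frontier_def)
 with s obtain u where u: "\<And>u'. norm u' = 1 \<and> (\<forall>y\<in>K. inner (y - x) u' \<le> 0) ==> u' = u" "cball (x - e *\<^sub>R u) e \<subseteq> K"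
  unfolding smooth_eps_def by blast
 have "n = u" using n x(2) by (intro u(1)) (auto simp: inner_diff_left)
 then show "\<exists>x\<in>K. (\<forall>y\<in>K. inner y n \<le> inner x n) \<and> cball (x - e *\<^sub>R n) e \<subseteq> K" using x u(2) by blast
qed

lemma inner_ball_rot:
 assumes "inner_ball e K" shows "inner_ball e (rot v ` K)" unfolding inner_ball_def
proof (intro allI impI)
 fix n :: pt assume n: "norm n = 1"
 then have "norm (rot (- v) n) = 1" by simp
 with assms obtain x where x: "x \<in> K" "\<forall>y\<in>K. inner y (rot (- v) n) \<le> inner x (rot (- v) n)" "cball (x - e *\<^sub>R rot (- v) n) e \<subseteq> K"
  unfolding inner_ball_def by blast
 have i: "inner (rot v y) n = inner y (rot (- v) n)" for y using inner_rot[of v y "rot (- v) n"] by simp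
 have "cball (rot v x - e *\<^sub>R n) e \<subseteq> rot v ` K"
 proof
  fix z assume z: "z \<in> cball (rot v x - e *\<^sub>R n) e"
  have "rot (- v) z - (x - e *\<^sub>R rot (- v) n) = rot (- v) (z - (rot v x - e *\<^sub>R n))"
   by (simp add: linear_diff[OF linear_rot] linear_scale[OF linear_rot])
  then have "dist (x - e *\<^sub>R rot (- v) n) (rot (- v) z) = dist (rot v x - e *\<^sub>R n) z"
   by (simp add: dist_norm norm_minus_commute[of "x - _"] norm_minus_commute[of "_ - _ " z])
  then have "rot (- v) z \<in> K" using z x(3) by auto
  then show "z \<in> rot v ` K" by (metis imageI rot_inverse(1))
 qed
 then show "\<exists>x\<in>rot v ` K. (\<forall>y\<in>rot v ` K. inner y n \<le> inner x n) \<and> cball (x - e *\<^sub>R n) e \<subseteq> rot v ` K"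
  using x by (intro bexI[of _ "rot v x"]) (simp_all add: i)
qed

lemma inner_ball_mink:
 assumes "inner_ball e K" shows "inner_ball e (mink K (seg u))" unfolding inner_ball_def
proof (intro allI impI)
 fix n :: pt assume n: "norm n = 1"
 with assms obtain x where x: "x \<in> K" "\<And>y. y \<in> K ==> inner y n \<le> inner x n" "cball (x - e *\<^sub>R n) e \<subseteq> K"
  unfolding inner_ball_def by blast
 obtain s where s: "s \<in> seg u" "\<And>y. y \<in> seg u ==> inner y n \<le> inner s n"
  using support_point[of "seg u" n] by auto
 have "inner y n \<le> inner (x + s) n" if "y \<in> mink K (seg u)" for y
 proof -
  from that obtain a b where "a \<in> K" "b \<in> seg u" "y = a + b" unfolding mink_def by blast
  then show ?thesis using x(2)[of a] s(2)[of b] by (simp add: inner_add_left)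
 qed
 moreover have "cball (x + s - e *\<^sub>R n) e \<subseteq> mink K (seg u)"
 proof
  fix z assume "z \<in> cball (x + s - e *\<^sub>R n) e"
  then have "z - s \<in> cball (x - e *\<^sub>R n) e" by (simp add: dist_norm algebra_simps)
  then have "z - s \<in> K" using x(3) by blast
  moreover have "z = (z - s) + s" by simp
  ultimately show "z \<in> mink K (seg u)" unfolding mink_def using s(1) by blast
 qed
 moreover have "x + s \<in> mink K (seg u)" unfolding mink_def using x(1) s(1) by blast
 ultimately show "\<exists>x\<in>mink K (seg u). (\<forall>y\<in>mink K (seg u). inner y n \<le> inner x n) \<and> cball (x - e *\<^sub>R n) e \<subseteq> mink K (seg u)" by blast
qed

text \<open>Near its highest and lowest points the body contains a disc of radius \<open>e\<close>, so that a horizontal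
 chord at distance \<open>s\<close> from the extremes has length at least \<open>2 * sqrt (e * s)\<close>.\<close>

lemma chord_long:
 assumes K: "K \<in> KC" and ib: "inner_ball e K" and e: "e > 0" and t: "0 \<le> t" "t \<le> e"
 obtains c d where "c \<le> d" "snd ` K = {c..d}"
  "\<And>y. c + t\<^sup>2 / (4 * e) \<le> y ==> y \<le> d - t\<^sup>2 / (4 * e) ==> \<exists>x. (x, y) \<in> K \<and> (x + t, y) \<in> K"
proof -
 obtain c d where cd: "c \<le> d" "snd ` K = {c..d}" using cross_image[OF K, of "(1,0)"] by (auto simp: cross_def)
 define \<delta> where "\<delta> = t\<^sup>2 / (4 * e)"
 have \<delta>: "\<delta> \<ge> 0" using e by (simp add: \<delta>_def)
 obtain p where p: "p \<in> K" "\<And>y. y \<in> K ==> snd y \<le> snd p" "cball (p - e *\<^sub>R (0, 1)) e \<subseteq> K"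
  using ib[unfolded inner_ball_def, rule_format, of "(0, 1)"] by (auto simp: inner_prod_def norm_Pair)
 obtain q where q: "q \<in> K" "\<And>y. y \<in> K ==> snd q \<le> snd y" "cball (q - e *\<^sub>R (0, -1)) e \<subseteq> K"
  using ib[unfolded inner_ball_def, rule_format, of "(0, -1)"] by (auto simp: inner_prod_def norm_Pair)
 have sp: "snd p = d"
 proof (rule antisym)
  show "snd p \<le> d" using p(1) cd by (metis atLeastAtMost_iff image_eqI)
  have "d \<in> snd ` K" using cd by simp
  then show "d \<le> snd p" using p(2) by auto
 qed
 have sq: "snd q = c"
 proof (rule antisym)
  show "c \<le> snd q" using q(1) cd by (metis atLeastAtMost_iff image_eqI)
  have "c \<in> snd ` K" using cd by simp
  then show "snd q \<le> c" using q(2) by auto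
 qed
 have disc: "(fst z - t / 2, y) \<in> cball z e \<and> (fst z + t / 2, y) \<in> cball z e"
  if "(t / 2)\<^sup>2 + (y - snd z)\<^sup>2 \<le> e\<^sup>2" for z y
 proof -
  have nrm: "norm (a, b) \<le> e" if "a\<^sup>2 + b\<^sup>2 \<le> e\<^sup>2" for a b :: real
   unfolding norm_Pair real_norm_def power2_abs using that e by (intro real_le_lsqrt) auto
  have "norm (t / 2, y - snd z) \<le> e" "norm (t / 2, snd z - y) \<le> e"
   using nrm[OF that] nrm[of "t / 2" "snd z - y"] that power2_commute[of y "snd z"] by simp_all
  moreover have "dist z (fst z - t / 2, y) = norm (t / 2, snd z - y)" by (cases z) (simp add: dist_norm)
  moreover have "dist z (fst z + t / 2, y) = norm (t / 2, y - snd z)" by (cases z) (simp add: dist_norm norm_Pair power2_commute)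
  ultimately show ?thesis by simp
 qed
 have near: "(t / 2)\<^sup>2 + (e - s)\<^sup>2 \<le> e\<^sup>2" if "\<delta> \<le> s" "s \<le> e" for s
 proof -
  have "t\<^sup>2 / 4 \<le> e * s" using that(1) e by (simp add: \<delta>_def field_simps)
  moreover have "s * s \<le> e * s" using that \<delta> by (intro mult_right_mono) auto
  ultimately show ?thesis by (simp add: power2_eq_square algebra_simps)
 qed
 have "\<exists>x. (x, y) \<in> K \<and> (x + t, y) \<in> K" if y: "c + \<delta> \<le> y" "y \<le> d - \<delta>" for y
 proof -
  have fin: ?thesis if "(t / 2)\<^sup>2 + (y - snd z)\<^sup>2 \<le> e\<^sup>2" "cball z e \<subseteq> K" for z
   using disc[OF that(1)] that(2) by (intro exI[of _ "fst z - t / 2"]) (auto simp: field_simps)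
  \<comment> \<open>Near the top and near the bottom the inner discs contain the chord; in between,
    the horizontal chords through the centres of the two discs are joined by convexity.\<close>
  consider "d - e \<le> y" | "y \<le> c + e" | "c + e \<le> y" "y \<le> d - e" by linarith
  then show ?thesis
  proof cases
   case 1
   have "(t / 2)\<^sup>2 + (y - snd (p - e *\<^sub>R (0, 1)))\<^sup>2 \<le> e\<^sup>2"
    using near[of "d - y"] 1 y by (simp add: sp power2_commute algebra_simps)
   then show ?thesis using fin p(3) by blast
  next
   case 2
   have "(t / 2)\<^sup>2 + (y - snd (q - e *\<^sub>R (0, -1)))\<^sup>2 \<le> e\<^sup>2"
    using near[of "y - c"] 2 y by (simp add: sq power2_commute algebra_simps)
   then show ?thesis using fin q(3) by blast
  next
   case 3
   define a b where "a = q - e *\<^sub>R (0, -1)" and "b = p - e *\<^sub>R (0, 1 :: real)"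
   have ab: "snd a = c + e" "snd b = d - e" by (simp_all add: a_def b_def sp sq)
   have "y \<in> closed_segment (snd a) (snd b)" using 3 by (auto simp: ab closed_segment_eq_real_ivl)
   then obtain l where l: "0 \<le> l" "l \<le> 1" "y = (1 - l) * snd a + l * snd b" by (auto simp: in_segment)
   have te: "(t / 2)\<^sup>2 + (0::real)\<^sup>2 \<le> e\<^sup>2" using t by (simp add: power_mono)
   have "(fst a - t / 2, snd a) \<in> K" "(fst a + t / 2, snd a) \<in> K" using disc[of "snd a" a] te q(3) by (auto simp: a_def)
   moreover have "(fst b - t / 2, snd b) \<in> K" "(fst b + t / 2, snd b) \<in> K" using disc[of "snd b" b] te p(3) by (auto simp: b_def)
   ultimately have "(1 - l) *\<^sub>R (fst a - t / 2, snd a) + l *\<^sub>R (fst b - t / 2, snd b) \<in> K"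
    "(1 - l) *\<^sub>R (fst a + t / 2, snd a) + l *\<^sub>R (fst b + t / 2, snd b) \<in> K"
    using l KC_D(2)[OF K] by (auto intro!: convexD simp del: scaleR_Pair add_Pair)
   moreover have "(1 - l) * (fst a + t / 2) + l * (fst b + t / 2) = (1 - l) * (fst a - t / 2) + l * (fst b - t / 2) + t"
    by (simp add: field_simps)
   ultimately show ?thesis by (intro exI[of _ "(1 - l) * (fst a - t / 2) + l * (fst b - t / 2)"]) (simp add: l(3))
  qed
 qed
 then show thesis using that[OF cd] by (simp add: \<delta>_def)
qed

text \<open>A slice of the sum is not covered by the two shifted slices only where the chord of
  \<open>K\<close> is shorter than \<open>t\<close>. Such slices lie within
  \<open>t\<^sup>2 / (4 * e)\<close> of the lowest or highest point, and each leaves out at most the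
  length \<open>t\<close>.\<close>

lemma gap_horizontal:
 assumes K: "K \<in> KC" and ib: "inner_ball e K" and e: "e > 0" and t: "0 \<le> t" "t \<le> e"
 shows "area (mink K (seg (t, 0)) - (K \<union> (%x. (t, 0) + x) ` K)) \<le> t ^ 3 / (2 * e)"
proof -
 obtain c d where cd: "c \<le> d" "snd ` K = {c..d}"
  and lg: "\<And>y. c + t\<^sup>2 / (4 * e) \<le> y ==> y \<le> d - t\<^sup>2 / (4 * e) ==> \<exists>x. (x, y) \<in> K \<and> (x + t, y) \<in> K"
  using chord_long[OF assms] by blast
 define \<delta> where "\<delta> = t\<^sup>2 / (4 * e)"
 have \<delta>: "\<delta> \<ge> 0" using e by (simp add: \<delta>_def)
 let ?D = "mink K (seg (t, 0)) - (K \<union> (%x. (t, 0) + x) ` K)"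
 have cm: "compact (mink K (seg (t, 0)))" using K KC_D(1) by (intro mink_compact) auto
 have Ds: "?D \<in> sets borel" using K cm KC_translation[OF K, of "(t, 0)"] by (intro sets.Diff sets.Un) auto
 have sl: "emeasure lborel {x. (x, y) \<in> ?D} \<le> ennreal t * indicator ({c..c + \<delta>} \<union> {d - \<delta>..d}) y" for y
 proof (cases "y \<in> snd ` K")
  case False
  then have "(x, y) \<notin> K" for x by (metis image_eqI snd_conv)
  note nK = this
  have "(x, y) \<notin> mink K (seg (t, 0))" for x
  proof
   assume "(x, y) \<in> mink K (seg (t, 0))"
   then obtain k s where k: "k \<in> K" "(x, y) = k + (s, 0)" unfolding mink_def seg_horizontal[OF t(1)] by blast
   then have "(x - s, y) \<in> K" by (cases k) simp
   then show False using nK by blast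
  qed
  then have em: "{x. (x, y) \<in> ?D} = {}" by blast
  show ?thesis unfolding em by simp
 next
  case True
  then obtain l r where lr: "l \<le> r" "{x. (x, y) \<in> K} = {l..r}" using slice_interval[OF K] by blast
  then have mem: "(x, y) \<in> K \<longleftrightarrow> l \<le> x \<and> x \<le> r" for x unfolding set_eq_iff by simp
  have sub: "{x. (x, y) \<in> ?D} \<subseteq> {r<..<l + t}"
  proof
   fix x assume "x \<in> {x. (x, y) \<in> ?D}"
   then have h: "(x, y) \<in> mink K (seg (t, 0))" "(x, y) \<notin> K" "(x, y) \<notin> (%x. (t, 0) + x) ` K" by auto
   from h(1) obtain k s where k: "k \<in> K" "0 \<le> s" "s \<le> t" "(x, y) = k + (s, 0)"
    unfolding mink_def seg_horizontal[OF t(1)] by blast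
   then have "(x - s, y) \<in> K" by (cases k) simp
   then have xs: "l \<le> x - s" "x - s \<le> r" using mem by auto
   have "(x - t, y) \<notin> K"
   proof
    assume "(x - t, y) \<in> K"
    moreover have "(x, y) = (t, 0) + (x - t, y)" by simp
    ultimately show False using h(3) by blast
   qed
   then have "\<not> (l \<le> x - t \<and> x - t \<le> r)" "\<not> (l \<le> x \<and> x \<le> r)" using mem h(2) by auto
   then show "x \<in> {r<..<l + t}" using xs k(2,3) by auto
  qed
  show ?thesis
  proof (cases "y \<in> {c..c + \<delta>} \<union> {d - \<delta>..d}")
   case True
   have "emeasure lborel {x. (x, y) \<in> ?D} \<le> emeasure lborel {r<..<l + t}" using sub by (intro emeasure_mono) auto
   also have "... \<le> ennreal t" using lr(1) t(1) by (cases "r \<le> l + t") (auto intro: ennreal_leI)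
   finally show ?thesis using True by simp
  next
   case False
   moreover have "c \<le> y" "y \<le> d" using True cd by auto
   ultimately obtain x where "(x, y) \<in> K" "(x + t, y) \<in> K" using lg[of y] by (auto simp: \<delta>_def)
   then have "l + t \<le> r" using mem by force
   then have em: "{x. (x, y) \<in> ?D} = {}" using sub by auto
   show ?thesis unfolding em by simp
  qed
 qed
 have "emeasure lborel ?D \<le> (\<integral>\<^sup>+y. ennreal t * indicator ({c..c + \<delta>} \<union> {d - \<delta>..d}) y \<partial>lborel)"
  unfolding emeasure_pt_slices(1)[OF Ds] by (intro nn_integral_mono sl)
 also have "... = ennreal t * emeasure lborel ({c..c + \<delta>} \<union> {d - \<delta>..d})"
  by (intro nn_integral_cmult_indicator) auto
 also have "... \<le> ennreal t * (emeasure lborel {c..c + \<delta>} + emeasure lborel {d - \<delta>..d})"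
  by (intro mult_left_mono emeasure_subadditive) auto
 also have "... = ennreal (t * (2 * \<delta>))"
  using \<delta> t by (simp add: ennreal_plus[symmetric] ennreal_mult[symmetric] del: ennreal_plus)
 finally have "emeasure lborel ?D \<le> ennreal (t * (2 * \<delta>))" .
 then have "area ?D \<le> t * (2 * \<delta>)" unfolding measure_def using \<delta> t by (intro enn2real_leI) auto
 also have "... = t ^ 3 / (2 * e)" using e by (simp add: \<delta>_def power3_eq_cube power2_eq_square)
 finally show ?thesis .
qed

lemma gap:
 assumes K: "K \<in> KC" and ib: "inner_ball e K" and e: "e > 0" and u: "norm u \<le> e"
 shows "area (mink K (seg u) - (K \<union> (%x. u + x) ` K)) \<le> norm u ^ 3 / (2 * e)"
proof -
 define w where "w = (norm u, 0 :: real)"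
 from polar[of u] obtain v where "u = rot v (norm u, 0)" ..
 then have v: "rot v w = u" unfolding w_def by (rule sym)
 let ?A = "rot (- v) ` K"
 have AA: "rot v ` ?A = K" by (simp add: image_image)
 have s: "seg u = rot v ` seg w" using closed_segment_linear_image[OF linear_rot, of v 0 w] v linear_0[OF linear_rot, of v] by simp
 have t: "(%x. u + x) ` rot v ` B = rot v ` (%x. w + x) ` B" for B
  by (simp add: image_image linear_add[OF linear_rot] v)
 have "mink K (seg u) - (K \<union> (%x. u + x) ` K) = mink (rot v ` ?A) (seg u) - (rot v ` ?A \<union> (%x. u + x) ` rot v ` ?A)"
  unfolding AA ..
 also have "... = rot v ` mink ?A (seg w) - (rot v ` ?A \<union> rot v ` (%x. w + x) ` ?A)"
  unfolding s t mink_linear_image[OF linear_rot] ..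
 also have "... = rot v ` (mink ?A (seg w) - (?A \<union> (%x. w + x) ` ?A))"
  using bij_rot[of v] by (simp only: image_Un[symmetric] image_set_diff[OF bij_is_inj])
 finally have eq: "mink K (seg u) - (K \<union> (%x. u + x) ` K) = rot v ` (mink ?A (seg w) - (?A \<union> (%x. w + x) ` ?A))" .
 have A: "?A \<in> KC" using K by simp
 have "mink ?A (seg w) - (?A \<union> (%x. w + x) ` ?A) \<in> sets borel"
  using A KC_translation[OF A, of w] mink_KC[OF A seg_KC[of 0 w]] by (intro sets.Diff sets.Un KC_sets)
 then have "area (mink K (seg u) - (K \<union> (%x. u + x) ` K)) = area (mink ?A (seg w) - (?A \<union> (%x. w + x) ` ?A))"
  unfolding eq by (rule area_rot)
 also have "... \<le> norm u ^ 3 / (2 * e)" unfolding w_def using u by (intro gap_horizontal[OF A inner_ball_rot[OF ib] e]) auto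
 finally show ?thesis .
qed

lemma pair_bounds:
 assumes K: "K \<in> KC" and ib: "inner_ball e K" and e: "e > 0" and u: "norm u \<le> e"
 shows "area (K \<union> (%x. u + x) ` K) \<le> area K + wd u K"
  and "area K + wd u K - norm u ^ 3 / (2 * e) \<le> area (K \<union> (%x. u + x) ` K)"
proof -
 let ?M = "mink K (seg u)" and ?U = "K \<union> (%x. u + x) ` K"
 have M: "?M \<in> KC" using K by simp
 have Uc: "compact ?U" using KC_D(1)[OF K] KC_D(1)[OF KC_translation[OF K]] by (intro compact_Un)
 have sub: "?U \<subseteq> ?M"
 proof -
  have "x + 0 \<in> ?M" "x + u \<in> ?M" if "x \<in> K" for x unfolding mink_def using that by blast+
  then show ?thesis by (auto simp: add.commute)
 qed
 have "area ?U \<le> area ?M" using sub Uc KC_D(1)[OF M] by (intro area_mono) auto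
 then show "area ?U \<le> area K + wd u K" using area_mink_seg[OF K] by simp
 have "area (?M - ?U) = area ?M - area ?U" using sub Uc KC_D(1)[OF M] by (intro measure_Diff) (auto simp: emeasure_compact)
 then show "area K + wd u K - norm u ^ 3 / (2 * e) \<le> area ?U" using gap[OF assms] area_mink_seg[OF K, of u] by simp
qed

text \<open>The two segments are added one after the other. The four translates can miss only the
  gap from adding \<open>v\<close> to the sum of \<open>K\<close> with the first segment, the gap of
  \<open>K\<close> for \<open>u\<close>, and the translate of the latter by \<open>v\<close>; hence
  the weights 1 and 2 of the cubes.\<close>

lemma quad_bounds:
 fixes u v :: pt and K :: "pt set"
 defines "T \<equiv> %w. (%x. w + x) ` K"
 assumes K: "K \<in> KC" and ib: "inner_ball e K" and e: "e > 0" and u: "norm u \<le> e" and v: "norm v \<le> e"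
 shows "area (K \<union> T u \<union> T v \<union> T (u + v)) \<le> area K + wd u K + wd v K + \<bar>cross v u\<bar>"
  and "area K + wd u K + wd v K + \<bar>cross v u\<bar> - (2 * norm u ^ 3 + norm v ^ 3) / (2 * e) \<le> area (K \<union> T u \<union> T v \<union> T (u + v))"
proof -
 let ?M = "mink K (seg u)"
 let ?N = "mink ?M (seg v)" and ?U = "K \<union> T u \<union> T v \<union> T (u + v)"
 have M: "?M \<in> KC" and N: "?N \<in> KC" using K by simp_all
 have vM: "(%x. v + x) ` ?M \<in> KC" by (rule KC_translation[OF M])
 have T: "T w \<in> KC" for w unfolding T_def by (rule KC_translation[OF K])
 have Uc: "compact ?U" by (intro compact_Un KC_D(1) K T)
 have aN: "area ?N = area K + wd u K + wd v K + \<bar>cross v u\<bar>"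
  using area_mink_seg[OF M, of v] area_mink_seg[OF K, of u] wd_mink[OF K seg_KC, of v 0 u] by (simp add: wd_seg)
 have i0: "x \<in> mink A (seg w)" "w + x \<in> mink A (seg w)" if "x \<in> A" for x w and A :: "pt set"
 proof -
  have "x + 0 \<in> mink A (seg w)" "x + w \<in> mink A (seg w)" unfolding mink_def using that by blast+
  then show "x \<in> mink A (seg w)" "w + x \<in> mink A (seg w)" by (simp_all add: add.commute)
 qed
 have sub: "?U \<subseteq> ?N"
 proof -
  have "K \<subseteq> ?N" using i0(1)[OF i0(1)] by blast
  moreover have "T u \<subseteq> ?N" unfolding T_def using i0(1)[OF i0(2)] by blast
  moreover have "T v \<subseteq> ?N" unfolding T_def using i0(2)[OF i0(1)] by blast
  moreover have "T (u + v) \<subseteq> ?N"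
  proof
   fix z assume "z \<in> T (u + v)"
   then obtain k where "k \<in> K" "z = u + v + k" unfolding T_def by blast
   then show "z \<in> ?N" using i0(2)[OF i0(2), of k K v u] by (simp add: add.assoc add.left_commute)
  qed
  ultimately show ?thesis by blast
 qed
 show "area ?U \<le> area K + wd u K + wd v K + \<bar>cross v u\<bar>"
  unfolding aN[symmetric] using sub Uc KC_D(1)[OF N] by (intro area_mono) auto
 let ?G = "?M - (K \<union> T u)"
 let ?H = "?N - (?M \<union> (%x. v + x) ` ?M)"
 have G: "?G \<in> sets borel" using M K T by (intro sets.Diff sets.Un KC_sets)
 have Gf: "?G \<in> fmeasurable lborel" using KC_D(1)[OF M] G by (intro fmeasurableI2[OF compact_fmeasurable]) auto
 have H: "?H \<in> sets borel" using M N vM by (intro sets.Diff sets.Un KC_sets)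
 have Hf: "?H \<in> fmeasurable lborel" using KC_D(1)[OF N] H by (intro fmeasurableI2[OF compact_fmeasurable]) auto
 have vG: "(%x. v + x) ` ?G = (%x. v + x) ` ?M - (T v \<union> T (u + v))"
 proof -
  have 1: "(%x. v + x) ` T u = T (u + v)" unfolding T_def image_image by (simp add: add.assoc add.left_commute)
  have 2: "(%x. v + x) ` K = T v" unfolding T_def ..
  have "inj (%x. v + x)" by (rule injI) simp
  from image_set_diff[OF this, of ?M "K \<union> T u"] show ?thesis unfolding image_Un 1 2 .
 qed
 have vGs: "(%x. v + x) ` ?G \<in> sets borel" unfolding vG using vM T by (intro sets.Diff sets.Un KC_sets)
 have vGf: "(%x. v + x) ` ?G \<in> fmeasurable lborel"
  using vGs KC_D(1)[OF vM] by (intro fmeasurableI2[OF compact_fmeasurable[OF KC_D(1)[OF vM]]]) auto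
 have "?N - ?U \<subseteq> ?H \<union> ?G \<union> (%x. v + x) ` ?G" unfolding vG by blast
 moreover have "?N - ?U \<in> sets lborel" using N Uc by auto
 ultimately have "area (?N - ?U) \<le> area (?H \<union> ?G \<union> (%x. v + x) ` ?G)"
  using Gf Hf vGf by (intro measure_mono_fmeasurable) auto
 also have "... \<le> area (?H \<union> ?G) + area ((%x. v + x) ` ?G)" using G H vGs by (intro measure_Un_le) simp_all
 also have "... \<le> area ?H + area ?G + area ((%x. v + x) ` ?G)"
  using G H by (intro add_right_mono measure_Un_le) simp_all
 also have "area ((%x. v + x) ` ?G) = area ?G" by (rule area_translation[OF G])
 also have "area ?G \<le> norm u ^ 3 / (2 * e)" unfolding T_def by (rule gap[OF K ib e u])
 also have "area ?H \<le> norm v ^ 3 / (2 * e)" by (rule gap[OF M inner_ball_mink[OF ib] e v])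
 finally have "area (?N - ?U) \<le> (2 * norm u ^ 3 + norm v ^ 3) / (2 * e)" using e by (simp add: field_simps)
 moreover have "area (?N - ?U) = area ?N - area ?U" using sub Uc KC_D(1)[OF N] by (intro measure_Diff) (auto simp: emeasure_compact)
 ultimately show "area K + wd u K + wd v K + \<bar>cross v u\<bar> - (2 * norm u ^ 3 + norm v ^ 3) / (2 * e) \<le> area ?U"
  unfolding aN[symmetric] by linarith
qed

text \<open>The union of four translates at the vertices of a parallelogram is the union of two triples whose
 intersection differs from the pair at the common diagonal only inside the convex hull of that pair.\<close>

lemma triple_bounds:
 fixes u v :: pt and K :: "pt set"
 defines "T \<equiv> %w. (%x. w + x) ` K"
 assumes K: "K \<in> KC" and ib: "inner_ball e K" and e: "e > 0" and uv: "norm (v - u) \<le> e"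
 shows "area (K \<union> T u \<union> T v) + area (T u \<union> T v \<union> T (u + v))
   \<le> area (K \<union> T u \<union> T v \<union> T (u + v)) + area K + wd (v - u) K"
  and "area (K \<union> T u \<union> T v \<union> T (u + v)) + area K + wd (v - u) K - norm (v - u) ^ 3 / (2 * e)
   \<le> area (K \<union> T u \<union> T v) + area (T u \<union> T v \<union> T (u + v))"
proof -
 have T: "T w \<in> KC" for w unfolding T_def by (rule KC_translation[OF K])
 let ?A = "K \<union> T u \<union> T v" and ?B = "T u \<union> T v \<union> T (u + v)"
 let ?N = "mink K (seg (v - u))"
 have N: "?N \<in> KC" using K by simp
 have uN: "(%x. u + x) ` ?N \<in> KC" by (rule KC_translation[OF N])
 have A: "compact ?A" and B: "compact ?B" by (intro compact_Un KC_D(1) K T)+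
 have "area (?A \<union> ?B) = area ?A + area ?B - area (?A \<inter> ?B)" using A B by (intro measure_Un3) auto
 moreover have "?A \<union> ?B = K \<union> T u \<union> T v \<union> T (u + v)" by blast
 ultimately have sum: "area ?A + area ?B = area (K \<union> T u \<union> T v \<union> T (u + v)) + area (?A \<inter> ?B)" by simp
 have Tuv: "T u \<union> T v = (%x. u + x) ` (K \<union> (%x. (v - u) + x) ` K)"
  unfolding T_def by (simp add: image_Un image_image algebra_simps)
 have cK: "compact (K \<union> (%x. (v - u) + x) ` K)" by (intro compact_Un KC_D(1) K KC_translation)
 have aTuv: "area (T u \<union> T v) = area (K \<union> (%x. (v - u) + x) ` K)"
  unfolding Tuv using cK by (intro area_translation) auto
 have lo: "area (T u \<union> T v) \<le> area (?A \<inter> ?B)" using A B T by (intro area_mono compact_Int sets.Un KC_sets) auto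
 have "?A \<inter> ?B \<subseteq> (%x. u + x) ` ?N"
 proof
  fix z assume z: "z \<in> ?A \<inter> ?B"
  have i: "z \<in> (%x. u + x) ` ?N" if "k \<in> K" "s \<in> seg (v - u)" "z = u + (k + s)" for k s
   using that unfolding mink_def by blast
  consider "z \<in> T u" | "z \<in> T v" | "z \<in> K" "z \<in> T (u + v)" using z by blast
  then show "z \<in> (%x. u + x) ` ?N"
  proof cases
   case 1 then obtain k where "k \<in> K" "z = u + k" unfolding T_def by blast
   then show ?thesis using i[of k 0] by simp
  next
   case 2 then obtain k where "k \<in> K" "z = v + k" unfolding T_def by blast
   then show ?thesis using i[of k "v - u"] by simp
  next
   \<comment> \<open>Here \<open>z\<close> lies in \<open>K\<close> and is also the translate of
     \<open>k\<close> by \<open>u + v\<close>. The midpoint of \<open>z\<close> and \<open>k\<close>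
     is in \<open>K\<close>, and moving it by \<open>u\<close> and by half of \<open>v - u\<close>
     gives \<open>z\<close>.\<close>
   case 3
   then obtain k where k: "k \<in> K" "z = u + v + k" unfolding T_def by blast
   have "(1 / 2) *\<^sub>R z + (1 / 2) *\<^sub>R k \<in> K" by (intro convexD[OF KC_D(2)[OF K]] 3 k) auto
   moreover have "(1 / 2) *\<^sub>R (v - u) \<in> seg (v - u)" by (auto simp: in_segment intro!: exI[of _ "1 / 2"])
   moreover have "z = u + (((1 / 2) *\<^sub>R z + (1 / 2) *\<^sub>R k) + (1 / 2) *\<^sub>R (v - u))"
    unfolding k(2) by (simp add: prod_eq_iff algebra_simps)
   ultimately show ?thesis by (rule i)
  qed
 qed
 then have "area (?A \<inter> ?B) \<le> area ((%x. u + x) ` ?N)" using A B KC_D(1)[OF uN] by (intro area_mono) auto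
 also have "... = area K + wd (v - u) K" using area_translation[OF KC_sets[OF N], of u] area_mink_seg[OF K] by simp
 finally have hi: "area (?A \<inter> ?B) \<le> area K + wd (v - u) K" .
 show "area ?A + area ?B \<le> area (K \<union> T u \<union> T v \<union> T (u + v)) + area K + wd (v - u) K" using sum hi by simp
 show "area (K \<union> T u \<union> T v \<union> T (u + v)) + area K + wd (v - u) K - norm (v - u) ^ 3 / (2 * e) \<le> area ?A + area ?B"
  using sum lo pair_bounds(2)[OF K ib e uv] aTuv by simp
qed

section \<open>Asymptotics of the configuration probabilities\<close>

text \<open>\<open>X = E - v\<close> is of order \<open>a\<close>, so the cubic Taylor remainder of
  the exponential is of order \<open>a ^ 3\<close>, and in the quadratic term \<open>X\<close> may
  be replaced by \<open>b * a\<close>.\<close>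

lemma exp_expand:
 fixes E :: "real => real"
 assumes E: "(%a. E a - (v + b * a + c * a\<^sup>2)) \<in> O[at_right 0](%a. a ^ 3)"
 shows "(%a. exp (- E a) - exp (- v) * (1 - b * a + (b\<^sup>2 / 2 - c) * a\<^sup>2)) \<in> O[at_right 0](%a. a ^ 3)"
proof -
 define X where "X a = E a - v" for a
 have o: "(%a. a ^ 3) \<in> O[at_right 0](%a::real. a\<^sup>2)" "(%a. a\<^sup>2) \<in> O[at_right 0](%a::real. a)"
  by real_asymp+
 have Xc: "(%a. X a - (b * a + c * a\<^sup>2)) \<in> O[at_right 0](%a. a ^ 3)"
  using E by (simp add: X_def algebra_simps)
 have "(%a. (X a - (b * a + c * a\<^sup>2)) + c * a\<^sup>2) \<in> O[at_right 0](%a. a\<^sup>2)"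
  by (intro sum_in_bigo landau_o.big_trans[OF Xc o(1)]) simp
 then have Xb: "(%a. X a - b * a) \<in> O[at_right 0](%a. a\<^sup>2)" by (simp add: algebra_simps)
 have "(%a. (X a - b * a) + b * a) \<in> O[at_right 0](%a. a)"
  by (intro sum_in_bigo landau_o.big_trans[OF Xb o(2)]) simp
 then have X: "X \<in> O[at_right 0](%a. a)" by simp
 then obtain C where C: "C > 0" "\<forall>\<^sub>F a in at_right 0. norm (X a) \<le> C * norm a" by (rule landau_o.bigE)
 have "((%a. C * norm a) \<longlongrightarrow> 0) (at_right 0)" by (auto intro!: tendsto_eq_intros)
 then have "(X \<longlongrightarrow> 0) (at_right 0)" by (rule Lim_null_comparison[OF C(2)])
 then have small: "\<forall>\<^sub>F a in at_right 0. \<bar>X a\<bar> < 1" by (auto dest: tendstoD[where e = 1] simp: dist_real_def)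
 have "(%a. exp (- X a) - (1 - X a + (X a)\<^sup>2 / 2)) \<in> O[at_right 0](%a. (X a) ^ 3)"
 proof (rule bigoI[of _ "exp 1"], use small in eventually_elim)
  case (elim a)
  obtain t where t: "\<bar>t\<bar> \<le> \<bar>- X a\<bar>" "exp (- X a) = (\<Sum>m<3. (- X a) ^ m / fact m) + exp t / fact 3 * (- X a) ^ 3"
   using Maclaurin_exp_le[of "- X a" 3] by blast
  have "exp (- X a) - (1 - X a + (X a)\<^sup>2 / 2) = exp t / fact 3 * (- X a) ^ 3" unfolding t(2) by (simp add: eval_nat_numeral)
  moreover have "exp t / fact 3 \<le> exp 1"
  proof -
   have "exp t \<le> exp 1" using t(1) elim by simp
   moreover have "exp t / fact 3 \<le> exp t / 1" by (intro divide_left_mono) auto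
   ultimately show ?thesis by linarith
  qed
  ultimately have "\<bar>exp (- X a) - (1 - X a + (X a)\<^sup>2 / 2)\<bar> \<le> exp 1 * \<bar>(- X a) ^ 3\<bar>"
   using mult_right_mono[of "exp t / fact 3" "exp 1" "\<bar>(- X a) ^ 3\<bar>"] by (simp only: abs_mult) simp
  then show ?case by (simp add: power_abs)
 qed
 also have "(%a. (X a) ^ 3) \<in> O[at_right 0](%a. a ^ 3)" by (rule landau_o.big_power[OF X])
 finally have 1: "(%a. exp (- X a) - (1 - X a + (X a)\<^sup>2 / 2)) \<in> O[at_right 0](%a. a ^ 3)" .
 have "(%a. (X a - b * a) * (X a + b * a)) \<in> O[at_right 0](%a. a\<^sup>2 * a)"
  by (intro landau_o.big.mult Xb sum_in_bigo X) simp
 then have 2: "(%a. ((X a)\<^sup>2 - (b * a)\<^sup>2) / 2) \<in> O[at_right 0](%a. a ^ 3)"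
  by (simp add: power2_eq_square power3_eq_cube algebra_simps)
 have "(%a. (exp (- X a) - (1 - X a + (X a)\<^sup>2 / 2)) + (((X a)\<^sup>2 - (b * a)\<^sup>2) / 2 - (X a - (b * a + c * a\<^sup>2))))
   \<in> O[at_right 0](%a. a ^ 3)" (is "?f \<in> _") by (intro sum_in_bigo 1 2 Xc)
 then have "(%a. exp (- v) * ?f a) \<in> O[at_right 0](%a. a ^ 3)" by simp
 also have "(%a. exp (- v) * ?f a) = (%a. exp (- E a) - exp (- v) * (1 - b * a + (b\<^sup>2 / 2 - c) * a\<^sup>2))"
 proof
  fix a
  have "exp (- E a) = exp (- v) * exp (- X a)" by (simp add: X_def exp_add[symmetric])
  then show "exp (- v) * ?f a = exp (- E a) - exp (- v) * (1 - b * a + (b\<^sup>2 / 2 - c) * a\<^sup>2)"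
   by (simp add: power_mult_distrib) (simp add: field_simps)
 qed
 finally show ?thesis .
qed

lemma cmult_bigo: "f \<in> O[F](g) ==> (%a. c * f a) \<in> O[F](g)" for c :: real by simp

section \<open>Mean area of unions of translates at lattice points\<close>

definition DS :: "pt set => real => pt set => real" where
 "DS S a K = area (\<Union>s\<in>S. (%y. a *\<^sub>R s + y) ` K)"

lemma DS_compact: "finite S ==> K \<in> KC ==> compact (\<Union>s\<in>S. (%y. a *\<^sub>R s + y) ` K)"
 by (intro compact_UN translate_KC) auto

text \<open>Congruent patterns give congruent unions when the body is rotated along; together with
  isotropy this leaves one mean per congruence class of patterns.\<close>

lemma DS_cong:
 assumes S: "finite S" and K: "K \<in> KC"
 shows "DS ((%s. c + rot v s) ` S) a (rot v ` K) = DS S a K"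
proof -
 let ?U = "\<Union>s\<in>S. (%y. a *\<^sub>R s + y) ` K"
 have "(\<Union>s\<in>(%s. c + rot v s) ` S. (%y. a *\<^sub>R s + y) ` rot v ` K) = (%x. a *\<^sub>R c + x) ` rot v ` ?U"
  by (simp add: image_UN image_image linear_add[OF linear_rot] linear_scale[OF linear_rot] scaleR_right_distrib add.assoc)
 moreover have "?U \<in> sets borel" by (rule compact_sets_borel[OF DS_compact[OF S K]])
 moreover have "rot v ` ?U \<in> sets borel"
  using DS_compact[OF S K] by (intro compact_sets_borel compact_continuous_image linear_continuous_on linear_conv_bounded_linear[THEN iffD1] linear_rot)
 ultimately show ?thesis unfolding DS_def by (simp only: area_translation area_rot)
qed

lemma DS_le:
 assumes "finite S" "K \<in> KC" shows "DS S a K \<le> card S * area K"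
proof -
 have "DS S a K \<le> (\<Sum>s\<in>S. area ((%y. a *\<^sub>R s + y) ` K))"
  unfolding DS_def using assms KC_translation[OF assms(2)] by (intro measure_UNION_le) simp_all
 then show ?thesis using assms by simp
qed

context grains
begin

lemma DS_measurable:
 assumes "finite S" shows "(%K. DS S a K) \<in> borel_measurable Q"
proof -
 have "{p \<in> space (Q \<Otimes>\<^sub>M borel). snd p \<in> (\<Union>s\<in>S. (%y. a *\<^sub>R s + y) ` fst p)} =
   (\<Union>s\<in>S. {p \<in> space (Q \<Otimes>\<^sub>M borel). snd p \<in> (%y. a *\<^sub>R s + y) ` fst p})" by blast
 also have "... \<in> sets (Q \<Otimes>\<^sub>M borel)"
  using assms by (intro sets.finite_UN rset_member rset_translation rset_Q) simp_all
 finally show ?thesis unfolding DS_def measure_def using measurable_area_sections by measurable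
qed

lemma DS_integrable: "finite S ==> integrable Q (%K. DS S a K)"
proof (rule Bochner_Integration.integrable_bound)
 assume S: "finite S"
 show "integrable Q (%K. card S * area K)" using area_integrable by simp
 show "(%K. DS S a K) \<in> borel_measurable Q" by (rule DS_measurable[OF S])
 show "AE K in Q. norm (DS S a K) \<le> norm (card S * area K)" using DS_le[OF S] by (intro AE_I2) (simp add: DS_def)
qed

definition ED where "ED S a = (\<integral>K. DS S a K \<partial>Q)"

lemma ED_cong:
 assumes S: "finite S" and S': "S' = (%s. c + rot v s) ` S" shows "ED S' a = ED S a"
proof -
 have "ED S' a = (\<integral>K. DS S' a (rot v ` K) \<partial>Q)"
  unfolding ED_def using S S' by (intro rot_invariant[symmetric] DS_measurable) simp
 also have "... = ED S a" unfolding ED_def S' using DS_cong[OF S] by (intro Bochner_Integration.integral_cong) auto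
 finally show ?thesis .
qed

definition hitS where "hitS S a = {p \<in> space mu. \<exists>s\<in>S. a *\<^sub>R s \<in> tg p}"

lemma hitS_sets: "finite S ==> hitS S a \<in> sets mu"
proof -
 assume S: "finite S"
 have "hitS S a = (\<Union>s\<in>S. {p \<in> space mu. {a *\<^sub>R s} \<inter> tg p ~= {}})" by (auto simp: hitS_def)
 also have "... \<in> sets mu" using S by (intro sets.finite_UN rset_nonempty rset_M_tg) (simp_all add: KC_def)
 finally show ?thesis .
qed

text \<open>For a fixed grain the positions at which it covers a point of the pattern form a union
  of translates of the reflected grain. Reflection is the rotation by \<open>pi\<close>, under which
  the law is invariant.\<close>

lemma emeasure_hitS:
 assumes S: "finite S" shows "emeasure mu (hitS S a) = ennreal (ED S a)"
proof -
 have "emeasure mu (hitS S a) = (\<integral>\<^sup>+p. indicator (hitS S a) p \<partial>mu)" using hitS_sets[OF S] by simp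
 also have "... = (\<integral>\<^sup>+K. \<integral>\<^sup>+x. indicator (hitS S a) (x, K) \<partial>lborel \<partial>Q)"
  using hitS_sets[OF S] by (intro nn_mu) simp
 also have "... = (\<integral>\<^sup>+K. ennreal (DS S a (uminus ` K)) \<partial>Q)"
 proof (rule nn_integral_cong)
  fix K assume "K \<in> space Q"
  then have K: "K \<in> KC" by simp
  let ?U = "\<Union>s\<in>S. (%y. a *\<^sub>R s + y) ` uminus ` K"
  have m: "(x, K) \<in> hitS S a \<longleftrightarrow> x \<in> ?U" for x
  proof -
   have "z \<in> (%y. x + y) ` K \<longleftrightarrow> x \<in> (%y. z + y) ` uminus ` K" for z :: pt
   proof
    assume "z \<in> (%y. x + y) ` K"
    then obtain k where "k \<in> K" "z = x + k" by blast
    then have "x = z + - k" "- k \<in> uminus ` K" by simp_all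
    then show "x \<in> (%y. z + y) ` uminus ` K" by blast
   next
    assume "x \<in> (%y. z + y) ` uminus ` K"
    then obtain k where "k \<in> K" "x = z + - k" by blast
    then have "z = x + k" by simp
    then show "z \<in> (%y. x + y) ` K" using \<open>k \<in> K\<close> by blast
   qed
   then show ?thesis using K unfolding hitS_def space_mu tg_def by simp
  qed
  have "(\<integral>\<^sup>+x. indicator (hitS S a) (x, K) \<partial>lborel) = (\<integral>\<^sup>+x. indicator ?U x \<partial>lborel)"
   using m by (intro nn_integral_cong) (simp add: indicator_def)
  also have "... = emeasure lborel ?U"
   using compact_sets_borel[OF DS_compact[OF S KC_uminus[OF K]]] by (intro nn_integral_indicator) simp
  also have "... = ennreal (DS S a (uminus ` K))" unfolding DS_def by (rule emeasure_compact[OF DS_compact[OF S KC_uminus[OF K]]])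
  finally show "(\<integral>\<^sup>+x. indicator (hitS S a) (x, K) \<partial>lborel) = ennreal (DS S a (uminus ` K))" .
 qed
 also have "... = ennreal (\<integral>K. DS S a (uminus ` K) \<partial>Q)"
 proof (rule nn_integral_eq_integral)
  show "integrable Q (%K. DS S a (uminus ` K))"
  proof (rule Bochner_Integration.integrable_bound)
   show "integrable Q (%K. card S * area K)" using area_integrable by simp
   show "(%K. DS S a (uminus ` K)) \<in> borel_measurable Q"
    using measurable_compose[OF rot_measurable[of pi] DS_measurable[OF S]] by (simp add: rot_pi[abs_def])
   show "AE K in Q. norm (DS S a (uminus ` K)) \<le> norm (card S * area K)"
   proof (rule AE_I2)
    fix K assume "K \<in> space Q"
    then have K: "K \<in> KC" by simp
    show "norm (DS S a (uminus ` K)) \<le> norm (card S * area K)" using DS_le[OF S KC_uminus[OF K], of a] K by (simp add: DS_def)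
   qed
  qed
 qed (simp add: DS_def)
 also have "(\<integral>K. DS S a (uminus ` K) \<partial>Q) = ED S a"
  unfolding ED_def using rot_invariant[OF DS_measurable[OF S], of a pi] by (simp add: rot_pi[abs_def])
 finally show ?thesis .
qed

lemma ED_nonneg: "ED S a \<ge> 0" unfolding ED_def by (intro Bochner_Integration.integral_nonneg) (simp add: DS_def)

lemma AE_inner_ball: "AE K in Q. K \<in> KC \<and> inner_ball \<epsilon> K"
proof -
 have "AE K in Q. smooth_eps \<epsilon> K" using law by (simp add: grain_law_def)
 then show ?thesis using AE_space by eventually_elim (auto intro: smooth_inner_ball)
qed

lemma ED_single: "ED {s} a = vv" unfolding ED_def vv_eq by (intro Bochner_Integration.integral_cong refl) (simp add: DS_def)

lemma integral_le_AE:
 fixes f g :: "pt set => real"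
 assumes "integrable Q f" "integrable Q g" "\<And>K. K \<in> KC ==> inner_ball \<epsilon> K ==> f K \<le> g K"
 shows "(\<integral>K. f K \<partial>Q) \<le> (\<integral>K. g K \<partial>Q)" using assms(1,2)
proof (rule integral_mono_AE)
 show "AE K in Q. f K \<le> g K" using AE_inner_ball by eventually_elim (simp add: assms(3))
qed

lemma ED_pair:
 assumes u: "norm (a *\<^sub>R (s' - s)) \<le> \<epsilon>"
 shows "\<bar>ED {s, s'} a - (vv + norm (a *\<^sub>R (s' - s)) * bb)\<bar> \<le> norm (a *\<^sub>R (s' - s)) ^ 3 / (2 * \<epsilon>)"
proof -
 define u where "u = a *\<^sub>R (s' - s)"
 have D: "DS {s, s'} a K = area (K \<union> (%x. u + x) ` K)" if K: "K \<in> KC" for K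
 proof -
  have "(\<Union>t\<in>{s, s'}. (%y. a *\<^sub>R t + y) ` K) = (%x. a *\<^sub>R s + x) ` (K \<union> (%x. u + x) ` K)"
   by (simp add: image_Un image_image u_def algebra_simps)
  moreover have "K \<union> (%x. u + x) ` K \<in> sets borel" using K by (intro sets.Un KC_sets KC_translation)
  ultimately show ?thesis unfolding DS_def by (simp only: area_translation)
 qed
 have "ED {s, s'} a \<le> (\<integral>K. area K + wd u K \<partial>Q)" unfolding ED_def
 proof (rule integral_le_AE)
  show "integrable Q (DS {s, s'} a)" by (rule DS_integrable) simp
  show "integrable Q (%K. area K + wd u K)" using area_integrable wd_integrable by simp
  fix K assume "K \<in> KC" "inner_ball \<epsilon> K"
  then show "DS {s, s'} a K \<le> area K + wd u K"
   unfolding D[OF \<open>K \<in> KC\<close>] using eps u by (intro pair_bounds(1)) (auto simp: u_def)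
 qed
 moreover have "(\<integral>K. area K + wd u K - norm u ^ 3 / (2 * \<epsilon>) \<partial>Q) \<le> ED {s, s'} a" unfolding ED_def
 proof (rule integral_le_AE)
  show "integrable Q (DS {s, s'} a)" by (rule DS_integrable) simp
  show "integrable Q (%K. area K + wd u K - norm u ^ 3 / (2 * \<epsilon>))" using area_integrable wd_integrable by simp
  fix K assume "K \<in> KC" "inner_ball \<epsilon> K"
  then show "area K + wd u K - norm u ^ 3 / (2 * \<epsilon>) \<le> DS {s, s'} a K"
   unfolding D[OF \<open>K \<in> KC\<close>] using eps u by (intro pair_bounds(2)) (auto simp: u_def)
 qed
 moreover have "(\<integral>K. area K + wd u K \<partial>Q) = vv + norm u * bb"
  using area_integrable wd_integrable by (simp add: vv_eq E_wd)
 moreover have "(\<integral>K. area K + wd u K - norm u ^ 3 / (2 * \<epsilon>) \<partial>Q) = vv + norm u * bb - norm u ^ 3 / (2 * \<epsilon>)"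
  using area_integrable wd_integrable prob_KC by (simp add: vv_eq E_wd)
 ultimately show ?thesis unfolding u_def[symmetric] by linarith
qed

lemma C0_translates:
 "(%y. a *\<^sub>R x0 + y) ` K = K" "(%y. a *\<^sub>R x1 + y) ` K = (%x. (a, 0) + x) ` K"
 "(%y. a *\<^sub>R x2 + y) ` K = (%x. (0, a) + x) ` K" "(%y. a *\<^sub>R x3 + y) ` K = (%x. ((a, 0) + (0, a)) + x) ` K"
 by (simp_all add: x0_def x1_def x2_def x3_def zero_prod_def[symmetric])

lemma ED_quad:
 assumes a: "0 \<le> a" "a \<le> \<epsilon>"
 shows "\<bar>ED C0 a - (vv + 2 * a * bb + a\<^sup>2)\<bar> \<le> 3 * a ^ 3 / (2 * \<epsilon>)"
proof -
 have D: "DS C0 a K = area (K \<union> (%x. (a, 0) + x) ` K \<union> (%x. (0, a) + x) ` K \<union> (%x. ((a, 0) + (0, a)) + x) ` K)" for K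
  unfolding DS_def C0_def by (simp only: UN_insert UN_empty C0_translates Un_empty_right Un_assoc)
 have n: "norm (a, 0::real) = a" "norm (0::real, a) = a" using a by simp_all
 have cr: "\<bar>cross (0, a) (a, 0)\<bar> = a\<^sup>2" by (simp add: cross_def power2_eq_square)
 have "ED C0 a \<le> (\<integral>K. area K + wd (a, 0) K + wd (0, a) K + a\<^sup>2 \<partial>Q)" unfolding ED_def
 proof (rule integral_le_AE)
  show "integrable Q (DS C0 a)" by (rule DS_integrable) (simp add: C0_def)
  show "integrable Q (%K. area K + wd (a, 0) K + wd (0, a) K + a\<^sup>2)" using area_integrable wd_integrable by simp
  fix K assume "K \<in> KC" "inner_ball \<epsilon> K"
  then show "DS C0 a K \<le> area K + wd (a, 0) K + wd (0, a) K + a\<^sup>2"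
   unfolding D cr[symmetric] using eps a by (intro quad_bounds(1)) (simp_all only: n)
 qed
 moreover have "(\<integral>K. area K + wd (a, 0) K + wd (0, a) K + a\<^sup>2 - 3 * a ^ 3 / (2 * \<epsilon>) \<partial>Q) \<le> ED C0 a" unfolding ED_def
 proof (rule integral_le_AE)
  show "integrable Q (DS C0 a)" by (rule DS_integrable) (simp add: C0_def)
  show "integrable Q (%K. area K + wd (a, 0) K + wd (0, a) K + a\<^sup>2 - 3 * a ^ 3 / (2 * \<epsilon>))"
   using area_integrable wd_integrable by simp
  fix K assume K: "K \<in> KC" "inner_ball \<epsilon> K"
  have "2 * norm (a, 0::real) ^ 3 + norm (0::real, a) ^ 3 = 3 * a ^ 3" unfolding n by simp
  then show "area K + wd (a, 0) K + wd (0, a) K + a\<^sup>2 - 3 * a ^ 3 / (2 * \<epsilon>) \<le> DS C0 a K"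
   unfolding D cr[symmetric] using quad_bounds(2)[OF K eps, of "(a, 0)" "(0, a)"] a by (simp only: n)
 qed
 moreover have "(\<integral>K. area K + wd (a, 0) K + wd (0, a) K + a\<^sup>2 \<partial>Q) = vv + 2 * a * bb + a\<^sup>2"
  using area_integrable wd_integrable a prob_KC by (simp add: vv_eq E_wd)
 moreover have "(\<integral>K. area K + wd (a, 0) K + wd (0, a) K + a\<^sup>2 - 3 * a ^ 3 / (2 * \<epsilon>) \<partial>Q) = vv + 2 * a * bb + a\<^sup>2 - 3 * a ^ 3 / (2 * \<epsilon>)"
  using area_integrable wd_integrable a prob_KC by (simp add: vv_eq E_wd)
 ultimately show ?thesis by linarith
qed

text \<open>The map is the quarter turn of the unit square about its centre.\<close>

lemma ED_quarter_turn:
 assumes "finite S" shows "ED ((%s. (1 - snd s, fst s)) ` S) a = ED S a" using assms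
 by (intro ED_cong[of S _ "(1, 0)" "pi / 2"]) (simp_all add: rot_def case_prod_unfold prod_eq_iff)

lemma ED_triple_eq:
 "ED {x0, x1, x3} a = ED {x0, x1, x2} a" "ED {x1, x2, x3} a = ED {x0, x1, x2} a" "ED {x0, x2, x3} a = ED {x0, x1, x2} a"
proof -
 have t: "(%s. (1 - snd s, fst s)) x0 = x1" "(%s. (1 - snd s, fst s)) x1 = x3" 
  "(%s. (1 - snd s, fst s)) x3 = x2" "(%s. (1 - snd s, fst s)) x2 = x0" by (simp_all add: x0_def x1_def x2_def x3_def)
 show 1: "ED {x0, x1, x3} a = ED {x0, x1, x2} a" using ED_quarter_turn[of "{x0, x1, x2}" a] by (simp add: t insert_commute)
 show 2: "ED {x1, x2, x3} a = ED {x0, x1, x2} a" using ED_quarter_turn[of "{x0, x1, x3}" a] 1 by (simp add: t insert_commute)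
 show "ED {x0, x2, x3} a = ED {x0, x1, x2} a" using ED_quarter_turn[of "{x1, x2, x3}" a] 2 by (simp add: t insert_commute)
qed

lemma ED_adj_eq:
 "ED {x1, x3} a = ED {x0, x1} a" "ED {x2, x3} a = ED {x0, x1} a" "ED {x0, x2} a = ED {x0, x1} a"
 "ED {x1, x2} a = ED {x0, x3} a"
proof -
 have t: "(%s. (1 - snd s, fst s)) x0 = x1" "(%s. (1 - snd s, fst s)) x1 = x3" 
  "(%s. (1 - snd s, fst s)) x3 = x2" "(%s. (1 - snd s, fst s)) x2 = x0" by (simp_all add: x0_def x1_def x2_def x3_def)
 show 1: "ED {x1, x3} a = ED {x0, x1} a" using ED_quarter_turn[of "{x0, x1}" a] by (simp add: t insert_commute)
 show 2: "ED {x2, x3} a = ED {x0, x1} a" using ED_quarter_turn[of "{x1, x3}" a] 1 by (simp add: t insert_commute)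
 show "ED {x0, x2} a = ED {x0, x1} a" using ED_quarter_turn[of "{x2, x3}" a] 2 by (simp add: t insert_commute)
 show "ED {x1, x2} a = ED {x0, x3} a" using ED_quarter_turn[of "{x0, x3}" a] by (simp add: t insert_commute)
qed

text \<open>The relation between two triples, the square and the diagonal pair is integrated. Both
  triples have the same mean by symmetry, so each is, up to order \<open>a ^ 3\<close>, the average
  of the means for the square and for the diagonal pair; this yields \<open>(2 + sqrt 2) / 2\<close>
  and \<open>1 / 2\<close>.\<close>

lemma ED_triple:
 assumes a: "0 \<le> a" "2 * a \<le> \<epsilon>"
 shows "\<bar>ED {x0, x1, x2} a - (vv + (2 + sqrt 2) / 2 * a * bb + a\<^sup>2 / 2)\<bar> \<le> 6 * a ^ 3 / \<epsilon>"
proof -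
 have D4: "DS C0 a K = area (K \<union> (%x. (a, 0) + x) ` K \<union> (%x. (0, a) + x) ` K \<union> (%x. ((a, 0) + (0, a)) + x) ` K)" for K
  unfolding DS_def C0_def by (simp only: UN_insert UN_empty C0_translates Un_empty_right Un_assoc)
 have D1: "DS {x0, x1, x2} a K = area (K \<union> (%x. (a, 0) + x) ` K \<union> (%x. (0, a) + x) ` K)" for K
  unfolding DS_def by (simp only: UN_insert UN_empty C0_translates Un_empty_right Un_assoc)
 have D2: "DS {x1, x2, x3} a K = area ((%x. (a, 0) + x) ` K \<union> (%x. (0, a) + x) ` K \<union> (%x. ((a, 0) + (0, a)) + x) ` K)" for K
  unfolding DS_def by (simp only: UN_insert UN_empty C0_translates Un_empty_right Un_assoc)
 let ?d = "(0, a) - (a, 0 :: real)"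
 have n: "norm ?d = sqrt 2 * a" using a by (simp add: norm_Pair real_sqrt_mult flip: mult_2)
 have s2: "sqrt 2 \<le> 2" using real_sqrt_le_mono[of 2 4] by simp
 have sa: "sqrt 2 * a \<le> 2 * a" using s2 a by (intro mult_right_mono)
 then have nd: "norm ?d \<le> \<epsilon>" unfolding n using a by linarith
 have n3: "norm ?d ^ 3 \<le> 8 * a ^ 3" unfolding n using power_mono[OF sa, of 3] a by (simp add: power_mult_distrib)
 define B where "B = norm ?d ^ 3 / (2 * \<epsilon>)"
 have i: "integrable Q (%K. DS C0 a K + area K + wd ?d K)" "integrable Q (%K. DS {x0, x1, x2} a K + DS {x1, x2, x3} a K)"
  using area_integrable wd_integrable by (intro Bochner_Integration.integrable_add DS_integrable; simp add: C0_def)+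
 have "(\<integral>K. DS {x0, x1, x2} a K + DS {x1, x2, x3} a K \<partial>Q) \<le> (\<integral>K. DS C0 a K + area K + wd ?d K \<partial>Q)"
 proof (rule integral_le_AE[OF i(2,1)])
  fix K assume K: "K \<in> KC" "inner_ball \<epsilon> K"
  show "DS {x0, x1, x2} a K + DS {x1, x2, x3} a K \<le> DS C0 a K + area K + wd ?d K"
   unfolding D1 D2 D4 by (rule triple_bounds(1)[OF K eps nd])
 qed
 moreover have "(\<integral>K. (DS C0 a K + area K + wd ?d K) - B \<partial>Q) \<le> (\<integral>K. DS {x0, x1, x2} a K + DS {x1, x2, x3} a K \<partial>Q)"
 proof (rule integral_le_AE[OF _ i(2)])
  show "integrable Q (%K. (DS C0 a K + area K + wd ?d K) - B)" using i(1) by simp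
  fix K assume K: "K \<in> KC" "inner_ball \<epsilon> K"
  show "DS C0 a K + area K + wd ?d K - B \<le> DS {x0, x1, x2} a K + DS {x1, x2, x3} a K"
   unfolding D1 D2 D4 B_def by (rule triple_bounds(2)[OF K eps nd])
 qed
 moreover have "(\<integral>K. DS {x0, x1, x2} a K + DS {x1, x2, x3} a K \<partial>Q) = 2 * ED {x0, x1, x2} a"
  using ED_triple_eq(2)[of a] DS_integrable by (simp add: ED_def)
 moreover have e: "(\<integral>K. DS C0 a K + area K + wd ?d K \<partial>Q) = ED C0 a + vv + sqrt 2 * a * bb"
 proof -
  have "(\<integral>K. DS C0 a K + area K + wd ?d K \<partial>Q) = ED C0 a + vv + (\<integral>K. wd ?d K \<partial>Q)"
   using area_integrable wd_integrable[of ?d] DS_integrable[of C0] by (simp add: ED_def vv_eq C0_def)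
  then show ?thesis unfolding E_wd n .
 qed
 moreover have "(\<integral>K. (DS C0 a K + area K + wd ?d K) - B \<partial>Q) = ED C0 a + vv + sqrt 2 * a * bb - B"
  unfolding e[symmetric] using i(1) prob_KC by simp
 moreover have "\<bar>ED C0 a - (vv + 2 * a * bb + a\<^sup>2)\<bar> \<le> 3 * a ^ 3 / (2 * \<epsilon>)" using a by (intro ED_quad) auto
 moreover have "B \<le> 8 * a ^ 3 / (2 * \<epsilon>)" unfolding B_def using n3 eps by (intro divide_right_mono) auto
 moreover have "B \<ge> 0" unfolding B_def using eps by simp
 moreover have "8 * a ^ 3 / (2 * \<epsilon>) = 8 * (a ^ 3 / (2 * \<epsilon>))" "3 * a ^ 3 / (2 * \<epsilon>) = 3 * (a ^ 3 / (2 * \<epsilon>))" "6 * a ^ 3 / \<epsilon> = 12 * (a ^ 3 / (2 * \<epsilon>))"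
  "a ^ 3 / (2 * \<epsilon>) \<ge> 0" "(2 + sqrt 2) / 2 * a * bb = a * bb + sqrt 2 * a * bb / 2"
  using eps a by (simp_all add: field_simps)
 ultimately show ?thesis by linarith
qed

lemma bigo_cubic:
 fixes f :: "real => real"
 assumes "d > 0" "\<And>a. 0 < a ==> a \<le> d ==> \<bar>f a\<bar> \<le> C * a ^ 3"
 shows "f \<in> O[at_right 0](%a. a ^ 3)"
proof (rule bigoI[of _ C])
 have "\<forall>\<^sub>F a in at_right 0. a \<in> {0<..<d}" by (rule eventually_at_right_real[OF assms(1)])
 then show "\<forall>\<^sub>F a in at_right 0. norm (f a) \<le> C * norm (a ^ 3)" by eventually_elim (use assms(2) in auto)
qed

end

section \<open>Probabilities of the six configuration classes\<close>

lemma indicator_eq_combination: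
 fixes f :: "'a => real"
 assumes i: "integrable M f" and f: "\<And>w. w \<in> space M ==> f w = of_bool (R w)"
 shows "{w \<in> space M. R w} \<in> sets M" "measure M {w \<in> space M. R w} = (\<integral>w. f w \<partial>M)"
proof -
 have [measurable]: "f \<in> borel_measurable M" using i by simp
 have "{w \<in> space M. R w} = {w \<in> space M. f w = 1}" using f by auto
 also have "... \<in> sets M" by measurable
 finally show S: "{w \<in> space M. R w} \<in> sets M" .
 have "(\<integral>w. f w \<partial>M) = (\<integral>w. indicator {w \<in> space M. R w} w \<partial>M)"
  using f by (intro Bochner_Integration.integral_cong) (auto simp: indicator_def)
 also have "... = measure M ({w \<in> space M. R w} \<inter> space M)" by simp
 also have "{w \<in> space M. R w} \<inter> space M = {w \<in> space M. R w}" by blast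
 finally show "measure M {w \<in> space M. R w} = (\<integral>w. f w \<partial>M)" by simp
qed

lemma C0_distinct: "x0 ~= x1" "x0 ~= x2" "x0 ~= x3" "x1 ~= x2" "x1 ~= x3" "x2 ~= x3"
 by (simp_all add: x0_def x1_def x2_def x3_def)

lemma C0_mem: "x0 \<in> C0" "x1 \<in> C0" "x2 \<in> C0" "x3 \<in> C0" by (simp_all add: C0_def)

lemma C0_all: "(\<forall>x. x \<in> C0 --> R x) \<longleftrightarrow> R x0 \<and> R x1 \<and> R x2 \<and> R x3"
 by (auto simp: C0_def)

lemma C0_filter_eq:
 assumes "T \<subseteq> C0"
 shows "{x \<in> C0. R x} = T \<longleftrightarrow> (R x0 \<longleftrightarrow> x0 \<in> T) \<and> (R x1 \<longleftrightarrow> x1 \<in> T) \<and> (R x2 \<longleftrightarrow> x2 \<in> T) \<and> (R x3 \<longleftrightarrow> x3 \<in> T)"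
proof -
 have *: "{x \<in> C0. R x} = T \<longleftrightarrow> (\<forall>x\<in>C0. R x \<longleftrightarrow> x \<in> T)" using assms by blast
 show ?thesis unfolding * by (simp add: C0_def)
qed

lemma config_0: "config Y a 0 0 = {x \<in> C0. a *\<^sub>R x \<in> Y}" by (simp add: config_def rot_def case_prod_unfold)

context bmodel
begin

definition gS where "gS S a \<phi> = (of_bool (\<forall>s\<in>S. a *\<^sub>R s \<notin> Xi \<phi>) :: real)"

definition qS where "qS S a = exp (- \<gamma> * ED S a)"

lemma gS_integral:
 assumes S: "finite S"
 shows "integrable P (gS S a)" "(\<integral>\<phi>. gS S a \<phi> \<partial>P) = qS S a"
proof -
 have fin: "emeasure mu (hitS S a) < \<infinity>" using emeasure_hitS[OF S] by simp
 let ?A = "{\<phi> \<in> space P. finite (\<phi> \<inter> hitS S a) \<and> card (\<phi> \<inter> hitS S a) = 0}"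
 have A: "?A \<in> sets P" by (rule count_event(1)[OF hitS_sets[OF S] fin])
 have "gS S a \<phi> = indicator ?A \<phi>" if "\<phi> \<in> space P" for \<phi>
 proof -
  have sub: "\<phi> \<subseteq> space mu" using that by (simp add: space_P space_mu)
  have "(\<forall>s\<in>S. a *\<^sub>R s \<notin> Xi \<phi>) \<longleftrightarrow> \<phi> \<inter> hitS S a = {}" using sub unfolding Xi_tg hitS_def by blast
  also have "... \<longleftrightarrow> \<phi> \<in> ?A" using that by auto
  finally show ?thesis by (simp add: gS_def indicator_def)
 qed
 note g = this
 have "integrable P (gS S a) \<longleftrightarrow> integrable P (indicator ?A :: _ => real)"
  by (rule Bochner_Integration.integrable_cong[OF refl g])
 moreover have "integrable P (indicator ?A :: _ => real)" by (rule integrable_real_indicator[OF A]) (simp add: P.emeasure_eq_measure)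
 ultimately show "integrable P (gS S a)" by simp
 have "(\<integral>\<phi>. gS S a \<phi> \<partial>P) = (\<integral>\<phi>. indicator ?A \<phi> \<partial>P)"
  by (rule Bochner_Integration.integral_cong[OF refl g])
 also have "... = measure P (?A \<inter> space P)" by simp
 also have "?A \<inter> space P = ?A" by blast
 also have "measure P ?A = qS S a" unfolding count_event(2)[OF hitS_sets[OF S] fin]
  using ED_nonneg by (simp add: poisson_prob_def qS_def measure_def emeasure_hitS[OF S])
 finally show "(\<integral>\<phi>. gS S a \<phi> \<partial>P) = qS S a" .
qed

definition pj where "pj j a = measure (completion P) {\<phi> \<in> space P. config (Xi \<phi>) a 0 0 \<in> eta j}"

text \<open>Measurability of the configuration event is read off from the integrable function that
  represents it, so its measure in the completion is its ordinary probability.\<close>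

lemma pj_eqI:
 assumes "integrable P f" "\<And>\<phi>. \<phi> \<in> space P ==> f \<phi> = of_bool (config (Xi \<phi>) a 0 0 \<in> eta j)"
 shows "pj j a = (\<integral>\<phi>. f \<phi> \<partial>P)"
proof -
 note * = indicator_eq_combination[of P f "%\<phi>. config (Xi \<phi>) a 0 0 \<in> eta j", OF assms]
 show ?thesis unfolding pj_def using *(1) by (simp add: *(2))
qed

lemma qS_eqs:
 "qS {s} a = exp (- \<gamma> * vv)"
 "qS {x1, x3} a = qS {x0, x1} a" "qS {x2, x3} a = qS {x0, x1} a" "qS {x0, x2} a = qS {x0, x1} a"
 "qS {x1, x2} a = qS {x0, x3} a"
 "qS {x0, x1, x3} a = qS {x0, x1, x2} a" "qS {x1, x2, x3} a = qS {x0, x1, x2} a" "qS {x0, x2, x3} a = qS {x0, x1, x2} a"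
 by (simp_all only: qS_def ED_single ED_adj_eq ED_triple_eq)

lemma eta_iff:
 fixes R :: "pt => bool" and a :: real
 shows
 "{x \<in> C0. R x} \<in> eta 1 \<longleftrightarrow> \<not> R x0 \<and> \<not> R x1 \<and> \<not> R x2 \<and> \<not> R x3"
 "{x \<in> C0. R x} \<in> eta 2 \<longleftrightarrow> R x0 \<and> \<not> R x1 \<and> \<not> R x2 \<and> \<not> R x3 \<or> \<not> R x0 \<and> R x1 \<and> \<not> R x2 \<and> \<not> R x3
   \<or> \<not> R x0 \<and> \<not> R x1 \<and> R x2 \<and> \<not> R x3 \<or> \<not> R x0 \<and> \<not> R x1 \<and> \<not> R x2 \<and> R x3"
 "{x \<in> C0. R x} \<in> eta 3 \<longleftrightarrow> R x0 \<and> R x1 \<and> \<not> R x2 \<and> \<not> R x3 \<or> R x0 \<and> \<not> R x1 \<and> R x2 \<and> \<not> R x3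
   \<or> \<not> R x0 \<and> R x1 \<and> \<not> R x2 \<and> R x3 \<or> \<not> R x0 \<and> \<not> R x1 \<and> R x2 \<and> R x3"
 "{x \<in> C0. R x} \<in> eta 4 \<longleftrightarrow> R x0 \<and> \<not> R x1 \<and> \<not> R x2 \<and> R x3 \<or> \<not> R x0 \<and> R x1 \<and> R x2 \<and> \<not> R x3"
 "{x \<in> C0. R x} \<in> eta 5 \<longleftrightarrow> \<not> R x0 \<and> R x1 \<and> R x2 \<and> R x3 \<or> R x0 \<and> \<not> R x1 \<and> R x2 \<and> R x3
   \<or> R x0 \<and> R x1 \<and> \<not> R x2 \<and> R x3 \<or> R x0 \<and> R x1 \<and> R x2 \<and> \<not> R x3"
 "{x \<in> C0. R x} \<in> eta 6 \<longleftrightarrow> R x0 \<and> R x1 \<and> R x2 \<and> R x3"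
 by (simp_all add: eta_def C0_filter_eq C0_all C0_mem C0_distinct C0_distinct[symmetric])

text \<open>Moebius inversion on the subsets of the square: the indicator of an exact configuration
  is a signed sum of indicators that given points are uncovered. Each identity is checked on the
  coverage patterns of the four corners, and symmetry merges the terms of equal shape.\<close>

lemma pj_formulas:
 defines "Q1 \<equiv> exp (- \<gamma> * vv)"
 shows "pj 1 a = qS C0 a"
  "pj 2 a = 4 * qS {x0, x1, x2} a - 4 * qS C0 a"
  "pj 3 a = 4 * qS {x0, x1} a - 8 * qS {x0, x1, x2} a + 4 * qS C0 a"
  "pj 4 a = 2 * qS {x0, x3} a - 4 * qS {x0, x1, x2} a + 2 * qS C0 a"
  "pj 5 a = 4 * Q1 - 8 * qS {x0, x1} a - 4 * qS {x0, x3} a + 12 * qS {x0, x1, x2} a - 4 * qS C0 a"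
  "pj 6 a = 1 - 4 * Q1 + 4 * qS {x0, x1} a + 2 * qS {x0, x3} a - 4 * qS {x0, x1, x2} a + qS C0 a"
proof -
 let ?g = "%S. gS S a"
 have i: "integrable P (?g (insert s S))" if "finite S" for s S using gS_integral(1)[of "insert s S"] that by simp
 have E: "(\<integral>\<phi>. ?g (insert s S) \<phi> \<partial>P) = qS (insert s S) a" if "finite S" for s S using gS_integral(2)[of "insert s S"] that by simp
 note gg = gS_def config_0 eta_iff
 have "pj 1 a = (\<integral>\<phi>. ?g {x0, x1, x2, x3} \<phi> \<partial>P)" by (rule pj_eqI, simp add: i, unfold gg) simp
 then show "pj 1 a = qS C0 a" by (simp add: E C0_def)
 have "pj 2 a = (\<integral>\<phi>. ?g {x1, x2, x3} \<phi> + ?g {x0, x2, x3} \<phi> + ?g {x0, x1, x3} \<phi> + ?g {x0, x1, x2} \<phi> - 4 * ?g {x0, x1, x2, x3} \<phi> \<partial>P)"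
  apply (rule pj_eqI, simp add: i)
  subgoal for \<phi>
   unfolding gg by (cases "a *\<^sub>R x0 \<in> Xi \<phi>"; cases "a *\<^sub>R x1 \<in> Xi \<phi>"; cases "a *\<^sub>R x2 \<in> Xi \<phi>"; cases "a *\<^sub>R x3 \<in> Xi \<phi>"; simp)
  done
 then show "pj 2 a = 4 * qS {x0, x1, x2} a - 4 * qS C0 a" by (simp add: i E qS_eqs C0_def)
 have "pj 3 a = (\<integral>\<phi>. ?g {x0, x1} \<phi> + ?g {x0, x2} \<phi> + ?g {x1, x3} \<phi> + ?g {x2, x3} \<phi>
   - 2 * (?g {x1, x2, x3} \<phi> + ?g {x0, x2, x3} \<phi> + ?g {x0, x1, x3} \<phi> + ?g {x0, x1, x2} \<phi>) + 4 * ?g {x0, x1, x2, x3} \<phi> \<partial>P)"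
  apply (rule pj_eqI, simp add: i)
  subgoal for \<phi>
   unfolding gg by (cases "a *\<^sub>R x0 \<in> Xi \<phi>"; cases "a *\<^sub>R x1 \<in> Xi \<phi>"; cases "a *\<^sub>R x2 \<in> Xi \<phi>"; cases "a *\<^sub>R x3 \<in> Xi \<phi>"; simp)
  done
 then show "pj 3 a = 4 * qS {x0, x1} a - 8 * qS {x0, x1, x2} a + 4 * qS C0 a" by (simp add: i E qS_eqs C0_def)
 have "pj 4 a = (\<integral>\<phi>. ?g {x0, x3} \<phi> + ?g {x1, x2} \<phi>
   - (?g {x1, x2, x3} \<phi> + ?g {x0, x2, x3} \<phi> + ?g {x0, x1, x3} \<phi> + ?g {x0, x1, x2} \<phi>) + 2 * ?g {x0, x1, x2, x3} \<phi> \<partial>P)"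
  apply (rule pj_eqI, simp add: i)
  subgoal for \<phi>
   unfolding gg by (cases "a *\<^sub>R x0 \<in> Xi \<phi>"; cases "a *\<^sub>R x1 \<in> Xi \<phi>"; cases "a *\<^sub>R x2 \<in> Xi \<phi>"; cases "a *\<^sub>R x3 \<in> Xi \<phi>"; simp)
  done
 then show "pj 4 a = 2 * qS {x0, x3} a - 4 * qS {x0, x1, x2} a + 2 * qS C0 a" by (simp add: i E qS_eqs C0_def)
 have "pj 5 a = (\<integral>\<phi>. ?g {x0} \<phi> + ?g {x1} \<phi> + ?g {x2} \<phi> + ?g {x3} \<phi>
   - 2 * (?g {x0, x1} \<phi> + ?g {x0, x2} \<phi> + ?g {x1, x3} \<phi> + ?g {x2, x3} \<phi> + ?g {x0, x3} \<phi> + ?g {x1, x2} \<phi>)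
   + 3 * (?g {x1, x2, x3} \<phi> + ?g {x0, x2, x3} \<phi> + ?g {x0, x1, x3} \<phi> + ?g {x0, x1, x2} \<phi>) - 4 * ?g {x0, x1, x2, x3} \<phi> \<partial>P)"
  apply (rule pj_eqI, simp add: i)
  subgoal for \<phi>
   unfolding gg by (cases "a *\<^sub>R x0 \<in> Xi \<phi>"; cases "a *\<^sub>R x1 \<in> Xi \<phi>"; cases "a *\<^sub>R x2 \<in> Xi \<phi>"; cases "a *\<^sub>R x3 \<in> Xi \<phi>"; simp)
  done
 then show "pj 5 a = 4 * Q1 - 8 * qS {x0, x1} a - 4 * qS {x0, x3} a + 12 * qS {x0, x1, x2} a - 4 * qS C0 a"
  by (simp add: i E qS_eqs C0_def Q1_def)
 have "pj 6 a = (\<integral>\<phi>. 1 - (?g {x0} \<phi> + ?g {x1} \<phi> + ?g {x2} \<phi> + ?g {x3} \<phi>)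
   + (?g {x0, x1} \<phi> + ?g {x0, x2} \<phi> + ?g {x1, x3} \<phi> + ?g {x2, x3} \<phi> + ?g {x0, x3} \<phi> + ?g {x1, x2} \<phi>)
   - (?g {x1, x2, x3} \<phi> + ?g {x0, x2, x3} \<phi> + ?g {x0, x1, x3} \<phi> + ?g {x0, x1, x2} \<phi>) + ?g {x0, x1, x2, x3} \<phi> \<partial>P)"
  apply (rule pj_eqI, simp add: i)
  subgoal for \<phi>
   unfolding gg by (cases "a *\<^sub>R x0 \<in> Xi \<phi>"; cases "a *\<^sub>R x1 \<in> Xi \<phi>"; cases "a *\<^sub>R x2 \<in> Xi \<phi>"; cases "a *\<^sub>R x3 \<in> Xi \<phi>"; simp)
  done
 then show "pj 6 a = 1 - 4 * Q1 + 4 * qS {x0, x1} a + 2 * qS {x0, x3} a - 4 * qS {x0, x1, x2} a + qS C0 a"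
  by (simp add: i E qS_eqs C0_def Q1_def P.prob_space)
qed

abbreviation ub where "ub \<equiv> \<gamma> / pi * mm"

text \<open>In all uses \<open>k1\<close> and \<open>k2\<close> are half the perimeter and the area
  of the convex hull of \<open>S\<close>. The factor 2 comes from
  \<open>\<gamma> * bb = 2 * ub\<close>.\<close>

lemma qS_expand:
 assumes "(%a. ED S a - (vv + k1 * a * bb + k2 * a\<^sup>2)) \<in> O[at_right 0](%a. a ^ 3)"
 shows "(%a. qS S a - exp (- \<gamma> * vv) * (1 - 2 * ub * k1 * a + (2 * ub\<^sup>2 * k1\<^sup>2 - \<gamma> * k2) * a\<^sup>2)) \<in> O[at_right 0](%a. a ^ 3)"
proof -
 have "(%a. \<gamma> * (ED S a - (vv + k1 * a * bb + k2 * a\<^sup>2))) \<in> O[at_right 0](%a. a ^ 3)"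
  using assms by simp
 then have "(%a. \<gamma> * ED S a - (\<gamma> * vv + (2 * ub * k1) * a + (\<gamma> * k2) * a\<^sup>2)) \<in> O[at_right 0](%a. a ^ 3)"
  by (simp add: bb_eq algebra_simps)
 note * = exp_expand[OF this]
 have eq: "(2 * ub * k1)\<^sup>2 / 2 = 2 * ub\<^sup>2 * k1\<^sup>2" by (simp add: power2_eq_square)
 from * show ?thesis unfolding eq qS_def by simp
qed

lemma qS_asymptotics:
 defines "ex \<equiv> exp (- \<gamma> * vv)"
 shows "(%a. qS {x0, x1} a - ex * (1 - 2 * ub * a + 2 * ub\<^sup>2 * a\<^sup>2)) \<in> O[at_right 0](%a. a ^ 3)"
  "(%a. qS {x0, x3} a - ex * (1 - 2 * sqrt 2 * ub * a + 4 * ub\<^sup>2 * a\<^sup>2)) \<in> O[at_right 0](%a. a ^ 3)"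
  "(%a. qS {x0, x1, x2} a - ex * (1 - (2 + sqrt 2) * ub * a + ((3 + 2 * sqrt 2) * ub\<^sup>2 - \<gamma> / 2) * a\<^sup>2)) \<in> O[at_right 0](%a. a ^ 3)"
  "(%a. qS C0 a - ex * (1 - 4 * ub * a + (8 * ub\<^sup>2 - \<gamma>) * a\<^sup>2)) \<in> O[at_right 0](%a. a ^ 3)"
proof -
 have s2: "sqrt 2 \<le> 2" using real_sqrt_le_mono[of 2 4] by simp
 have h: "\<epsilon> / 2 > 0" using eps by simp
 have n1: "norm (a *\<^sub>R (x1 - x0)) = a" if "a > 0" for a using that by (simp add: x0_def x1_def)
 have n3: "norm (a *\<^sub>R (x3 - x0)) = sqrt 2 * a" if "a > 0" for a
  using that by (simp add: x0_def x3_def norm_Pair real_sqrt_mult mult.commute flip: mult_2)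
 have "(%a. ED {x0, x1} a - (vv + 1 * a * bb + 0 * a\<^sup>2)) \<in> O[at_right 0](%a. a ^ 3)"
 proof (rule bigo_cubic[OF h, of _ "1 / (2 * \<epsilon>)"])
  fix a :: real assume a: "0 < a" "a \<le> \<epsilon> / 2"
  then have l: "norm (a *\<^sub>R (x1 - x0)) \<le> \<epsilon>" unfolding n1[OF a(1)] by simp
  show "\<bar>ED {x0, x1} a - (vv + 1 * a * bb + 0 * a\<^sup>2)\<bar> \<le> 1 / (2 * \<epsilon>) * a ^ 3"
   using ED_pair[OF l] unfolding n1[OF a(1)] by simp
 qed
 from qS_expand[OF this] show "(%a. qS {x0, x1} a - ex * (1 - 2 * ub * a + 2 * ub\<^sup>2 * a\<^sup>2)) \<in> O[at_right 0](%a. a ^ 3)"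
  by (simp add: ex_def)
 have "(%a. ED {x0, x3} a - (vv + sqrt 2 * a * bb + 0 * a\<^sup>2)) \<in> O[at_right 0](%a. a ^ 3)"
 proof (rule bigo_cubic[OF h, of _ "sqrt 2 ^ 3 / (2 * \<epsilon>)"])
  fix a :: real assume a: "0 < a" "a \<le> \<epsilon> / 2"
  have "sqrt 2 * a \<le> 2 * a" using s2 a by (intro mult_right_mono) auto
  moreover have "2 * a \<le> \<epsilon>" using a by simp
  ultimately have l: "norm (a *\<^sub>R (x3 - x0)) \<le> \<epsilon>" unfolding n3[OF a(1)] by linarith
  show "\<bar>ED {x0, x3} a - (vv + sqrt 2 * a * bb + 0 * a\<^sup>2)\<bar> \<le> sqrt 2 ^ 3 / (2 * \<epsilon>) * a ^ 3"
   using ED_pair[OF l] unfolding n3[OF a(1)] power_mult_distrib by simp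
 qed
 from qS_expand[OF this] show "(%a. qS {x0, x3} a - ex * (1 - 2 * sqrt 2 * ub * a + 4 * ub\<^sup>2 * a\<^sup>2)) \<in> O[at_right 0](%a. a ^ 3)"
  by (simp add: ex_def mult.assoc mult.left_commute)
 have "(%a. ED {x0, x1, x2} a - (vv + (2 + sqrt 2) / 2 * a * bb + 1 / 2 * a\<^sup>2)) \<in> O[at_right 0](%a. a ^ 3)"
 proof (rule bigo_cubic[OF h, of _ "6 / \<epsilon>"])
  fix a :: real assume "0 < a" "a \<le> \<epsilon> / 2"
  then show "\<bar>ED {x0, x1, x2} a - (vv + (2 + sqrt 2) / 2 * a * bb + 1 / 2 * a\<^sup>2)\<bar> \<le> 6 / \<epsilon> * a ^ 3"
   using ED_triple[of a] by simp
 qed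
 note * = qS_expand[OF this]
 have "2 * ub\<^sup>2 * ((2 + sqrt 2) / 2)\<^sup>2 = (3 + 2 * sqrt 2) * ub\<^sup>2" by (simp add: power2_eq_square field_simps)
 moreover have "2 * ub * ((2 + sqrt 2) / 2) = (2 + sqrt 2) * ub" by simp
 moreover have "\<gamma> * (1 / 2) = \<gamma> / 2" by simp
 ultimately show "(%a. qS {x0, x1, x2} a - ex * (1 - (2 + sqrt 2) * ub * a + ((3 + 2 * sqrt 2) * ub\<^sup>2 - \<gamma> / 2) * a\<^sup>2)) \<in> O[at_right 0](%a. a ^ 3)"
  using * by (simp only: ex_def)
 have "(%a. ED C0 a - (vv + 2 * a * bb + 1 * a\<^sup>2)) \<in> O[at_right 0](%a. a ^ 3)"
 proof (rule bigo_cubic[OF h, of _ "3 / (2 * \<epsilon>)"])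
  fix a :: real assume "0 < a" "a \<le> \<epsilon> / 2"
  then show "\<bar>ED C0 a - (vv + 2 * a * bb + 1 * a\<^sup>2)\<bar> \<le> 3 / (2 * \<epsilon>) * a ^ 3" using ED_quad[of a] by simp
 qed
 from qS_expand[OF this] show "(%a. qS C0 a - ex * (1 - 4 * ub * a + (8 * ub\<^sup>2 - \<gamma>) * a\<^sup>2)) \<in> O[at_right 0](%a. a ^ 3)"
  by (simp add: ex_def)
qed

lemma sum_expansion:
 fixes w :: "nat => real"
 defines "ex \<equiv> exp (- \<gamma> * vv)"
 shows "(%a. (\<Sum>j = 1..6. w j * pj j a)
   - ((w 1 * ex + w 6 * (1 - ex)) + ex * ub * c3 w * a + ex * (c4 w * \<gamma> + c5 w * ub\<^sup>2) * a\<^sup>2))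
  \<in> O[at_right 0](%a. a ^ 3)"
proof -
 define ra where "ra a = qS {x0, x1} a - ex * (1 - 2 * ub * a + 2 * ub\<^sup>2 * a\<^sup>2)" for a
 define rd where "rd a = qS {x0, x3} a - ex * (1 - 2 * sqrt 2 * ub * a + 4 * ub\<^sup>2 * a\<^sup>2)" for a
 define rt where "rt a = qS {x0, x1, x2} a - ex * (1 - (2 + sqrt 2) * ub * a + ((3 + 2 * sqrt 2) * ub\<^sup>2 - \<gamma> / 2) * a\<^sup>2)" for a
 define rq where "rq a = qS C0 a - ex * (1 - 4 * ub * a + (8 * ub\<^sup>2 - \<gamma>) * a\<^sup>2)" for a
 \<comment> \<open>The coefficient of each remainder is that of the corresponding void probability
   in the sum of the \<open>w j * pj j a\<close>.\<close>
 have R: "(%a. (4 * w 3 - 8 * w 5 + 4 * w 6) * ra a + (2 * w 4 - 4 * w 5 + 2 * w 6) * rd a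
   + (4 * w 2 - 8 * w 3 - 4 * w 4 + 12 * w 5 - 4 * w 6) * rt a
   + (w 1 - 4 * w 2 + 4 * w 3 + 2 * w 4 - 4 * w 5 + w 6) * rq a) \<in> O[at_right 0](%a. a ^ 3)"
  unfolding ra_def rd_def rt_def rq_def ex_def by (intro sum_in_bigo cmult_bigo qS_asymptotics)
 have "(\<Sum>j = 1..6. w j * pj j a)
   - ((w 1 * ex + w 6 * (1 - ex)) + ex * ub * c3 w * a + ex * (c4 w * \<gamma> + c5 w * ub\<^sup>2) * a\<^sup>2)
  = (4 * w 3 - 8 * w 5 + 4 * w 6) * ra a + (2 * w 4 - 4 * w 5 + 2 * w 6) * rd a
   + (4 * w 2 - 8 * w 3 - 4 * w 4 + 12 * w 5 - 4 * w 6) * rt a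
   + (w 1 - 4 * w 2 + 4 * w 3 + 2 * w 4 - 4 * w 5 + w 6) * rq a" for a
 proof -
  define z where "z = ub"
  have "{1..6::nat} = {1, 2, 3, 4, 5, 6}" by auto
  then have S: "(\<Sum>j = 1..6. w j * pj j a) = w 1 * pj 1 a + w 2 * pj 2 a + w 3 * pj 3 a + w 4 * pj 4 a + w 5 * pj 5 a + w 6 * pj 6 a"
   by (simp add: add.assoc)
  show ?thesis unfolding S pj_formulas ex_def[symmetric] ra_def rd_def rt_def rq_def c3_def c4_def c5_def z_def[symmetric] by algebra
 qed
 then show ?thesis using R by simp
qed

end

section \<open>Construction of a Poisson process\<close>

text \<open>Serves to recover probabilities from generating functions. These are available only for
  arguments between 0 and 1, hence the limit at 0 from the right.\<close>

lemma powser_zero_0: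
 fixes d :: "nat => real"
 assumes d: "\<And>t. 0 < t ==> t < 1 ==> (%n. d n * t ^ n) sums 0"
 shows "d 0 = 0"
proof -
 define f where "f x = (\<Sum>n. d n * x ^ n)" for x :: real
 have s: "(%n. d n * x ^ n) sums f x" if x: "norm x < 1" for x
 proof -
  obtain t where t: "norm x < t" "t < 1" using dense[OF x] by blast
  then have t0: "0 < t" using norm_ge_zero[of x] by linarith
  have "summable (%n. d n * x ^ n)" using sums_summable[OF d[OF t0 t(2)]] t(1) t0 by (intro powser_inside[of d t x]) auto
  then show ?thesis unfolding f_def by (rule summable_sums)
 qed
 have "(f \<longlongrightarrow> d 0) (at 0)" using powser_limit_0[of 1 d f] s by simp
 then have l: "(f \<longlongrightarrow> d 0) (at_right 0)" by (rule tendsto_mono[OF at_le, rotated]) simp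
 have "(f \<longlongrightarrow> 0) (at_right 0)"
 proof (rule tendsto_eventually)
  have "\<forall>\<^sub>F x in at_right 0. x \<in> {0<..<1::real}" by (rule eventually_at_right_real) simp
  then show "\<forall>\<^sub>F x in at_right 0. f x = 0"
  proof eventually_elim
   case (elim x)
   then show ?case using sums_unique2[OF s d] by simp
  qed
 qed
 from tendsto_unique[OF _ l this] show ?thesis by simp
qed

lemma powser_zero:
 fixes d :: "nat => real"
 assumes "\<And>t. 0 < t ==> t < 1 ==> (%n. d n * t ^ n) sums 0"
 shows "d n = 0" using assms
proof (induction n arbitrary: d)
 case 0 then show ?case by (rule powser_zero_0)
next
 case (Suc n d)
 have d0: "d 0 = 0" using Suc.prems by (rule powser_zero_0)
 have "(%n. d (Suc n) * t ^ n) sums 0" if t: "0 < t" "t < 1" for t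
 proof -
  have "(%n. d (Suc n) * t ^ Suc n) sums (0 - d 0 * t ^ 0)" using Suc.prems[OF t] by (subst sums_Suc_iff) simp
  then have "(%n. inverse t * (d (Suc n) * t ^ Suc n)) sums (inverse t * 0)" using d0 by (intro sums_mult) simp
  then show ?thesis using t by (simp add: field_simps)
 qed
 then show ?case by (rule Suc.IH)
qed

lemma powser_unique:
 fixes a b :: "nat => real"
 assumes "\<And>t. 0 \<le> t ==> t < 1 ==> (%n. a n * t ^ n) sums s t" "\<And>t. 0 \<le> t ==> t < 1 ==> (%n. b n * t ^ n) sums s t"
 shows "a n = b n"
proof -
 have "a n - b n = 0"
 proof (rule powser_zero[where d = "%n. a n - b n"])
  fix t :: real assume "0 < t" "t < 1"
  then show "(%n. (a n - b n) * t ^ n) sums 0" using sums_diff[OF assms(1)[of t] assms(2)[of t]] by (simp add: algebra_simps)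
 qed
 then show ?thesis by simp
qed

text \<open>Only the coordinates in \<open>J\<close> occur, so the infinite product measure may be
  restricted to a finite one.\<close>

lemma nn_integral_PiM_prod:
 fixes M :: "'i => 'a measure"
 assumes M: "\<And>i. prob_space (M i)" and J: "finite J" and f: "\<And>i. i \<in> J ==> f i \<in> borel_measurable (M i)"
 shows "(\<integral>\<^sup>+\<omega>. (\<Prod>i\<in>J. f i (\<omega> i)) \<partial>PiM UNIV M) = (\<Prod>i\<in>J. \<integral>\<^sup>+x. f i x \<partial>M i)"
proof -
 interpret product_prob_space M UNIV using M by (rule product_prob_spaceI)
 have R: "(%\<omega>. restrict \<omega> J) \<in> measurable (PiM UNIV M) (PiM J M)" by (rule measurable_restrict_subset) simp
 have mf: "(%\<omega>. \<Prod>i\<in>J. f i (\<omega> i)) \<in> borel_measurable (PiM J M)"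
  using f by (intro borel_measurable_prod_ennreal measurable_compose[OF measurable_component_singleton]) auto
 have "(\<integral>\<^sup>+\<omega>. (\<Prod>i\<in>J. f i (\<omega> i)) \<partial>PiM UNIV M) = (\<integral>\<^sup>+\<omega>. (\<Prod>i\<in>J. f i (restrict \<omega> J i)) \<partial>PiM UNIV M)"
  by (intro nn_integral_cong prod.cong) auto
 also have "... = (\<integral>\<^sup>+\<omega>. (\<Prod>i\<in>J. f i (\<omega> i)) \<partial>distr (PiM UNIV M) (PiM J M) (%\<omega>. restrict \<omega> J))"
  using R mf by (simp add: nn_integral_distr)
 also have "... = (\<integral>\<^sup>+\<omega>. (\<Prod>i\<in>J. f i (\<omega> i)) \<partial>PiM J M)"
  using J by (subst distr_PiM_restrict_finite) auto
 also have "... = (\<Prod>i\<in>J. \<integral>\<^sup>+x. f i x \<partial>M i)" using J f by (rule product_nn_integral_prod)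
 finally show ?thesis .
qed

section \<open>Independent samples of points in the unit squares\<close>

definition cell :: "nat => pt set" where
 "cell c = {x. (\<lfloor>fst x\<rfloor>, \<lfloor>snd x\<rfloor>) = from_nat_into (UNIV :: (int \<times> int) set) c}"

lemma bij_from_nat_into_int: "bij (from_nat_into (UNIV :: (int \<times> int) set))"
 by (intro bij_betw_from_nat_into) (auto simp: finite_prod)

lemma cell_disjoint: "disjoint_family cell"
 using bij_is_inj[OF bij_from_nat_into_int] by (auto simp: disjoint_family_on_def cell_def dest: injD)

lemma cell_UN: "(\<Union>c. cell c) = UNIV"
proof -
 have "x \<in> (\<Union>c. cell c)" for x
  using bij_is_surj[OF bij_from_nat_into_int] surjD[of "from_nat_into UNIV" "(\<lfloor>fst x\<rfloor>, \<lfloor>snd x\<rfloor>)"] by (force simp: cell_def)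
 then show ?thesis by blast
qed

lemma cell_area: "cell c \<in> sets borel" "emeasure lborel (cell c) = 1"
proof -
 obtain i j where ij: "from_nat_into (UNIV :: (int \<times> int) set) c = (i, j)" by (meson surj_pair)
 have eq: "cell c = {real_of_int i..<real_of_int i + 1} \<times> {real_of_int j..<real_of_int j + 1}"
  by (auto simp: cell_def ij floor_eq_iff)
 have "cell c \<in> sets (borel \<Otimes>\<^sub>M borel)" unfolding eq by (intro pair_measureI) auto
 then show "cell c \<in> sets borel" unfolding borel_prod .
 have "emeasure lborel (cell c) = emeasure (lborel \<Otimes>\<^sub>M lborel) (cell c)" by (simp add: lborel_prod)
 also have "... = 1" unfolding eq by (subst lborel.emeasure_pair_measure_Times) auto
 finally show "emeasure lborel (cell c) = 1" .
qed

definition unif :: "nat => pt measure" where "unif c = uniform_measure lborel (cell c)"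

lemma unif_basic: "prob_space (unif c)" "sets (unif c) = sets borel" "space (unif c) = UNIV"
 "A \<in> sets borel ==> measure (unif c) A = area (cell c \<inter> A)"
 "AE x in unif c. x \<in> cell c" "emeasure (unif c) {y} = 0"
proof -
 have n: "emeasure lborel (cell c) ~= 0" "emeasure lborel (cell c) ~= \<infinity>" using cell_area[of c] by simp_all
 show "prob_space (unif c)" unfolding unif_def using n by (rule prob_space_uniform_measure)
 show "sets (unif c) = sets borel" "space (unif c) = UNIV" by (simp_all add: unif_def)
 show "measure (unif c) A = area (cell c \<inter> A)" if "A \<in> sets borel"
  using measure_uniform_measure[OF n, of A] that cell_area[of c] by (simp add: unif_def measure_def)
 show "AE x in unif c. x \<in> cell c" unfolding unif_def using cell_area(1) by (intro AE_uniform_measureI) auto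
 have "emeasure lborel (cell c \<inter> {y}) \<le> emeasure lborel {y}" by (intro emeasure_mono) auto
 then show "emeasure (unif c) {y} = 0" using cell_area[of c] by (simp add: unif_def)
qed

lemma unif_no_ties:
 assumes "i ~= j" shows "AE x in PiM UNIV (%_ :: nat. unif c). x i ~= x j"
proof -
 interpret U: prob_space "unif c" by (rule unif_basic)
 interpret product_prob_space "%_ :: nat. unif c" UNIV by (rule product_prob_spaceI) (rule unif_basic)
 note [measurable_cong] = unif_basic(2)[of c]
 let ?P = "PiM {i, j} (%_. unif c)"
 have m: "{x \<in> space ?P. x i = x j} \<in> sets ?P"
 proof -
  have [measurable]: "(%x. x i) \<in> borel_measurable ?P" "(%x. x j) \<in> borel_measurable ?P"
   using measurable_component_singleton[of i "{i, j}" "%_. unif c"] measurable_component_singleton[of j "{i, j}" "%_. unif c"]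
    measurable_cong_sets[OF refl unif_basic(2)[of c]] by auto
  show ?thesis by measurable
 qed
 have "emeasure ?P {x \<in> space ?P. x i = x j} = (\<integral>\<^sup>+x. indicator {x \<in> space ?P. x i = x j} x \<partial>?P)" using m by simp
 also have "... = (\<integral>\<^sup>+x. \<integral>\<^sup>+y. indicator {x \<in> space ?P. x i = x j} (x(i := y)) \<partial>unif c \<partial>PiM {j} (%_. unif c))"
  using m assms by (intro product_nn_integral_insert) auto
 also have "... = (\<integral>\<^sup>+x. 0 \<partial>PiM {j} (%_. unif c))"
 proof (rule nn_integral_cong)
  fix x assume "x \<in> space (PiM {j} (%_. unif c))"
  have "(\<integral>\<^sup>+y. indicator {x \<in> space ?P. x i = x j} (x(i := y)) \<partial>unif c) \<le> (\<integral>\<^sup>+y. indicator {x j} y \<partial>unif c)"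
   using assms by (intro nn_integral_mono) (auto simp: indicator_def)
  also have "... = emeasure (unif c) {x j}" using unif_basic(2)[of c] by (intro nn_integral_indicator) simp
  also have "... = 0" by (rule unif_basic)
  finally show "(\<integral>\<^sup>+y. indicator {x \<in> space ?P. x i = x j} (x(i := y)) \<partial>unif c) = 0" by simp
 qed
 finally have "AE x in ?P. x i ~= x j" using m by (intro AE_I[of _ _ "{x \<in> space ?P. x i = x j}"]) auto
 then have "AE x in distr (PiM UNIV (%_. unif c)) ?P (%x. restrict x {i, j}). x i ~= x j"
  by (subst distr_PiM_restrict_finite) auto
 from AE_distrD[OF measurable_restrict_subset this] show ?thesis by simp
qed

text \<open>A sample assigns to every square a number of points and an infinite sequence of
  positions, of which only the first \<open>fst (\<omega> c)\<close> are points of the process.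
  \<open>n\<close> is the number of squares inspected.\<close>

definition cnt :: "nat => pt set => (nat => nat \<times> (nat => pt)) => nat" where
 "cnt n A \<omega> = (\<Sum>c<n. card {i. i < fst (\<omega> c) \<and> snd (\<omega> c) i \<in> A})"

text \<open>The total count in \<open>A\<close> is \<open>m\<close>, expressed by the stabilisation
  of the partial counts; an infinite total is the case in which no \<open>m\<close>
  qualifies.\<close>

definition ev :: "pt set => nat => (nat => nat \<times> (nat => pt)) => bool" where
 "ev A m \<omega> \<longleftrightarrow> (\<forall>\<^sub>F n in sequentially. cnt n A \<omega> = m)"

text \<open>\<open>z\<close> raised to the total count in \<open>A\<close>, with value 0 when that
  count is infinite. Written as a power series in \<open>z\<close> whose coefficients are indicators
  of exact counts.\<close>

definition Lz :: "real => pt set => (nat => nat \<times> (nat => pt)) => real" where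
 "Lz z A \<omega> = (\<Sum>m. z ^ m * of_bool (ev A m \<omega>))"

lemma ev_unique: "ev A m \<omega> ==> ev A m' \<omega> ==> m = m'"
 unfolding ev_def using eventually_happens'[OF sequentially_bot eventually_conj] by blast

lemma Lz_ev: fixes z :: real shows "ev A m \<omega> ==> (%m. z ^ m * of_bool (ev A m \<omega>)) sums z ^ m"
proof -
 assume e: "ev A m \<omega>"
 have "ev A k \<omega> \<longleftrightarrow> k = m" for k using e ev_unique by blast
 then have "(%k. z ^ k * of_bool (ev A k \<omega>)) = (%k. if k = m then z ^ k else 0)" by (intro ext) simp
 then show ?thesis using sums_single[of m "%k. z ^ k"] by simp
qed

lemma Lz_sums: "(%m. z ^ m * of_bool (ev A m \<omega>)) sums Lz z A \<omega>"
proof (cases "\<exists>m. ev A m \<omega>")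
 case True then show ?thesis unfolding Lz_def using Lz_ev sums_summable summable_sums by blast
next
 case False then show ?thesis by (simp add: Lz_def)
qed

text \<open>If the monotone counts do not stabilise they are unbounded, and powers of
  \<open>z < 1\<close> tend to 0, the value of \<open>Lz\<close> in this case.\<close>

lemma Lz_limit:
 assumes z: "0 \<le> z" "z < 1" shows "(%n. z ^ cnt n A \<omega>) \<longlonglongrightarrow> Lz z A \<omega>"
proof (cases "\<exists>m. ev A m \<omega>")
 case True
 then obtain m where m: "ev A m \<omega>" by blast
 have "Lz z A \<omega> = z ^ m" using sums_unique2[OF Lz_sums Lz_ev[OF m]] .
 moreover have "\<forall>\<^sub>F n in sequentially. z ^ cnt n A \<omega> = z ^ m" using m unfolding ev_def by eventually_elim simp
 ultimately show ?thesis by (simp add: tendsto_eventually)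
next
 case False
 then have "Lz z A \<omega> = 0" by (simp add: Lz_def)
 have inc: "cnt n A \<omega> \<le> cnt n' A \<omega>" if "n \<le> n'" for n n' unfolding cnt_def using that by (intro sum_mono2) auto
 have "\<exists>n. cnt n A \<omega> \<ge> B" for B
 proof (rule ccontr)
  assume "\<not> (\<exists>n. cnt n A \<omega> \<ge> B)"
  then have b: "\<And>n. cnt n A \<omega> < B" by (simp add: not_le)
  have fin: "finite (range (%n. cnt n A \<omega>))" by (rule finite_subset[OF _ finite_lessThan[of B]]) (use b in auto)
  then have "Max (range (%n. cnt n A \<omega>)) \<in> range (%n. cnt n A \<omega>)" by (rule Max_in) blast
  then obtain n where n: "Max (range (%n. cnt n A \<omega>)) = cnt n A \<omega>" by blast
  have "cnt k A \<omega> = cnt n A \<omega>" if "k \<ge> n" for k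
  proof -
   have "cnt k A \<omega> \<le> cnt n A \<omega>" unfolding n[symmetric] by (rule Max_ge[OF fin]) blast
   then show ?thesis using inc[OF that] by simp
  qed
  then have "ev A (cnt n A \<omega>) \<omega>" unfolding ev_def eventually_sequentially by blast
  then show False using False by blast
 qed
 then have "filterlim (%n. cnt n A \<omega>) at_top sequentially"
  unfolding filterlim_at_top eventually_sequentially using inc order_trans by meson
 then have "(%n. z ^ cnt n A \<omega>) \<longlonglongrightarrow> 0" using z by (intro filterlim_compose[OF LIMSEQ_power_zero]) auto
 then show ?thesis using \<open>Lz z A \<omega> = 0\<close> by simp
qed

lemma Lz_bounds:
 assumes z: "0 \<le> z" "z < 1" shows "0 \<le> Lz z A \<omega> \<and> Lz z A \<omega> \<le> 1"
proof
 show "0 \<le> Lz z A \<omega>" using z by (intro LIMSEQ_le_const[OF Lz_limit[OF z]]) auto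
 show "Lz z A \<omega> \<le> 1" using z by (intro LIMSEQ_le_const2[OF Lz_limit[OF z]]) (auto intro!: power_le_one)
qed

lemma prod_if_card: fixes n :: nat shows "(\<Prod>i<n. if R i then z else 1) = (z :: real) ^ card {i. i < n \<and> R i}"
proof -
 have "(\<Prod>i<n. if R i then z else 1) = (\<Prod>i\<in>{i \<in> {..<n}. R i}. z)" by (rule prod.inter_filter[symmetric]) simp
 then show ?thesis by simp
qed

locale pconstr = fixes \<gamma> :: real assumes gam: "\<gamma> > 0"
begin

definition D where "D c = measure_pmf (poisson_pmf \<gamma>) \<Otimes>\<^sub>M PiM UNIV (%_ :: nat. unif c)"
definition OM where "OM = PiM UNIV D"

lemma prob_seq: "prob_space (PiM UNIV (%_ :: nat. unif c))" by (intro prob_space_PiM unif_basic)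

lemma prob_D: "prob_space (D c)" unfolding D_def by (intro prob_space_pair prob_seq measure_pmf.prob_space_axioms)

sublocale O: prob_space OM unfolding OM_def by (intro prob_space_PiM prob_D)

lemma meas_count: "fst \<in> measurable (D c) (count_space UNIV)" unfolding D_def by (rule measurable_compose[OF measurable_fst]) simp

lemma meas_point: "(%w. snd w i) \<in> borel_measurable (D c)"
proof -
 have "(%x. x i) \<in> measurable (PiM UNIV (%_ :: nat. unif c)) (unif c)" by (rule measurable_component_singleton) simp
 then have "(%x. x i) \<in> borel_measurable (PiM UNIV (%_ :: nat. unif c))"
  using measurable_cong_sets[OF refl unif_basic(2)[of c]] by blast
 then show ?thesis unfolding D_def by (intro measurable_compose[OF measurable_snd])
qed

lemma meas_D: "(%\<omega>. \<omega> c) \<in> measurable OM (D c)"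
 unfolding OM_def by (rule measurable_component_singleton) simp

text \<open>Given the number of points, their factors are independent with mean \<open>u\<close>;
  summing \<open>u ^ n\<close> against the Poisson weights gives the exponential.\<close>

lemma pgf_cell:
 assumes [measurable]: "h \<in> borel_measurable borel" and h: "\<And>x. 0 \<le> h x"
  and u: "(\<integral>\<^sup>+x. ennreal (h x) \<partial>unif c) = ennreal u" "0 \<le> u"
 shows "(%w. \<Prod>i<fst w. ennreal (h (snd w i))) \<in> borel_measurable (D c)"
  "(\<integral>\<^sup>+w. (\<Prod>i<fst w. ennreal (h (snd w i))) \<partial>D c) = ennreal (exp (- \<gamma> * (1 - u)))"
proof -
 interpret S: prob_space "PiM UNIV (%_ :: nat. unif c)" by (rule prob_seq)
 note [measurable] = meas_point meas_count
 show m: "(%w. \<Prod>i<fst w. ennreal (h (snd w i))) \<in> borel_measurable (D c)"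
  by (rule measurable_compose_countable[where f = "%n w. \<Prod>i<n. ennreal (h (snd w i))", OF _ meas_count]) measurable
 have "(\<integral>\<^sup>+w. (\<Prod>i<fst w. ennreal (h (snd w i))) \<partial>D c) =
   (\<integral>\<^sup>+n. \<integral>\<^sup>+x. (\<Prod>i<n. ennreal (h (x i))) \<partial>PiM UNIV (%_ :: nat. unif c) \<partial>measure_pmf (poisson_pmf \<gamma>))"
  using m unfolding D_def by (subst S.nn_integral_fst[symmetric]) simp_all
 also have "... = (\<integral>\<^sup>+n. ennreal (u ^ n) \<partial>measure_pmf (poisson_pmf \<gamma>))"
 proof (rule nn_integral_cong)
  fix n :: nat
  have "(\<integral>\<^sup>+x. (\<Prod>i<n. ennreal (h (x i))) \<partial>PiM UNIV (%_ :: nat. unif c)) = (\<Prod>i<n. \<integral>\<^sup>+x. ennreal (h x) \<partial>unif c)"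
   using unif_basic by (intro nn_integral_PiM_prod) (auto cong: measurable_cong_sets)
  then show "(\<integral>\<^sup>+x. (\<Prod>i<n. ennreal (h (x i))) \<partial>PiM UNIV (%_ :: nat. unif c)) = ennreal (u ^ n)"
   using u by (simp add: ennreal_power)
 qed
 also have "... = (\<Sum>n. ennreal (exp (- \<gamma>) * ((\<gamma> * u) ^ n / fact n)))"
  unfolding nn_integral_measure_pmf nn_integral_count_space_nat
  using gam u by (intro suminf_cong) (simp add: ennreal_mult'[symmetric] power_mult_distrib mult_ac)
 also have "... = ennreal (exp (- \<gamma>) * exp (\<gamma> * u))"
 proof (rule suminf_ennreal_eq)
  have "(%n. (\<gamma> * u) ^ n / fact n) sums exp (\<gamma> * u)"
   using exp_converges[of "\<gamma> * u"] by (simp add: scaleR_conv_of_real divide_inverse mult.commute)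
  then show "(%n. exp (- \<gamma>) * ((\<gamma> * u) ^ n / fact n)) sums (exp (- \<gamma>) * exp (\<gamma> * u))" by (rule sums_mult)
 qed (use gam u in simp)
 also have "exp (- \<gamma>) * exp (\<gamma> * u) = exp (- \<gamma> * (1 - u))" by (simp add: exp_add[symmetric] algebra_simps)
 finally show "(\<integral>\<^sup>+w. (\<Prod>i<fst w. ennreal (h (snd w i))) \<partial>D c) = ennreal (exp (- \<gamma> * (1 - u)))" .
qed

lemma meas_cnt: "A \<in> sets borel ==> (%\<omega>. cnt n A \<omega>) \<in> measurable OM (count_space UNIV)"
proof -
 assume [measurable]: "A \<in> sets borel"
 have 1: "(%w. card {i. i < fst w \<and> snd w i \<in> A}) \<in> measurable (D c) (count_space UNIV)" for c
 proof (rule measurable_compose_countable[where f = "%n w. card {i. i < n \<and> snd w i \<in> A}", OF _ meas_count])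
  fix n :: nat
  note [measurable] = meas_point
  have "card {i. i < n \<and> R i} = (\<Sum>i<n. if R i then 1 else 0)" for R
  proof -
   have "(\<Sum>i<n. if R i then 1 else 0 :: nat) = (\<Sum>i\<in>{i \<in> {..<n}. R i}. 1)" by (rule sum.inter_filter[symmetric]) simp
   then show ?thesis by simp
  qed
  then show "(%w. card {i. i < n \<and> snd w i \<in> A}) \<in> measurable (D c) (count_space UNIV)" by simp
 qed
 note [measurable] = measurable_compose[OF meas_D 1]
 show ?thesis unfolding cnt_def by measurable
qed

lemma meas_ev [measurable]: "A \<in> sets borel ==> Measurable.pred OM (ev A m)"
proof -
 assume "A \<in> sets borel"
 note [measurable] = meas_cnt[OF this]
 show ?thesis unfolding ev_def eventually_sequentially by measurable
qed

lemma meas_Lz [measurable]: assumes [measurable]: "A \<in> sets borel" shows "Lz z A \<in> borel_measurable OM"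
 unfolding Lz_def[abs_def] of_bool_def by measurable

text \<open>Because the sets are disjoint, every point contributes one factor \<open>h\<close>,
  equal to \<open>z l\<close> on \<open>A l\<close> and to 1 elsewhere, and \<open>h\<close> is
  affine in the indicators. The generating function therefore factorises over the squares, and
  regrouping the exponent factorises it over the sets.\<close>

lemma pgf_finite:
 fixes A :: "nat => pt set"
 assumes J: "finite J" and A: "\<And>l. l \<in> J ==> A l \<in> sets borel" and dj: "disjoint_family_on A J"
  and z: "\<And>l. l \<in> J ==> 0 \<le> z l" "\<And>l. l \<in> J ==> z l < 1"
 shows "(\<integral>\<omega>. (\<Prod>l\<in>J. z l ^ cnt n (A l) \<omega>) \<partial>OM) = (\<Prod>l\<in>J. exp (- \<gamma> * (1 - z l) * (\<Sum>c<n. area (cell c \<inter> A l))))"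
proof -
 define h where "h x = (\<Prod>l\<in>J. if x \<in> A l then z l else 1)" for x
 have hm [measurable]: "h \<in> borel_measurable borel" unfolding h_def[abs_def] using A by measurable
 have h0: "0 \<le> h x" for x unfolding h_def using z by (intro prod_nonneg) auto
 have hsum: "h x = 1 - (\<Sum>l\<in>J. (1 - z l) * indicator (A l) x)" for x
 proof (cases "\<exists>l\<in>J. x \<in> A l")
  case True
  then obtain l0 where l0: "l0 \<in> J" "x \<in> A l0" by blast
  have iff: "x \<in> A l \<longleftrightarrow> l = l0" if "l \<in> J" for l using dj that l0 unfolding disjoint_family_on_def by blast
  have "h x = (\<Prod>l\<in>J. if l = l0 then z l else 1)" unfolding h_def by (intro prod.cong) (auto simp: iff)
  moreover have "(\<Sum>l\<in>J. (1 - z l) * indicator (A l) x) = (\<Sum>l\<in>J. if l = l0 then 1 - z l else 0)"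
   by (intro sum.cong) (auto simp: iff indicator_def)
  ultimately show ?thesis using J l0 by (simp add: prod.delta sum.delta)
 next
  case False
  then show ?thesis by (simp add: h_def indicator_def sum.neutral)
 qed
 define u where "u c = 1 - (\<Sum>l\<in>J. (1 - z l) * area (cell c \<inter> A l))" for c
 have u: "(\<integral>\<^sup>+x. ennreal (h x) \<partial>unif c) = ennreal (u c)" "0 \<le> u c" for c
 proof -
  interpret U: prob_space "unif c" by (rule unif_basic)
  have AU: "A l \<in> sets (unif c)" if "l \<in> J" for l using A[OF that] unif_basic(2) by simp
  have ii: "integrable (unif c) (%x. (1 - z l) * indicator (A l) x)" if "l \<in> J" for l
   using AU[OF that] by (intro integrable_mult_right integrable_real_indicator) (simp_all add: U.emeasure_eq_measure)
  have hi: "integrable (unif c) h" unfolding hsum[abs_def] using ii by (intro Bochner_Integration.integrable_diff Bochner_Integration.integrable_sum) auto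
  have "(\<integral>x. h x \<partial>unif c) = 1 - (\<Sum>l\<in>J. \<integral>x. (1 - z l) * indicator (A l) x \<partial>unif c)"
   unfolding hsum using ii U.prob_space by (subst Bochner_Integration.integral_diff) (auto simp: Bochner_Integration.integral_sum)
  also have "... = u c" unfolding u_def using unif_basic(4)[OF A, of _ c] unif_basic(3)[of c] by (simp cong: sum.cong)
  finally have e: "(\<integral>x. h x \<partial>unif c) = u c" .
  show "(\<integral>\<^sup>+x. ennreal (h x) \<partial>unif c) = ennreal (u c)" using nn_integral_eq_integral[OF hi] h0 e by simp
  show "0 \<le> u c" unfolding e[symmetric] using h0 by (intro Bochner_Integration.integral_nonneg) simp
 qed
 have eq: "(\<Prod>l\<in>J. z l ^ cnt n (A l) \<omega>) = (\<Prod>c<n. \<Prod>i<fst (\<omega> c). h (snd (\<omega> c) i))" for \<omega>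
 proof -
  have "(\<Prod>l\<in>J. z l ^ cnt n (A l) \<omega>) = (\<Prod>l\<in>J. \<Prod>c<n. \<Prod>i<fst (\<omega> c). if snd (\<omega> c) i \<in> A l then z l else 1)"
   unfolding cnt_def power_sum prod_if_card ..
  also have "... = (\<Prod>c<n. \<Prod>l\<in>J. \<Prod>i<fst (\<omega> c). if snd (\<omega> c) i \<in> A l then z l else 1)" by (rule prod.swap)
  also have "... = (\<Prod>c<n. \<Prod>i<fst (\<omega> c). h (snd (\<omega> c) i))" unfolding h_def by (intro prod.cong refl prod.swap)
  finally show ?thesis .
 qed
 have m: "(%\<omega>. \<Prod>l\<in>J. z l ^ cnt n (A l) \<omega>) \<in> borel_measurable OM"
  using measurable_compose[OF meas_cnt[OF A], of _ "%k. z _ ^ k" borel n] by (intro borel_measurable_prod) simp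
 have "(\<integral>\<^sup>+\<omega>. ennreal (\<Prod>l\<in>J. z l ^ cnt n (A l) \<omega>) \<partial>OM) = (\<integral>\<^sup>+\<omega>. (\<Prod>c<n. \<Prod>i<fst (\<omega> c). ennreal (h (snd (\<omega> c) i))) \<partial>OM)"
  unfolding eq using h0 by (simp add: prod_ennreal prod_nonneg)
 also have "... = (\<Prod>c<n. \<integral>\<^sup>+w. (\<Prod>i<fst w. ennreal (h (snd w i))) \<partial>D c)"
  unfolding OM_def using prob_D pgf_cell(1)[OF hm h0 u]
  by (intro nn_integral_PiM_prod[where f = "%c w. \<Prod>i<fst w. ennreal (h (snd w i))"]) auto
 also have "... = (\<Prod>c<n. ennreal (exp (- \<gamma> * (1 - u c))))" using pgf_cell(2)[OF hm h0 u] by simp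
 also have "... = ennreal (\<Prod>c<n. exp (- \<gamma> * (1 - u c)))" by (rule prod_ennreal) simp
 also have "(\<Prod>c<n. exp (- \<gamma> * (1 - u c))) = (\<Prod>l\<in>J. exp (- \<gamma> * (1 - z l) * (\<Sum>c<n. area (cell c \<inter> A l))))"
  using J by (simp add: exp_sum[symmetric] u_def sum_distrib_left sum.swap[of _ J] mult.assoc)
 finally have fin: "(\<integral>\<^sup>+\<omega>. ennreal (\<Prod>l\<in>J. z l ^ cnt n (A l) \<omega>) \<partial>OM) = ennreal (\<Prod>l\<in>J. exp (- \<gamma> * (1 - z l) * (\<Sum>c<n. area (cell c \<inter> A l))))" .
 have "(\<integral>\<omega>. (\<Prod>l\<in>J. z l ^ cnt n (A l) \<omega>) \<partial>OM) = enn2real (\<integral>\<^sup>+\<omega>. ennreal (\<Prod>l\<in>J. z l ^ cnt n (A l) \<omega>) \<partial>OM)"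
  using m z by (intro integral_eq_nn_integral) (auto intro!: prod_nonneg AE_I2)
 also have "... = (\<Prod>l\<in>J. exp (- \<gamma> * (1 - z l) * (\<Sum>c<n. area (cell c \<inter> A l))))"
  unfolding fin by (intro enn2real_ennreal prod_nonneg) simp
 finally show ?thesis .
qed

lemma cell_area_sums:
 assumes "A \<in> sets borel" "emeasure lborel A < \<infinity>"
 shows "(%c. area (cell c \<inter> A)) sums area A"
proof -
 have U: "(\<Union>c. cell c \<inter> A) = A" using cell_UN by blast
 have "(%c. measure lborel (cell c \<inter> A)) sums measure lborel (\<Union>c. cell c \<inter> A)"
 proof (rule measure_UNION)
  show "range (%c. cell c \<inter> A) \<subseteq> sets lborel" using assms cell_area by auto
  show "disjoint_family (%c. cell c \<inter> A)" using cell_disjoint unfolding disjoint_family_on_def by blast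
  show "emeasure lborel (\<Union>c. cell c \<inter> A) ~= \<infinity>" unfolding U using assms by simp
 qed
 then show ?thesis unfolding U .
qed

context
 fixes A :: "nat => pt set" and J :: "nat set"
 assumes J: "finite J" and A: "\<And>l. l \<in> J ==> A l \<in> sets borel" and Afin: "\<And>l. l \<in> J ==> emeasure lborel (A l) < \<infinity>"
  and dj: "disjoint_family_on A J"
begin

lemma pgf_Lz:
 assumes z: "\<And>l. l \<in> J ==> 0 \<le> z l" "\<And>l. l \<in> J ==> z l < 1"
 shows "(\<integral>\<omega>. (\<Prod>l\<in>J. Lz (z l) (A l) \<omega>) \<partial>OM) = (\<Prod>l\<in>J. exp (- \<gamma> * (1 - z l) * area (A l)))"
proof (rule LIMSEQ_unique)
 show "(%n. \<integral>\<omega>. (\<Prod>l\<in>J. z l ^ cnt n (A l) \<omega>) \<partial>OM) \<longlonglongrightarrow> (\<integral>\<omega>. (\<Prod>l\<in>J. Lz (z l) (A l) \<omega>) \<partial>OM)"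
 proof (rule integral_dominated_convergence[where w = "%_. 1"])
  show "(%\<omega>. \<Prod>l\<in>J. Lz (z l) (A l) \<omega>) \<in> borel_measurable OM" using A by (intro borel_measurable_prod meas_Lz)
  show "(%\<omega>. \<Prod>l\<in>J. z l ^ cnt n (A l) \<omega>) \<in> borel_measurable OM" for n
   using measurable_compose[OF meas_cnt[OF A], of _ "%k. z _ ^ k" borel n] by (intro borel_measurable_prod) simp
  show "AE \<omega> in OM. (%n. \<Prod>l\<in>J. z l ^ cnt n (A l) \<omega>) \<longlonglongrightarrow> (\<Prod>l\<in>J. Lz (z l) (A l) \<omega>)"
   using z by (intro AE_I2 tendsto_prod Lz_limit) auto
  show "AE \<omega> in OM. norm (\<Prod>l\<in>J. z l ^ cnt n (A l) \<omega>) \<le> 1" for n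
  proof (intro AE_I2)
   fix \<omega>
   have "0 \<le> z l ^ cnt n (A l) \<omega> \<and> z l ^ cnt n (A l) \<omega> \<le> 1" if "l \<in> J" for l
    using z(1)[OF that] z(2)[OF that] by (auto intro!: power_le_one)
   then show "norm (\<Prod>l\<in>J. z l ^ cnt n (A l) \<omega>) \<le> 1" by (simp add: prod_nonneg prod_le_1)
  qed
 qed simp
 have "(%n. \<Prod>l\<in>J. exp (- \<gamma> * (1 - z l) * (\<Sum>c<n. area (cell c \<inter> A l)))) \<longlonglongrightarrow> (\<Prod>l\<in>J. exp (- \<gamma> * (1 - z l) * area (A l)))"
  using cell_area_sums[OF A Afin] unfolding sums_def by (intro tendsto_intros) auto
 then show "(%n. \<integral>\<omega>. (\<Prod>l\<in>J. z l ^ cnt n (A l) \<omega>) \<partial>OM) \<longlonglongrightarrow> (\<Prod>l\<in>J. exp (- \<gamma> * (1 - z l) * area (A l)))"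
  using pgf_finite[OF J A dj z] by simp
qed

text \<open>One generating-function factor at a time is exchanged for the event of an exact count.
  With the remaining factors as a bounded weight \<open>W\<close>, both sides are power series in
  the variable of the chosen set, and their coefficients are compared.\<close>

lemma pgf_mixed:
 assumes I: "I \<subseteq> J" and z: "\<And>l. l \<in> J ==> 0 \<le> z l" "\<And>l. l \<in> J ==> z l < 1"
 shows "(\<integral>\<omega>. (\<Prod>l\<in>I. of_bool (ev (A l) (m l) \<omega>)) * (\<Prod>l\<in>J - I. Lz (z l) (A l) \<omega>) \<partial>OM)
  = (\<Prod>l\<in>I. poisson_prob (\<gamma> * area (A l)) (m l)) * (\<Prod>l\<in>J - I. exp (- \<gamma> * (1 - z l) * area (A l)))"
 using finite_subset[OF I J] I z
proof (induction I arbitrary: z rule: finite_induct)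
 case empty
 then show ?case using pgf_Lz by simp
next
 case (insert j I z)
 define W where "W \<omega> = (\<Prod>l\<in>I. of_bool (ev (A l) (m l) \<omega>)) * (\<Prod>l\<in>J - insert j I. Lz (z l) (A l) \<omega>)" for \<omega>
 define C where "C = (\<Prod>l\<in>I. poisson_prob (\<gamma> * area (A l)) (m l)) * (\<Prod>l\<in>J - insert j I. exp (- \<gamma> * (1 - z l) * area (A l)))"
 define la where "la = \<gamma> * area (A j)"
 have j: "j \<in> J" "j \<notin> I" "I \<subseteq> J" using insert by auto
 have JI: "J - I = insert j (J - insert j I)" "finite (J - insert j I)" "j \<notin> J - insert j I" using j J by auto
 have Wm [measurable]: "W \<in> borel_measurable OM"
 proof -
  have [measurable]: "(%\<omega>. of_bool (ev (A l) k \<omega>) :: real) \<in> borel_measurable OM" if "l \<in> J" for l k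
   unfolding of_bool_def using A[OF that] by measurable
  show ?thesis unfolding W_def[abs_def] using j A by (intro borel_measurable_times borel_measurable_prod meas_Lz) auto
 qed
 have Wb: "0 \<le> W \<omega>" "W \<omega> \<le> 1" for \<omega>
 proof -
  have L: "0 \<le> Lz (z l) (A l) \<omega> \<and> Lz (z l) (A l) \<omega> \<le> 1" if "l \<in> J - insert j I" for l
   using that insert.prems by (intro Lz_bounds) auto
  then have 1: "0 \<le> (\<Prod>l\<in>J - insert j I. Lz (z l) (A l) \<omega>)" "(\<Prod>l\<in>J - insert j I. Lz (z l) (A l) \<omega>) \<le> 1"
   by (auto intro!: prod_nonneg prod_le_1)
  have 2: "0 \<le> (\<Prod>l\<in>I. of_bool (ev (A l) (m l) \<omega>) :: real)" "(\<Prod>l\<in>I. of_bool (ev (A l) (m l) \<omega>) :: real) \<le> 1"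
   by (auto intro!: prod_nonneg prod_le_1)
  show "0 \<le> W \<omega>" "W \<omega> \<le> 1" unfolding W_def using 1 2 by (auto intro: mult_le_one)
 qed
 define q where "q k = (\<integral>\<omega>. W \<omega> * of_bool (ev (A j) k \<omega>) \<partial>OM)" for k
 have em [measurable]: "(%\<omega>. of_bool (ev (A j) k \<omega>) :: real) \<in> borel_measurable OM" for k
  unfolding of_bool_def using A[OF j(1)] by measurable
 have iW: "integrable OM (%\<omega>. W \<omega> * of_bool (ev (A j) k \<omega>))" for k
  using Wb by (intro O.integrable_const_bound[of _ 1] AE_I2) auto
 have q1: "q k \<le> 1" "0 \<le> q k" for k
 proof -
  have "q k \<le> (\<integral>\<omega>. 1 \<partial>OM)" unfolding q_def using Wb iW by (intro integral_mono) auto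
  then show "q k \<le> 1" using O.prob_space by simp
  show "0 \<le> q k" unfolding q_def using Wb by (intro Bochner_Integration.integral_nonneg) simp
 qed
 have "q k = C * poisson_prob la k" for k
 proof (rule powser_unique[where a = q and b = "%k. C * poisson_prob la k" and s = "%t. C * exp (- \<gamma> * (1 - t) * area (A j))"])
  fix t :: real assume t: "0 \<le> t" "t < 1"
  have eqp: "(\<Prod>l\<in>J - I. f l ((z(j := t)) l)) = f j t * (\<Prod>l\<in>J - insert j I. f l (z l))" for f :: "nat => real => real"
  proof -
   have "(\<Prod>l\<in>J - insert j I. f l ((z(j := t)) l)) = (\<Prod>l\<in>J - insert j I. f l (z l))" by (intro prod.cong) auto
   then show ?thesis unfolding JI(1) using JI(2,3) by simp
  qed
  have "(\<integral>\<omega>. (\<Prod>l\<in>I. of_bool (ev (A l) (m l) \<omega>)) * (\<Prod>l\<in>J - I. Lz ((z(j := t)) l) (A l) \<omega>) \<partial>OM)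
    = (\<Prod>l\<in>I. poisson_prob (\<gamma> * area (A l)) (m l)) * (\<Prod>l\<in>J - I. exp (- \<gamma> * (1 - (z(j := t)) l) * area (A l)))"
   by (rule insert.IH) (use insert.prems t j in auto)
  then have int: "(\<integral>\<omega>. W \<omega> * Lz t (A j) \<omega> \<partial>OM) = C * exp (- \<gamma> * (1 - t) * area (A j))"
   unfolding eqp[of "%l x. Lz x (A l) _"] eqp[of "%l x. exp (- \<gamma> * (1 - x) * area (A l))"] W_def C_def by (simp only: mult_ac)
  have nb: "norm (t ^ k * (W \<omega> * of_bool (ev (A j) k \<omega>))) \<le> t ^ k" for k \<omega>
   using Wb[of \<omega>] t by (cases "ev (A j) k \<omega>") (auto simp: abs_mult mult_left_le)
  have gs: "summable (%k. t ^ k)" using t by (simp add: summable_geometric)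
  have "(%k. \<integral>\<omega>. t ^ k * (W \<omega> * of_bool (ev (A j) k \<omega>)) \<partial>OM) sums (\<integral>\<omega>. (\<Sum>k. t ^ k * (W \<omega> * of_bool (ev (A j) k \<omega>))) \<partial>OM)"
  proof (rule sums_integral)
   show "integrable OM (%\<omega>. t ^ k * (W \<omega> * of_bool (ev (A j) k \<omega>)))" for k using iW by simp
   show "AE \<omega> in OM. summable (%k. norm (t ^ k * (W \<omega> * of_bool (ev (A j) k \<omega>))))"
    using nb by (intro AE_I2 summable_comparison_test'[OF gs, of 0]) auto
   show "summable (%k. \<integral>\<omega>. norm (t ^ k * (W \<omega> * of_bool (ev (A j) k \<omega>))) \<partial>OM)"
   proof (rule summable_comparison_test'[OF gs, of 0])
    fix k
    have "norm (\<integral>\<omega>. norm (t ^ k * (W \<omega> * of_bool (ev (A j) k \<omega>))) \<partial>OM) = (\<integral>\<omega>. norm (t ^ k * (W \<omega> * of_bool (ev (A j) k \<omega>))) \<partial>OM)"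
     by simp
    also have "... \<le> (\<integral>\<omega>. t ^ k \<partial>OM)" using iW nb by (intro integral_mono integrable_norm) auto
    finally show "norm (\<integral>\<omega>. norm (t ^ k * (W \<omega> * of_bool (ev (A j) k \<omega>))) \<partial>OM) \<le> t ^ k" using O.prob_space by simp
   qed
  qed
  moreover have "(\<Sum>k. t ^ k * (W \<omega> * of_bool (ev (A j) k \<omega>))) = W \<omega> * Lz t (A j) \<omega>" for \<omega>
   using sums_unique[OF sums_mult[OF Lz_sums[of t "A j" \<omega>], of "W \<omega>"]] by (simp add: mult_ac)
  ultimately show "(%k. q k * t ^ k) sums (C * exp (- \<gamma> * (1 - t) * area (A j)))"
   unfolding q_def int[symmetric] using iW by (simp add: mult.commute)
  have "(%n. (la * t) ^ n / fact n) sums exp (la * t)"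
   using exp_converges[of "la * t"] by (simp add: scaleR_conv_of_real divide_inverse mult.commute)
  then have "(%k. (C * exp (- la)) * ((la * t) ^ k / fact k)) sums ((C * exp (- la)) * exp (la * t))" by (rule sums_mult)
  moreover have "(C * exp (- la)) * exp (la * t) = C * exp (- \<gamma> * (1 - t) * area (A j))"
   by (simp add: exp_add[symmetric] mult.assoc) (simp add: la_def algebra_simps)
  moreover have "(%k. C * poisson_prob la k * t ^ k) = (%k. (C * exp (- la)) * ((la * t) ^ k / fact k))"
   by (intro ext) (simp add: poisson_prob_def power_mult_distrib mult_ac)
  ultimately show "(%k. C * poisson_prob la k * t ^ k) sums (C * exp (- \<gamma> * (1 - t) * area (A j)))" by (simp only:)
 qed
 then have "(\<integral>\<omega>. W \<omega> * of_bool (ev (A j) (m j) \<omega>) \<partial>OM) = C * poisson_prob la (m j)" by (simp add: q_def)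
 then show ?case using insert.hyps unfolding W_def C_def la_def by (simp add: mult_ac)
qed

lemma prob_ev:
 "measure OM {\<omega> \<in> space OM. \<forall>l\<in>J. ev (A l) (m l) \<omega>} = (\<Prod>l\<in>J. poisson_prob (\<gamma> * area (A l)) (m l))"
proof -
 have [measurable]: "Measurable.pred OM (ev (A l) k)" if "l \<in> J" for l k using A[OF that] by measurable
 have "(\<integral>\<omega>. (\<Prod>l\<in>J. of_bool (ev (A l) (m l) \<omega>)) \<partial>OM) = (\<Prod>l\<in>J. poisson_prob (\<gamma> * area (A l)) (m l))"
  using pgf_mixed[of J "%_. 0" m] by simp
 moreover have "(\<Prod>l\<in>J. of_bool (ev (A l) (m l) \<omega>)) = (of_bool (\<forall>l\<in>J. ev (A l) (m l) \<omega>) :: real)" for \<omega>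
  using J by (induction J rule: finite_induct) auto
 ultimately have i: "(\<integral>\<omega>. of_bool (\<forall>l\<in>J. ev (A l) (m l) \<omega>) \<partial>OM) = (\<Prod>l\<in>J. poisson_prob (\<gamma> * area (A l)) (m l))" by simp
 have "Measurable.pred OM (%\<omega>. \<forall>l\<in>J. ev (A l) (m l) \<omega>)" using J by (intro pred_intros_finite) auto
 then have "integrable OM (%\<omega>. of_bool (\<forall>l\<in>J. ev (A l) (m l) \<omega>) :: real)"
  unfolding of_bool_def by (intro O.integrable_const_bound[of _ 1] AE_I2) auto
 from indicator_eq_combination(2)[OF this] show ?thesis using i by simp
qed

end

end

section \<open>The Poisson process as a law on sets of marked points\<close>

context pconstr
begin

text \<open>Samples whose positions stay in their squares and are distinct within each square. As
  the squares are disjoint, no element of \<open>pts\<close> is then produced twice.\<close>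

definition good :: "(nat => nat \<times> (nat => pt)) => bool" where
 "good \<omega> \<longleftrightarrow> (\<forall>c. (\<forall>i. snd (\<omega> c) i \<in> cell c) \<and> (\<forall>i j. i ~= j --> snd (\<omega> c) i ~= snd (\<omega> c) j))"

lemma AE_good: "AE \<omega> in OM. good \<omega>"
proof -
 interpret S: prob_space "PiM UNIV (%_ :: nat. unif c)" for c by (rule prob_seq)
 interpret PP: pair_sigma_finite "measure_pmf (poisson_pmf \<gamma>)" "PiM UNIV (%_ :: nat. unif c)" for c ..
 have m1: "Measurable.pred (D c) (%w. snd w i \<in> cell c)" for c i
  using measurable_compose[OF meas_point[of i c], of "%x. x \<in> cell c" "count_space UNIV"] cell_area(1)[of c] by simp
 have m2: "Measurable.pred (D c) (%w. snd w i ~= snd w j)" for c i j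
 proof -
  note [measurable] = meas_point[of _ c]
  show ?thesis by measurable
 qed
 have 1: "AE w in D c. snd w i \<in> cell c" for c i unfolding D_def
 proof (rule PP.AE_pair_measure)
  show "{w \<in> space (measure_pmf (poisson_pmf \<gamma>) \<Otimes>\<^sub>M PiM UNIV (%_ :: nat. unif c)). snd w i \<in> cell c}
    \<in> sets (measure_pmf (poisson_pmf \<gamma>) \<Otimes>\<^sub>M PiM UNIV (%_ :: nat. unif c))"
   using m1 unfolding D_def pred_def .
  have "AE x in PiM UNIV (%_ :: nat. unif c). x i \<in> cell c"
   by (rule AE_PiM_component[where P = "%x. x \<in> cell c"]) (simp_all add: unif_basic)
  then show "AE n in measure_pmf (poisson_pmf \<gamma>). AE x in PiM UNIV (%_ :: nat. unif c). snd (n, x) i \<in> cell c" by simp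
 qed
 have 2: "AE w in D c. snd w i ~= snd w j" if ij: "i ~= j" for c i j unfolding D_def
 proof (rule PP.AE_pair_measure)
  show "{w \<in> space (measure_pmf (poisson_pmf \<gamma>) \<Otimes>\<^sub>M PiM UNIV (%_ :: nat. unif c)). snd w i ~= snd w j}
    \<in> sets (measure_pmf (poisson_pmf \<gamma>) \<Otimes>\<^sub>M PiM UNIV (%_ :: nat. unif c))"
   using m2 unfolding D_def pred_def .
  show "AE n in measure_pmf (poisson_pmf \<gamma>). AE x in PiM UNIV (%_ :: nat. unif c). snd (n, x) i ~= snd (n, x) j"
   using unif_no_ties[OF ij] by simp
 qed
 have "AE w in D c. (\<forall>i. snd w i \<in> cell c) \<and> (\<forall>i j. i ~= j --> snd w i ~= snd w j)" for c
  using 1 2 by (auto simp: AE_all_countable)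
 then have "AE \<omega> in OM. (\<forall>i. snd (\<omega> c) i \<in> cell c) \<and> (\<forall>i j. i ~= j --> snd (\<omega> c) i ~= snd (\<omega> c) j)" for c
  unfolding OM_def using prob_D
  by (intro AE_PiM_component[where P = "%w. (\<forall>i. snd w i \<in> cell c) \<and> (\<forall>i j. i ~= j --> snd w i ~= snd w j)"]) auto
 then show ?thesis unfolding good_def by (simp add: AE_all_countable)
qed

definition pts :: "pt set => (nat => nat \<times> (nat => pt)) => (pt \<times> pt set) set" where
 "pts K \<omega> = {(snd (\<omega> c) i, K) | c i. i < fst (\<omega> c)}"

text \<open>Finiteness has to be part of the equivalence: if infinitely many points fall into
  \<open>B\<close>, no \<open>ev\<close> holds, while \<open>card\<close> would be 0.\<close>

lemma card_pts:
 assumes g: "good \<omega>"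
 shows "finite (pts K \<omega> \<inter> B) \<and> card (pts K \<omega> \<inter> B) = m \<longleftrightarrow> ev {x. (x, K) \<in> B} m \<omega>"
proof -
 let ?A = "{x. (x, K) \<in> B}"
 define S where "S n = (SIGMA c:{..<n::nat}. {i. i < fst (\<omega> c) \<and> snd (\<omega> c) i \<in> ?A})" for n
 define T where "T = (\<Union>n. S n)"
 have fS: "finite (S n)" for n unfolding S_def by (intro finite_SigmaI) auto
 have cS: "card (S n) = cnt n ?A \<omega>" for n unfolding S_def cnt_def by (intro card_SigmaI) auto
 have mono: "S n \<subseteq> S n'" if "n \<le> n'" for n n' unfolding S_def using that by auto
 have T: "T = {p. snd p < fst (\<omega> (fst p)) \<and> snd (\<omega> (fst p)) (snd p) \<in> ?A}" unfolding T_def S_def by auto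
 define f where "f p = (snd (\<omega> (fst p)) (snd p), K)" for p :: "nat \<times> nat"
 have "inj f"
 proof (rule injI)
  fix p q assume "f p = f q"
  then have e: "snd (\<omega> (fst p)) (snd p) = snd (\<omega> (fst q)) (snd q)" by (simp add: f_def)
  have "fst p = fst q"
  proof (rule ccontr)
   assume "fst p ~= fst q"
   then have "cell (fst p) \<inter> cell (fst q) = {}" using cell_disjoint by (auto simp: disjoint_family_on_def)
   moreover have "snd (\<omega> (fst p)) (snd p) \<in> cell (fst p)" "snd (\<omega> (fst q)) (snd q) \<in> cell (fst q)" using g by (auto simp: good_def)
   ultimately show False using e by auto
  qed
  moreover have "snd p = snd q" using e g unfolding good_def \<open>fst p = fst q\<close> by metis
  ultimately show "p = q" by (simp add: prod_eq_iff)
 qed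
 then have inj: "inj_on f T" by (rule inj_on_subset) simp
 have im: "pts K \<omega> \<inter> B = f ` T" 
 proof (intro equalityI subsetI)
  fix y assume y: "y \<in> pts K \<omega> \<inter> B"
  then obtain c i where ci: "i < fst (\<omega> c)" "y = (snd (\<omega> c) i, K)" unfolding pts_def by blast
  then have "(c, i) \<in> T" "y = f (c, i)" using y by (auto simp: T f_def)
  then show "y \<in> f ` T" by blast
 next
  fix y assume "y \<in> f ` T"
  then obtain p where "p \<in> T" "y = f p" by blast
  then show "y \<in> pts K \<omega> \<inter> B" unfolding T f_def pts_def by blast
 qed
 have "finite T \<and> card T = m \<longleftrightarrow> ev ?A m \<omega>"
 proof
  assume t: "finite T \<and> card T = m"
  have "\<forall>p\<in>T. \<exists>n. p \<in> S n" by (auto simp: T_def)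
  then obtain n where n: "\<And>p. p \<in> T ==> p \<in> S (n p)" by metis
  \<comment> \<open>A stage at which all of the finitely many elements of \<open>T\<close> have
    appeared.\<close>
  define N where "N = Max (insert 0 (n ` T))"
  have "S k = T" if "k \<ge> N" for k
  proof
   show "S k \<subseteq> T" unfolding T_def by blast
   show "T \<subseteq> S k"
   proof
    fix p assume p: "p \<in> T"
    then have "n p \<le> N" unfolding N_def using t by (intro Max_ge) auto
    then show "p \<in> S k" using n[OF p] mono[of "n p" k] that by auto
   qed
  qed
  then show "ev ?A m \<omega>" unfolding ev_def eventually_sequentially cS[symmetric] using t by (intro exI[of _ N]) simp
 next
  assume "ev ?A m \<omega>"
  then obtain N where N: "\<And>n. n \<ge> N ==> card (S n) = m" unfolding ev_def eventually_sequentially cS by blast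
  have "S n \<subseteq> S N" for n
  proof (cases "n \<le> N")
   case True then show ?thesis by (rule mono)
  next
   case False
   then have "S N = S n" using N[of n] N[of N] by (intro card_subset_eq fS mono) auto
   then show ?thesis by simp
  qed
  then have "T = S N" unfolding T_def by blast
  then show "finite T \<and> card T = m" using fS N by simp
 qed
 then show ?thesis unfolding im using inj by (simp add: finite_image_iff card_image)
qed

end

text \<open>Joint independence from product formulas for singletons: sets of naturals are generated by the
 intersection-stable class of singletons, the empty set and the whole space.\<close>

lemma (in prob_space) indep_vars_natI:
 fixes X :: "'i => 'a => nat" and I :: "'i set"
 assumes I: "finite I" and rv: "\<And>i. i \<in> I ==> X i \<in> measurable M (count_space UNIV)"
  and joint: "\<And>J m. J \<subseteq> I ==> prob {w \<in> space M. \<forall>i\<in>J. X i w = m i} = (\<Prod>i\<in>J. prob {w \<in> space M. X i w = m i})"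
 shows "indep_vars (%_. count_space UNIV) X I"
proof (cases "I = {}")
 case True
 then show ?thesis by (simp add: indep_vars_def2 indep_sets_def)
next
 case False
 define E where "E = insert UNIV (insert {} (range (%n::nat. {n})))"
 have gen: "UNIV = sigma_sets UNIV E"
 proof -
  have "S \<in> sigma_sets UNIV E" for S :: "nat set"
  proof -
   have "(\<Union>n. if n \<in> S then {n} else {}) \<in> sigma_sets UNIV E"
    by (intro sigma_sets.Union) (auto simp: E_def intro: sigma_sets.Basic sigma_sets.Empty)
   moreover have "(\<Union>n. if n \<in> S then {n} else {}) = S" by auto
   ultimately show ?thesis by simp
  qed
  then show ?thesis by blast
 qed
 have "indep_vars (%_. count_space UNIV) X I \<longleftrightarrow>
  (\<forall>A\<in>(\<Pi> i\<in>I. E). prob (\<Inter>j\<in>I. X j -` A j \<inter> space M) = (\<Prod>j\<in>I. prob (X j -` A j \<inter> space M)))"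
  using False I gen rv by (intro indep_vars_finite) (auto simp: Int_stable_def E_def)
 moreover have "prob (\<Inter>j\<in>I. X j -` A j \<inter> space M) = (\<Prod>j\<in>I. prob (X j -` A j \<inter> space M))" if A: "A \<in> (\<Pi> i\<in>I. E)" for A
 proof (cases "\<exists>j\<in>I. A j = {}")
  case True
  then have "(\<Inter>j\<in>I. X j -` A j \<inter> space M) = {}" by auto
  moreover have "(\<Prod>j\<in>I. prob (X j -` A j \<inter> space M)) = 0"
  proof -
   from True obtain j where j: "j \<in> I" "A j = {}" by blast
   then have "prob (X j -` A j \<inter> space M) = 0" by simp
   with I j(1) show ?thesis by (intro prod_zero) blast+
  qed
  ultimately show ?thesis by simp
 next
  case nempty: False
  \<comment> \<open>The indices with a genuine constraint; all others contribute the whole space and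
    the factor 1.\<close>
  define J where "J = {j \<in> I. A j ~= UNIV}"
  define m where "m j = the_elem (A j)" for j
  have Aj: "A j = {m j}" if "j \<in> J" for j
  proof -
   have "A j \<in> E" "A j ~= UNIV" "A j ~= {}" using A that nempty by (auto simp: J_def)
   then obtain n where "A j = {n}" unfolding E_def by blast
   then show ?thesis by (simp add: m_def)
  qed
  have Au: "A j = UNIV" if "j \<in> I - J" for j using that by (auto simp: J_def)
  have J: "J \<subseteq> I" by (auto simp: J_def)
  have v: "X j -` A j \<inter> space M = {w \<in> space M. X j w = m j}" if "j \<in> J" for j using Aj[OF that] by auto
  have mem: "w \<in> X j -` A j \<inter> space M \<longleftrightarrow> w \<in> space M \<and> (j \<in> J --> X j w = m j)" if "j \<in> I" for w j
   using Aj[of j] Au[of j] that by (cases "j \<in> J") auto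
  have "(\<Inter>j\<in>I. X j -` A j \<inter> space M) = {w \<in> space M. \<forall>j\<in>J. X j w = m j}"
  proof (rule set_eqI)
   fix w
   have "w \<in> (\<Inter>j\<in>I. X j -` A j \<inter> space M) \<longleftrightarrow> (\<forall>j\<in>I. w \<in> space M \<and> (j \<in> J --> X j w = m j))"
    unfolding INT_iff using mem by blast
   also have "... \<longleftrightarrow> w \<in> {w \<in> space M. \<forall>j\<in>J. X j w = m j}" using False J by blast
   finally show "w \<in> (\<Inter>j\<in>I. X j -` A j \<inter> space M) \<longleftrightarrow> w \<in> {w \<in> space M. \<forall>j\<in>J. X j w = m j}" .
  qed
  moreover have "(\<Prod>j\<in>I. prob (X j -` A j \<inter> space M)) = (\<Prod>j\<in>J. prob {w \<in> space M. X j w = m j})"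
  proof -
   have "(\<Prod>j\<in>I. prob (X j -` A j \<inter> space M)) = (\<Prod>j\<in>J. prob (X j -` A j \<inter> space M))"
    using I J Au prob_space by (intro prod.mono_neutral_right) auto
   then show ?thesis using v by simp
  qed
  ultimately show ?thesis using joint[OF J] by simp
 qed
 ultimately show ?thesis by blast
qed

text \<open>With a deterministic grain only the section of \<open>B\<close> at \<open>K\<close>
  carries mass, which reduces marked points to points of the plane.\<close>

lemma return_section:
 assumes K: "K \<in> KC" and B: "B \<in> sets (lborel \<Otimes>\<^sub>M return grain_space K)"
 shows "{x. (x, K) \<in> B} \<in> sets borel" "emeasure (lborel \<Otimes>\<^sub>M return grain_space K) B = emeasure lborel {x. (x, K) \<in> B}"
proof -
 interpret R: prob_space "return grain_space K" using K by (intro prob_space_return) simp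
 interpret pair_sigma_finite lborel "return grain_space K" ..
 have v: "(%x. (x, K)) -` B = {x. (x, K) \<in> B}" by auto
 show "{x. (x, K) \<in> B} \<in> sets borel" using sets_Pair2[OF B, of K] unfolding v by simp
 have m: "(%y. emeasure lborel ((%x. (x, y)) -` B)) \<in> borel_measurable grain_space"
  using measurable_emeasure_Pair2[OF B] by (simp cong: measurable_cong_sets)
 have "emeasure (lborel \<Otimes>\<^sub>M return grain_space K) B = (\<integral>\<^sup>+y. emeasure lborel ((%x. (x, y)) -` B) \<partial>return grain_space K)"
  by (rule emeasure_pair_measure_alt2[OF B])
 also have "... = emeasure lborel {x. (x, K) \<in> B}" using K m by (subst nn_integral_return) (auto simp: v)
 finally show "emeasure (lborel \<Otimes>\<^sub>M return grain_space K) B = emeasure lborel {x. (x, K) \<in> B}" .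
qed

lemma poisson_process_exists:
 assumes K: "K \<in> KC" and \<gamma>: "\<gamma> > 0"
 shows "\<exists>P. bm_law \<gamma> (return grain_space K) P"
proof -
 interpret pconstr \<gamma> using \<gamma> by unfold_locales
 let ?Q = "return grain_space K"
 obtain N where N: "N \<in> null_sets OM" "\<And>\<omega>. \<omega> \<in> space OM - N ==> good \<omega>" using AE_E3[OF AE_good] by metis
 \<comment> \<open>Samples in the null set \<open>N\<close> are sent to the empty configuration, as
   the description of the counts is available for good samples only.\<close>
 define F where "F \<omega> = (if \<omega> \<in> N then {} else pts K \<omega>)" for \<omega>
 define sp where "sp = {\<phi> :: (pt \<times> pt set) set. \<phi> \<subseteq> UNIV \<times> KC}"
 \<comment> \<open>All sets with measurable preimage under \<open>F\<close>. With this choice every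
   count event becomes measurable by transport from the samples.\<close>
 define G where "G = {E. E \<subseteq> sp \<and> F -` E \<inter> space OM \<in> sets OM}"
 define M' where "M' = sigma sp G"
 have Gsp: "G \<subseteq> Pow sp" by (auto simp: G_def)
 have F: "F \<in> space OM \<rightarrow> sp" using K by (auto simp: F_def sp_def pts_def split: if_splits)
 have Fm: "F \<in> measurable OM M'" unfolding M'_def by (rule measurable_measure_of[OF Gsp F]) (simp add: G_def)
 define P where "P = distr OM M' F"
 have spP: "space P = sp" unfolding P_def M'_def using Gsp by simp
 have PP: "prob_space P" unfolding P_def by (rule O.prob_space_distr[OF Fm])
 interpret P: prob_space P by (rule PP)
 have setsG: "E \<in> sets P" if "E \<in> G" for E unfolding P_def M'_def using that Gsp by (simp add: sigma_sets.Basic)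
 have measG: "measure P E = measure OM (F -` E \<inter> space OM)" if "E \<in> G" for E
  using setsG[OF that] unfolding P_def by (intro measure_distr Fm) simp
 let ?A = "%B. {x. (x, K) \<in> B}"
 let ?fc = "%B m. {\<phi> \<in> space P. finite (\<phi> \<inter> B) \<and> card (\<phi> \<inter> B) = m}"
 have joint: "{\<phi> \<in> space P. \<forall>l\<in>J. finite (\<phi> \<inter> B l) \<and> card (\<phi> \<inter> B l) = m l} \<in> sets P"
  "measure P {\<phi> \<in> space P. \<forall>l\<in>J. finite (\<phi> \<inter> B l) \<and> card (\<phi> \<inter> B l) = m l} = (\<Prod>l\<in>J. poisson_prob (\<gamma> * measure (lborel \<Otimes>\<^sub>M ?Q) (B l)) (m l))"
  if J: "finite (J :: nat set)" and B: "\<And>l. l \<in> J ==> B l \<in> sets (lborel \<Otimes>\<^sub>M ?Q)" "\<And>l. l \<in> J ==> emeasure (lborel \<Otimes>\<^sub>M ?Q) (B l) < \<infinity>"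
   and dj: "disjoint_family_on B J" for J B m
 proof -
  let ?E = "{\<phi> \<in> space P. \<forall>l\<in>J. finite (\<phi> \<inter> B l) \<and> card (\<phi> \<inter> B l) = m l}"
  let ?H = "{\<omega> \<in> space OM. \<forall>l\<in>J. ev (?A (B l)) (m l) \<omega>}"
  have Ab: "?A (B l) \<in> sets borel" if "l \<in> J" for l using return_section(1)[OF K B(1)[OF that]] .
  have Af: "emeasure lborel (?A (B l)) < \<infinity>" if "l \<in> J" for l
   using return_section(2)[OF K B(1)[OF that]] B(2)[OF that] by simp
  have Ad: "disjoint_family_on (%l. ?A (B l)) J" using dj unfolding disjoint_family_on_def by blast
  have Hs: "?H \<in> sets OM"
  proof -
   have "{\<omega> \<in> space OM. ev (?A (B l)) (m l) \<omega>} \<in> sets OM" if "l \<in> J" for l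
    using meas_ev[OF Ab[OF that]] by (simp add: pred_def)
   then show ?thesis using J by (intro sets.sets_Collect_finite_All) auto
  qed
  have Ns: "N \<in> sets OM" using N(1) by auto
  \<comment> \<open>On \<open>N\<close> the configuration is empty, so it meets the requirement
    exactly when all prescribed counts are 0.\<close>
  define c where "c \<longleftrightarrow> (\<forall>l\<in>J. m l = 0)"
  have pre: "F -` ?E \<inter> space OM = (?H - N) \<union> (if c then N else {})"
  proof (intro set_eqI)
   fix \<omega>
   show "\<omega> \<in> F -` ?E \<inter> space OM \<longleftrightarrow> \<omega> \<in> (?H - N) \<union> (if c then N else {})"
   proof (cases "\<omega> \<in> N")
    case True
    then have s: "\<omega> \<in> space OM" using sets.sets_into_space[OF Ns] by blast
    have "{} \<in> space P" by (simp add: spP sp_def)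
    then have "F \<omega> \<in> ?E \<longleftrightarrow> c" using True by (auto simp: F_def c_def)
    then show ?thesis using True s by (simp split: if_splits)
   next
    case False
    show ?thesis
    proof (cases "\<omega> \<in> space OM")
     case True
     have "F \<omega> = pts K \<omega>" using False by (simp add: F_def)
     moreover have "F \<omega> \<in> space P" using F True by (auto simp: spP)
     ultimately have "F \<omega> \<in> ?E \<longleftrightarrow> (\<forall>l\<in>J. ev (?A (B l)) (m l) \<omega>)"
      using card_pts[OF N(2), of \<omega> K] True False by simp
     then show ?thesis using True False by (simp split: if_splits)
    next
     case False
     then show ?thesis using sets.sets_into_space[OF Ns] by auto
    qed
   qed
  qed
  have EG: "?E \<in> G" unfolding G_def using pre Hs Ns by (auto simp: spP)
  show "?E \<in> sets P" by (rule setsG[OF EG])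
  have "measure P ?E = measure OM ((?H - N) \<union> (if c then N else {}))" unfolding measG[OF EG] pre ..
  also have "... = measure OM ?H"
  proof (rule O.finite_measure_eq_AE)
   have "AE \<omega> in OM. \<omega> \<notin> N" using N(1) by (rule AE_not_in)
   then show "AE \<omega> in OM. \<omega> \<in> (?H - N) \<union> (if c then N else {}) \<longleftrightarrow> \<omega> \<in> ?H" by eventually_elim auto
  qed (use Hs Ns in auto)
  also have "... = (\<Prod>l\<in>J. poisson_prob (\<gamma> * area (?A (B l))) (m l))" using J Ab Af Ad by (rule prob_ev)
  also have "... = (\<Prod>l\<in>J. poisson_prob (\<gamma> * measure (lborel \<Otimes>\<^sub>M ?Q) (B l)) (m l))"
   using return_section(2)[OF K B(1)] by (simp add: measure_def cong: prod.cong)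
  finally show "measure P ?E = (\<Prod>l\<in>J. poisson_prob (\<gamma> * measure (lborel \<Otimes>\<^sub>M ?Q) (B l)) (m l))" .
 qed
 have single: "?fc B n \<in> sets P" "measure P (?fc B n) = poisson_prob (\<gamma> * measure (lborel \<Otimes>\<^sub>M ?Q) B) n"
  if B: "B \<in> sets (lborel \<Otimes>\<^sub>M ?Q)" "emeasure (lborel \<Otimes>\<^sub>M ?Q) B < \<infinity>" for B n
  using joint[of "{0}" "%_. B" "%_. n"] B by (simp_all add: disjoint_family_on_def)
 have AEfin: "AE \<phi> in P. finite (\<phi> \<inter> B)"
  if B: "B \<in> sets (lborel \<Otimes>\<^sub>M ?Q)" "emeasure (lborel \<Otimes>\<^sub>M ?Q) B < \<infinity>" for B
 proof -
  have "(%n. measure P (?fc B n)) sums measure P (\<Union>n. ?fc B n)"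
   using single[OF B] by (intro P.finite_measure_UNION) (auto simp: disjoint_family_on_def)
  then have "(%n. poisson_prob (\<gamma> * measure (lborel \<Otimes>\<^sub>M ?Q) B) n) sums measure P (\<Union>n. ?fc B n)"
   using single(2)[OF B] by simp
  then have "measure P (\<Union>n. ?fc B n) = 1" using poisson_sums sums_unique2 by blast
  moreover have "(\<Union>n. ?fc B n) \<in> sets P" using single(1)[OF B] by (intro sets.countable_UN) auto
  ultimately have "AE \<phi> in P. \<phi> \<in> (\<Union>n. ?fc B n)" using P.AE_in_set_eq_1 by blast
  then show ?thesis by eventually_elim auto
 qed
 have indep: "P.indep_vars (%_. count_space UNIV) (%i \<phi>. card (\<phi> \<inter> B i)) {..<k}"
  if B: "\<And>i. i < k ==> B i \<in> sets (lborel \<Otimes>\<^sub>M ?Q)" "\<And>i. i < k ==> emeasure (lborel \<Otimes>\<^sub>M ?Q) (B i) < \<infinity>"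
   and dj: "disjoint_family_on B {..<k}" for B and k :: nat
 proof (rule P.indep_vars_natI)
  have cm: "(%\<phi>. card (\<phi> \<inter> B i)) \<in> measurable P (count_space UNIV)" if "i < k" for i
   using single(1)[OF B[OF that]] by (rule card_Int_measurable)
  then show "(%\<phi>. card (\<phi> \<inter> B i)) \<in> measurable P (count_space UNIV)" if "i \<in> {..<k}" for i using that by simp
  fix J m assume J: "J \<subseteq> {..<k}"
  have fJ: "finite J" using J finite_subset by blast
  have Bj: "B l \<in> sets (lborel \<Otimes>\<^sub>M ?Q)" "emeasure (lborel \<Otimes>\<^sub>M ?Q) (B l) < \<infinity>" if "l \<in> J" for l using that J B by auto
  have djJ: "disjoint_family_on B J" using dj J unfolding disjoint_family_on_def by blast
  have ce: "{\<phi> \<in> space P. card (\<phi> \<inter> B l) = m l} \<in> sets P" if "l \<in> J" for l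
   using measurable_sets[OF cm, of l "{m l}"] that J by (auto simp: vimage_def Int_def conj_commute)
  have aef: "AE \<phi> in P. \<forall>l\<in>J. finite (\<phi> \<inter> B l)" using AEfin[OF Bj] fJ by (simp add: AE_finite_all)
  \<comment> \<open>The events in terms of \<open>card\<close> alone differ from those that include
    finiteness only by null sets, so the joint formula carries over to the counts.\<close>
  have "P.prob {\<phi> \<in> space P. \<forall>l\<in>J. card (\<phi> \<inter> B l) = m l}
    = P.prob {\<phi> \<in> space P. \<forall>l\<in>J. finite (\<phi> \<inter> B l) \<and> card (\<phi> \<inter> B l) = m l}"
  proof (rule P.finite_measure_eq_AE)
   show "AE \<phi> in P. \<phi> \<in> {\<phi> \<in> space P. \<forall>l\<in>J. card (\<phi> \<inter> B l) = m l} \<longleftrightarrow> \<phi> \<in> {\<phi> \<in> space P. \<forall>l\<in>J. finite (\<phi> \<inter> B l) \<and> card (\<phi> \<inter> B l) = m l}"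
    using aef by eventually_elim blast
   show "{\<phi> \<in> space P. \<forall>l\<in>J. card (\<phi> \<inter> B l) = m l} \<in> sets P"
    using ce fJ by (intro sets.sets_Collect_finite_All) auto
   show "{\<phi> \<in> space P. \<forall>l\<in>J. finite (\<phi> \<inter> B l) \<and> card (\<phi> \<inter> B l) = m l} \<in> sets P"
    by (rule joint(1)[OF fJ Bj djJ])
  qed
  also have "... = (\<Prod>l\<in>J. poisson_prob (\<gamma> * measure (lborel \<Otimes>\<^sub>M ?Q) (B l)) (m l))"
   by (rule joint(2)[OF fJ Bj djJ])
  also have "... = (\<Prod>l\<in>J. P.prob {\<phi> \<in> space P. card (\<phi> \<inter> B l) = m l})"
  proof (rule prod.cong[OF refl])
   fix l assume l: "l \<in> J"
   have "P.prob {\<phi> \<in> space P. card (\<phi> \<inter> B l) = m l} = P.prob (?fc (B l) (m l))"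
    using AEfin[OF Bj[OF l]] ce[OF l] single(1)[OF Bj[OF l]] by (intro P.finite_measure_eq_AE) (auto elim: eventually_mono)
   then show "poisson_prob (\<gamma> * measure (lborel \<Otimes>\<^sub>M ?Q) (B l)) (m l) = P.prob {\<phi> \<in> space P. card (\<phi> \<inter> B l) = m l}"
    using single(2)[OF Bj[OF l]] by simp
  qed
  finally show "P.prob {\<phi> \<in> space P. \<forall>l\<in>J. card (\<phi> \<inter> B l) = m l} = (\<Prod>l\<in>J. P.prob {\<phi> \<in> space P. card (\<phi> \<inter> B l) = m l})" .
 qed simp
 have "bm_law \<gamma> ?Q P" unfolding bm_law_def using PP spP single indep by (auto simp: sp_def)
 then show ?thesis by blast
qed

section \<open>The Boolean model with disc grains\<close>

lemma smooth_eps_cball: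
 assumes e: "\<epsilon> > 0" shows "smooth_eps \<epsilon> (cball 0 \<epsilon>)" unfolding smooth_eps_def
proof
 fix x :: pt assume "x \<in> frontier (cball 0 \<epsilon>)"
 then have x: "norm x = \<epsilon>" by (simp add: frontier_cball dist_norm)
 define u where "u = (1 / \<epsilon>) *\<^sub>R x"
 have u: "norm u = 1" using x e by (simp add: u_def)
 have xu: "\<epsilon> *\<^sub>R u = x" using e by (simp add: u_def)
 show "\<exists>u. norm u = 1 \<and> (\<forall>y\<in>cball 0 \<epsilon>. inner (y - x) u \<le> 0) \<and>
   (\<forall>u'. norm u' = 1 \<and> (\<forall>y\<in>cball 0 \<epsilon>. inner (y - x) u' \<le> 0) --> u' = u) \<and> cball (x - \<epsilon> *\<^sub>R u) \<epsilon> \<subseteq> cball 0 \<epsilon>"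
 proof (intro exI[of _ u] conjI ballI allI impI)
  fix y :: pt assume "y \<in> cball 0 \<epsilon>"
  then have "norm y \<le> \<epsilon>" by simp
  have "inner y u \<le> norm y * norm u" by (rule norm_cauchy_schwarz)
  moreover have "inner x u = \<epsilon>" unfolding xu[symmetric] using u by (simp add: power2_norm_eq_inner[symmetric])
  ultimately show "inner (y - x) u \<le> 0" using u \<open>norm y \<le> \<epsilon>\<close> by (simp add: inner_diff_left)
 next
  fix v :: pt assume v: "norm v = 1 \<and> (\<forall>y\<in>cball 0 \<epsilon>. inner (y - x) v \<le> 0)"
  \<comment> \<open>Testing the normal \<open>v\<close> with the boundary point in its own direction
    forces equality in the Cauchy-Schwarz inequality, hence \<open>v = u\<close>.\<close>
  have "\<epsilon> *\<^sub>R v \<in> cball 0 \<epsilon>" using v e by simp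
  then have "inner (\<epsilon> *\<^sub>R v - x) v \<le> 0" using v by blast
  moreover have "inner v v = 1" using v by (simp add: power2_norm_eq_inner[symmetric])
  ultimately have "\<epsilon> \<le> inner x v" by (simp add: inner_diff_left)
  moreover have "inner x v = \<epsilon> * inner u v" unfolding xu[symmetric] by simp
  ultimately have i: "1 \<le> inner u v" using e by simp
  have "inner u u = 1" using u by (simp add: power2_norm_eq_inner[symmetric])
  then have "(norm (v - u))\<^sup>2 = 2 - 2 * inner u v"
   using \<open>inner v v = 1\<close> by (simp add: power2_norm_eq_inner inner_diff inner_commute)
  then have "(norm (v - u))\<^sup>2 \<le> 0" using i by simp
  then show "v = u" by simp
 qed (use u xu in simp_all)
qed

text \<open>\<open>K\<close> is the only body that misses countably many compact sets exhausting the
  complement of \<open>K\<close> and contains a countable dense subset of \<open>K\<close>. This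
  makes it measurable that a point mass is concentrated on its grain.\<close>

lemma singleton_grain:
 assumes K: "K \<in> KC" shows "{K} \<in> sets grain_space"
proof -
 have hit: "{L \<in> KC. L \<inter> C ~= {}} \<in> sets grain_space" if "compact C" for C
 proof -
  have eq: "{L \<in> KC. L \<inter> C ~= {}} = space grain_space - {L \<in> KC. L \<inter> C = {}}" by auto
  show ?thesis unfolding eq by (rule sets.compl_sets[OF sets_grain_basic[OF that]])
 qed
 obtain T where T: "countable T" "T \<subseteq> K" "K \<subseteq> closure T" using separable by metis
 have Tn: "T ~= {}" using T(3) KC_D(3)[OF K] by auto
 have "open (- K)" using compact_imp_closed[OF KC_D(1)[OF K]] by (simp add: open_Compl)
 then obtain D :: "nat => pt set" where D: "\<And>n. compact (D n)" "(\<Union>n. D n) = - K"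
  using open_Union_compact_subsets by metis
 have "{K} = (\<Inter>n. {L \<in> KC. L \<inter> D n = {}}) \<inter> (\<Inter>q\<in>T. {L \<in> KC. L \<inter> {q} ~= {}})"
 proof (intro equalityI subsetI)
  fix L assume "L \<in> {K}"
  moreover have "K \<inter> D n = {}" for n using D(2) by blast
  ultimately show "L \<in> (\<Inter>n. {L \<in> KC. L \<inter> D n = {}}) \<inter> (\<Inter>q\<in>T. {L \<in> KC. L \<inter> {q} ~= {}})"
   using K T(2) by auto
 next
  fix L assume L: "L \<in> (\<Inter>n. {L \<in> KC. L \<inter> D n = {}}) \<inter> (\<Inter>q\<in>T. {L \<in> KC. L \<inter> {q} ~= {}})"
  then have "L \<inter> (\<Union>n. D n) = {}" by blast
  then have "L \<subseteq> K" unfolding D(2) by blast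
  moreover have "T \<subseteq> L" "L \<in> KC" using L by auto
  then have "closure T \<subseteq> L" using KC_D(1) compact_imp_closed closure_minimal by blast
  ultimately show "L \<in> {K}" using T(3) by blast
 qed
 also have "... \<in> sets grain_space"
 proof (intro sets.Int)
  show "(\<Inter>n. {L \<in> KC. L \<inter> D n = {}}) \<in> sets grain_space" using sets_grain_basic[OF D(1)] by (intro sets.countable_INT) auto
  show "(\<Inter>q\<in>T. {L \<in> KC. L \<inter> {q} ~= {}}) \<in> sets grain_space"
  proof (rule sets.countable_INT'[OF T(1) Tn])
   have "{L \<in> KC. L \<inter> {q} ~= {}} \<in> sets grain_space" for q by (rule hit) simp
   then show "(%q. {L \<in> KC. L \<inter> {q} ~= {}}) ` T \<subseteq> sets grain_space" by blast
  qed
 qed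
 finally show ?thesis .
qed

lemma grain_law_ball:
 assumes e: "\<epsilon> > 0" shows "grain_law \<epsilon> (return grain_space (cball 0 \<epsilon>))"
proof -
 let ?K = "cball 0 \<epsilon> :: pt set" and ?Q = "return grain_space (cball 0 \<epsilon>)"
 have K: "?K \<in> KC" using e by (simp add: KC_def)
 interpret R: prob_space ?Q using K by (intro prob_space_return) simp
 have AEK: "AE L in ?Q. L = ?K"
 proof -
  have "AE L in ?Q. L \<in> {?K}" using singleton_grain[OF K] by (subst R.AE_in_set_eq_1) (simp_all add: measure_def)
  then show ?thesis by simp
 qed
 have "distr ?Q ?Q (%L. rot v ` L) = ?Q" for v
 proof -
  have "distr ?Q ?Q (%L. rot v ` L) = distr ?Q grain_space (%L. rot v ` L)" by (rule distr_cong) simp_all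
  also have "... = return grain_space (rot v ` ?K)" using K by (intro distr_return measurable_rot_grain) simp
  also have "rot v ` ?K = ?K" by (rule rot_cball)
  finally show ?thesis .
 qed
 moreover have "integrable ?Q (%L. V j L)" if "j \<le> 2" for j
 proof -
  have "(%L. V j L) \<in> borel_measurable grain_space"
  proof -
   have Vc: "V j L = Vconv j L" if "L \<in> space grain_space" for L using V_convex KC_D that by simp
   have "(%L. V1c L) \<in> borel_measurable grain_space" by (intro rset_V1c rset_grain) (simp add: KC_D)
   moreover have "(%L. area L) \<in> borel_measurable grain_space" by (rule rset_area[OF rset_grain])
   moreover have "(%L. if L = {} then 0 else 1 :: real) \<in> borel_measurable grain_space"
    by (subst measurable_cong[of _ _ "%_. 1"]) (auto simp: KC_D)
   ultimately have "(%L. Vconv j L) \<in> borel_measurable grain_space" unfolding Vconv_def by simp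
   then show ?thesis by (subst measurable_cong[OF Vc])
  qed
  then have m: "(%L. V j L) \<in> borel_measurable ?Q" by (simp cong: measurable_cong_sets)
  have ae: "AE L in ?Q. V j L = V j ?K" using AEK by eventually_elim simp
  show ?thesis using m ae by (subst integrable_cong_AE[of _ _ "%_. V j ?K"]) auto
 qed
 moreover have "AE L in ?Q. smooth_eps \<epsilon> L" using AEK by eventually_elim (simp add: smooth_eps_cball[OF e])
 ultimately show ?thesis unfolding grain_law_def using R.prob_space_axioms by simp
qed

lemma ball_model:
 assumes e: "\<epsilon> > 0" and \<gamma>: "\<gamma> > 0"
 obtains P where "boolean_model \<epsilon> \<gamma> (return grain_space (cball 0 \<epsilon>)) P"
proof -
 have "cball 0 \<epsilon> \<in> KC" using e by (simp add: KC_def)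
 from poisson_process_exists[OF this \<gamma>] obtain P where "bm_law \<gamma> (return grain_space (cball 0 \<epsilon>)) P" ..
 then show thesis using that grain_law_ball[OF e] \<gamma> unfolding boolean_model_def by blast
qed

lemma ball_EV:
 assumes e: "\<epsilon> > 0"
 shows "EV 2 (return grain_space (cball 0 \<epsilon>)) = pi * \<epsilon>\<^sup>2" "EV 1 (return grain_space (cball 0 \<epsilon>)) = pi * \<epsilon>"
proof -
 interpret grains \<epsilon> "return grain_space (cball 0 \<epsilon>)" using e grain_law_ball[OF e] by unfold_locales
 have K: "cball 0 \<epsilon> \<in> space grain_space" using e by (simp add: KC_def)
 have "vv = area (cball 0 \<epsilon>)" unfolding vv_eq using rset_area[OF rset_grain] K by (intro integral_return) auto
 then show "EV 2 (return grain_space (cball 0 \<epsilon>)) = pi * \<epsilon>\<^sup>2" using e by (simp add: vv_def area_cball)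
 have "mm = V1c (cball 0 \<epsilon>)" unfolding mm_eq using K by (intro integral_return rset_V1c rset_grain) (auto simp: KC_D)
 then show "EV 1 (return grain_space (cball 0 \<epsilon>)) = pi * \<epsilon>" using e by (simp add: mm_def V1c_cball)
qed

section \<open>The estimators\<close>

text \<open>The limits follow by dividing the expansion termwise. Conversely, if the divided
  function converges, multiplying back by a power of \<open>a\<close> shows that the undivided one
  tends to 0, so the lower coefficients vanish.\<close>

lemma expansion_facts:
 fixes S :: "real => real"
 assumes S: "(%a. S a - (k0 + k1 * a + k2 * a\<^sup>2)) \<in> O[at_right 0](%a. a ^ 3)"
 shows expansion_limit_1: "k0 = 0 ==> ((%a. a powi (int 1 - 2) * S a) \<longlongrightarrow> k1) (at_right 0)"
  and expansion_exists_1: "((%a. a powi (int 1 - 2) * S a) \<longlongrightarrow> L) (at_right 0) ==> k0 = 0"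
  and expansion_bigo_1: "k0 = 0 ==> (%a. a powi (int 1 - 2) * S a - k1 - a * k2) \<in> O[at_right 0](%a. a\<^sup>2)"
  and expansion_limit_0: "k0 = 0 ==> k1 = 0 ==> ((%a. a powi (int 0 - 2) * S a) \<longlongrightarrow> k2) (at_right 0)"
  and expansion_exists_0: "((%a. a powi (int 0 - 2) * S a) \<longlongrightarrow> L) (at_right 0) ==> k0 = 0 \<and> k1 = 0"
proof -
 define r where "r a = S a - (k0 + k1 * a + k2 * a\<^sup>2)" for a
 obtain C where C: "\<forall>\<^sub>F a in at_right 0. norm (r a) \<le> C * norm (a ^ 3)"
  using S unfolding r_def by (rule landau_o.bigE)
 have pos: "\<forall>\<^sub>F a in at_right 0. a > (0::real)" by (rule eventually_at_right_less)
 have p: "a powi (int 1 - 2) = inverse a" "a powi (int 0 - 2) = inverse (a\<^sup>2)" for a :: real by (simp_all add: power_int_minus)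
 have Cr: "\<forall>\<^sub>F a in at_right 0. \<bar>r a\<bar> \<le> C * a ^ 3" using C pos by eventually_elim simp
 have r1: "\<forall>\<^sub>F a in at_right 0. norm (inverse a * r a) \<le> C * a\<^sup>2"
  using Cr pos by eventually_elim (simp add: abs_mult field_simps power2_eq_square power3_eq_cube)
 have r2: "\<forall>\<^sub>F a in at_right 0. norm (inverse (a\<^sup>2) * r a) \<le> C * a"
  using Cr pos by eventually_elim (simp add: abs_mult field_simps power2_eq_square power3_eq_cube)
 have z: "((%a. C * a ^ 3) \<longlongrightarrow> 0) (at_right 0)" "((%a. C * a\<^sup>2) \<longlongrightarrow> 0) (at_right 0)" "((%a. C * a) \<longlongrightarrow> 0) (at_right (0::real))"
  by (auto intro!: tendsto_eq_intros)
 have t0: "(r \<longlongrightarrow> 0) (at_right 0)" using Lim_null_comparison[OF _ z(1), of r] Cr by simp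
 have t1: "((%a. inverse a * r a) \<longlongrightarrow> 0) (at_right 0)" by (rule Lim_null_comparison[OF r1 z(2)])
 have t2: "((%a. inverse (a\<^sup>2) * r a) \<longlongrightarrow> 0) (at_right 0)" by (rule Lim_null_comparison[OF r2 z(3)])
 have SS: "S a = k0 + k1 * a + k2 * a\<^sup>2 + r a" for a by (simp add: r_def)
 have "((%a. k0 + k1 * a + k2 * a\<^sup>2) \<longlongrightarrow> k0) (at_right 0)" by (auto intro!: tendsto_eq_intros)
 from tendsto_add[OF this t0] have S0: "(S \<longlongrightarrow> k0) (at_right 0)" by (simp add: SS[symmetric])
 have e1: "\<forall>\<^sub>F a in at_right 0. inverse a * S a = k1 + k2 * a + inverse a * r a" if "k0 = 0"
  using pos by eventually_elim (simp add: SS that field_simps power2_eq_square)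
 show lim1: "((%a. a powi (int 1 - 2) * S a) \<longlongrightarrow> k1) (at_right 0)" if k: "k0 = 0"
 proof -
  have "((%a. k1 + k2 * a) \<longlongrightarrow> k1) (at_right 0)" by (auto intro!: tendsto_eq_intros)
  from tendsto_add[OF this t1] show ?thesis unfolding p by (subst tendsto_cong[OF e1[OF k]]) simp
 qed
 show "k0 = 0" if l: "((%a. a powi (int 1 - 2) * S a) \<longlongrightarrow> L) (at_right 0)" for L
 proof -
  have "((%a. a * (inverse a * S a)) \<longlongrightarrow> 0 * L) (at_right 0)"
   using l unfolding p by (intro tendsto_mult tendsto_ident_at)
  moreover have "\<forall>\<^sub>F a in at_right 0. a * (inverse a * S a) = S a" using pos by eventually_elim simp
  ultimately have "(S \<longlongrightarrow> 0 * L) (at_right 0)" by (rule Lim_transform_eventually)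
  from tendsto_unique[OF _ S0 this] show ?thesis by simp
 qed
 show "(%a. a powi (int 1 - 2) * S a - k1 - a * k2) \<in> O[at_right 0](%a. a\<^sup>2)" if k: "k0 = 0" unfolding p
 proof (rule bigoI[of _ C])
  show "\<forall>\<^sub>F a in at_right 0. norm (inverse a * S a - k1 - a * k2) \<le> C * norm (a\<^sup>2)"
   using e1[OF k] r1 by eventually_elim (simp add: algebra_simps)
 qed
 show "((%a. a powi (int 0 - 2) * S a) \<longlongrightarrow> k2) (at_right 0)" if k: "k0 = 0" "k1 = 0"
 proof -
  have e: "\<forall>\<^sub>F a in at_right 0. inverse (a\<^sup>2) * S a = k2 + inverse (a\<^sup>2) * r a"
   using pos by eventually_elim (simp add: SS k field_simps)
  from tendsto_add[OF tendsto_const t2, of k2] show ?thesis unfolding p by (subst tendsto_cong[OF e]) simp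
 qed
 show "k0 = 0 \<and> k1 = 0" if l: "((%a. a powi (int 0 - 2) * S a) \<longlongrightarrow> L) (at_right 0)" for L
 proof
  have "((%a. a\<^sup>2 * (inverse (a\<^sup>2) * S a)) \<longlongrightarrow> 0\<^sup>2 * L) (at_right 0)"
   using l unfolding p by (intro tendsto_mult tendsto_power tendsto_ident_at)
  moreover have "\<forall>\<^sub>F a in at_right 0. a\<^sup>2 * (inverse (a\<^sup>2) * S a) = S a" using pos by eventually_elim simp
  ultimately have "(S \<longlongrightarrow> 0\<^sup>2 * L) (at_right 0)" by (rule Lim_transform_eventually)
  from tendsto_unique[OF _ S0 this] show k: "k0 = 0" by simp
  have "((%a. a * (inverse (a\<^sup>2) * S a)) \<longlongrightarrow> 0 * L) (at_right 0)"
   using l unfolding p by (intro tendsto_mult tendsto_ident_at)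
  moreover have "\<forall>\<^sub>F a in at_right 0. a * (inverse (a\<^sup>2) * S a) = inverse a * S a"
   using pos by eventually_elim (simp add: power2_eq_square)
  ultimately have "((%a. inverse a * S a) \<longlongrightarrow> 0 * L) (at_right 0)" by (rule Lim_transform_eventually)
  from tendsto_unique[OF _ lim1[OF k, unfolded p] this] show "k1 = 0" by simp
 qed
qed

lemma linear_bigo_square:
 fixes k :: real
 assumes "(%a. a * k) \<in> O[at_right 0](%a. a\<^sup>2)" shows "k = 0"
proof -
 obtain C where C: "\<forall>\<^sub>F a in at_right 0. norm (a * k) \<le> C * norm (a\<^sup>2)" using assms by (rule landau_o.bigE)
 have "\<forall>\<^sub>F a in at_right 0. a > (0::real)" by (rule eventually_at_right_less)
 with C have "\<forall>\<^sub>F a in at_right 0. norm k \<le> C * a" by eventually_elim (simp add: abs_mult power2_eq_square)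
 moreover have "((%a. C * a) \<longlongrightarrow> 0) (at_right (0::real))" by (auto intro!: tendsto_eq_intros)
 ultimately have "((%_. k) \<longlongrightarrow> 0) (at_right (0::real))" by (rule Lim_null_comparison)
 then show ?thesis by (simp add: tendsto_const_iff)
qed

text \<open>\<open>k0\<close>, \<open>k1\<close> and \<open>k2\<close> are the coefficients of the
  powers of \<open>a\<close> in the weighted sum of configuration probabilities. In the limit the
  four corners behave like a single point, so \<open>k0\<close> only weighs uncovered against
  covered.\<close>

definition k0 where "k0 \<gamma> Q w = w 1 * exp (- \<gamma> * EV 2 Q) + w 6 * (1 - exp (- \<gamma> * EV 2 Q))"
definition k1 where "k1 \<gamma> Q w = exp (- \<gamma> * EV 2 Q) * (\<gamma> / pi * EV 1 Q) * c3 w"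
definition k2 where "k2 \<gamma> Q w = (c4 w * \<gamma> + c5 w * (\<gamma> / pi * EV 1 Q)\<^sup>2) * exp (- \<gamma> * EV 2 Q)"

lemma model_facts:
 assumes e: "\<epsilon> > 0" and M: "boolean_model \<epsilon> \<gamma> Q P"
 shows "k0 \<gamma> Q w = 0 ==> ((%a. EVhat 1 w P a) \<longlongrightarrow> k1 \<gamma> Q w) (at_right 0)"
  and "((%a. EVhat 1 w P a) \<longlongrightarrow> L) (at_right 0) ==> k0 \<gamma> Q w = 0"
  and "k0 \<gamma> Q w = 0 ==> (%a. EVhat 1 w P a - k1 \<gamma> Q w - a * k2 \<gamma> Q w) \<in> O[at_right 0](%a. a\<^sup>2)"
  and "k0 \<gamma> Q w = 0 ==> k1 \<gamma> Q w = 0 ==> ((%a. EVhat 0 w P a) \<longlongrightarrow> k2 \<gamma> Q w) (at_right 0)"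
  and "((%a. EVhat 0 w P a) \<longlongrightarrow> L) (at_right 0) ==> k0 \<gamma> Q w = 0 \<and> k1 \<gamma> Q w = 0"
  and "barV 1 P = \<gamma> * EV 1 Q * exp (- \<gamma> * EV 2 Q)"
  and "barV 0 P = (\<gamma> - pi * (\<gamma> / pi * EV 1 Q)\<^sup>2) * exp (- \<gamma> * EV 2 Q)"
proof -
 interpret bmodel \<epsilon> Q \<gamma> P using e M unfolding boolean_model_def by unfold_locales auto
 have E: "EVhat i w P a = a powi (int i - 2) * (\<Sum>j = 1..6. w j * pj j a)" for i a unfolding EVhat_def pj_def ..
 have "(%a. (\<Sum>j = 1..6. w j * pj j a) - (k0 \<gamma> Q w + k1 \<gamma> Q w * a + k2 \<gamma> Q w * a\<^sup>2)) \<in> O[at_right 0](%a. a ^ 3)"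
  using sum_expansion[of w] unfolding k0_def k1_def k2_def vv_def mm_def by (simp add: mult_ac)
 note X = expansion_facts[OF this]
 show "k0 \<gamma> Q w = 0 ==> ((%a. EVhat 1 w P a) \<longlongrightarrow> k1 \<gamma> Q w) (at_right 0)" unfolding E by (rule X(1))
 show "((%a. EVhat 1 w P a) \<longlongrightarrow> L) (at_right 0) ==> k0 \<gamma> Q w = 0" unfolding E by (rule X(2))
 show "k0 \<gamma> Q w = 0 ==> (%a. EVhat 1 w P a - k1 \<gamma> Q w - a * k2 \<gamma> Q w) \<in> O[at_right 0](%a. a\<^sup>2)" unfolding E by (rule X(3))
 show "k0 \<gamma> Q w = 0 ==> k1 \<gamma> Q w = 0 ==> ((%a. EVhat 0 w P a) \<longlongrightarrow> k2 \<gamma> Q w) (at_right 0)" unfolding E by (rule X(4))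
 show "((%a. EVhat 0 w P a) \<longlongrightarrow> L) (at_right 0) ==> k0 \<gamma> Q w = 0 \<and> k1 \<gamma> Q w = 0" unfolding E by (rule X(5))
 show "barV 1 P = \<gamma> * EV 1 Q * exp (- \<gamma> * EV 2 Q)" using barV_1 by (simp add: ex0_def vv_def mm_def)
 show "barV 0 P = (\<gamma> - pi * (\<gamma> / pi * EV 1 Q)\<^sup>2) * exp (- \<gamma> * EV 2 Q)" using barV_0 by (simp add: ex0_def vv_def mm_def)
qed

text \<open>The intensities 1 and 2 already separate the linear from the quadratic term.\<close>

lemma two_point_zero:
 fixes c d t :: real
 assumes "t > 0" "\<And>\<gamma>. \<gamma> > 0 ==> c * \<gamma> + d * (\<gamma> * t)\<^sup>2 = 0"
 shows "c = 0 \<and> d = 0"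
proof -
 have "c + d * t\<^sup>2 = 0" "2 * c + 4 * (d * t\<^sup>2) = 0" using assms(2)[of 1] assms(2)[of 2] by (simp_all add: power_mult_distrib)
 then have "c = 0" "d * t\<^sup>2 = 0" by linarith+
 then show ?thesis using assms(1) by simp
qed

theorem theorem5p3:
  fixes \<epsilon> :: real and w1 w0 :: "nat \<Rightarrow> real"
  assumes "\<epsilon> > 0"
  shows
   "((\<forall>\<gamma> Q P. boolean_model \<epsilon> \<gamma> Q P \<longrightarrow>
        (\<exists>L. ((\<lambda>a. EVhat 1 w1 P a) \<longlongrightarrow> L) (at_right 0)))
      \<longleftrightarrow> w1 1 = 0 \<and> w1 6 = 0)
  \<and> (w1 1 = 0 \<and> w1 6 = 0 \<longrightarrow>
       (\<forall>\<gamma> Q P. boolean_model \<epsilon> \<gamma> Q P \<longrightarrow>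
          ((\<lambda>a. EVhat 1 w1 P a) \<longlongrightarrow> c3 w1 / pi * barV 1 P) (at_right 0))
     \<and> ((\<forall>\<gamma> Q P. boolean_model \<epsilon> \<gamma> Q P \<longrightarrow>
          ((\<lambda>a. EVhat 1 w1 P a) \<longlongrightarrow> barV 1 P) (at_right 0))
        \<longleftrightarrow> c3 w1 = pi))
  \<and> (w1 1 = 0 \<and> w1 6 = 0 \<and> c3 w1 = pi \<longrightarrow>
       (\<forall>\<gamma> Q P. boolean_model \<epsilon> \<gamma> Q P \<longrightarrow>
          (\<lambda>a. EVhat 1 w1 P a - barV 1 P
                - a * (c4 w1 * \<gamma> + c5 w1 * (\<gamma> / pi * EV 1 Q)\<^sup>2) * exp (- \<gamma> * EV 2 Q))
            \<in> O[at_right 0](\<lambda>a. a\<^sup>2))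
     \<and> ((\<forall>\<gamma> Q P. boolean_model \<epsilon> \<gamma> Q P \<longrightarrow>
          (\<lambda>a. EVhat 1 w1 P a - barV 1 P) \<in> O[at_right 0](\<lambda>a. a\<^sup>2))
        \<longleftrightarrow> w1 2 = w1 5 \<and>
            (-5 + 2 * sqrt 2) * w1 2 + (4 - 4 * sqrt 2) * w1 3 + (3 - 2 * sqrt 2) * w1 4
              + (-7 + 6 * sqrt 2) * w1 5 = 0))
  \<and> ((\<forall>\<gamma> Q P. boolean_model \<epsilon> \<gamma> Q P \<longrightarrow>
        (\<exists>L. ((\<lambda>a. EVhat 0 w0 P a) \<longlongrightarrow> L) (at_right 0)))
      \<longleftrightarrow> w0 1 = 0 \<and> w0 6 = 0 \<and>
          (2 - sqrt 2) * w0 2 + (-2 + 2 * sqrt 2) * w0 3 + (2 - sqrt 2) * w0 5 = 0)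
  \<and> (w0 1 = 0 \<and> w0 6 = 0 \<and>
       (2 - sqrt 2) * w0 2 + (-2 + 2 * sqrt 2) * w0 3 + (2 - sqrt 2) * w0 5 = 0 \<longrightarrow>
       (\<forall>\<gamma> Q P. boolean_model \<epsilon> \<gamma> Q P \<longrightarrow>
          ((\<lambda>a. EVhat 0 w0 P a) \<longlongrightarrow>
             (c4 w0 * \<gamma> + c5 w0 * (\<gamma> / pi * EV 1 Q)\<^sup>2) * exp (- \<gamma> * EV 2 Q)) (at_right 0))
     \<and> ((\<forall>\<gamma> Q P. boolean_model \<epsilon> \<gamma> Q P \<longrightarrow>
          ((\<lambda>a. EVhat 0 w0 P a) \<longlongrightarrow> barV 0 P) (at_right 0))
        \<longleftrightarrow> 2 * w0 2 - 2 * w0 5 = 1 \<and>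
            (-5 + 2 * sqrt 2) * w0 2 + (4 - 4 * sqrt 2) * w0 3 + (3 - 2 * sqrt 2) * w0 4
              + (-7 + 6 * sqrt 2) * w0 5 = - pi / 4))"
proof -
 note e = assms
 define Q0 where "Q0 = return grain_space (cball 0 \<epsilon> :: pt set)"
 have ball: "\<exists>P. boolean_model \<epsilon> \<gamma> Q0 P" if "\<gamma> > 0" for \<gamma>
  unfolding Q0_def using ball_model[OF e that] by blast
 have Q0: "EV 2 Q0 = pi * \<epsilon>\<^sup>2" "EV 1 Q0 = pi * \<epsilon>" unfolding Q0_def using ball_EV[OF e] by auto
 then have Q0': "EV (Suc 0) Q0 = pi * \<epsilon>" by simp
 have ub0: "\<gamma> / pi * EV 1 Q0 = \<gamma> * \<epsilon>" for \<gamma> by (simp add: Q0')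
 note MF = model_facts[OF e]
 have k0z: "k0 \<gamma> Q w = 0" if "w 1 = 0" "w 6 = 0" for \<gamma> Q and w :: "nat => real" using that by (simp add: k0_def)
 have w16: "w 1 = 0 \<and> w 6 = 0" if "\<And>\<gamma>. \<gamma> > 0 ==> k0 \<gamma> Q0 w = 0" for w :: "nat => real"
 proof -
  \<comment> \<open>The probability that a point is uncovered at intensity 1. Intensities 1 and 2
    give two linear conditions with weights \<open>x\<close> and \<open>x * x\<close>, which are
    independent because \<open>x\<close> lies strictly between 0 and 1.\<close>
  define x where "x = exp (- (pi * \<epsilon>\<^sup>2))"
  have x: "0 < x" "x < 1" using e by (simp_all add: x_def)
  have "exp (- 2 * (pi * \<epsilon>\<^sup>2)) = x * x" by (simp add: x_def exp_add[symmetric])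
  then have "w 1 * x + w 6 * (1 - x) = 0" "w 1 * (x * x) + w 6 * (1 - x * x) = 0"
   using that[of 1] that[of 2] by (simp_all add: k0_def Q0 x_def)
  then have "w 6 * (1 - x) = 0" "w 1 * x = - (w 6 * (1 - x))" by algebra+
  then show ?thesis using x by simp
 qed
 have c3e: "c3 w = 4 * ((2 - sqrt 2) * w 2 + (-2 + 2 * sqrt 2) * w 3 + (2 - sqrt 2) * w 5)"
  and c4e: "c4 w = 2 * w 2 - 2 * w 5"
  and c5e: "c5 w = 4 * ((-5 + 2 * sqrt 2) * w 2 + (4 - 4 * sqrt 2) * w 3 + (3 - 2 * sqrt 2) * w 4 + (-7 + 6 * sqrt 2) * w 5)"
  if "w 1 = 0" "w 6 = 0" for w :: "nat => real" using that by (simp_all add: c3_def c4_def c5_def)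
 have k1b: "k1 \<gamma> Q w = c3 w / pi * barV 1 P" if "boolean_model \<epsilon> \<gamma> Q P" for \<gamma> Q P and w :: "nat => real"
  unfolding MF(6)[OF that] k1_def by simp
 have a1: "(\<forall>\<gamma> Q P. boolean_model \<epsilon> \<gamma> Q P --> (\<exists>L. ((%a. EVhat 1 w1 P a) \<longlongrightarrow> L) (at_right 0))) \<longleftrightarrow> w1 1 = 0 \<and> w1 6 = 0" (is "?L \<longleftrightarrow> ?R")
 proof
  assume ?L
  have "k0 \<gamma> Q0 w1 = 0" if "\<gamma> > 0" for \<gamma> using ball[OF that] \<open>?L\<close> MF(2) by blast
  then show ?R by (rule w16)
 next
  assume ?R then show ?L using MF(1) k0z by blast
 qed
 have b1: "(\<forall>\<gamma> Q P. boolean_model \<epsilon> \<gamma> Q P --> (\<exists>L. ((%a. EVhat 0 w0 P a) \<longlongrightarrow> L) (at_right 0)))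
   \<longleftrightarrow> w0 1 = 0 \<and> w0 6 = 0 \<and> (2 - sqrt 2) * w0 2 + (-2 + 2 * sqrt 2) * w0 3 + (2 - sqrt 2) * w0 5 = 0" (is "?L \<longleftrightarrow> ?R")
 proof
  assume ?L
  have k: "k0 \<gamma> Q0 w0 = 0 \<and> k1 \<gamma> Q0 w0 = 0" if "\<gamma> > 0" for \<gamma> using ball[OF that] \<open>?L\<close> MF(5) by blast
  have w: "w0 1 = 0 \<and> w0 6 = 0" by (rule w16) (use k in blast)
  moreover have "c3 w0 = 0" using k[of 1] e by (simp add: k1_def Q0')
  ultimately show ?R using c3e[of w0] by simp
 next
  assume R: ?R
  then have "c3 w0 = 0" using c3e[of w0] by simp
  then have "k1 \<gamma> Q w0 = 0" for \<gamma> Q by (simp add: k1_def)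
  then show ?L using MF(4) k0z R by blast
 qed
 have a2: "(\<forall>\<gamma> Q P. boolean_model \<epsilon> \<gamma> Q P --> ((%a. EVhat 1 w1 P a) \<longlongrightarrow> c3 w1 / pi * barV 1 P) (at_right 0))"
  if "w1 1 = 0 \<and> w1 6 = 0" using MF(1)[OF _ k0z] k1b that by metis
 have a2': "(\<forall>\<gamma> Q P. boolean_model \<epsilon> \<gamma> Q P --> ((%a. EVhat 1 w1 P a) \<longlongrightarrow> barV 1 P) (at_right 0)) \<longleftrightarrow> c3 w1 = pi" (is "?L \<longleftrightarrow> ?R")
  if w: "w1 1 = 0 \<and> w1 6 = 0"
 proof
  assume L: ?L
  obtain P where P: "boolean_model \<epsilon> 1 Q0 P" using ball[of 1] by auto
  have "c3 w1 / pi * barV 1 P = barV 1 P" by (rule tendsto_unique[OF _ a2[OF w, rule_format, OF P] L[rule_format, OF P]]) simp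
  \<comment> \<open>This permits cancelling, so that the limit determines
    \<open>c3 w1\<close>.\<close>
  moreover have "barV 1 P ~= 0" unfolding MF(6)[OF P] using e by (simp add: Q0 Q0')
  ultimately have "c3 w1 / pi = 1" using mult_cancel_right[of "c3 w1 / pi" "barV 1 P" 1] by simp
  then show ?R by simp
 next
  assume ?R then show ?L using a2[OF w] by simp
 qed
 have a3: "\<forall>\<gamma> Q P. boolean_model \<epsilon> \<gamma> Q P --> (%a. EVhat 1 w1 P a - barV 1 P - a * k2 \<gamma> Q w1) \<in> O[at_right 0](%a. a\<^sup>2)"
  if w: "w1 1 = 0 \<and> w1 6 = 0 \<and> c3 w1 = pi"
 proof (intro allI impI)
  fix \<gamma> Q P assume P: "boolean_model \<epsilon> \<gamma> Q P"
  have eq: "k1 \<gamma> Q w1 = barV 1 P" using k1b[OF P, of w1] w by simp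
  have kz: "k0 \<gamma> Q w1 = 0" using k0z w by blast
  show "(%a. EVhat 1 w1 P a - barV 1 P - a * k2 \<gamma> Q w1) \<in> O[at_right 0](%a. a\<^sup>2)"
   using MF(3)[OF P kz] unfolding eq .
 qed
 have a3': "(\<forall>\<gamma> Q P. boolean_model \<epsilon> \<gamma> Q P --> (%a. EVhat 1 w1 P a - barV 1 P) \<in> O[at_right 0](%a. a\<^sup>2))
   \<longleftrightarrow> w1 2 = w1 5 \<and> (-5 + 2 * sqrt 2) * w1 2 + (4 - 4 * sqrt 2) * w1 3 + (3 - 2 * sqrt 2) * w1 4 + (-7 + 6 * sqrt 2) * w1 5 = 0" (is "?L \<longleftrightarrow> ?R")
  if w: "w1 1 = 0 \<and> w1 6 = 0 \<and> c3 w1 = pi"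
 proof
  assume L: ?L
  have "c4 w1 * \<gamma> + c5 w1 * (\<gamma> * \<epsilon>)\<^sup>2 = 0" if g: "\<gamma> > 0" for \<gamma>
  proof -
   obtain P where P: "boolean_model \<epsilon> \<gamma> Q0 P" using ball[OF g] by auto
   \<comment> \<open>Subtracting the known expansion isolates the linear term, which is of quadratic
     order only if its coefficient is zero.\<close>
   have "(%a. (EVhat 1 w1 P a - barV 1 P) - (EVhat 1 w1 P a - barV 1 P - a * k2 \<gamma> Q0 w1)) \<in> O[at_right 0](%a. a\<^sup>2)"
    using L[rule_format, OF P] a3[OF w, rule_format, OF P] by (rule sum_in_bigo)
   then have "k2 \<gamma> Q0 w1 = 0" by (intro linear_bigo_square) simp
   then show ?thesis unfolding k2_def ub0 by simp
  qed
  then have "c4 w1 = 0 \<and> c5 w1 = 0" by (rule two_point_zero[OF e])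
  then show ?R using c4e[of w1] c5e[of w1] w by simp
 next
  assume ?R
  then have "c4 w1 = 0 \<and> c5 w1 = 0" unfolding c4e[OF conjunct1[OF w] conjunct1[OF conjunct2[OF w]]]
   c5e[OF conjunct1[OF w] conjunct1[OF conjunct2[OF w]]] by (elim conjE) simp
  then have "k2 \<gamma> Q w1 = 0" for \<gamma> Q by (simp add: k2_def)
  then show ?L using a3[OF w] by simp
 qed
 have b2: "\<forall>\<gamma> Q P. boolean_model \<epsilon> \<gamma> Q P --> ((%a. EVhat 0 w0 P a) \<longlongrightarrow> k2 \<gamma> Q w0) (at_right 0)"
  if w: "w0 1 = 0 \<and> w0 6 = 0 \<and> (2 - sqrt 2) * w0 2 + (-2 + 2 * sqrt 2) * w0 3 + (2 - sqrt 2) * w0 5 = 0"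
 proof -
  have "c3 w0 = 0" using c3e[of w0] w by simp
  then have "k1 \<gamma> Q w0 = 0" for \<gamma> Q by (simp add: k1_def)
  then show ?thesis using MF(4) k0z w by blast
 qed
 have b2': "(\<forall>\<gamma> Q P. boolean_model \<epsilon> \<gamma> Q P --> ((%a. EVhat 0 w0 P a) \<longlongrightarrow> barV 0 P) (at_right 0))
   \<longleftrightarrow> 2 * w0 2 - 2 * w0 5 = 1 \<and>
    (-5 + 2 * sqrt 2) * w0 2 + (4 - 4 * sqrt 2) * w0 3 + (3 - 2 * sqrt 2) * w0 4 + (-7 + 6 * sqrt 2) * w0 5 = - pi / 4" (is "?L \<longleftrightarrow> ?R")
  if w: "w0 1 = 0 \<and> w0 6 = 0 \<and> (2 - sqrt 2) * w0 2 + (-2 + 2 * sqrt 2) * w0 3 + (2 - sqrt 2) * w0 5 = 0"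
 proof -
  define X where "X = (-5 + 2 * sqrt 2) * w0 2 + (4 - 4 * sqrt 2) * w0 3 + (3 - 2 * sqrt 2) * w0 4 + (-7 + 6 * sqrt 2) * w0 5"
  have c: "c4 w0 = 2 * w0 2 - 2 * w0 5" "c5 w0 = 4 * X" unfolding X_def using w by (intro c4e c5e; blast)+
  show ?thesis
 proof
  assume L: ?L
  have "(c4 w0 - 1) * \<gamma> + (c5 w0 + pi) * (\<gamma> * \<epsilon>)\<^sup>2 = 0" if g: "\<gamma> > 0" for \<gamma>
  proof -
   obtain P where P: "boolean_model \<epsilon> \<gamma> Q0 P" using ball[OF g] by auto
   have "k2 \<gamma> Q0 w0 = barV 0 P" by (rule tendsto_unique[OF _ b2[OF w, rule_format, OF P] L[rule_format, OF P]]) simp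
   then have "c4 w0 * \<gamma> + c5 w0 * (\<gamma> * \<epsilon>)\<^sup>2 = \<gamma> - pi * (\<gamma> * \<epsilon>)\<^sup>2"
    unfolding MF(7)[OF P] k2_def ub0 by simp
   then show ?thesis by (simp add: algebra_simps)
  qed
  then have "c4 w0 - 1 = 0 \<and> c5 w0 + pi = 0" by (rule two_point_zero[OF e])
  then have "2 * w0 2 - 2 * w0 5 = 1" "4 * X + pi = 0" unfolding c by simp_all
  then have "X = - pi / 4" by linarith
  then show ?R using \<open>2 * w0 2 - 2 * w0 5 = 1\<close> unfolding X_def by simp
 next
  assume R: ?R
  then have "X = - pi / 4" unfolding X_def by simp
  then have c': "c4 w0 = 1" "c5 w0 = - pi" using R c by simp_all
  have "k2 \<gamma> Q w0 = barV 0 P" if "boolean_model \<epsilon> \<gamma> Q P" for \<gamma> Q P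
   unfolding MF(7)[OF that] k2_def c' by simp
  then show ?L using b2[OF w] by metis
 qed
 qed
 show ?thesis
  apply (intro conjI impI)
  subgoal by (rule a1)
  subgoal by (rule a2)
  subgoal by (rule a2')
  subgoal premises p using a3[OF p] unfolding k2_def mult.assoc by blast
  subgoal by (rule a3')
  subgoal by (rule b1)
  subgoal premises p using b2[OF p] unfolding k2_def by blast
  subgoal by (rule b2')
  done
qed

end
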